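(* Let $\theta>0$ and suppose that Assumptions 1, 2 and 3 (stated in the context) hold. Then there exist constants $g^{*1},g^{*2}$, real-valued functions $y^{*1},y^{*2}$ on $S$ and a pair of stationary policies $(\phi^{*1},\phi^{*2})\in\Phi^1\times\Phi^2$ such that for all $i\in S$ $$e^{\theta y^{*1}(i)}=\inf_{\psi\in\mathcal{P}(A(i))}\Big\{\int_{A(i)}\int_{B(i)}\int_0^{\bar s}e^{\theta[\int_0^s\rho^1_{(i,a,b)}(t)dt-g^{*1}s]}dF_{i,a,b}(s)\sum_{j\in S}e^{\theta y^{*1}(j)}p_{i,j}(a,b)\,\phi^{*2}(db|i)\,\psi(da)\Big\}$$ $$=\int_{A(i)}\int_{B(i)}\int_0^{\bar s}e^{\theta[\int_0^s\rho^1_{(i,a,b)}(t)dt-g^{*1}s]}dF_{i,a,b}(s)\sum_{j\in S}e^{\theta y^{*1}(j)}p_{i,j}(a,b)\,\phi^{*2}(db|i)\,\phi^{*1}(da|i),$$ and $$e^{\theta y^{*2}(i)}=\inf_{\varphi\in\mathcal{P}(B(i))}\Big\{\int_{A(i)}\int_{B(i)}\int_0^{\bar s}e^{\theta[\int_0^s\rho^2_{(i,a,b)}(t)dt-g^{*2}s]}dF_{i,a,b}(s)\sum_{j\in S}e^{\theta y^{*2}(j)}p_{i,j}(a,b)\,\varphi(db)\,\phi^{*1}(da|i)\Big\}$$ $$=\int_{A(i)}\int_{B(i)}\int_0^{\bar s}e^{\theta[\int_0^s\rho^2_{(i,a,b)}(t)dt-g^{*2}s]}dF_{i,a,b}(s)\sum_{j\in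 S}e^{\theta y^{*2}(j)}p_{i,j}(a,b)\,\phi^{*2}(db|i)\,\phi^{*1}(da|i).$$ Moreover, $(\phi^{*1},\phi^{*2})$ is a Nash equilibrium, and $J^m_\theta(i,\phi^{*1},\phi^{*2})=g^{*m}$ for all $i\in S$ and $m=1,2$.
   Context: Non-zero sum semi-Markov game model. $S$ is a finite state space with the discrete topology. $A$ and $B$ are Borel spaces (action sets of players 1 and 2); for each $i\in S$, $A(i)\subset A$ and $B(i)\subset B$ are Borel subsets (admissible actions). $\mathbb{K}=\{(i,a,b): i\in S, a\in A(i), b\in B(i)\}$. There is no immediate cost. For $m=1,2$ and $(i,a,b)\in\mathbb{K}$, $\rho^m_{(i,a,b)}:[0,\infty)\to\mathbb{R}$ is the running cost of player $m$; $F_{i,a,b}$ is the sojourn time distribution function, with $F_{i,a,b}(0)=0$; $[p_{i,j}(a,b)]$ is the controlled transition law, $\sum_{j\in S}p_{i,j}(a,b)=1$. $\mathcal{P}(E)$ is the set of probability measures on $E$. Policies. $H_0=S$, $H_n=\mathbb{K}\times(0,\infty)\times H_{n-1}$ is the space of histories $h_n=(i_0,a_0,b_0,s_0,\ldots,i_{n-1},a_{n-1},b_{n-1},s_{n-1},i_n)$. A policy for player 1 is a sequence $\pi^1=\{\pi^1_n\}_{n\ge0}$ of stochastic kernels on $A$ given $H_n$ with $\pi^1_n(A(i_n)|h_n)=1$; policies $\pi^2$ for player 2 are analogous (on $B$). $\Pi_m$ is the set of all policies of player $m$. $\Phi^1$ is the set of stochastic kernels $\phi^1$ on $A$ given $S$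 with $\phi^1(A(i)|i)=1$, identified with the stationary policies $\pi^1_n(\cdot|h_n)=\phi^1(\cdot|i_n)$; $\Phi^2$ is defined analogously. Given $X_0=i$ and $(\pi^1,\pi^2)$, $\mathbb{P}_i^{\pi^1,\pi^2}$ (expectation $\mathbb{E}_i^{\pi^1,\pi^2}$) is the law of $\{(X_n,A_n,B_n,S_n)\}_{n\ge 0}$ (states, actions, sojourn times) determined, with $\mathcal{H}_n=(X_0,A_0,B_0,S_0,\ldots,X_{n-1},A_{n-1},B_{n-1},S_{n-1},X_n)$, by: $\mathbb{P}[X_0=i]=1$; $\mathbb{P}[A_n\in G,B_n\in D|\mathcal{H}_n]=\pi^1_n(G|\mathcal{H}_n)\pi^2_n(D|\mathcal{H}_n)$; $\mathbb{P}[S_n\le t|\mathcal{H}_n,A_n,B_n]=F_{X_n,A_n,B_n}(t)$; $\mathbb{P}[X_{n+1}=j|\mathcal{H}_n,A_n,B_n,S_n]=p_{X_n,j}(A_n,B_n)$. Set $T_0=0$, $T_n=\sum_{k=0}^{n-1}S_k$, $N_t=\sup\{n:T_n\le t\}$. Criterion. For $m=1,2$, $\mathcal{C}^m_t=\sum_{k=0}^{N_t-1}\int_0^{S_k}\rho^m_{(X_k,A_k,B_k)}(r)dr+\int_0^{t-T_{N_t}}\rho^m_{(X_{N_t},A_{N_t},B_{N_t})}(r)dr$ and $J^m_\theta(i,\pi^1,\pi^2)=\limsup_{t\to\infty}\frac{1}{\theta t}\log\mathbb{E}_i^{\pi^1,\pi^2}[e^{\theta\mathcal{C}^m_t}]$.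 Each player minimizes her own cost. A pair $(\pi^{*1},\pi^{*2})\in\Pi_1\times\Pi_2$ is a Nash equilibrium if $J^1_\theta(i,\pi^{*1},\pi^{*2})\le J^1_\theta(i,\pi^1,\pi^{*2})$ and $J^2_\theta(i,\pi^{*1},\pi^{*2})\le J^2_\theta(i,\pi^{*1},\pi^2)$ for all $i\in S$ and all $(\pi^1,\pi^2)\in\Pi_1\times\Pi_2$. Assumption 1. (i) For each $i\in S$, $A(i)$ and $B(i)$ are compact. (ii) For each $i,j\in S$, $(a,b)\mapsto p_{i,j}(a,b)$ is continuous on $A(i)\times B(i)$. (iii) There is a constant $\bar s>0$ such that $F_{i,a,b}(\bar s)=1$ for all $(i,a,b)\in\mathbb{K}$, and for each $i\in S$ and each bounded measurable $u$, $(a,b)\mapsto\int_0^{\bar s}u(s)\,dF_{i,a,b}(s)$ is continuous on $A(i)\times B(i)$. (iv) For each $i\in S$ and $m=1,2$, $(a,b,s)\mapsto\rho^m_{(i,a,b)}(s)$ is continuous on $A(i)\times B(i)\times[0,\bar s]$. Assumption 2. Under each pair of stationary policies, the embedded discrete-time Markov chain $\{X_n\}$ is irreducible. Assumption 3. Fix a state $i^*\in S$ and let $\tau^*=\inf\{n\ge1:X_n=i^*\}$. There exist constants $R$ and $M$ such that $\sup_{\phi^1\in\Phi^1}\sup_{\phi^2\in\Phi^2}\sup_{i\in S}\mathbb{E}_i^{\phi^1,\phi^2}[R^{\tau^*}]\le M$, and for this $R$, $\theta$ is such that $e^{2\theta\bar sM_\rho}\le R$, where $M_\rho=\max\{M_{\rho^1},M_{\rho^2}\}$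 and $M_{\rho^m}=\sup_{(i,a,b)\in\mathbb{K},\,s\in[0,\bar s]}|\rho^m_{(i,a,b)}(s)|$. *)

theory Defs
  imports "HOL-Probability.Probability"
begin

section \<open>Model\<close>

text \<open>The state space is the whole (finite) type \<open>'s\<close>. A Borel space is a Borel subset
  (\<open>act1\<close>, \<open>act2\<close>) of a Polish space, equipped with the trace of the Borel sets. Functions on the
  admissible triples or on \<open>[0, \<infinity>)\<close> are total functions here; only their values on these sets
  are ever constrained or used.\<close>

record ('s, 'a, 'b) smg =
  act1 :: "'a set"
  act2 :: "'b set"
  adm1 :: "'s \<Rightarrow> 'a set"
  adm2 :: "'s \<Rightarrow> 'b set"
  rho :: "nat \<Rightarrow> 's \<Rightarrow> 'a \<Rightarrow> 'b \<Rightarrow> real \<Rightarrow> real"  \<comment> \<open>the first argument is the player, 1 or 2\<close>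
  sojourn_cdf :: "'s \<Rightarrow> 'a \<Rightarrow> 'b \<Rightarrow> real \<Rightarrow> real"
  trans_prob :: "'s \<Rightarrow> 's \<Rightarrow> 'a \<Rightarrow> 'b \<Rightarrow> real"

definition admissible :: "('s, 'a, 'b) smg \<Rightarrow> ('s \<times> 'a \<times> 'b) set" where
  "admissible G = {(i, a, b). a \<in> adm1 G i \<and> b \<in> adm2 G i}"

definition semi_markov_game ::
  "('s::finite, 'a::polish_space, 'b::polish_space) smg \<Rightarrow> bool" where
  "semi_markov_game G \<longleftrightarrow>
     act1 G \<in> sets borel \<and> act2 G \<in> sets borel \<and>
     (\<forall>i. adm1 G i \<in> sets borel \<and> adm1 G i \<subseteq> act1 G \<and> adm1 G i \<noteq> {}) \<and>
     (\<forall>i. adm2 G i \<in> sets borel \<and> adm2 G i \<subseteq> act2 G \<and> adm2 G i \<noteq> {}) \<and>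
     (\<forall>(i, a, b) \<in> admissible G.
        (\<forall>s t. s \<le> t \<longrightarrow> sojourn_cdf G i a b s \<le> sojourn_cdf G i a b t) \<and>
        (\<forall>t. continuous (at_right t) (sojourn_cdf G i a b)) \<and>
        (sojourn_cdf G i a b \<longlongrightarrow> 0) at_bot \<and>
        (sojourn_cdf G i a b \<longlongrightarrow> 1) at_top \<and>
        sojourn_cdf G i a b 0 = 0) \<and>
     (\<forall>(i, a, b) \<in> admissible G.
        (\<forall>j. 0 \<le> trans_prob G i j a b) \<and> (\<Sum>j\<in>UNIV. trans_prob G i j a b) = 1)"

definition sojourn :: "('s, 'a, 'b) smg \<Rightarrow> 's \<Rightarrow> 'a \<Rightarrow> 'b \<Rightarrow> real measure" where
  "sojourn G i a b = interval_measure (sojourn_cdf G i a b)"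

section \<open>Histories and policies\<close>

text \<open>A step is \<open>(i, a, b, s)\<close>, an element of \<open>K \<times> (0, \<infinity>)\<close> with \<open>K\<close> the set of
  admissible triples. A history \<open>h\<^sub>n\<close> is the pair of its \<open>n\<close> completed steps, indexed by
  \<open>{..<n}\<close>, and its last state \<open>i\<^sub>n\<close>.\<close>

type_synonym ('s, 'a, 'b) step = "'s \<times> 'a \<times> 'b \<times> real"
type_synonym ('s, 'a, 'b) path = "nat \<Rightarrow> ('s, 'a, 'b) step"
type_synonym ('s, 'a, 'b) hist = "('s, 'a, 'b) path \<times> 's"
type_synonym ('s, 'a, 'b, 'c) policy = "nat \<Rightarrow> ('s, 'a, 'b) hist \<Rightarrow> 'c measure"

definition step_space ::
  "('s, 'a::polish_space, 'b::polish_space) smg \<Rightarrow> ('s, 'a, 'b) step measure" where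
  "step_space G = restrict_space
     (count_space UNIV \<Otimes>\<^sub>M borel \<Otimes>\<^sub>M borel \<Otimes>\<^sub>M borel)
     {(i, a, b, s). (i, a, b) \<in> admissible G \<and> 0 < s}"

definition hist_space ::
  "('s, 'a::polish_space, 'b::polish_space) smg \<Rightarrow> nat \<Rightarrow> ('s, 'a, 'b) hist measure" where
  "hist_space G n = (\<Pi>\<^sub>M k\<in>{..<n}. step_space G) \<Otimes>\<^sub>M count_space UNIV"

definition path_space ::
  "('s, 'a::polish_space, 'b::polish_space) smg \<Rightarrow> ('s, 'a, 'b) path measure" where
  "path_space G = (\<Pi>\<^sub>M k\<in>UNIV. step_space G)"

definition act_space1 :: "('s, 'a::polish_space, 'b::polish_space) smg \<Rightarrow> 'a measure" where
  "act_space1 G = restrict_space borel (act1 G)"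

definition act_space2 :: "('s, 'a::polish_space, 'b::polish_space) smg \<Rightarrow> 'b measure" where
  "act_space2 G = restrict_space borel (act2 G)"

definition policies1 ::
  "('s, 'a::polish_space, 'b::polish_space) smg \<Rightarrow> ('s, 'a, 'b, 'a) policy set" where
  "policies1 G = {\<pi>. \<forall>n. \<pi> n \<in> hist_space G n \<rightarrow>\<^sub>M prob_algebra (act_space1 G) \<and>
     (\<forall>h\<in>space (hist_space G n). measure (\<pi> n h) (adm1 G (snd h)) = 1)}"

definition policies2 ::
  "('s, 'a::polish_space, 'b::polish_space) smg \<Rightarrow> ('s, 'a, 'b, 'b) policy set" where
  "policies2 G = {\<pi>. \<forall>n. \<pi> n \<in> hist_space G n \<rightarrow>\<^sub>M prob_algebra (act_space2 G) \<and>
     (\<forall>h\<in>space (hist_space G n). measure (\<pi> n h) (adm2 G (snd h)) = 1)}"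

definition stationary1 ::
  "('s, 'a::polish_space, 'b::polish_space) smg \<Rightarrow> ('s \<Rightarrow> 'a measure) set" where
  "stationary1 G = {\<phi>. \<phi> \<in> count_space UNIV \<rightarrow>\<^sub>M prob_algebra (act_space1 G) \<and>
     (\<forall>i. measure (\<phi> i) (adm1 G i) = 1)}"

definition stationary2 ::
  "('s, 'a::polish_space, 'b::polish_space) smg \<Rightarrow> ('s \<Rightarrow> 'b measure) set" where
  "stationary2 G = {\<phi>. \<phi> \<in> count_space UNIV \<rightarrow>\<^sub>M prob_algebra (act_space2 G) \<and>
     (\<forall>i. measure (\<phi> i) (adm2 G i) = 1)}"

definition stat_policy :: "('s \<Rightarrow> 'c measure) \<Rightarrow> ('s, 'a, 'b, 'c) policy" where
  "stat_policy \<phi> = (\<lambda>n h. \<phi> (snd h))"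

section \<open>The law of the process\<close>

definition state_at :: "nat \<Rightarrow> ('s, 'a, 'b) path \<Rightarrow> 's" where
  "state_at n \<omega> = fst (\<omega> n)"

definition action1_at :: "nat \<Rightarrow> ('s, 'a, 'b) path \<Rightarrow> 'a" where
  "action1_at n \<omega> = fst (snd (\<omega> n))"

definition action2_at :: "nat \<Rightarrow> ('s, 'a, 'b) path \<Rightarrow> 'b" where
  "action2_at n \<omega> = fst (snd (snd (\<omega> n)))"

definition sojourn_at :: "nat \<Rightarrow> ('s, 'a, 'b) path \<Rightarrow> real" where
  "sojourn_at n \<omega> = snd (snd (snd (\<omega> n)))"

definition history :: "nat \<Rightarrow> ('s, 'a, 'b) path \<Rightarrow> ('s, 'a, 'b) hist" where
  "history n \<omega> = (restrict \<omega> {..<n}, state_at n \<omega>)"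

text \<open>\<open>cond_prob_given P f N E\<close> is (a version of) the conditional probability of the event \<open>E\<close>
  given the \<open>N\<close>-valued random variable \<open>f\<close>.\<close>

definition cond_prob_given ::
  "'w measure \<Rightarrow> ('w \<Rightarrow> 'h) \<Rightarrow> 'h measure \<Rightarrow> 'w set \<Rightarrow> 'w \<Rightarrow> real" where
  "cond_prob_given P f N E = real_cond_exp P (vimage_algebra (space P) f N) (indicator E)"

definition is_law ::
  "('s, 'a::polish_space, 'b::polish_space) smg \<Rightarrow> 's \<Rightarrow>
   ('s, 'a, 'b, 'a) policy \<Rightarrow> ('s, 'a, 'b, 'b) policy \<Rightarrow> ('s, 'a, 'b) path measure \<Rightarrow> bool" where
  "is_law G i \<pi>1 \<pi>2 P \<longleftrightarrow>
     prob_space P \<and> sets P = sets (path_space G) \<and>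
     measure P {\<omega> \<in> space P. state_at 0 \<omega> = i} = 1 \<and>
     (\<forall>n. \<forall>E \<in> sets (act_space1 G). \<forall>D \<in> sets (act_space2 G).
        AE \<omega> in P. cond_prob_given P (history n) (hist_space G n)
            {\<omega> \<in> space P. action1_at n \<omega> \<in> E \<and> action2_at n \<omega> \<in> D} \<omega>
          = measure (\<pi>1 n (history n \<omega>)) E * measure (\<pi>2 n (history n \<omega>)) D) \<and>
     (\<forall>n t. AE \<omega> in P. cond_prob_given P
            (\<lambda>\<omega>. (history n \<omega>, action1_at n \<omega>, action2_at n \<omega>))
            (hist_space G n \<Otimes>\<^sub>M act_space1 G \<Otimes>\<^sub>M act_space2 G)
            {\<omega> \<in> space P. sojourn_at n \<omega> \<le> t} \<omega>
          = sojourn_cdf G (state_at n \<omega>) (action1_at n \<omega>) (action2_at n \<omega>) t) \<and>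
     (\<forall>n j. AE \<omega> in P. cond_prob_given P
            (\<lambda>\<omega>. (history n \<omega>, action1_at n \<omega>, action2_at n \<omega>, sojourn_at n \<omega>))
            (hist_space G n \<Otimes>\<^sub>M act_space1 G \<Otimes>\<^sub>M act_space2 G \<Otimes>\<^sub>M borel)
            {\<omega> \<in> space P. state_at (Suc n) \<omega> = j} \<omega>
          = trans_prob G (state_at n \<omega>) j (action1_at n \<omega>) (action2_at n \<omega>))"

text \<open>Whenever the model data are measurable, existence and uniqueness are the Ionescu-Tulcea
  theorem.\<close>

definition law ::
  "('s, 'a::polish_space, 'b::polish_space) smg \<Rightarrow> 's \<Rightarrow>
   ('s, 'a, 'b, 'a) policy \<Rightarrow> ('s, 'a, 'b, 'b) policy \<Rightarrow> ('s, 'a, 'b) path measure" where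
  "law G i \<pi>1 \<pi>2 = (THE P. is_law G i \<pi>1 \<pi>2 P)"

section \<open>Criterion\<close>

definition jump_time :: "nat \<Rightarrow> ('s, 'a, 'b) path \<Rightarrow> real" where
  "jump_time n \<omega> = (\<Sum>k<n. sojourn_at k \<omega>)"

text \<open>On \<^typ>\<open>nat\<close> the supremum is meaningful for bounded sets only: \<open>jump_count t \<omega>\<close> is unspecified on
  paths with infinitely many jumps up to time \<open>t\<close>.\<close>

definition jump_count :: "real \<Rightarrow> ('s, 'a, 'b) path \<Rightarrow> nat" where
  "jump_count t \<omega> = Sup {n. jump_time n \<omega> \<le> t}"

definition run_cost :: "('s, 'a, 'b) smg \<Rightarrow> nat \<Rightarrow> 's \<Rightarrow> 'a \<Rightarrow> 'b \<Rightarrow> real \<Rightarrow> real" where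
  "run_cost G m i a b s = (LINT r:{0..s}|lborel. rho G m i a b r)"

definition total_cost :: "('s, 'a, 'b) smg \<Rightarrow> nat \<Rightarrow> real \<Rightarrow> ('s, 'a, 'b) path \<Rightarrow> real" where
  "total_cost G m t \<omega> =
     (\<Sum>k<jump_count t \<omega>. run_cost G m (state_at k \<omega>) (action1_at k \<omega>) (action2_at k \<omega>) (sojourn_at k \<omega>)) +
     run_cost G m (state_at (jump_count t \<omega>) \<omega>) (action1_at (jump_count t \<omega>) \<omega>) (action2_at (jump_count t \<omega>) \<omega>) (t - jump_time (jump_count t \<omega>) \<omega>)"

definition ext_ln :: "ennreal \<Rightarrow> ereal" where
  "ext_ln x = (if x = 0 then -\<infinity> else if x = \<infinity> then \<infinity> else ereal (ln (enn2real x)))"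

definition risk_cost ::
  "('s, 'a::polish_space, 'b::polish_space) smg \<Rightarrow> real \<Rightarrow> nat \<Rightarrow> 's \<Rightarrow>
   ('s, 'a, 'b, 'a) policy \<Rightarrow> ('s, 'a, 'b, 'b) policy \<Rightarrow> ereal" where
  "risk_cost G \<theta> m i \<pi>1 \<pi>2 = Limsup at_top (\<lambda>t::real. ereal (1 / (\<theta> * t)) *
     ext_ln (\<integral>\<^sup>+ \<omega>. ennreal (exp (\<theta> * total_cost G m t \<omega>)) \<partial>law G i \<pi>1 \<pi>2))"

definition nash_equilibrium ::
  "('s, 'a::polish_space, 'b::polish_space) smg \<Rightarrow> real \<Rightarrow>
   ('s, 'a, 'b, 'a) policy \<Rightarrow> ('s, 'a, 'b, 'b) policy \<Rightarrow> bool" where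
  "nash_equilibrium G \<theta> \<sigma>1 \<sigma>2 \<longleftrightarrow>
     \<sigma>1 \<in> policies1 G \<and> \<sigma>2 \<in> policies2 G \<and>
     (\<forall>i. \<forall>\<pi>1\<in>policies1 G. \<forall>\<pi>2\<in>policies2 G.
        risk_cost G \<theta> 1 i \<sigma>1 \<sigma>2 \<le> risk_cost G \<theta> 1 i \<pi>1 \<sigma>2 \<and> risk_cost G \<theta> 2 i \<sigma>1 \<sigma>2 \<le> risk_cost G \<theta> 2 i \<sigma>1 \<pi>2)"

section \<open>Assumptions\<close>

definition assumption1 ::
  "('s, 'a::polish_space, 'b::polish_space) smg \<Rightarrow> real \<Rightarrow> bool" where
  "assumption1 G sbar \<longleftrightarrow>
     (\<forall>i. compact (adm1 G i) \<and> compact (adm2 G i)) \<and>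
     (\<forall>i j. continuous_on (adm1 G i \<times> adm2 G i) (\<lambda>(a, b). trans_prob G i j a b)) \<and>
     0 < sbar \<and>
     (\<forall>(i, a, b) \<in> admissible G. sojourn_cdf G i a b sbar = 1) \<and>
     (\<forall>i. \<forall>u \<in> borel_measurable borel. bounded (range u) \<longrightarrow>
        continuous_on (adm1 G i \<times> adm2 G i)
          (\<lambda>(a, b). LINT s:{0..sbar}|sojourn G i a b. (u s :: real))) \<and>
     (\<forall>i. \<forall>m\<in>{1, 2}. continuous_on (adm1 G i \<times> adm2 G i \<times> {0..sbar})
        (\<lambda>(a, b, s). rho G m i a b s))"

definition assumption2 :: "('s, 'a::polish_space, 'b::polish_space) smg \<Rightarrow> bool" where
  "assumption2 G \<longleftrightarrow> (\<forall>\<phi>1\<in>stationary1 G. \<forall>\<phi>2\<in>stationary2 G. \<forall>i j. \<exists>n.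
     0 < measure (law G i (stat_policy \<phi>1) (stat_policy \<phi>2))
           {\<omega> \<in> space (path_space G). state_at n \<omega> = j})"

definition return_time :: "'s \<Rightarrow> ('s, 'a, 'b) path \<Rightarrow> enat" where
  "return_time istar \<omega> = (INF n\<in>{n. 1 \<le> n \<and> state_at n \<omega> = istar}. enat n)"

definition pow_enat :: "real \<Rightarrow> enat \<Rightarrow> ennreal" where
  "pow_enat R k = (case k of enat n \<Rightarrow> ennreal (R ^ n) | \<infinity> \<Rightarrow> \<infinity>)"

definition rho_bound :: "('s, 'a, 'b) smg \<Rightarrow> real \<Rightarrow> nat \<Rightarrow> real" where
  "rho_bound G sbar m =
     Sup {\<bar>rho G m i a b s\<bar> | i a b s. (i, a, b) \<in> admissible G \<and> s \<in> {0..sbar}}"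

definition assumption3 ::
  "('s, 'a::polish_space, 'b::polish_space) smg \<Rightarrow> real \<Rightarrow> real \<Rightarrow> 's \<Rightarrow> bool" where
  "assumption3 G sbar \<theta> istar \<longleftrightarrow> (\<exists>R M :: real.
     (SUP \<phi>1\<in>stationary1 G. SUP \<phi>2\<in>stationary2 G. SUP i.
        \<integral>\<^sup>+ \<omega>. pow_enat R (return_time istar \<omega>)
          \<partial>law G i (stat_policy \<phi>1) (stat_policy \<phi>2)) \<le> ennreal M \<and>
     exp (2 * \<theta> * sbar * max (rho_bound G sbar 1) (rho_bound G sbar 2)) \<le> R)"

section \<open>The optimality equations\<close>

text \<open>\<open>bellman\<close> is the expression under the infimum for player \<open>m\<close> when, in state \<open>i\<close>, player 1
  uses the mixed action \<open>\<alpha>\<close> and player 2 the mixed action \<open>\<beta>\<close>.\<close>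

definition bellman ::
  "('s::finite, 'a::polish_space, 'b::polish_space) smg \<Rightarrow> real \<Rightarrow> real \<Rightarrow> nat \<Rightarrow> real \<Rightarrow>
   ('s \<Rightarrow> real) \<Rightarrow> 's \<Rightarrow> 'a measure \<Rightarrow> 'b measure \<Rightarrow> real" where
  "bellman G sbar \<theta> m g y i \<alpha> \<beta> =
     (LINT a:adm1 G i|\<alpha>. LINT b:adm2 G i|\<beta>.
        (LINT s:{0..sbar}|sojourn G i a b. exp (\<theta> * (run_cost G m i a b s - g * s))) *
        (\<Sum>j\<in>UNIV. exp (\<theta> * y j) * trans_prob G i j a b))"

definition mixed1 :: "('s, 'a::polish_space, 'b) smg \<Rightarrow> 's \<Rightarrow> 'a measure set" where
  "mixed1 G i = space (prob_algebra (restrict_space borel (adm1 G i)))"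

definition mixed2 :: "('s, 'a, 'b::polish_space) smg \<Rightarrow> 's \<Rightarrow> 'b measure set" where
  "mixed2 G i = space (prob_algebra (restrict_space borel (adm2 G i)))"

end

theory Submission
  imports Defs
begin

text \<open>A pair of stationary policies is an equilibrium with values \<open>g\<close> as soon as each player has a rate \<open>g\<close> and
a positive function \<open>V\<close> on the states such that \<open>V\<close> is the stage cost of \<open>V\<close>, discounted at rate \<open>g\<close>,
under the two mixed actions, and is at most the stage cost under every deviation of that player.
Indeed, \<open>exp (\<theta> * (cost of the first n steps - g * T\<^sub>n)) * V X\<^sub>n\<close> is then a martingale in \<open>n\<close>, and a
submartingale when the player deviates to any policy, with any memory. It is stopped at the first
jump after time \<open>t\<close>. Stopping is harmless because the jump times tend to infinity: sojourn times are
positive, by compactness uniformly so, and \<open>E exp (- T\<^sub>n)\<close> decays geometrically. Sojourn times and cost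
rates being bounded, the stopped weight is \<open>exp (\<theta> * (C\<^sub>t - g * t))\<close> up to a constant factor; hence
\<open>E exp (\<theta> * C\<^sub>t)\<close> equals \<open>exp (\<theta> * g * t)\<close> up to constant factors, or dominates it under a
deviation. This is \<open>risk_cost_ge\<close> and \<open>risk_cost_le\<close>.

The rates, values and mixed actions come from one fixed point. Both players are restricted to finitely
many points of dense sequences of actions; they respond to the expected costs by Gibbs weights, the
values are replaced by the normalised stage costs, and the rate of each player moves up or down
according to whether the normalising factor exceeds 1. At a fixed point the factor is 1: at the largest rate
discounting is too strong, at the smallest too weak. So \<open>V\<close> solves its equation and
the responses are optimal up to a small error (\<open>discretised_game_equilibrium\<close>). Refining the
discretisation and passing to weak limits of the mixed actions removes the error
(\<open>compact_game_equilibrium\<close>, \<open>bellman_equilibrium\<close>). The limit \<open>V\<close> is nonnegative with sum 1. It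
vanishes nowhere: started in a state where it does, the nonnegative martingale is 0, so the states with
positive value would never be visited, against irreducibility (\<open>vanishing_value_unreachable\<close>).

All of this needs the law of the process, which is specified by conditional probabilities. These clauses
are equivalent to integral identities (\<open>has_cond_law_iff\<close>), and the Ionescu-Tulcea theorem yields a
measure satisfying them; it is unique since they determine the laws of all finite prefixes of the path
(\<open>is_law_law\<close>).\<close>

section \<open>Fixed points of continuous maps of a cube\<close>

lemma compact_cube: "compact {x :: 'i \<Rightarrow> real. \<forall>i. x i \<in> {0..1}}"
proof -
  have "{x :: 'i \<Rightarrow> real. \<forall>i. x i \<in> {0..1}} = PiE UNIV (\<lambda>_. {0..1})"
    by (auto simp: PiE_def)
  moreover have "compactin (product_topology (\<lambda>i :: 'i. euclidean :: real topology) UNIV) (PiE UNIV (\<lambda>_. {0..1}))"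
    by (simp add: compactin_PiE)
  ultimately show ?thesis
    unfolding euclidean_product_topology by simp
qed

text \<open>Brouwer's theorem for the cube in the first \<open>n\<close> coordinates, where \<open>n\<close> is a number and not the
dimension of a type. On the grid of mesh \<open>1 / p\<close>, Kuhn's lemma finds a small cube in which, for every coordinate \<open>i\<close>,
some corner is moved up and some corner is moved down by \<open>f\<close>. A limit point of these cubes for
\<open>p \<rightarrow> \<infinity>\<close> is moved in neither direction.\<close>

lemma cube_fixed_point_nat:
  fixes f :: "(nat \<Rightarrow> real) \<Rightarrow> nat \<Rightarrow> real"
  defines "Q \<equiv> {x. \<forall>i. x i \<in> {0..1}}"
  assumes cont: "\<And>i. i < n \<Longrightarrow> continuous_on Q (\<lambda>x. f x i)"
    and maps: "\<And>x i. x \<in> Q \<Longrightarrow> i < n \<Longrightarrow> f x i \<in> {0..1}"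
  shows "\<exists>x\<in>Q. \<forall>i<n. f x i = x i"
proof -
  define pt :: "nat \<Rightarrow> (nat \<Rightarrow> nat) \<Rightarrow> nat \<Rightarrow> real"
    where "pt p v = (\<lambda>j. if j < n then real (v j) / real p else 0)" for p v
  \<comment> \<open>Label 0 where \<open>f\<close> does not decrease coordinate \<open>i\<close>; points on the upper face get label 1, as Kuhn's lemma requires.\<close>
  define label :: "nat \<Rightarrow> (nat \<Rightarrow> nat) \<Rightarrow> nat \<Rightarrow> nat"
    where "label p v i = (if v i \<noteq> p \<and> pt p v i \<le> f (pt p v) i then 0 else 1)" for p v i
  have pt_Q: "pt p v \<in> Q" if "\<forall>i<n. v i \<le> p" for p v
    using that by (auto simp: pt_def Q_def divide_le_eq_1)
  have "\<exists>q. (\<forall>i<n. q i < p) \<and> (\<forall>i<n. \<exists>r s. (\<forall>j<n. q j \<le> r j \<and> r j \<le> q j + 1) \<and>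
      (\<forall>j<n. q j \<le> s j \<and> s j \<le> q j + 1) \<and> label p r i \<noteq> label p s i)" if "0 < p" for p
  proof -
    have a: "\<forall>x. (\<forall>i<n. x i \<le> p) \<longrightarrow> (\<forall>i<n. label p x i = 0 \<or> label p x i = 1)"
      by (auto simp: label_def)
    have b: "\<forall>x. (\<forall>i<n. x i \<le> p) \<longrightarrow> (\<forall>i<n. x i = 0 \<longrightarrow> label p x i = 0)"
    proof (intro allI impI)
      fix x i assume "\<forall>i<n. x i \<le> p" "i < n" "x i = 0"
      with maps[OF pt_Q, of x p i] \<open>0 < p\<close> show "label p x i = 0"
        by (auto simp: label_def pt_def)
    qed
    have c: "\<forall>x. (\<forall>i<n. x i \<le> p) \<longrightarrow> (\<forall>i<n. x i = p \<longrightarrow> label p x i = 1)"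
      by (auto simp: label_def)
    show ?thesis
      by (rule kuhn_lemma[OF that a b c]) blast
  qed
  then have "\<forall>k. \<exists>q. (\<forall>i<n. q i < Suc k) \<and> (\<forall>i<n. \<exists>r s. (\<forall>j<n. q j \<le> r j \<and> r j \<le> q j + 1) \<and>
      (\<forall>j<n. q j \<le> s j \<and> s j \<le> q j + 1) \<and> label (Suc k) r i \<noteq> label (Suc k) s i)"
    by blast
  from choice[OF this] obtain q where qrs: "\<forall>k. (\<forall>i<n. q k i < Suc k) \<and>
      (\<forall>i<n. \<exists>r s. (\<forall>j<n. q k j \<le> r j \<and> r j \<le> q k j + 1) \<and>
      (\<forall>j<n. q k j \<le> s j \<and> s j \<le> q k j + 1) \<and> label (Suc k) r i \<noteq> label (Suc k) s i)" ..
  have q: "\<And>k i. i < n \<Longrightarrow> q k i < Suc k" using qrs by blast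
  define near where "near k v \<longleftrightarrow> (\<forall>j<n. q k j \<le> v j \<and> v j \<le> q k j + 1)" for k and v :: "nat \<Rightarrow> nat"
  \<comment> \<open>For each coordinate, corners of the \<open>k\<close>-th small cube with the labels 0 and 1.\<close>
  define r where "r k i = (SOME v. near k v \<and> label (Suc k) v i = 0)" for k i
  define s where "s k i = (SOME v. near k v \<and> label (Suc k) v i = 1)" for k i
  have "(near k (r k i) \<and> label (Suc k) (r k i) i = 0) \<and> (near k (s k i) \<and> label (Suc k) (s k i) i = 1)"
    if "i < n" for k i
  proof -
    have "\<forall>i<n. \<exists>r s. near k r \<and> near k s \<and> label (Suc k) r i \<noteq> label (Suc k) s i"
      using qrs unfolding near_def by simp
    then obtain v v' where v: "near k v" "near k v'" "label (Suc k) v i \<noteq> label (Suc k) v' i"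
      using \<open>i < n\<close> by blast
    have "label (Suc k) w i = 0 \<or> label (Suc k) w i = 1" for w by (simp add: label_def)
    with v have "\<exists>v. near k v \<and> label (Suc k) v i = 0" "\<exists>v. near k v \<and> label (Suc k) v i = 1"
      by metis+
    from someI_ex[OF this(1)] someI_ex[OF this(2)] show ?thesis
      by (simp add: r_def s_def)
  qed
  then have r: "\<And>k i j. i < n \<Longrightarrow> j < n \<Longrightarrow> q k j \<le> r k i j \<and> r k i j \<le> q k j + 1"
    and s: "\<And>k i j. i < n \<Longrightarrow> j < n \<Longrightarrow> q k j \<le> s k i j \<and> s k i j \<le> q k j + 1"
    and lr: "\<And>k i. i < n \<Longrightarrow> label (Suc k) (r k i) i = 0"
    and ls: "\<And>k i. i < n \<Longrightarrow> label (Suc k) (s k i) i = 1"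
    unfolding near_def by blast+
  have "pt (Suc k) (q k) \<in> Q" for k
    by (rule pt_Q) (auto intro: less_imp_le q)
  then have in_Q: "\<forall>k. pt (Suc k) (q k) \<in> Q" by (rule allI)
  have "seq_compact Q"
    using compact_cube[where 'i=nat] unfolding Q_def compact_eq_seq_compact_metric .
  from seq_compactE[OF this in_Q]
  obtain l \<sigma> where l: "l \<in> Q" "strict_mono (\<sigma> :: nat \<Rightarrow> nat)" "((\<lambda>k. pt (Suc k) (q k)) \<circ> \<sigma>) \<longlonglongrightarrow> l" .
  have close: "(\<lambda>k. pt (Suc (\<sigma> k)) (v (\<sigma> k))) \<longlonglongrightarrow> l"
    if v: "\<And>k j. j < n \<Longrightarrow> q k j \<le> v k j \<and> v k j \<le> q k j + 1" for v
  proof -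
    have "((\<lambda>k. pt (Suc (\<sigma> k)) (v (\<sigma> k)) j) \<longlongrightarrow> l j) sequentially" for j
    proof (rule tendsto_sandwich)
      have 1: "((\<lambda>k. pt (Suc (\<sigma> k)) (q (\<sigma> k)) j) \<longlongrightarrow> l j) sequentially"
        using continuous_on_tendsto_compose[OF continuous_on_product_coordinates[of j] l(3)] by (simp add: o_def)
      show "((\<lambda>k. pt (Suc (\<sigma> k)) (q (\<sigma> k)) j) \<longlongrightarrow> l j) sequentially" by fact
      have 2: "((\<lambda>k. inverse (real (Suc (\<sigma> k)))) \<longlongrightarrow> 0) sequentially"
        using LIMSEQ_subseq_LIMSEQ[OF LIMSEQ_inverse_real_of_nat l(2)] by (simp add: o_def)
      show "((\<lambda>k. pt (Suc (\<sigma> k)) (q (\<sigma> k)) j + inverse (real (Suc (\<sigma> k)))) \<longlongrightarrow> l j) sequentially"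
        using tendsto_add[OF 1 2] by simp
      show "\<forall>\<^sub>F k in sequentially. pt (Suc (\<sigma> k)) (q (\<sigma> k)) j \<le> pt (Suc (\<sigma> k)) (v (\<sigma> k)) j"
        using v by (auto intro!: always_eventually divide_right_mono simp: pt_def)
      have "real (v k j) / real (Suc k) \<le> real (q k j) / real (Suc k) + inverse (real (Suc k))"
        if "j < n" for k
      proof -
        have "real (v k j) \<le> real (q k j) + 1" using v[OF that, of k] by linarith
        then have "real (v k j) / real (Suc k) \<le> (real (q k j) + 1) / real (Suc k)"
          by (intro divide_right_mono) auto
        then show ?thesis by (simp add: field_simps)
      qed
      then show "\<forall>\<^sub>F k in sequentially. pt (Suc (\<sigma> k)) (v (\<sigma> k)) j \<le> pt (Suc (\<sigma> k)) (q (\<sigma> k)) j + inverse (real (Suc (\<sigma> k)))"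
        by (auto intro!: always_eventually simp: pt_def)
    qed
    then have "limitin (product_topology (\<lambda>i. euclidean) UNIV) (\<lambda>k. pt (Suc (\<sigma> k)) (v (\<sigma> k))) l sequentially"
      by (subst limitin_componentwise) auto
    then show ?thesis
      by (simp add: euclidean_product_topology)
  qed
  have "f l i = l i" if i: "i < n" for i
  proof (rule antisym)
    have lim: "(\<lambda>k. pt (Suc (\<sigma> k)) (v (\<sigma> k)) i) \<longlonglongrightarrow> l i"
      "(\<lambda>k. f (pt (Suc (\<sigma> k)) (v (\<sigma> k))) i) \<longlonglongrightarrow> f l i"
      if v: "\<And>k j. j < n \<Longrightarrow> q k j \<le> v k j \<and> v k j \<le> q k j + 1" for v
    proof -
      show "(\<lambda>k. pt (Suc (\<sigma> k)) (v (\<sigma> k)) i) \<longlonglongrightarrow> l i"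
        using continuous_on_tendsto_compose[OF continuous_on_product_coordinates[of i] close[OF v]] by simp
      have "v k j \<le> Suc k" if "j < n" for k j
        using v[OF that, of k] q[OF that, of k] by linarith
      then show "(\<lambda>k. f (pt (Suc (\<sigma> k)) (v (\<sigma> k))) i) \<longlonglongrightarrow> f l i"
        by (intro continuous_on_tendsto_compose[OF cont[OF i] close[OF v] l(1)] always_eventually allI pt_Q) auto
    qed
    have "pt (Suc k) (r k i) i \<le> f (pt (Suc k) (r k i)) i" for k
      using lr[OF i, of k] by (auto simp: label_def split: if_splits)
    then show "l i \<le> f l i"
      by (intro LIMSEQ_le[OF lim[of "\<lambda>k. r k i"]]) (use r[OF i] in auto)
    have "f (pt (Suc k) (s k i)) i \<le> pt (Suc k) (s k i) i" for k
    proof (cases "s k i i = Suc k")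
      case True
      have "s k i j \<le> Suc k" if "j < n" for j
        using s[OF i that, of k] q[OF that, of k] by linarith
      then show ?thesis
        using maps[OF pt_Q[of "s k i" "Suc k"] i] True i by (auto simp: pt_def)
    next
      case False
      then show ?thesis
        using ls[OF i, of k] by (auto simp: label_def split: if_splits)
    qed
    then show "f l i \<le> l i"
      by (intro LIMSEQ_le[OF lim(2)[of "\<lambda>k. s k i"] lim(1)[of "\<lambda>k. s k i"]]) (use s[OF i] in auto)
  qed
  then show ?thesis
    by (intro bexI[OF _ l(1)]) simp
qed

lemma cube_fixed_point:
  fixes f :: "('i \<Rightarrow> real) \<Rightarrow> 'i \<Rightarrow> real"
  defines "Q \<equiv> {x. \<forall>i. x i \<in> {0..1}}"
  assumes "finite I"
    and cont: "\<And>i. i \<in> I \<Longrightarrow> continuous_on Q (\<lambda>x. f x i)"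
    and maps: "\<And>x i. x \<in> Q \<Longrightarrow> i \<in> I \<Longrightarrow> f x i \<in> {0..1}"
  shows "\<exists>x\<in>Q. \<forall>i\<in>I. f x i = x i"
proof -
  obtain h where h: "bij_betw h I {..<card I}"
    using \<open>finite I\<close> ex_bij_betw_finite_nat atLeast0LessThan by metis
  define e :: "(nat \<Rightarrow> real) \<Rightarrow> 'i \<Rightarrow> real" where "e x = (\<lambda>i. if i \<in> I then x (h i) else 0)" for x
  \<comment> \<open>Transport along an enumeration of \<open>I\<close>; coordinates outside \<open>I\<close> are set to 0.\<close>
  define k where "k = the_inv_into I h"
  have k: "k j \<in> I" "h (k j) = j" if "j < card I" for j
    using h that unfolding k_def bij_betw_def
    by (auto intro!: the_inv_into_into f_the_inv_into_f)
  have e: "e x \<in> Q" if "x \<in> {x. \<forall>i. x i \<in> {0..1}}" for x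
    using that by (auto simp: e_def Q_def)
  have cont_e: "continuous_on S e" for S
  proof (rule continuous_on_coordinatewise_then_product)
    fix i show "continuous_on S (\<lambda>x. e x i)"
      by (cases "i \<in> I") (auto simp: e_def intro: continuous_on_subset[OF continuous_on_product_coordinates])
  qed
  have "\<exists>x\<in>{x. \<forall>i. x i \<in> {0..1}}. \<forall>j<card I. f (e x) (k j) = x j"
  proof (rule cube_fixed_point_nat)
    fix j assume "j < card I"
    show "continuous_on {x. \<forall>i. x i \<in> {0..1}} (\<lambda>x. f (e x) (k j))"
      by (rule continuous_on_compose2[OF cont[OF k(1)[OF \<open>j < card I\<close>]] cont_e]) (use e in blast)
    show "f (e x) (k j) \<in> {0..1}" if "x \<in> {x. \<forall>i. x i \<in> {0..1}}" for x
      by (rule maps[OF e[OF that] k(1)[OF \<open>j < card I\<close>]])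
  qed
  then obtain x where "x \<in> {x. \<forall>i. x i \<in> {0..1}}" and x: "\<And>j. j < card I \<Longrightarrow> f (e x) (k j) = x j"
    by blast
  moreover have "f (e x) i = e x i" if "i \<in> I" for i
  proof -
    have "h i < card I" "k (h i) = i"
      using h that by (auto simp: k_def bij_betw_def the_inv_into_f_f)
    then show ?thesis using x[of "h i"] that by (simp add: e_def)
  qed
  ultimately show ?thesis
    by (intro bexI[of _ "e x"] ballI e)
qed

section \<open>Approximate equilibria of discretised games\<close>

text \<open>The coordinates of the cube. Here and below players are named by truth values, with \<open>True\<close> for player 1:
the opponent of \<open>m\<close> is \<open>\<not> m\<close>.\<close>

datatype 's game_var = Weight bool 's nat | Value bool 's | Rate bool

text \<open>The stage cost of the pure action \<open>k\<close> for player \<open>m\<close> in state \<open>i\<close> when the opponent mixes with the weights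
\<open>x (\<not> m) i\<close>. The first action argument of \<open>w\<close> and \<open>p\<close> is the player's own.\<close>

definition expected_cost ::
  "nat \<Rightarrow> (bool \<Rightarrow> 's::finite \<Rightarrow> nat \<Rightarrow> nat \<Rightarrow> real \<Rightarrow> real) \<Rightarrow> (bool \<Rightarrow> 's \<Rightarrow> 's \<Rightarrow> nat \<Rightarrow> nat \<Rightarrow> real) \<Rightarrow>
   (bool \<Rightarrow> 's \<Rightarrow> nat \<Rightarrow> real) \<Rightarrow> (bool \<Rightarrow> 's \<Rightarrow> real) \<Rightarrow> (bool \<Rightarrow> real) \<Rightarrow> bool \<Rightarrow> 's \<Rightarrow> nat \<Rightarrow> real" where
  "expected_cost N w p x V g m i k =
     (\<Sum>l<N. x (\<not> m) i l * (w m i k l (g m) * (\<Sum>j\<in>UNIV. V m j * p m i j k l)))"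

text \<open>Gibbs weights are nearly optimal responses and, unlike optimal ones, depend continuously on the costs. An
action worse than \<open>k\<close> by \<open>d\<close> has weight at most \<open>exp (- \<eta> * d)\<close>, and \<open>t * exp (- t) \<le> 1\<close>.\<close>

lemma sum_exp_weights_le:
  fixes q :: "nat \<Rightarrow> real"
  assumes "0 < \<eta>" "k < N"
  shows "(\<Sum>l<N. exp (- \<eta> * q l) / (\<Sum>l<N. exp (- \<eta> * q l)) * q l) \<le> q k + N / \<eta>"
proof -
  define Z where "Z = (\<Sum>l<N. exp (- \<eta> * q l))"
  have Z: "exp (- \<eta> * q k) \<le> Z"
    unfolding Z_def using \<open>k < N\<close> by (intro member_le_sum) auto
  then have "0 < Z" by (smt (verit) exp_gt_zero)
  have bound: "exp (- \<eta> * q l) / Z * (q l - q k) \<le> 1 / \<eta>" for l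
  proof (cases "q l \<le> q k")
    case True
    then have "exp (- \<eta> * q l) / Z * (q l - q k) \<le> 0"
      using \<open>0 < Z\<close> by (intro mult_nonneg_nonpos) auto
    then show ?thesis using \<open>0 < \<eta>\<close> by (smt (verit) zero_le_divide_1_iff)
  next
    case False
    define d where "d = \<eta> * (q l - q k)"
    have "0 < d" using False \<open>0 < \<eta>\<close> by (simp add: d_def)
    have "exp (- \<eta> * q l) / Z \<le> exp (- \<eta> * q l) / exp (- \<eta> * q k)"
      using Z by (intro divide_left_mono) (auto intro!: mult_pos_pos \<open>0 < Z\<close>)
    also have "\<dots> = exp (- d)"
      by (simp add: d_def exp_diff [symmetric] algebra_simps)
    finally have "exp (- \<eta> * q l) / Z * (q l - q k) \<le> exp (- d) * (q l - q k)"
      using False by (intro mult_right_mono) auto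
    also have "\<dots> = d * exp (- d) / \<eta>"
      using \<open>0 < \<eta>\<close> by (simp add: d_def)
    also have "\<dots> \<le> 1 / \<eta>"
    proof (rule divide_right_mono)
      have "d \<le> exp d" using exp_ge_add_one_self[of d] by linarith
      then show "d * exp (- d) \<le> 1" by (simp add: exp_minus field_simps)
    qed (use \<open>0 < \<eta>\<close> in auto)
    finally show ?thesis .
  qed
  have one: "(\<Sum>l<N. exp (- \<eta> * q l) / Z) = 1"
    using \<open>0 < Z\<close> by (simp add: Z_def flip: sum_divide_distrib)
  have "(\<Sum>l<N. exp (- \<eta> * q l) / Z * q l) = (\<Sum>l<N. exp (- \<eta> * q l) / Z * (q l - q k)) + (\<Sum>l<N. exp (- \<eta> * q l) / Z) * q k"
    unfolding sum_distrib_right sum.distrib [symmetric] by (simp add: right_diff_distrib)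
  also have "\<dots> \<le> (\<Sum>l<N. 1 / \<eta>) + 1 * q k"
    unfolding one by (intro add_mono sum_mono bound) simp
  finally show ?thesis by (simp add: Z_def)
qed

lemma convex_sum_le:
  fixes x q :: "nat \<Rightarrow> real"
  assumes "\<And>k. k < N \<Longrightarrow> 0 \<le> x k" "(\<Sum>k<N. x k) = 1" "\<And>k. k < N \<Longrightarrow> q k \<le> c"
  shows "(\<Sum>k<N. x k * q k) \<le> c"
proof -
  have "(\<Sum>k<N. x k * q k) \<le> (\<Sum>k<N. x k * c)"
    by (intro sum_mono mult_left_mono assms) auto
  also have "\<dots> = c" by (simp add: assms flip: sum_distrib_right)
  finally show ?thesis .
qed

lemma convex_sum_ge:
  fixes x q :: "nat \<Rightarrow> real"
  assumes "\<And>k. k < N \<Longrightarrow> 0 \<le> x k" "(\<Sum>k<N. x k) = 1" "\<And>k. k < N \<Longrightarrow> c \<le> q k"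
  shows "c \<le> (\<Sum>k<N. x k * q k)"
  using convex_sum_le[of N x "\<lambda>k. - q k" "- c"] assms by (simp add: sum_negf)

lemma finite_game_var: "finite {v :: 's::finite game_var. \<forall>m i k. v = Weight m i k \<longrightarrow> k < N}"
proof (rule finite_subset)
  show "{v :: 's game_var. \<forall>m i k. v = Weight m i k \<longrightarrow> k < N} \<subseteq>
    (\<lambda>(m, i, k). Weight m i k) ` (UNIV \<times> UNIV \<times> {..<N}) \<union> (\<lambda>(m, i). Value m i) ` UNIV \<union> range Rate"
  proof
    fix v :: "'s game_var" assume "v \<in> {v. \<forall>m i k. v = Weight m i k \<longrightarrow> k < N}"
    then show "v \<in> (\<lambda>(m, i, k). Weight m i k) ` (UNIV \<times> UNIV \<times> {..<N}) \<union> (\<lambda>(m, i). Value m i) ` UNIV \<union> range Rate"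
      by (cases v) (auto simp: image_iff)
  qed
qed auto

text \<open>The fixed-point map sends the weights to the Gibbs weights of the current costs, the values to
\<open>(r + \<delta>) / c\<close> with \<open>r\<close> the current stage cost and \<open>c\<close> the normalising sum, and the rate
variable \<open>z\<close> to \<open>z + (c - 1)\<close>, truncated to the unit interval. The rate itself is \<open>L * (2 * z - 1)\<close>.
The perturbation \<open>\<delta>\<close> keeps \<open>c\<close> and the values positive. At a fixed point \<open>c = 1\<close> unless the
truncation is active, and it never is: at the rate \<open>L\<close> the hypothesis \<open>w_top\<close> forces \<open>c < 1\<close>, as seen
at the state of largest value, and at \<open>- L\<close> the hypothesis \<open>w_bot\<close> forces \<open>c > 1\<close>, as seen at the state of
smallest value.\<close>

lemma discretised_game_equilibrium:
  fixes w :: "bool \<Rightarrow> 's::finite \<Rightarrow> nat \<Rightarrow> nat \<Rightarrow> real \<Rightarrow> real"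
    and p :: "bool \<Rightarrow> 's \<Rightarrow> 's \<Rightarrow> nat \<Rightarrow> nat \<Rightarrow> real"
    and L \<eta> \<delta> \<omega> :: real
  assumes "0 < N" "0 < L" "0 < \<eta>" "0 < \<delta>" and \<delta>: "\<omega> + CARD('s) * \<delta> < 1"
    and p_nonneg: "\<And>m i j k l. k < N \<Longrightarrow> l < N \<Longrightarrow> 0 \<le> p m i j k l"
    and p_sum: "\<And>m i k l. k < N \<Longrightarrow> l < N \<Longrightarrow> (\<Sum>j\<in>UNIV. p m i j k l) = 1"
    and w_cont: "\<And>m i k l. k < N \<Longrightarrow> l < N \<Longrightarrow> continuous_on {-L..L} (w m i k l)"
    and w_nonneg: "\<And>m i k l g. k < N \<Longrightarrow> l < N \<Longrightarrow> g \<in> {-L..L} \<Longrightarrow> 0 \<le> w m i k l g"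
    and w_top: "\<And>m i k l. k < N \<Longrightarrow> l < N \<Longrightarrow> w m i k l L \<le> \<omega>"
    and w_bot: "\<And>m i k l. k < N \<Longrightarrow> l < N \<Longrightarrow> 1 \<le> w m i k l (- L)"
  shows "\<exists>x V g. (\<forall>m i k. 0 \<le> x m i k) \<and> (\<forall>m i. (\<Sum>k<N. x m i k) = 1) \<and>
    (\<forall>m i. V m i \<in> {0..1}) \<and> (\<forall>m. (\<Sum>i\<in>UNIV. V m i) = 1) \<and> (\<forall>m. g m \<in> {-L..L}) \<and>
    (\<forall>m i. V m i = (\<Sum>k<N. x m i k * expected_cost N w p x V g m i k) + \<delta>) \<and>
    (\<forall>m i k. k < N \<longrightarrow>
      (\<Sum>k<N. x m i k * expected_cost N w p x V g m i k) \<le> expected_cost N w p x V g m i k + N / \<eta>)"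
proof -
  define xx where "xx y = (\<lambda>m i k. y (Weight m i k))" for y :: "'s game_var \<Rightarrow> real"
  define vv where "vv y = (\<lambda>m i. y (Value m i))" for y :: "'s game_var \<Rightarrow> real"
  define gg where "gg y = (\<lambda>m. L * (2 * y (Rate m) - 1))" for y :: "'s game_var \<Rightarrow> real"
  define q where "q y = expected_cost N w p (xx y) (vv y) (gg y)" for y :: "'s game_var \<Rightarrow> real"
  define r where "r y m i = (\<Sum>k<N. y (Weight m i k) * q y m i k)" for y m i
  define c where "c y m = (\<Sum>i\<in>UNIV. r y m i + \<delta>)" for y m
  define f where "f y v = (case v of
      Weight m i k \<Rightarrow> exp (- \<eta> * q y m i k) / (\<Sum>l<N. exp (- \<eta> * q y m i l))
    | Value m i \<Rightarrow> (r y m i + \<delta>) / c y m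
    | Rate m \<Rightarrow> min 1 (max 0 (y (Rate m) + (c y m - 1))))" for y v
  define Q where "Q = {y :: 's game_var \<Rightarrow> real. \<forall>i. y i \<in> {0..1}}"
  define I where "I = {v :: 's game_var. \<forall>m i k. v = Weight m i k \<longrightarrow> k < N}"
  have coord [continuous_intros]: "continuous_on Q (\<lambda>y. y v)" for v :: "'s game_var"
    by (rule continuous_on_subset[OF continuous_on_product_coordinates]) simp
  have gg: "gg y m \<in> {-L..L}" if "y \<in> Q" for y m
  proof -
    have "0 \<le> y (Rate m)" "y (Rate m) \<le> 1" using that by (auto simp: Q_def)
    then have "L * (-1) \<le> gg y m" "gg y m \<le> L * 1"
      unfolding gg_def using \<open>0 < L\<close> by (intro mult_left_mono; simp)+
    then show ?thesis by simp
  qed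
  have w_gg: "continuous_on Q (\<lambda>y. w m i k l (gg y m))" if "k < N" "l < N" for m i k l
    by (rule continuous_on_compose2[OF w_cont[OF that]])
       (use gg in \<open>auto simp: gg_def intro!: continuous_intros\<close>)
  have q_cont [continuous_intros]: "continuous_on Q (\<lambda>y. q y m i k)" if "k < N" for m i k
    unfolding q_def expected_cost_def xx_def vv_def
    using that by (intro continuous_intros w_gg) auto
  have r_cont [continuous_intros]: "continuous_on Q (\<lambda>y. r y m i)" for m i
    unfolding r_def by (intro continuous_intros) auto
  have c_cont [continuous_intros]: "continuous_on Q (\<lambda>y. c y m)" for m
    unfolding c_def by (intro continuous_intros)
  have Q: "0 \<le> y v" "y v \<le> 1" if "y \<in> Q" for y v
    using that by (auto simp: Q_def)
  have q_nonneg: "0 \<le> q y m i k" if "y \<in> Q" "k < N" for y m i k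
    unfolding q_def expected_cost_def xx_def vv_def using that
    by (intro sum_nonneg mult_nonneg_nonneg w_nonneg[OF _ _ gg] p_nonneg Q) auto
  have r_nonneg: "0 \<le> r y m i" if "y \<in> Q" for y m i
    unfolding r_def using that by (intro sum_nonneg mult_nonneg_nonneg q_nonneg Q) auto
  have c_pos: "0 < c y m" if "y \<in> Q" for y m
    unfolding c_def using r_nonneg[OF that] \<open>0 < \<delta>\<close> by (intro sum_pos) (auto intro: add_nonneg_pos)
  have Z_pos: "0 < (\<Sum>l<N. exp (- \<eta> * q y m i l))" for y m i
    using \<open>0 < N\<close> by (intro sum_pos) auto
  have "\<exists>y\<in>Q. \<forall>v\<in>I. f y v = y v"
    unfolding Q_def
  proof (rule cube_fixed_point)
    show "finite I" unfolding I_def by (rule finite_game_var)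
  next
    fix v assume "v \<in> I"
    show "continuous_on {y. \<forall>i. y i \<in> {0..1}} (\<lambda>y. f y v)"
      unfolding Q_def[symmetric]
    proof (cases v)
      case (Weight m i k)
      then have "k < N" using \<open>v \<in> I\<close> by (auto simp: I_def)
      then show "continuous_on Q (\<lambda>y. f y v)"
        unfolding f_def Weight using Z_pos by (auto intro!: continuous_intros simp: less_imp_neq[symmetric])
    next
      case (Value m i)
      then show "continuous_on Q (\<lambda>y. f y v)"
        unfolding f_def Value using c_pos by (auto intro!: continuous_intros simp: less_imp_neq[symmetric])
    next
      case (Rate m)
      then show "continuous_on Q (\<lambda>y. f y v)"
        unfolding f_def Rate by (auto intro!: continuous_intros)
    qed
  next
    fix y :: "'s game_var \<Rightarrow> real" and v assume "y \<in> {y. \<forall>i. y i \<in> {0..1}}" "v \<in> I"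
    then have y: "y \<in> Q" by (simp add: Q_def)
    show "f y v \<in> {0..1}"
    proof (cases v)
      case (Weight m i k)
      then have "k < N" using \<open>v \<in> I\<close> by (auto simp: I_def)
      then have "exp (- \<eta> * q y m i k) \<le> (\<Sum>l<N. exp (- \<eta> * q y m i l))"
        by (intro member_le_sum) auto
      then show ?thesis
        using Z_pos[of y m i] by (simp add: f_def Weight divide_le_eq_1)
    next
      case (Value m i)
      have "r y m i + \<delta> \<le> c y m"
        unfolding c_def using r_nonneg[OF y] \<open>0 < \<delta>\<close> by (intro member_le_sum) (auto intro: add_nonneg_nonneg)
      then show ?thesis
        using c_pos[OF y, of m] r_nonneg[OF y, of m i] \<open>0 < \<delta>\<close> by (simp add: f_def Value divide_le_eq_1)
    next
      case (Rate m)
      then show ?thesis by (simp add: f_def)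
    qed
  qed
  then obtain y where y: "y \<in> Q" and fix_y: "\<And>v. v \<in> I \<Longrightarrow> f y v = y v" by blast
  have weight: "y (Weight m i k) = exp (- \<eta> * q y m i k) / (\<Sum>l<N. exp (- \<eta> * q y m i l))" if "k < N" for m i k
    using fix_y[of "Weight m i k"] that by (simp add: I_def f_def)
  have weight_sum: "(\<Sum>k<N. y (Weight m i k)) = 1" for m i
    using Z_pos[of y m i] by (simp add: weight flip: sum_divide_distrib)
  have val: "y (Value m i) = (r y m i + \<delta>) / c y m" for m i
    using fix_y[of "Value m i"] by (simp add: I_def f_def)
  have val_sum: "(\<Sum>i\<in>UNIV. y (Value m i)) = 1" for m
    using c_pos[OF y, of m] by (simp add: val c_def flip: sum_divide_distrib)
  have val_pos: "0 < y (Value m i)" for m i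
    using c_pos[OF y, of m] r_nonneg[OF y, of m i] \<open>0 < \<delta>\<close> by (simp add: val)
  have val_c: "c y m * y (Value m i) = r y m i + \<delta>" for m i
    using c_pos[OF y, of m] by (simp add: val)
  have avg_ge: "v \<le> (\<Sum>j\<in>UNIV. y (Value m j) * p m i j k l)"
    if "k < N" "l < N" "\<And>j. v \<le> y (Value m j)" for v m i k l
  proof -
    have "v = (\<Sum>j\<in>UNIV. v * p m i j k l)"
      using p_sum[OF that(1,2)] by (simp flip: sum_distrib_left)
    also have "\<dots> \<le> (\<Sum>j\<in>UNIV. y (Value m j) * p m i j k l)"
      by (intro sum_mono mult_right_mono that p_nonneg)
    finally show ?thesis .
  qed
  have avg_le: "(\<Sum>j\<in>UNIV. y (Value m j) * p m i j k l) \<le> v"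
    if "k < N" "l < N" "\<And>j. y (Value m j) \<le> v" for v m i k l
  proof -
    have "(\<Sum>j\<in>UNIV. y (Value m j) * p m i j k l) \<le> (\<Sum>j\<in>UNIV. v * p m i j k l)"
      by (intro sum_mono mult_right_mono that p_nonneg)
    also have "\<dots> = v"
      using p_sum[OF that(1,2)] by (simp flip: sum_distrib_left)
    finally show ?thesis .
  qed
  have c_one: "c y m = 1" for m
  proof -
    have rate: "y (Rate m) = min 1 (max 0 (y (Rate m) + (c y m - 1)))"
      using fix_y[of "Rate m"] by (simp add: I_def f_def)
    have "c y m < 1" if "y (Rate m) = 1"
    proof -
      define v where "v = Max (range (\<lambda>i. y (Value m i)))"
      have v: "y (Value m j) \<le> v" for j
        unfolding v_def by (intro Max_ge) auto
      have "v \<in> range (\<lambda>i. y (Value m i))"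
        unfolding v_def by (intro Max_in) auto
      then obtain i where i: "y (Value m i) = v" by auto
      have "0 < v" using val_pos[of m i] i by simp
      have "1 \<le> (\<Sum>j\<in>(UNIV :: 's set). v)"
        unfolding val_sum[of m, symmetric] by (intro sum_mono v)
      then have "1 \<le> CARD('s) * v" by simp
      have "gg y m = L" using that by (simp add: gg_def)
      have "q y m i k \<le> \<omega> * v" if k: "k < N" for k
        unfolding q_def expected_cost_def xx_def vv_def
      proof (rule convex_sum_le[OF Q(1)[OF y] weight_sum])
        fix l assume l: "l < N"
        have "0 \<le> (\<Sum>j\<in>UNIV. y (Value m j) * p m i j k l)"
          by (intro sum_nonneg mult_nonneg_nonneg Q y p_nonneg k l)
        moreover have "0 \<le> w m i k l L"
          by (rule w_nonneg[OF k l]) (use \<open>0 < L\<close> in simp)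
        ultimately show "w m i k l (gg y m) * (\<Sum>j\<in>UNIV. y (Value m j) * p m i j k l) \<le> \<omega> * v"
          unfolding \<open>gg y m = L\<close>
          by (intro mult_mono w_top k l avg_le v) (use w_top[OF k l, of m i] in auto)
      qed
      then have "r y m i \<le> \<omega> * v"
        unfolding r_def by (intro convex_sum_le[OF Q(1)[OF y] weight_sum]) auto
      then have "c y m * v \<le> \<omega> * v + \<delta> * 1"
        using val_c[of m i] by (simp add: i)
      also have "\<dots> \<le> \<omega> * v + \<delta> * (CARD('s) * v)"
        using \<open>1 \<le> CARD('s) * v\<close> \<open>0 < \<delta>\<close> by (intro add_left_mono mult_left_mono) auto
      also have "\<dots> = (\<omega> + CARD('s) * \<delta>) * v" by (simp add: algebra_simps)
      finally show ?thesis using \<open>0 < v\<close> \<delta> by simp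
    qed
    moreover have "1 < c y m" if "y (Rate m) = 0"
    proof -
      define v where "v = Min (range (\<lambda>i. y (Value m i)))"
      have v: "v \<le> y (Value m j)" for j
        unfolding v_def by (intro Min_le) auto
      have "v \<in> range (\<lambda>i. y (Value m i))"
        unfolding v_def by (intro Min_in) auto
      then obtain i where i: "y (Value m i) = v" by auto
      have "0 < v" using val_pos[of m i] i by simp
      have "gg y m = - L" using that by (simp add: gg_def)
      have "v \<le> q y m i k" if k: "k < N" for k
        unfolding q_def expected_cost_def xx_def vv_def
      proof (rule convex_sum_ge[OF Q(1)[OF y] weight_sum])
        fix l assume l: "l < N"
        have "1 * v \<le> w m i k l (- L) * (\<Sum>j\<in>UNIV. y (Value m j) * p m i j k l)"
          using w_bot[OF k l, of m i] \<open>0 < v\<close> by (intro mult_mono avg_ge k l v) auto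
        then show "v \<le> w m i k l (gg y m) * (\<Sum>j\<in>UNIV. y (Value m j) * p m i j k l)"
          by (simp add: \<open>gg y m = - L\<close>)
      qed
      then have "v \<le> r y m i"
        unfolding r_def by (intro convex_sum_ge[OF Q(1)[OF y] weight_sum]) auto
      then have "1 * v < c y m * v"
        using val_c[of m i] \<open>0 < \<delta>\<close> by (simp add: i)
      then show ?thesis using \<open>0 < v\<close> by (simp only: mult_less_cancel_right_pos)
    qed
    ultimately show ?thesis using rate by linarith
  qed
  have r_eq: "r y m i = (\<Sum>k<N. y (Weight m i k) * q y m i k)" for m i
    by (simp add: r_def)
  show ?thesis
  proof (intro exI conjI allI impI)
    show "0 \<le> xx y m i k" for m i k using Q[OF y] by (simp add: xx_def)
    show "(\<Sum>k<N. xx y m i k) = 1" for m i by (simp add: xx_def weight_sum)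
    show "vv y m i \<in> {0..1}" for m i using Q[OF y] by (simp add: vv_def)
    show "(\<Sum>i\<in>UNIV. vv y m i) = 1" for m by (simp add: vv_def val_sum)
    show "gg y m \<in> {-L..L}" for m by (rule gg[OF y])
    show "vv y m i = (\<Sum>k<N. xx y m i k * expected_cost N w p (xx y) (vv y) (gg y) m i k) + \<delta>" for m i
      using val_c[of m i] by (simp add: c_one vv_def r_eq q_def xx_def)
    show "(\<Sum>k<N. xx y m i k * expected_cost N w p (xx y) (vv y) (gg y) m i k)
        \<le> expected_cost N w p (xx y) (vv y) (gg y) m i k + N / \<eta>" if "k < N" for m i k
      unfolding q_def[symmetric] using sum_exp_weights_le[OF \<open>0 < \<eta>\<close> that, of "q y m i"]
      by (simp add: xx_def weight)
  qed
qed

section \<open>Weak compactness of probability measures on a compact set\<close>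

text \<open>A Borel coding of a compact metric space by real numbers with continuous decoding on a compact set of
codes; it transports questions about measures on \<open>K\<close> to the real line. For every \<open>n\<close>, the \<open>n\<close>-th digit of \<open>x\<close> is the index of the first ball of radius
\<open>(1/2) ^ n\<close> of a finite cover that contains \<open>x\<close>. The place values \<open>w n\<close> decrease so fast that the
later digits never outweigh a difference in an earlier one. So close codes have equal leading digits, which puts the points into a
common small ball: decoding is uniformly continuous and extends to the closure of the codes.\<close>

lemma compact_metric_coding:
  fixes K :: "'a::polish_space set"
  assumes K: "compact K" "K \<noteq> {}"
  obtains E :: "'a \<Rightarrow> real" and D C where "E \<in> borel_measurable borel" "compact C" "E ` K \<subseteq> C"
    "continuous_on C D" "D ` C \<subseteq> K" "\<forall>x\<in>K. D (E x) = x"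
proof -
  have "\<forall>n. \<exists>c. \<exists>m::nat. K \<subseteq> (\<Union>k<m. ball (c k) ((1/2) ^ n))"
  proof
    fix n :: nat
    have "(0::real) < (1/2) ^ n" by simp
    then have "\<exists>F. finite F \<and> K \<subseteq> (\<Union>x\<in>F. ball x ((1/2) ^ n))"
      using K(1) unfolding compact_eq_totally_bounded by simp
    then obtain F where F: "finite F" "K \<subseteq> (\<Union>x\<in>F. ball x ((1/2) ^ n))" by (elim exE conjE)
    from finite_list[OF F(1)] obtain l where "set l = F" by (elim exE)
    have "K \<subseteq> (\<Union>k<length l. ball (l ! k) ((1/2) ^ n))"
    proof
      fix x assume "x \<in> K"
      then obtain y where "y \<in> set l" "x \<in> ball y ((1/2) ^ n)" using F \<open>set l = F\<close> by blast
      then show "x \<in> (\<Union>k<length l. ball (l ! k) ((1/2) ^ n))"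
        by (auto simp: in_set_conv_nth)
    qed
    then show "\<exists>c. \<exists>m::nat. K \<subseteq> (\<Union>k<m. ball (c k) ((1/2) ^ n))"
      by (intro exI[of _ "\<lambda>k. l ! k"] exI[of _ "length l"])
  qed
  from choice[OF this] obtain c where "\<forall>n. \<exists>m::nat. K \<subseteq> (\<Union>k<m. ball (c n k) ((1/2) ^ n))" ..
  from choice[OF this] obtain m where cm: "\<And>n. K \<subseteq> (\<Union>k<m n. ball (c n k) ((1/2) ^ n))" by blast
  define idx where "idx n x = (LEAST k. dist (c n k) x < (1/2) ^ n)" for n x
  define d where "d n x = real (min (idx n x) (m n))" for n x
  define w where "w = rec_nat (1::real) (\<lambda>n v. v / (4 * (real (m (Suc n)) + 1)))"
  have w_Suc: "w (Suc n) = w n / (4 * (real (m (Suc n)) + 1))" for n by (simp add: w_def)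
  have w_pos: "0 < w n" for n
    by (induction n) (auto simp: w_Suc, simp add: w_def)
  have w_step: "w (Suc n) * m (Suc n) \<le> w n / 4" "w (Suc n) \<le> w n / 4" for n
    unfolding w_Suc using w_pos[of n] by (auto simp: field_simps)
  have w_geo: "w (j + i) \<le> w j * (1/4) ^ i" for j i
  proof (induction i)
    case (Suc i)
    then show ?case using w_step(2)[of "j + i"] by simp
  qed simp
  have d_le: "0 \<le> d n x" "d n x \<le> m n" for n x
    by (auto simp: d_def)
  have d_w: "d (Suc n) x * w (Suc n) \<le> w n / 4" for n x
    using w_step(1)[of n] mult_right_mono[OF d_le(2)[of "Suc n" x] less_imp_le[OF w_pos[of "Suc n"]]] by (simp add: mult.commute)
  \<comment> \<open>Each step of the place values loses a factor 4, the largest digit included, so all digits after \<open>j\<close> contribute at most a third of \<open>w j\<close>.\<close>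
  have geo: "(\<lambda>i. w j * (1/4) ^ i / 4) sums (w j / 3)" for j
    using sums_divide[OF sums_mult[OF geometric_sums[of "1/4::real"], of "w j"], of 4] by simp
  have summ: "summable (\<lambda>n. d n x * w n)" for x
  proof (rule iffD1[OF summable_Suc_iff], rule summable_comparison_test)
    show "\<exists>N. \<forall>n\<ge>N. norm (d (Suc n) x * w (Suc n)) \<le> w 0 * (1/4) ^ n / 4"
      using d_w[of _ x] w_geo[of 0] w_pos d_le(1)
      by (intro exI[of _ 0] allI impI) (auto simp: abs_mult less_imp_le intro: order.trans)
    show "summable (\<lambda>n. w 0 * (1/4) ^ n / 4)" using geo sums_summable by blast
  qed
  define E where "E x = (\<Sum>n. d n x * w n)" for x
  have idx_lt: "idx n x < m n" "dist (c n (idx n x)) x < (1/2) ^ n" if x: "x \<in> K" for n x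
  proof -
    obtain k where k: "k < m n" "dist (c n k) x < (1/2) ^ n"
      using subsetD[OF cm[of n] x] by (auto simp: ball_def)
    show "dist (c n (idx n x)) x < (1/2) ^ n"
      unfolding idx_def by (rule LeastI[of "\<lambda>k. dist (c n k) x < (1/2) ^ n", OF k(2)])
    have "idx n x \<le> k"
      unfolding idx_def by (rule Least_le) (rule k(2))
    with k(1) show "idx n x < m n" by simp
  qed
  have gap: "2 / 3 * w n \<le> \<bar>E x - E y\<bar>" if ne: "d n x \<noteq> d n y" for n x y
  proof -
    define j where "j = (LEAST j. d j x \<noteq> d j y)"
    have j: "d j x \<noteq> d j y" "j \<le> n"
      unfolding j_def by (rule LeastI[of "\<lambda>j. d j x \<noteq> d j y", OF ne], rule Least_le[of "\<lambda>j. d j x \<noteq> d j y", OF ne])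
    have eq: "d i x = d i y" if "i < j" for i
      using not_less_Least[of i "\<lambda>j. d j x \<noteq> d j y"] that by (simp add: j_def)
    define a where "a i = (d i x - d i y) * w i" for i
    have sa: "summable a"
      unfolding a_def left_diff_distrib by (intro summable_diff summ)
    have "E x - E y = suminf a"
      unfolding E_def a_def left_diff_distrib by (rule suminf_diff[OF summ summ])
    also have "\<dots> = (\<Sum>i. a (i + Suc j)) + (\<Sum>i<Suc j. a i)"
      by (rule suminf_split_initial_segment[OF sa])
    also have "(\<Sum>i<Suc j. a i) = a j"
      using eq by (simp add: a_def)
    finally have E_eq: "E x - E y = (\<Sum>i. a (i + Suc j)) + a j" .
    have le: "norm (a (i + Suc j)) \<le> w j * (1/4) ^ i / 4" for i
    proof -
      have "\<bar>d (Suc (j + i)) x * w (Suc (j + i)) - d (Suc (j + i)) y * w (Suc (j + i))\<bar> \<le> w (j + i) / 4"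
        using d_w[of "j + i" x] d_w[of "j + i" y] d_le(1) w_pos[of "Suc (j + i)"]
        by (smt (verit) mult_nonneg_nonneg)
      also have "\<dots> \<le> w j * (1/4) ^ i / 4" using w_geo[of j i] by simp
      finally show ?thesis by (simp add: a_def left_diff_distrib add.commute)
    qed
    have "norm (\<Sum>i. a (i + Suc j)) \<le> (\<Sum>i. w j * (1/4) ^ i / 4)"
      by (rule norm_suminf_le[OF le]) (use geo sums_summable in blast)
    also have "\<dots> = w j / 3" using geo sums_unique by metis
    finally have "\<bar>\<Sum>i. a (i + Suc j)\<bar> \<le> w j / 3" by simp
    moreover have "w j \<le> \<bar>a j\<bar>"
    proof -
      have "1 \<le> \<bar>d j x - d j y\<bar>" using j(1) by (auto simp: d_def)
      then show ?thesis
        using mult_right_mono[of 1 "\<bar>d j x - d j y\<bar>" "w j"] w_pos[of j] by (simp add: a_def abs_mult)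
    qed
    ultimately have "2 / 3 * w j \<le> \<bar>E x - E y\<bar>"
      unfolding E_eq by linarith
    moreover have "w n \<le> w j"
    proof -
      have "w n \<le> w j * (1/4) ^ (n - j)" using w_geo[of j "n - j"] j(2) by simp
      also have "\<dots> \<le> w j * 1" using w_pos[of j] by (intro mult_left_mono power_le_one) auto
      finally show ?thesis by simp
    qed
    ultimately show ?thesis by simp
  qed
  have close: "dist x y < 2 * (1/2) ^ n" if "x \<in> K" "y \<in> K" "\<bar>E x - E y\<bar> < 2 / 3 * w n" for x y n
  proof -
    have "d n x = d n y" using gap[of n x y] that(3) by linarith
    then have "idx n x = idx n y"
      using idx_lt(1)[OF that(1), of n] idx_lt(1)[OF that(2), of n] by (simp add: d_def)
    then show ?thesis
      using idx_lt(2)[OF that(1), of n] idx_lt(2)[OF that(2), of n] dist_triangle3[of x y "c n (idx n x)"] by simp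
  qed
  have inj: "inj_on E K"
  proof (rule inj_onI)
    fix x y assume xy: "x \<in> K" "y \<in> K" "E x = E y"
    have bound: "dist x y \<le> 2 * (1/2) ^ n" for n
      using close[OF xy(1,2), of n] xy(3) w_pos[of n] by simp
    have lim: "(\<lambda>n. 2 * (1/2) ^ n :: real) \<longlonglongrightarrow> 2 * 0"
      by (intro tendsto_mult tendsto_const LIMSEQ_realpow_zero) auto
    have "dist x y \<le> 2 * 0" by (rule LIMSEQ_le_const[OF lim]) (use bound in blast)
    then show "x = y" by simp
  qed
  define D where "D = the_inv_into K E"
  have DE: "D (E x) = x" if "x \<in> K" for x
    unfolding D_def by (rule the_inv_into_f_f[OF inj that])
  have "uniformly_continuous_on (E ` K) D"
    unfolding uniformly_continuous_on_def
  proof (intro allI impI)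
    fix e :: real assume "0 < e"
    then obtain n where n: "(1/2) ^ n < e / 2"
      using real_arch_pow_inv[of "e/2" "1/2"] by auto
    show "\<exists>d>0. \<forall>x\<in>E ` K. \<forall>x'\<in>E ` K. dist x' x < d \<longrightarrow> dist (D x') (D x) < e"
    proof (intro exI[of _ "2 / 3 * w n"] conjI ballI impI)
      fix u v assume "u \<in> E ` K" "v \<in> E ` K" "dist v u < 2 / 3 * w n"
      then obtain x y where "x \<in> K" "y \<in> K" "u = E x" "v = E y" "\<bar>E y - E x\<bar> < 2 / 3 * w n"
        by (auto simp: dist_real_def)
      then have "dist (D v) (D u) < 2 * (1/2) ^ n" using close[of y x n] by (simp add: DE)
      then show "dist (D v) (D u) < e" using n by simp
    qed (use w_pos in simp)
  qed
  then obtain g where g: "uniformly_continuous_on (closure (E ` K)) g" "\<And>x. x \<in> E ` K \<Longrightarrow> D x = g x"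
    by (rule uniformly_continuous_on_extension_on_closure) blast
  have gE: "g (E x) = x" if "x \<in> K" for x
    using g(2)[of "E x"] DE[OF that] that by simp
  have E_bd: "norm (E x) \<le> real (m 0) * w 0 + w 0 / 3" for x
  proof -
    have Ex: "E x = (\<Sum>n. d (Suc n) x * w (Suc n)) + d 0 x * w 0"
      unfolding E_def using suminf_split_head[OF summ[of x]] by simp
    have "norm (\<Sum>n. d (Suc n) x * w (Suc n)) \<le> (\<Sum>i. w 0 * (1/4) ^ i / 4)"
    proof (rule norm_suminf_le)
      show "norm (d (Suc n) x * w (Suc n)) \<le> w 0 * (1/4) ^ n / 4" for n
        using d_w[of n x] w_geo[of 0 n] w_pos[of "Suc n"] d_le(1)[of "Suc n" x] by (simp add: abs_mult)
    qed (use geo sums_summable in blast)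
    moreover have "(\<Sum>i. w 0 * (1/4) ^ i / 4) = w 0 / 3" using geo sums_unique by metis
    moreover have "norm (d 0 x * w 0) \<le> real (m 0) * w 0"
      using d_le[of 0 x] w_pos[of 0] by (simp add: abs_mult mult_right_mono)
    ultimately show ?thesis
      unfolding Ex using norm_triangle_ineq[of "\<Sum>n. d (Suc n) x * w (Suc n)" "d 0 x * w 0"] by linarith
  qed
  show ?thesis
  proof
    show "E \<in> borel_measurable borel"
      unfolding E_def d_def idx_def by measurable
    have "bounded (E ` K)" using E_bd by (auto intro!: boundedI)
    then show "compact (closure (E ` K))" unfolding compact_closure .
    show "E ` K \<subseteq> closure (E ` K)" by (rule closure_subset)
    show "continuous_on (closure (E ` K)) g" using g(1) by (rule uniformly_continuous_imp_continuous)
    then show "g ` closure (E ` K) \<subseteq> K"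
    proof (rule image_closure_subset)
      show "closed K" using K(1) by (rule compact_imp_closed)
      show "g ` E ` K \<subseteq> K" by (auto simp: gE)
    qed
    show "\<forall>x\<in>K. g (E x) = x" by (simp add: gE)
  qed
qed

definition probs_on :: "'a::topological_space set \<Rightarrow> 'a measure set" where
  "probs_on K = {\<mu>. prob_space \<mu> \<and> sets \<mu> = sets borel \<and> (AE x in \<mu>. x \<in> K)}"

lemma set_integrable_probs_on:
  fixes f :: "'a::polish_space \<Rightarrow> real"
  assumes "compact K" "\<mu> \<in> probs_on K" "continuous_on K f"
  shows "set_integrable \<mu> K f"
proof -
  interpret prob_space \<mu> using assms by (simp add: probs_on_def)
  have sets: "sets \<mu> = sets borel" using assms by (simp add: probs_on_def)
  obtain B where B: "\<And>x. x \<in> K \<Longrightarrow> norm (f x) \<le> B"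
    using compact_imp_bounded[OF compact_continuous_image[OF assms(3,1)]]
    by (auto simp: bounded_iff)
  have "K \<in> sets borel" using assms(1) by (rule borel_compact)
  then have "(\<lambda>x. indicator K x *\<^sub>R f x) \<in> borel_measurable \<mu>"
    unfolding measurable_cong_sets[OF sets refl]
    using assms(3) by (rule borel_measurable_continuous_on_indicator)
  then show ?thesis
    unfolding set_integrable_def
    by (rule integrable_const_bound[where B = "\<bar>B\<bar>", rotated])
       (auto intro!: AE_I2 split: split_indicator dest: B)
qed

lemma set_integral_probs_on_const [simp]:
  fixes K :: "'a::polish_space set"
  assumes "compact K" "\<mu> \<in> probs_on K"
  shows "(LINT x:K|\<mu>. (c :: real)) = c"
proof -
  interpret prob_space \<mu> using assms by (simp add: probs_on_def)
  have "(LINT x:K|\<mu>. c) = (LINT x|\<mu>. c)"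
    unfolding set_lebesgue_integral_def
  proof (rule integral_cong_AE)
    have "K \<in> sets \<mu>" using assms by (simp add: probs_on_def borel_compact)
    then show "(\<lambda>x. indicat_real K x *\<^sub>R c) \<in> borel_measurable \<mu>" by simp
    have "AE x in \<mu>. x \<in> K" using assms(2) by (simp add: probs_on_def)
    then show "AE x in \<mu>. indicat_real K x *\<^sub>R c = c" by eventually_elim simp
  qed simp
  then show ?thesis by (simp add: prob_space)
qed

lemma set_integral_probs_on_mono:
  fixes f g :: "'a::polish_space \<Rightarrow> real"
  assumes "compact K" "\<mu> \<in> probs_on K" "continuous_on K f" "continuous_on K g" "\<And>x. x \<in> K \<Longrightarrow> f x \<le> g x"
  shows "(LINT x:K|\<mu>. f x) \<le> (LINT x:K|\<mu>. g x)"
  by (rule set_integral_mono[OF set_integrable_probs_on set_integrable_probs_on]) (use assms in auto)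

lemma set_integral_probs_on_close:
  fixes f g :: "'a::polish_space \<Rightarrow> real"
  assumes "compact K" "\<mu> \<in> probs_on K" "continuous_on K f" "continuous_on K g" "\<And>x. x \<in> K \<Longrightarrow> \<bar>f x - g x\<bar> \<le> e"
  shows "\<bar>(LINT x:K|\<mu>. f x) - (LINT x:K|\<mu>. g x)\<bar> \<le> e"
proof -
  have bounds: "f x - g x \<le> e" "- e \<le> f x - g x" if "x \<in> K" for x
    using assms(5)[OF that] by linarith+
  have "(LINT x:K|\<mu>. f x - g x) \<le> (LINT x:K|\<mu>. e)" "(LINT x:K|\<mu>. - e) \<le> (LINT x:K|\<mu>. f x - g x)"
    by (rule set_integral_probs_on_mono[OF assms(1,2)]; intro continuous_intros assms bounds; assumption)+
  moreover have "(LINT x:K|\<mu>. f x - g x) = (LINT x:K|\<mu>. f x) - (LINT x:K|\<mu>. g x)"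
    by (rule set_integral_diff(2)[OF set_integrable_probs_on set_integrable_probs_on]) (use assms in auto)
  ultimately show ?thesis
    using assms(1,2) by simp
qed

definition weakly_on :: "'a::topological_space set \<Rightarrow> (nat \<Rightarrow> 'a measure) \<Rightarrow> 'a measure \<Rightarrow> bool" where
  "weakly_on K \<mu>s \<mu> \<longleftrightarrow> (\<forall>n. \<mu>s n \<in> probs_on K) \<and> \<mu> \<in> probs_on K \<and>
     (\<forall>f :: 'a \<Rightarrow> real. continuous_on K f \<longrightarrow> (\<lambda>n. LINT x:K|\<mu>s n. f x) \<longlonglongrightarrow> (LINT x:K|\<mu>. f x))"

lemma weakly_on_subseq:
  assumes "weakly_on K \<mu>s \<mu>" "strict_mono r"
  shows "weakly_on K (\<mu>s \<circ> r) \<mu>"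
  unfolding weakly_on_def
proof (intro conjI allI impI)
  fix f :: "'a \<Rightarrow> real" assume "continuous_on K f"
  then have "(\<lambda>n. LINT x:K|\<mu>s n. f x) \<longlonglongrightarrow> (LINT x:K|\<mu>. f x)"
    using assms(1) by (simp add: weakly_on_def)
  from LIMSEQ_subseq_LIMSEQ[OF this assms(2)]
  show "(\<lambda>n. LINT x:K|(\<mu>s \<circ> r) n. f x) \<longlonglongrightarrow> (LINT x:K|\<mu>. f x)" by (simp add: o_def)
qed (use assms(1) in \<open>simp_all add: weakly_on_def\<close>)

text \<open>Coded as measures on the real line, the sequence is tight, and Helly's selection theorem gives a weakly
convergent subsequence. Its limit lives on the set \<open>C\<close> of codes, which is closed; decoding it gives the
limit on \<open>K\<close>. A continuous function on \<open>K\<close> becomes a function of the code that is continuous on \<open>C\<close>, and extends to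
the line by Tietze's theorem.\<close>

lemma probs_on_seq_compact:
  fixes K :: "'a::polish_space set"
  assumes K: "compact K" and \<mu>: "\<And>n :: nat. \<mu> n \<in> probs_on K"
  shows "\<exists>r \<nu>. strict_mono r \<and> weakly_on K (\<mu> \<circ> r) \<nu>"
proof -
  have "K \<noteq> {}"
  proof
    assume "K = {}"
    then have "AE x in \<mu> 0. False" "prob_space (\<mu> 0)" using \<mu>[of 0] by (auto simp: probs_on_def)
    then show False by (simp add: prob_space.AE_False)
  qed
  obtain E :: "'a \<Rightarrow> real" and D C where E: "E \<in> borel_measurable borel" and C: "compact C" "E ` K \<subseteq> C"
    and D: "continuous_on C D" "D ` C \<subseteq> K" "\<forall>x\<in>K. D (E x) = x"
    by (rule compact_metric_coding[OF K \<open>K \<noteq> {}\<close>]) (rule that)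
  from \<open>K \<noteq> {}\<close> C have "C \<noteq> {}" by blast
  define \<mu>' where "\<mu>' n = distr (\<mu> n) borel E" for n
  have sets_\<mu>: "sets (\<mu> n) = sets borel" and prob_\<mu>: "prob_space (\<mu> n)" and AE_\<mu>: "AE x in \<mu> n. x \<in> K" for n
    using \<mu>[of n] by (auto simp: probs_on_def)
  have E_n [measurable]: "E \<in> borel_measurable (\<mu> n)" for n
    using E by (simp add: measurable_cong_sets[OF sets_\<mu> refl])
  have rd: "real_distribution (\<mu>' n)" for n
    unfolding \<mu>'_def by (rule prob_space.real_distribution_distr[OF prob_\<mu>]) simp
  have "bounded C" using C compact_imp_bounded by auto
  then obtain b where b: "0 < b" "\<And>x. x \<in> C \<Longrightarrow> norm x \<le> b" by (auto simp: bounded_pos)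
  \<comment> \<open>Tightness is phrased with half-open intervals, whence the shift of the left end point.\<close>
  have meas1: "measure (\<mu>' n) {-b - 1<..b} = 1" for n
  proof -
    have "AE x in \<mu> n. E x \<in> {-b - 1<..b}"
      using AE_\<mu>[of n]
    proof eventually_elim
      case (elim x)
      then have "norm (E x) \<le> b" using C by (intro b) auto
      then show ?case by (auto simp: abs_le_iff)
    qed
    then have "AE x in \<mu>' n. x \<in> {-b - 1<..b}"
      unfolding \<mu>'_def by (subst AE_distr_iff) auto
    moreover interpret real_distribution "\<mu>' n" by (rule rd)
    show ?thesis by (rule prob_eq_1[THEN iffD2]) (use calculation in auto)
  qed
  have "tight \<mu>'"
    unfolding tight_def
  proof (intro conjI allI impI rd)
    fix e :: real assume "0 < e"
    then show "\<exists>a b. a < b \<and> (\<forall>n. 1 - e < measure (\<mu>' n) {a<..b})"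
      using b(1) by (intro exI[of _ "- b - 1"] exI[of _ b]) (simp add: meas1)
  qed
  from tight_imp_convergent_subsubsequence[OF this strict_mono_id]
  obtain r M where r: "strict_mono r" and M: "real_distribution M" "weak_conv_m (\<mu>' \<circ> r) M"
    by (auto simp: o_def id_def)
  have conv: "(\<lambda>n. LINT x|\<mu> (r n). h (E x)) \<longlonglongrightarrow> (LINT y|M. h y)"
    if h: "continuous_on UNIV h" "\<And>y. \<bar>h y\<bar> \<le> B" for h :: "real \<Rightarrow> real" and B
  proof -
    have "(\<lambda>n. integral\<^sup>L ((\<mu>' \<circ> r) n) h) \<longlonglongrightarrow> integral\<^sup>L M h"
      by (rule weak_conv_imp_integral_bdd_continuous_conv[OF _ M(1) M(2), of h B])
         (use h rd in \<open>auto simp: o_def continuous_on_eq_continuous_at\<close>)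
    moreover have "integral\<^sup>L ((\<mu>' \<circ> r) n) h = (LINT x|\<mu> (r n). h (E x))" for n
      unfolding \<mu>'_def o_def using h(1)
      by (intro integral_distr borel_measurable_continuous_onI) auto
    ultimately show ?thesis by simp
  qed
  interpret M: real_distribution M by (rule M(1))
  \<comment> \<open>The truncated distance to \<open>C\<close> is bounded and continuous, and its integrals vanish along the sequence.\<close>
  have AE_M: "AE y in M. y \<in> C"
  proof -
    define h where "h y = min 1 (infdist y C)" for y
    have h: "continuous_on UNIV h" unfolding h_def by (intro continuous_intros)
    have h_bd: "\<bar>h y\<bar> \<le> 1" for y by (auto simp: h_def infdist_nonneg)
    have "(LINT x|\<mu> (r n). h (E x)) = (LINT x|\<mu> (r n). 0)" for n
    proof (rule integral_cong_AE)
      show "(\<lambda>x. h (E x)) \<in> borel_measurable (\<mu> (r n))"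
        using borel_measurable_continuous_onI[OF h] by measurable
      show "AE x in \<mu> (r n). h (E x) = 0"
        using AE_\<mu>[of "r n"] by eventually_elim (use C in \<open>auto simp: h_def\<close>)
    qed simp
    then have "(LINT y|M. h y) = 0"
      using conv[OF h h_bd] by (simp add: LIMSEQ_const_iff)
    moreover have "integrable M h"
      by (rule M.integrable_const_bound[of _ 1]) (use h_bd borel_measurable_continuous_onI[OF h] in \<open>auto\<close>)
    moreover have "AE y in M. 0 \<le> h y" by (auto simp: h_def infdist_nonneg)
    ultimately have "AE y in M. h y = 0" by (simp add: integral_nonneg_eq_0_iff_AE)
    then show ?thesis
    proof eventually_elim
      case (elim y)
      then have "infdist y C = 0" by (auto simp: h_def min_def split: if_splits)
      then show ?case
        using in_closed_iff_infdist_zero[OF compact_imp_closed[OF C(1)] \<open>C \<noteq> {}\<close>] by blast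
    qed
  qed
  obtain k0 where k0: "k0 \<in> K" using \<open>K \<noteq> {}\<close> by blast
  define D' where "D' y = (if y \<in> C then D y else k0)" for y
  have D' [measurable]: "D' \<in> borel_measurable borel"
    unfolding D'_def by (rule borel_measurable_continuous_on_if) (use borel_compact C D in auto)
  define \<nu> where "\<nu> = distr M borel D'"
  have D'_K: "D' y \<in> K" for y using D(2) k0 by (auto simp: D'_def)
  have [measurable]: "K \<in> sets borel" using K by (rule borel_compact)
  have \<nu>: "\<nu> \<in> probs_on K"
    unfolding probs_on_def \<nu>_def
    by (auto simp: AE_distr_iff D'_K intro!: M.prob_space_distr)
  have "(\<lambda>n. LINT x:K|\<mu> (r n). f x) \<longlonglongrightarrow> (LINT x:K|\<nu>. f x)" if f: "continuous_on K f" for f :: "'a \<Rightarrow> real"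
  proof -
    obtain B where B: "\<And>x. x \<in> K \<Longrightarrow> norm (f x) \<le> B"
      using compact_imp_bounded[OF compact_continuous_image[OF f K]]
      unfolding bounded_iff by auto
    have "0 \<le> B" using B[OF k0] by (rule order.trans[OF norm_ge_zero])
    have "continuous_on C (\<lambda>y. f (D y))"
      by (rule continuous_on_compose2[OF f D(1) D(2)])
    moreover have "closedin (top_of_set UNIV) C" using C compact_imp_closed by auto
    moreover have "f (D y) \<in> cbox (- B) B" if "y \<in> C" for y
      using B[of "D y"] D(2) that by (auto simp: abs_le_iff)
    ultimately obtain h where h: "continuous_on UNIV h" "\<And>y. y \<in> C \<Longrightarrow> h y = f (D y)"
      "\<And>y. h y \<in> cbox (- B) B"
      using Tietze_closed_interval_1[of C "\<lambda>y. f (D y)" UNIV "- B" B] \<open>0 \<le> B\<close> by auto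
    note [measurable] = borel_measurable_continuous_onI[OF h(1)]
    have f_meas [measurable]: "(\<lambda>x. indicat_real K x *\<^sub>R f x) \<in> borel_measurable borel"
      using f by (intro borel_measurable_continuous_on_indicator) auto
    have "(LINT x:K|\<mu> (r n). f x) = (LINT x|\<mu> (r n). h (E x))" for n
      unfolding set_lebesgue_integral_def
    proof (rule integral_cong_AE)
      show "AE x in \<mu> (r n). indicat_real K x *\<^sub>R f x = h (E x)"
        using AE_\<mu>[of "r n"]
      proof eventually_elim
        case (elim x)
        then have "E x \<in> C" using C by auto
        then show ?case using elim by (simp add: h D)
      qed
      show "(\<lambda>x. indicat_real K x *\<^sub>R f x) \<in> borel_measurable (\<mu> (r n))"
        unfolding measurable_cong_sets[OF sets_\<mu> refl] by (rule f_meas)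
    qed measurable
    moreover have "(LINT x:K|\<nu>. f x) = (LINT y|M. indicat_real K (D' y) *\<^sub>R f (D' y))"
      unfolding \<nu>_def set_lebesgue_integral_def by (rule integral_distr[OF _ f_meas]) simp
    moreover have "\<dots> = (LINT y|M. h y)"
    proof (rule integral_cong_AE)
      show "AE y in M. indicat_real K (D' y) *\<^sub>R f (D' y) = h y"
        using AE_M by eventually_elim (simp add: D'_K h(2), simp add: D'_def)
      show "(\<lambda>y. indicat_real K (D' y) *\<^sub>R f (D' y)) \<in> borel_measurable M"
        by (rule measurable_compose[OF _ f_meas]) simp
    qed auto
    moreover have h_bd: "\<bar>h y\<bar> \<le> B" for y using h(3)[of y] by (auto simp: abs_le_iff)
    ultimately show ?thesis using conv[OF h(1) h_bd] by simp
  qed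
  then show ?thesis
    using r \<mu> \<nu> unfolding weakly_on_def by (intro exI[of _ r] exI[of _ \<nu>]) (auto simp: o_def)
qed

section \<open>Integrals of continuous functions under weak convergence\<close>

lemma uniform_slices:
  fixes f :: "'a::metric_space \<times> 'b::metric_space \<Rightarrow> real"
  assumes "compact K1" "compact K2" "continuous_on (K1 \<times> K2) f" "0 < e"
  shows "\<exists>d>0. \<forall>a\<in>K1. \<forall>a'\<in>K1. dist a a' < d \<longrightarrow> (\<forall>b\<in>K2. \<bar>f (a, b) - f (a', b)\<bar> < e)"
proof -
  have "uniformly_continuous_on (K1 \<times> K2) f"
    by (intro compact_uniformly_continuous compact_Times assms)
  then obtain d where d: "0 < d"
    "\<And>x x'. x \<in> K1 \<times> K2 \<Longrightarrow> x' \<in> K1 \<times> K2 \<Longrightarrow> dist x' x < d \<Longrightarrow> dist (f x') (f x) < e"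
    unfolding uniformly_continuous_on_def using \<open>0 < e\<close> by auto
  show ?thesis
  proof (intro exI[of _ d] conjI ballI impI)
    fix a a' b assume "a \<in> K1" "a' \<in> K1" "dist a a' < d" "b \<in> K2"
    then have "dist (f (a, b)) (f (a', b)) < e"
      by (intro d(2)) (auto simp: dist_Pair_Pair)
    then show "\<bar>f (a, b) - f (a', b)\<bar> < e" by (simp add: dist_real_def)
  qed (rule d(1))
qed

lemma continuous_on_slice:
  assumes "continuous_on (K1 \<times> K2) f" "a \<in> K1"
  shows "continuous_on K2 (\<lambda>b. f (a, b))"
  by (rule continuous_on_compose2[OF assms(1)]) (auto intro!: continuous_intros assms(2))

lemma continuous_on_set_integral_probs_on:
  fixes f :: "'a::polish_space \<times> 'b::polish_space \<Rightarrow> real"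
  assumes "compact K1" "compact K2" "continuous_on (K1 \<times> K2) f" "\<beta> \<in> probs_on K2"
  shows "continuous_on K1 (\<lambda>a. LINT b:K2|\<beta>. f (a, b))"
  unfolding continuous_on_iff
proof (intro ballI allI impI)
  fix a and e :: real assume "a \<in> K1" "0 < e"
  then obtain d where d: "0 < d"
    "\<forall>a\<in>K1. \<forall>a'\<in>K1. dist a a' < d \<longrightarrow> (\<forall>b\<in>K2. \<bar>f (a, b) - f (a', b)\<bar> < e / 2)"
    using uniform_slices[OF assms(1-3), of "e/2"] by auto
  show "\<exists>d>0. \<forall>a'\<in>K1. dist a' a < d \<longrightarrow> dist (LINT b:K2|\<beta>. f (a', b)) (LINT b:K2|\<beta>. f (a, b)) < e"
  proof (intro exI[of _ d] conjI ballI impI)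
    fix a' assume "a' \<in> K1" "dist a' a < d"
    then have "\<bar>(LINT b:K2|\<beta>. f (a', b)) - (LINT b:K2|\<beta>. f (a, b))\<bar> \<le> e / 2"
      using d(2) \<open>a \<in> K1\<close>
      by (intro set_integral_probs_on_close assms continuous_on_slice[OF assms(3)]) (auto intro: less_imp_le)
    then show "dist (LINT b:K2|\<beta>. f (a', b)) (LINT b:K2|\<beta>. f (a, b)) < e"
      using \<open>0 < e\<close> by (simp add: dist_real_def)
  qed (rule d(1))
qed

text \<open>Weak convergence gives convergence at finitely many parameters \<open>c\<close> forming a net of \<open>K1\<close>; equicontinuity
of the slices carries it over to all parameters uniformly.\<close>

lemma uniform_limit_set_integral_weakly_on:
  fixes f :: "'a::polish_space \<times> 'b::polish_space \<Rightarrow> real"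
  assumes K: "compact K1" "compact K2" and \<beta>: "weakly_on K2 \<beta>s \<beta>"
    and cont: "continuous_on (K1 \<times> K2) f" "\<And>n. continuous_on (K1 \<times> K2) (fs n)"
    and lim: "uniform_limit (K1 \<times> K2) fs f sequentially"
  shows "uniform_limit K1 (\<lambda>n a. LINT b:K2|\<beta>s n. fs n (a, b)) (\<lambda>a. LINT b:K2|\<beta>. f (a, b)) sequentially"
  unfolding uniform_limit_iff
proof (intro allI impI)
  fix e :: real assume "0 < e"
  then have e: "0 < e / 8" by simp
  have mem: "\<beta>s n \<in> probs_on K2" "\<beta> \<in> probs_on K2" for n using \<beta> by (auto simp: weakly_on_def)
  obtain d where d: "0 < d"
    "\<forall>a\<in>K1. \<forall>a'\<in>K1. dist a a' < d \<longrightarrow> (\<forall>b\<in>K2. \<bar>f (a, b) - f (a', b)\<bar> < e / 8)"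
    using uniform_slices[OF K cont(1) e] by blast
  have "\<exists>F. finite F \<and> F \<subseteq> K1 \<and> K1 \<subseteq> (\<Union>x\<in>F. ball x d)"
    using seq_compact_imp_totally_bounded[OF K(1)[unfolded compact_eq_seq_compact_metric], rule_format, OF d(1)] .
  then obtain F where F: "finite F" "F \<subseteq> K1" "K1 \<subseteq> (\<Union>x\<in>F. ball x d)" by (elim exE conjE)
  have "\<forall>\<^sub>F n in sequentially. \<forall>c\<in>F. \<bar>(LINT b:K2|\<beta>s n. f (c, b)) - (LINT b:K2|\<beta>. f (c, b))\<bar> < e / 8"
    using F(1)
  proof (rule eventually_ball_finite, intro ballI)
    fix c assume "c \<in> F"
    then have "(\<lambda>n. LINT b:K2|\<beta>s n. f (c, b)) \<longlonglongrightarrow> (LINT b:K2|\<beta>. f (c, b))"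
      using \<beta> F(2) continuous_on_slice[OF cont(1)] by (auto simp: weakly_on_def)
    from tendstoD[OF this e]
    show "\<forall>\<^sub>F n in sequentially. \<bar>(LINT b:K2|\<beta>s n. f (c, b)) - (LINT b:K2|\<beta>. f (c, b))\<bar> < e / 8"
      by (simp add: dist_real_def)
  qed
  moreover have "\<forall>\<^sub>F n in sequentially. \<forall>x\<in>K1 \<times> K2. dist (fs n x) (f x) < e / 8"
    by (rule uniform_limitD[OF lim e])
  ultimately show "\<forall>\<^sub>F n in sequentially. \<forall>a\<in>K1. dist (LINT b:K2|\<beta>s n. fs n (a, b)) (LINT b:K2|\<beta>. f (a, b)) < e"
  proof eventually_elim
    case (elim n)
    show ?case
    proof
      fix a assume "a \<in> K1"
      then obtain c where c: "c \<in> F" "dist c a < d" using F(3) by auto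
      then have "c \<in> K1" using F(2) by blast
      note sl = continuous_on_slice[OF cont(1)] continuous_on_slice[OF cont(2)]
      have ca: "\<bar>f (a, b) - f (c, b)\<bar> \<le> e / 8" if "b \<in> K2" for b
        using d(2)[rule_format, OF \<open>a \<in> K1\<close> \<open>c \<in> K1\<close> _ that] c(2) by (simp add: dist_commute less_imp_le)
      have "\<bar>(LINT b:K2|\<beta>s n. fs n (a, b)) - (LINT b:K2|\<beta>s n. f (a, b))\<bar> \<le> e / 8"
        using elim(2) \<open>a \<in> K1\<close>
        by (intro set_integral_probs_on_close K mem sl) (auto intro: less_imp_le simp: dist_real_def)
      moreover have "\<bar>(LINT b:K2|\<beta>s n. f (a, b)) - (LINT b:K2|\<beta>s n. f (c, b))\<bar> \<le> e / 8"
        by (intro set_integral_probs_on_close K mem sl ca \<open>a \<in> K1\<close> \<open>c \<in> K1\<close>)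
      moreover have "\<bar>(LINT b:K2|\<beta>. f (a, b)) - (LINT b:K2|\<beta>. f (c, b))\<bar> \<le> e / 8"
        by (intro set_integral_probs_on_close K mem sl ca \<open>a \<in> K1\<close> \<open>c \<in> K1\<close>)
      moreover have "\<bar>(LINT b:K2|\<beta>s n. f (c, b)) - (LINT b:K2|\<beta>. f (c, b))\<bar> < e / 8"
        using elim(1) c by blast
      ultimately show "dist (LINT b:K2|\<beta>s n. fs n (a, b)) (LINT b:K2|\<beta>. f (a, b)) < e"
        using \<open>0 < e\<close> unfolding dist_real_def by linarith
    qed
  qed
qed

lemma tendsto_set_integral_weakly_on:
  fixes h :: "'a::polish_space \<Rightarrow> real"
  assumes K: "compact K" and \<alpha>: "weakly_on K \<alpha>s \<alpha>"
    and cont: "continuous_on K h" "\<And>n. continuous_on K (hs n)"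
    and lim: "uniform_limit K hs h sequentially"
  shows "(\<lambda>n. LINT a:K|\<alpha>s n. hs n a) \<longlonglongrightarrow> (LINT a:K|\<alpha>. h a)"
proof -
  have mem: "\<alpha>s n \<in> probs_on K" for n using \<alpha> by (auto simp: weakly_on_def)
  have diff: "(\<lambda>n. (LINT a:K|\<alpha>s n. hs n a) - (LINT a:K|\<alpha>s n. h a)) \<longlonglongrightarrow> 0"
  proof (rule tendstoI)
    fix e :: real assume "0 < e"
    then have "\<forall>\<^sub>F n in sequentially. \<forall>x\<in>K. dist (hs n x) (h x) < e / 2"
      by (intro uniform_limitD[OF lim]) simp
    then show "\<forall>\<^sub>F n in sequentially. dist ((LINT a:K|\<alpha>s n. hs n a) - (LINT a:K|\<alpha>s n. h a)) 0 < e"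
    proof eventually_elim
      case (elim n)
      have "\<bar>(LINT a:K|\<alpha>s n. hs n a) - (LINT a:K|\<alpha>s n. h a)\<bar> \<le> e / 2"
        using elim by (intro set_integral_probs_on_close K mem cont) (auto intro: less_imp_le simp: dist_real_def)
      then show ?case using \<open>0 < e\<close> by (simp add: dist_real_def)
    qed
  qed
  have "(\<lambda>n. LINT a:K|\<alpha>s n. h a) \<longlonglongrightarrow> (LINT a:K|\<alpha>. h a)"
    using \<alpha> cont by (auto simp: weakly_on_def)
  from tendsto_add[OF diff this] show ?thesis by simp
qed

lemma tendsto_iterated_integral_weakly_on:
  fixes f :: "'a::polish_space \<times> 'b::polish_space \<Rightarrow> real"
  assumes K: "compact K1" "compact K2" and \<alpha>: "weakly_on K1 \<alpha>s \<alpha>" and \<beta>: "weakly_on K2 \<beta>s \<beta>"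
    and cont: "continuous_on (K1 \<times> K2) f" "\<And>n. continuous_on (K1 \<times> K2) (fs n)"
    and lim: "uniform_limit (K1 \<times> K2) fs f sequentially"
  shows "(\<lambda>n. LINT a:K1|\<alpha>s n. LINT b:K2|\<beta>s n. fs n (a, b)) \<longlonglongrightarrow> (LINT a:K1|\<alpha>. LINT b:K2|\<beta>. f (a, b))"
  using \<beta>
  by (intro tendsto_set_integral_weakly_on[OF K(1) \<alpha>] continuous_on_set_integral_probs_on K cont
      uniform_limit_set_integral_weakly_on[OF K \<beta> cont lim]) (auto simp: weakly_on_def)

lemma weakly_on_common_subseq:
  fixes K :: "'i \<Rightarrow> 'a::polish_space set" and \<mu> :: "'i \<Rightarrow> nat \<Rightarrow> 'a measure"
  assumes "finite I" "\<And>i. i \<in> I \<Longrightarrow> compact (K i)" "\<And>i n. i \<in> I \<Longrightarrow> \<mu> i n \<in> probs_on (K i)"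
  shows "\<exists>r \<nu>. strict_mono r \<and> (\<forall>i\<in>I. weakly_on (K i) (\<mu> i \<circ> r) (\<nu> i))"
  using assms
proof (induction I rule: finite_induct)
  case empty
  show ?case by (intro exI[of _ id]) (auto intro: strict_mono_id)
next
  case (insert j I)
  have "\<exists>r \<nu>. strict_mono r \<and> (\<forall>i\<in>I. weakly_on (K i) (\<mu> i \<circ> r) (\<nu> i))"
    by (rule insert.IH) (use insert.prems in auto)
  then obtain r \<nu> where r: "strict_mono r" "\<forall>i\<in>I. weakly_on (K i) (\<mu> i \<circ> r) (\<nu> i)"
    by (elim exE conjE)
  obtain r' \<nu>' where r': "strict_mono r'" "weakly_on (K j) ((\<mu> j \<circ> r) \<circ> r') \<nu>'"
    using probs_on_seq_compact[of "K j" "\<mu> j \<circ> r"] insert.prems by auto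
  show ?case
  proof (intro exI[of _ "r \<circ> r'"] exI[of _ "\<nu>(j := \<nu>')"] conjI ballI)
    show "strict_mono (r \<circ> r')" by (rule strict_mono_o[OF r(1) r'(1)])
    fix i assume "i \<in> insert j I"
    then show "weakly_on (K i) (\<mu> i \<circ> (r \<circ> r')) ((\<nu>(j := \<nu>')) i)"
      using r' r(2) weakly_on_subseq[OF _ r'(1), of "K i" "\<mu> i \<circ> r" "\<nu> i"] insert.hyps
      by (auto simp: o_assoc)
  qed
qed

definition weighted_points :: "nat \<Rightarrow> (nat \<Rightarrow> real) \<Rightarrow> (nat \<Rightarrow> 'a::polish_space) \<Rightarrow> 'a measure" where
  "weighted_points N x a = distr (point_measure {..<N} (\<lambda>k. ennreal (x k))) borel a"

lemma weighted_points:
  fixes a :: "nat \<Rightarrow> 'a::polish_space" and f :: "'a \<Rightarrow> real"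
  assumes K: "compact K" "\<And>k. a k \<in> K" and x: "\<And>k. 0 \<le> x k" "(\<Sum>k<N. x k) = 1"
  shows "weighted_points N x a \<in> probs_on K"
    and "continuous_on K f \<Longrightarrow> (LINT y:K|weighted_points N x a. f y) = (\<Sum>k<N. x k * f (a k))"
proof -
  let ?P = "point_measure {..<N} (\<lambda>k. ennreal (x k))"
  have [measurable]: "a \<in> measurable ?P borel" by (simp add: point_measure_def)
  have [measurable]: "K \<in> sets borel" using K(1) by (rule borel_compact)
  have "emeasure ?P (space ?P) = 1"
    using x by (simp add: space_point_measure emeasure_point_measure_finite sum_ennreal)
  then interpret P: prob_space ?P by (rule prob_spaceI)
  show "weighted_points N x a \<in> probs_on K"
    unfolding probs_on_def weighted_points_def
    by (auto intro!: P.prob_space_distr simp: AE_distr_iff K)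
  assume f: "continuous_on K f"
  have "(LINT y:K|weighted_points N x a. f y) = (LINT k|?P. indicat_real K (a k) *\<^sub>R f (a k))"
    unfolding weighted_points_def set_lebesgue_integral_def
    by (intro integral_distr borel_measurable_continuous_on_indicator f) auto
  also have "\<dots> = (\<Sum>k<N. x k * f (a k))"
    using x by (simp add: K lebesgue_integral_point_measure_finite)
  finally show "(LINT y:K|weighted_points N x a. f y) = (\<Sum>k<N. x k * f (a k))" .
qed

section \<open>Equilibria on compact action sets\<close>

lemma uniform_limit_parameter:
  fixes f :: "'c::metric_space \<times> 'd::metric_space \<Rightarrow> real"
  assumes "compact P" "compact K" "continuous_on (P \<times> K) f" "\<And>n. \<theta>s n \<in> P" "\<theta> \<in> P" "\<theta>s \<longlonglongrightarrow> \<theta>"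
  shows "uniform_limit K (\<lambda>n x. f (\<theta>s n, x)) (\<lambda>x. f (\<theta>, x)) sequentially"
  unfolding uniform_limit_iff
proof (intro allI impI)
  fix e :: real assume "0 < e"
  then obtain d where d: "0 < d"
    "\<forall>t\<in>P. \<forall>t'\<in>P. dist t t' < d \<longrightarrow> (\<forall>x\<in>K. \<bar>f (t, x) - f (t', x)\<bar> < e)"
    using uniform_slices[OF assms(1-3) \<open>0 < e\<close>] by blast
  from tendstoD[OF assms(6) d(1)]
  show "\<forall>\<^sub>F n in sequentially. \<forall>x\<in>K. dist (f (\<theta>s n, x)) (f (\<theta>, x)) < e"
    by eventually_elim (use d(2) assms(4,5) in \<open>simp add: dist_real_def\<close>)
qed

lemma dense_sequence:
  fixes A :: "'a::polish_space set"
  assumes "A \<noteq> {}"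
  obtains a :: "nat \<Rightarrow> 'a" where "range a \<subseteq> A" "A \<subseteq> closure (range a)"
proof -
  obtain T where T: "countable T" "T \<subseteq> A" "A \<subseteq> closure T"
    by (rule separable)
  have "T \<noteq> {}" using T(3) assms by auto
  from range_from_nat_into[OF this T(1)] have rng: "range (from_nat_into T) = T" .
  show ?thesis by (rule that[of "from_nat_into T"]) (unfold rng, rule T(2), rule T(3))
qed

lemma continuous_ge_on_closure:
  fixes h :: "'a::polish_space \<Rightarrow> real"
  assumes "continuous_on A h" "range a \<subseteq> A" "A \<subseteq> closure (range a)" "\<And>k. c \<le> h (a k)" "x \<in> A"
  shows "c \<le> h x"
proof -
  have "x \<in> closure (range a)" using assms(3,5) by (rule subsetD)
  then obtain s where s: "\<forall>n. s n \<in> range a" "s \<longlonglongrightarrow> x"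
    unfolding closure_sequential by (elim exE conjE)
  have in_A: "s n \<in> A" and ge: "c \<le> h (s n)" for n
    using s(1)[rule_format, of n] assms(2,4) by auto
  have "(\<lambda>n. h (s n)) \<longlonglongrightarrow> h x"
    by (rule continuous_on_tendsto_compose[OF assms(1) s(2) assms(5)]) (simp add: in_A)
  then show ?thesis
    by (rule LIMSEQ_le_const) (simp add: ge)
qed

text \<open>The right-hand side of the optimality equation for fixed actions \<open>ab\<close>. The parameter is the pair of a rate and a value
function, so that both pass to the limit together.\<close>

definition stage_cost :: "('s::finite \<Rightarrow> 'a \<Rightarrow> 'b \<Rightarrow> real \<Rightarrow> real) \<Rightarrow> ('s \<Rightarrow> 's \<Rightarrow> 'a \<Rightarrow> 'b \<Rightarrow> real) \<Rightarrow>
    's \<Rightarrow> real \<times> ('s \<Rightarrow> real) \<Rightarrow> 'a \<times> 'b \<Rightarrow> real" where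
  "stage_cost w p i \<theta> ab = w i (fst ab) (snd ab) (fst \<theta>) * (\<Sum>j\<in>UNIV. snd \<theta> j * p i j (fst ab) (snd ab))"

definition parameters :: "real \<Rightarrow> (real \<times> ('s \<Rightarrow> real)) set" where
  "parameters L = {-L..L} \<times> {V. \<forall>i. V i \<in> {0..1}}"

lemma compact_parameters: "compact (parameters L :: (real \<times> ('s::finite \<Rightarrow> real)) set)"
  unfolding parameters_def by (intro compact_Times compact_Icc compact_cube)

lemma continuous_on_stage_cost:
  fixes w :: "'s::finite \<Rightarrow> 'a::polish_space \<Rightarrow> 'b::polish_space \<Rightarrow> real \<Rightarrow> real"
  assumes p: "\<And>j. continuous_on (A \<times> B) (\<lambda>(a, b). p i j a b)"
    and w: "continuous_on (A \<times> B \<times> {-L..L}) (\<lambda>(a, b, g). w i a b g)"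
  shows "continuous_on (parameters L \<times> (A \<times> B)) (\<lambda>(\<theta>, ab). stage_cost w p i \<theta> ab)"
proof -
  let ?S = "parameters L \<times> (A \<times> B) :: ((real \<times> ('s \<Rightarrow> real)) \<times> ('a \<times> 'b)) set"
  have "continuous_on ?S (\<lambda>x. (\<lambda>(a, b, g). w i a b g) (fst (snd x), snd (snd x), fst (fst x)))"
    by (rule continuous_on_compose2[OF w]) (auto intro!: continuous_intros simp: parameters_def)
  then have 1: "continuous_on ?S (\<lambda>x. w i (fst (snd x)) (snd (snd x)) (fst (fst x)))" by simp
  have "continuous_on ?S (\<lambda>x. (\<lambda>(a, b). p i j a b) (snd x))" for j
    by (rule continuous_on_compose2[OF p]) (auto intro!: continuous_intros)
  then have 2: "continuous_on ?S (\<lambda>x. p i j (fst (snd x)) (snd (snd x)))" for j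
    by (simp add: case_prod_beta)
  have 3: "continuous_on ?S (\<lambda>x. snd (fst x) j)" for j
    by (rule continuous_on_compose2[OF continuous_on_product_coordinates[of j]
          continuous_on_snd[OF continuous_on_fst[OF continuous_on_id]]]) simp
  have "continuous_on ?S (\<lambda>x. w i (fst (snd x)) (snd (snd x)) (fst (fst x)) *
      (\<Sum>j\<in>UNIV. snd (fst x) j * p i j (fst (snd x)) (snd (snd x))))"
    by (intro continuous_on_mult continuous_on_sum 1 2 3)
  then show ?thesis by (simp add: stage_cost_def case_prod_beta)
qed

text \<open>The \<open>n\<close>-th discretised game uses the first \<open>n + 1\<close> points of sequences dense in the action sets. Mixed
actions, rates and values converge along a common subsequence, and the equations pass to the limit since all integrands
converge uniformly. Optimality against each point of the dense sequences extends to all actions by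
continuity.\<close>

theorem compact_game_equilibrium:
  fixes A :: "'s::finite \<Rightarrow> 'a::polish_space set" and B :: "'s \<Rightarrow> 'b::polish_space set"
    and w :: "bool \<Rightarrow> 's \<Rightarrow> 'a \<Rightarrow> 'b \<Rightarrow> real \<Rightarrow> real" and p :: "'s \<Rightarrow> 's \<Rightarrow> 'a \<Rightarrow> 'b \<Rightarrow> real"
  assumes AB: "\<And>i. compact (A i)" "\<And>i. A i \<noteq> {}" "\<And>i. compact (B i)" "\<And>i. B i \<noteq> {}"
    and "0 < L" "\<omega> < 1"
    and p_cont: "\<And>i j. continuous_on (A i \<times> B i) (\<lambda>(a, b). p i j a b)"
    and p_nonneg: "\<And>i j a b. a \<in> A i \<Longrightarrow> b \<in> B i \<Longrightarrow> 0 \<le> p i j a b"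
    and p_sum: "\<And>i a b. a \<in> A i \<Longrightarrow> b \<in> B i \<Longrightarrow> (\<Sum>j\<in>UNIV. p i j a b) = 1"
    and w_cont: "\<And>m i. continuous_on (A i \<times> B i \<times> {-L..L}) (\<lambda>(a, b, g). w m i a b g)"
    and w_nonneg: "\<And>m i a b g. a \<in> A i \<Longrightarrow> b \<in> B i \<Longrightarrow> g \<in> {-L..L} \<Longrightarrow> 0 \<le> w m i a b g"
    and w_top: "\<And>m i a b. a \<in> A i \<Longrightarrow> b \<in> B i \<Longrightarrow> w m i a b L \<le> \<omega>"
    and w_bot: "\<And>m i a b. a \<in> A i \<Longrightarrow> b \<in> B i \<Longrightarrow> 1 \<le> w m i a b (- L)"
  shows "\<exists>\<alpha> \<beta> \<theta>. (\<forall>i. \<alpha> i \<in> probs_on (A i)) \<and> (\<forall>i. \<beta> i \<in> probs_on (B i)) \<and>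
    (\<forall>m. \<theta> m \<in> parameters L \<and> (\<Sum>i\<in>UNIV. snd (\<theta> m) i) = 1) \<and>
    (\<forall>m i. snd (\<theta> m) i = (LINT a:A i|\<alpha> i. LINT b:B i|\<beta> i. stage_cost (w m) p i (\<theta> m) (a, b))) \<and>
    (\<forall>i. \<forall>a\<in>A i. snd (\<theta> True) i \<le> (LINT b:B i|\<beta> i. stage_cost (w True) p i (\<theta> True) (a, b))) \<and>
    (\<forall>i. \<forall>b\<in>B i. snd (\<theta> False) i \<le> (LINT a:A i|\<alpha> i. stage_cost (w False) p i (\<theta> False) (a, b)))"
proof -
  have "\<forall>i. \<exists>a :: nat \<Rightarrow> 'a. range a \<subseteq> A i \<and> A i \<subseteq> closure (range a)"
    by (rule allI, rule dense_sequence[OF AB(2)]) blast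
  from choice[OF this] obtain a :: "'s \<Rightarrow> nat \<Rightarrow> 'a"
    where "\<forall>i. range (a i) \<subseteq> A i \<and> A i \<subseteq> closure (range (a i))" ..
  then have a: "range (a i) \<subseteq> A i" "A i \<subseteq> closure (range (a i))" for i by simp_all
  have "\<forall>i. \<exists>b :: nat \<Rightarrow> 'b. range b \<subseteq> B i \<and> B i \<subseteq> closure (range b)"
    by (rule allI, rule dense_sequence[OF AB(4)]) blast
  from choice[OF this] obtain b :: "'s \<Rightarrow> nat \<Rightarrow> 'b"
    where "\<forall>i. range (b i) \<subseteq> B i \<and> B i \<subseteq> closure (range (b i))" ..
  then have b: "range (b i) \<subseteq> B i" "B i \<subseteq> closure (range (b i))" for i by simp_all
  have aA: "a i k \<in> A i" and bB: "b i k \<in> B i" for i k using a(1)[of i] b(1)[of i] by auto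
  \<comment> \<open>The weights and probabilities as seen by player \<open>m\<close>, with her own action first.\<close>
  define w' where "w' m i k l = (if m then w m i (a i k) (b i l) else w m i (a i l) (b i k))" for m i k l
  define p' where "p' m i j k l = (if m then p i j (a i k) (b i l) else p i j (a i l) (b i k))" for m i j k l
  define \<delta> where "\<delta> n = (1 - \<omega>) / (2 * real CARD('s)) * inverse (real (Suc n))" for n
  have card: "0 < CARD('s)" by simp
  have \<delta>_pos: "0 < \<delta> n" for n unfolding \<delta>_def using \<open>\<omega> < 1\<close>
    by (intro divide_pos_pos mult_pos_pos) simp_all
  have \<delta>_small: "\<omega> + CARD('s) * \<delta> n < 1" for n
  proof -
    have "real CARD('s) * \<delta> n = (1 - \<omega>) / 2 * inverse (real (Suc n))"
      unfolding \<delta>_def by simp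
    also have "\<dots> \<le> (1 - \<omega>) / 2 * 1"
      using \<open>\<omega> < 1\<close> by (intro mult_left_mono) (simp_all add: inverse_le_1_iff)
    also have "\<dots> < 1 - \<omega>" using \<open>\<omega> < 1\<close> by simp
    finally show ?thesis by linarith
  qed
  have w_slice: "continuous_on {-L..L} (w m i u v)" if "u \<in> A i" "v \<in> B i" for m i u v
  proof -
    have "continuous_on {-L..L} (\<lambda>g. (\<lambda>(a, b, g). w m i a b g) (u, v, g))"
      by (rule continuous_on_compose2[OF w_cont]) (auto intro!: continuous_intros that)
    then show ?thesis by simp
  qed
  \<comment> \<open>With \<open>n + 1\<close> actions, the Gibbs parameter \<open>(n + 1)\<^sup>2\<close> makes the regret at most \<open>1 / (n + 1)\<close>.\<close>
  define sol where "sol n x V g \<longleftrightarrow> (\<forall>m i k. 0 \<le> x m i k) \<and> (\<forall>m i. (\<Sum>k<Suc n. x m i k) = 1) \<and>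
    (\<forall>m i. V m i \<in> {0..1}) \<and> (\<forall>m. (\<Sum>i\<in>UNIV. V m i) = 1) \<and> (\<forall>m. g m \<in> {-L..L}) \<and>
    (\<forall>m i. V m i = (\<Sum>k<Suc n. x m i k * expected_cost (Suc n) w' p' x V g m i k) + \<delta> n) \<and>
    (\<forall>m i k. k < Suc n \<longrightarrow>
      (\<Sum>k<Suc n. x m i k * expected_cost (Suc n) w' p' x V g m i k)
        \<le> expected_cost (Suc n) w' p' x V g m i k + Suc n / real ((Suc n)^2))" for n x V g
  have "\<exists>x V g. sol n x V g" for n
    unfolding sol_def
  proof (rule discretised_game_equilibrium[where L = L and \<omega> = \<omega>])
    show "continuous_on {-L..L} (w' m i k l)" for m i k l
      by (cases m) (simp_all add: w'_def w_slice aA bB)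
  next
    show "(\<Sum>j\<in>UNIV. p' m i j k l) = 1" for m i k l
      by (cases m) (simp_all add: p'_def aA bB p_sum)
  qed (use \<delta>_pos \<delta>_small \<open>0 < L\<close> in \<open>simp_all add: w'_def p'_def aA bB p_nonneg p_sum w_nonneg w_top w_bot\<close>)
  then have "\<forall>n. \<exists>t. sol n (fst t) (fst (snd t)) (snd (snd t))" by simp
  from choice[OF this] obtain t where t: "\<forall>n. sol n (fst (t n)) (fst (snd (t n))) (snd (snd (t n)))" ..
  define x where "x n = fst (t n)" for n
  define V where "V n = fst (snd (t n))" for n
  define g where "g n = snd (snd (t n))" for n
  have sol: "sol n (x n) (V n) (g n)" for n using t by (simp add: x_def V_def g_def)
  note s = sol[unfolded sol_def]
  have x: "0 \<le> x n m i k" "(\<Sum>k<Suc n. x n m i k) = 1" for n m i k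
    using s[THEN conjunct1] s[THEN conjunct2, THEN conjunct1] by blast+
  have V: "V n m i \<in> {0..1}" "(\<Sum>i\<in>UNIV. V n m i) = 1" for n m i
    using s[THEN conjunct2, THEN conjunct2, THEN conjunct1] s[THEN conjunct2, THEN conjunct2, THEN conjunct2, THEN conjunct1] by blast+
  have g: "g n m \<in> {-L..L}" for n m
    using s[THEN conjunct2, THEN conjunct2, THEN conjunct2, THEN conjunct2, THEN conjunct1] by blast
  have val: "V n m i = (\<Sum>k<Suc n. x n m i k * expected_cost (Suc n) w' p' (x n) (V n) (g n) m i k) + \<delta> n" for n m i
    using s[THEN conjunct2, THEN conjunct2, THEN conjunct2, THEN conjunct2, THEN conjunct2, THEN conjunct1] by blast
  have opt: "(\<Sum>k<Suc n. x n m i k * expected_cost (Suc n) w' p' (x n) (V n) (g n) m i k)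
        \<le> expected_cost (Suc n) w' p' (x n) (V n) (g n) m i k + Suc n / real ((Suc n)^2)" if "k < Suc n" for n m i k
    using s[THEN conjunct2, THEN conjunct2, THEN conjunct2, THEN conjunct2, THEN conjunct2, THEN conjunct2] that by blast
  define \<alpha>s where "\<alpha>s i n = weighted_points (Suc n) (x n True i) (a i)" for i n
  define \<beta>s where "\<beta>s i n = weighted_points (Suc n) (x n False i) (b i)" for i n
  define \<theta>s where "\<theta>s n m = (g n m, V n m)" for n m
  have \<theta>s: "\<theta>s n m \<in> parameters L" for n m using V g by (auto simp: \<theta>s_def parameters_def)
  have \<alpha>s: "\<alpha>s i n \<in> probs_on (A i)" for i n
    unfolding \<alpha>s_def by (rule weighted_points(1)[OF AB(1) aA x])
  have \<beta>s: "\<beta>s i n \<in> probs_on (B i)" for i n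
    unfolding \<beta>s_def by (rule weighted_points(1)[OF AB(3) bB x])
  have sc: "continuous_on (parameters L \<times> (A i \<times> B i)) (\<lambda>(\<theta>, ab). stage_cost (w m) p i \<theta> ab)" for m i
    by (rule continuous_on_stage_cost[of "A i" "B i" p i L "w m", OF p_cont w_cont])
  have f_cont: "continuous_on (A i \<times> B i) (stage_cost (w m) p i \<theta>)" if "\<theta> \<in> parameters L" for m i \<theta>
    using continuous_on_slice[OF sc that] by simp
  have int_\<alpha>: "(LINT u:A i|\<alpha>s i n. h u) = (\<Sum>k<Suc n. x n True i k * h (a i k))"
    if "continuous_on (A i) h" for i n and h :: "'a \<Rightarrow> real"
    unfolding \<alpha>s_def by (rule weighted_points(2)[OF AB(1) aA x that])
  have int_\<beta>: "(LINT u:B i|\<beta>s i n. h u) = (\<Sum>k<Suc n. x n False i k * h (b i k))"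
    if "continuous_on (B i) h" for i n and h :: "'b \<Rightarrow> real"
    unfolding \<beta>s_def by (rule weighted_points(2)[OF AB(3) bB x that])
  have cost_True: "(LINT v:B i|\<beta>s i n. stage_cost (w True) p i (\<theta>s n True) (a i k, v)) =
      expected_cost (Suc n) w' p' (x n) (V n) (g n) True i k" for i n k
    by (subst int_\<beta>[OF continuous_on_slice[OF f_cont[OF \<theta>s] aA]])
       (simp add: expected_cost_def stage_cost_def \<theta>s_def w'_def p'_def)
  have cost_False: "(LINT u:A i|\<alpha>s i n. stage_cost (w False) p i (\<theta>s n False) (u, b i k)) =
      expected_cost (Suc n) w' p' (x n) (V n) (g n) False i k" for i n k
    by (subst int_\<alpha>[OF continuous_on_compose2[OF f_cont[OF \<theta>s, of i]]])
       (auto intro!: continuous_intros simp: bB expected_cost_def stage_cost_def \<theta>s_def w'_def p'_def)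
  have value_True: "V n True i = (LINT u:A i|\<alpha>s i n. LINT v:B i|\<beta>s i n. stage_cost (w True) p i (\<theta>s n True) (u, v)) + \<delta> n" for n i
    by (subst int_\<alpha>[OF continuous_on_set_integral_probs_on[OF AB(1,3) f_cont[OF \<theta>s] \<beta>s]])
       (unfold cost_True, rule val)
  have value_False: "V n False i = (LINT u:A i|\<alpha>s i n. LINT v:B i|\<beta>s i n. stage_cost (w False) p i (\<theta>s n False) (u, v)) + \<delta> n" for n i
  proof -
    have "(LINT u:A i|\<alpha>s i n. LINT v:B i|\<beta>s i n. stage_cost (w False) p i (\<theta>s n False) (u, v)) =
        (\<Sum>k<Suc n. x n True i k * (LINT v:B i|\<beta>s i n. stage_cost (w False) p i (\<theta>s n False) (a i k, v)))"
      by (rule int_\<alpha>[OF continuous_on_set_integral_probs_on[OF AB(1,3) f_cont[OF \<theta>s] \<beta>s]])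
    also have "\<dots> = (\<Sum>k<Suc n. x n True i k * (\<Sum>l<Suc n. x n False i l * stage_cost (w False) p i (\<theta>s n False) (a i k, b i l)))"
      by (intro sum.cong refl arg_cong2[where f = "(*)"] int_\<beta> continuous_on_slice[OF f_cont[OF \<theta>s] aA])
    also have "\<dots> = (\<Sum>l<Suc n. x n False i l * (\<Sum>k<Suc n. x n True i k * stage_cost (w False) p i (\<theta>s n False) (a i k, b i l)))"
      unfolding sum_distrib_left by (subst sum.swap) (simp add: mult.left_commute)
    also have "\<dots> = (\<Sum>l<Suc n. x n False i l * expected_cost (Suc n) w' p' (x n) (V n) (g n) False i l)"
      by (simp add: expected_cost_def stage_cost_def \<theta>s_def w'_def p'_def)
    finally show ?thesis using val[of n False i] by simp
  qed
  let ?P = "parameters L \<times> parameters L :: ((real \<times> ('s \<Rightarrow> real)) \<times> (real \<times> ('s \<Rightarrow> real))) set"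
  have "seq_compact ?P"
    using compact_Times[OF compact_parameters compact_parameters] unfolding compact_eq_seq_compact_metric .
  moreover have "\<forall>n. (\<theta>s n True, \<theta>s n False) \<in> ?P" using \<theta>s by simp
  ultimately obtain \<theta>\<theta> r0 where r0: "\<theta>\<theta> \<in> ?P" "strict_mono r0" "((\<lambda>n. (\<theta>s n True, \<theta>s n False)) \<circ> r0) \<longlonglongrightarrow> \<theta>\<theta>"
    by (rule seq_compactE)
  obtain r1 \<alpha> where r1: "strict_mono r1" "\<And>i. weakly_on (A i) ((\<lambda>n. \<alpha>s i (r0 n)) \<circ> r1) (\<alpha> i)"
    using weakly_on_common_subseq[of UNIV A "\<lambda>i n. \<alpha>s i (r0 n)"] AB(1) \<alpha>s by auto
  obtain r2 \<beta> where r2: "strict_mono r2" "\<And>i. weakly_on (B i) ((\<lambda>n. \<beta>s i (r0 (r1 n))) \<circ> r2) (\<beta> i)"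
    using weakly_on_common_subseq[of UNIV B "\<lambda>i n. \<beta>s i (r0 (r1 n))"] AB(3) \<beta>s by auto
  \<comment> \<open>Successive subsequences: for rates and values, for player 1, for player 2.\<close>
  define r where "r = (\<lambda>n. r0 (r1 (r2 n)))"
  have r: "strict_mono r"
    using strict_mono_o[OF r0(2) strict_mono_o[OF r1(1) r2(1)]] by (simp add: r_def o_def)
  have \<alpha>: "weakly_on (A i) (\<lambda>n. \<alpha>s i (r n)) (\<alpha> i)" for i
    using weakly_on_subseq[OF r1(2) r2(1)] by (simp add: r_def o_def)
  have \<beta>: "weakly_on (B i) (\<lambda>n. \<beta>s i (r n)) (\<beta> i)" for i
    using r2(2) by (simp add: r_def o_def)
  define \<theta> where "\<theta> m = (if m then fst \<theta>\<theta> else snd \<theta>\<theta>)" for m :: bool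
  have \<theta>: "\<theta> m \<in> parameters L" for m using r0(1) by (auto simp: \<theta>_def)
  have "(\<lambda>n. (\<theta>s (r n) True, \<theta>s (r n) False)) \<longlonglongrightarrow> \<theta>\<theta>"
    using LIMSEQ_subseq_LIMSEQ[OF r0(3) strict_mono_o[OF r1(1) r2(1)]] by (simp add: r_def o_def)
  from tendsto_fst[OF this] tendsto_snd[OF this]
  have \<theta>_lim: "(\<lambda>n. \<theta>s (r n) m) \<longlonglongrightarrow> \<theta> m" for m by (cases m) (simp_all add: \<theta>_def)
  have V_lim: "(\<lambda>n. V (r n) m i) \<longlonglongrightarrow> snd (\<theta> m) i" for m i
    using continuous_on_tendsto_compose[OF continuous_on_product_coordinates[of i] tendsto_snd[OF \<theta>_lim[of m]]]
    by (simp add: \<theta>s_def)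
  have f_lim: "uniform_limit (A i \<times> B i) (\<lambda>n. stage_cost (w m) p i (\<theta>s (r n) m)) (stage_cost (w m) p i (\<theta> m)) sequentially" for m i
    using uniform_limit_parameter[OF compact_parameters compact_Times[OF AB(1)[of i] AB(3)[of i]]
        sc[where m = m and i = i] \<theta>s[where m = m] \<theta>[of m] \<theta>_lim[of m]] by simp
  have to_0: "(\<lambda>n. inverse (real (Suc (r n)))) \<longlonglongrightarrow> 0"
    using LIMSEQ_subseq_LIMSEQ[OF LIMSEQ_inverse_real_of_nat r] by (simp add: o_def)
  have \<delta>_lim: "(\<lambda>n. \<delta> (r n)) \<longlonglongrightarrow> 0"
    unfolding \<delta>_def using tendsto_mult[OF tendsto_const[of "(1 - \<omega>) / (2 * real CARD('s))"] to_0] by simp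
  have int_lim: "(\<lambda>n. LINT u:A i|\<alpha>s i (r n). LINT v:B i|\<beta>s i (r n). stage_cost (w m) p i (\<theta>s (r n) m) (u, v))
      \<longlonglongrightarrow> (LINT u:A i|\<alpha> i. LINT v:B i|\<beta> i. stage_cost (w m) p i (\<theta> m) (u, v))" for m i
    by (rule tendsto_iterated_integral_weakly_on[OF AB(1,3) \<alpha> \<beta> f_cont[OF \<theta>] f_cont[OF \<theta>s] f_lim])
  have payoff: "snd (\<theta> m) i = (LINT u:A i|\<alpha> i. LINT v:B i|\<beta> i. stage_cost (w m) p i (\<theta> m) (u, v))" for m i
  proof (rule LIMSEQ_unique[OF V_lim])
    have "V (r n) m i = (LINT u:A i|\<alpha>s i (r n). LINT v:B i|\<beta>s i (r n). stage_cost (w m) p i (\<theta>s (r n) m) (u, v)) + \<delta> (r n)" for n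
      using value_True[of "r n" i] value_False[of "r n" i] by (cases m) auto
    then show "(\<lambda>n. V (r n) m i) \<longlonglongrightarrow> (LINT u:A i|\<alpha> i. LINT v:B i|\<beta> i. stage_cost (w m) p i (\<theta> m) (u, v))"
      using tendsto_add[OF int_lim \<delta>_lim] by simp
  qed
  have regret: "V n m i \<le> expected_cost (Suc n) w' p' (x n) (V n) (g n) m i k + inverse (real (Suc n)) + \<delta> n"
    if "k \<le> n" for n m i k
  proof -
    have "x / x\<^sup>2 = inverse x" if "x \<noteq> 0" for x :: real
      using that by (simp add: power2_eq_square field_simps)
    from this[of "real (Suc n)"] have "Suc n / real ((Suc n)^2) = inverse (real (Suc n))" by simp
    then show ?thesis using opt[of k n m i] that val[of n m i] by simp
  qed
  have sum_one: "(\<Sum>i\<in>UNIV. snd (\<theta> m) i) = 1" for m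
  proof (rule LIMSEQ_unique)
    show "(\<lambda>n. \<Sum>i\<in>UNIV. V (r n) m i) \<longlonglongrightarrow> (\<Sum>i\<in>UNIV. snd (\<theta> m) i)" by (intro tendsto_sum V_lim)
    show "(\<lambda>n. \<Sum>i\<in>UNIV. V (r n) m i) \<longlonglongrightarrow> 1" by (simp add: V)
  qed
  have mem: "\<alpha> i \<in> probs_on (A i)" "\<beta> i \<in> probs_on (B i)" for i
    using \<alpha> \<beta> by (auto simp: weakly_on_def)
  have large: "\<exists>N. \<forall>n\<ge>N. k \<le> r n" for k
    by (intro exI[of _ k] allI impI) (use seq_suble[OF r] order.trans in blast)
  have opt_True: "snd (\<theta> True) i \<le> (LINT v:B i|\<beta> i. stage_cost (w True) p i (\<theta> True) (u, v))" if "u \<in> A i" for i u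
  proof (rule continuous_ge_on_closure[OF _ a _ that])
    show "continuous_on (A i) (\<lambda>u. LINT v:B i|\<beta> i. stage_cost (w True) p i (\<theta> True) (u, v))"
      by (rule continuous_on_set_integral_probs_on[OF AB(1,3) f_cont[OF \<theta>] mem(2)])
    fix k
    have "(\<lambda>n. LINT v:B i|\<beta>s i (r n). stage_cost (w True) p i (\<theta>s (r n) True) (a i k, v))
        \<longlonglongrightarrow> (LINT v:B i|\<beta> i. stage_cost (w True) p i (\<theta> True) (a i k, v))"
      by (rule tendsto_uniform_limitI[OF uniform_limit_set_integral_weakly_on[OF AB(1,3) \<beta> f_cont[OF \<theta>] f_cont[OF \<theta>s] f_lim] aA])
    from tendsto_add[OF tendsto_add[OF this to_0] \<delta>_lim]
    have lim: "(\<lambda>n. expected_cost (Suc (r n)) w' p' (x (r n)) (V (r n)) (g (r n)) True i k + inverse (real (Suc (r n))) + \<delta> (r n))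
        \<longlonglongrightarrow> (LINT v:B i|\<beta> i. stage_cost (w True) p i (\<theta> True) (a i k, v))"
      by (simp add: cost_True)
    show "snd (\<theta> True) i \<le> (LINT v:B i|\<beta> i. stage_cost (w True) p i (\<theta> True) (a i k, v))"
      by (rule LIMSEQ_le[OF V_lim lim]) (use large[of k] regret in blast)
  qed
  have f_cont': "continuous_on (B i \<times> A i) (\<lambda>(v, u). stage_cost (w m) p i \<theta> (u, v))" if "\<theta> \<in> parameters L" for m i \<theta>
  proof -
    have "continuous_on (B i \<times> A i) (\<lambda>x. stage_cost (w m) p i \<theta> (snd x, fst x))"
      by (rule continuous_on_compose2[OF f_cont[OF that]]) (auto intro!: continuous_intros)
    then show ?thesis by (simp add: case_prod_beta)
  qed
  have f_lim': "uniform_limit (B i \<times> A i) (\<lambda>n (v, u). stage_cost (w m) p i (\<theta>s (r n) m) (u, v))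
      (\<lambda>(v, u). stage_cost (w m) p i (\<theta> m) (u, v)) sequentially" for m i
    unfolding uniform_limit_iff
  proof (intro allI impI)
    fix e :: real assume "0 < e"
    from uniform_limitD[OF f_lim[where m = m and i = i] this]
    show "\<forall>\<^sub>F n in sequentially. \<forall>x\<in>B i \<times> A i. dist (case x of (v, u) \<Rightarrow> stage_cost (w m) p i (\<theta>s (r n) m) (u, v))
        (case x of (v, u) \<Rightarrow> stage_cost (w m) p i (\<theta> m) (u, v)) < e"
      by (rule eventually_mono) auto
  qed
  have opt_False: "snd (\<theta> False) i \<le> (LINT u:A i|\<alpha> i. stage_cost (w False) p i (\<theta> False) (u, v))" if "v \<in> B i" for i v
  proof (rule continuous_ge_on_closure[OF _ b _ that])
    show "continuous_on (B i) (\<lambda>v. LINT u:A i|\<alpha> i. stage_cost (w False) p i (\<theta> False) (u, v))"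
      using continuous_on_set_integral_probs_on[OF AB(3,1) f_cont'[OF \<theta>] mem(1)] by simp
    fix k
    have "(\<lambda>n. LINT u:A i|\<alpha>s i (r n). stage_cost (w False) p i (\<theta>s (r n) False) (u, b i k))
        \<longlonglongrightarrow> (LINT u:A i|\<alpha> i. stage_cost (w False) p i (\<theta> False) (u, b i k))"
      using tendsto_uniform_limitI[OF uniform_limit_set_integral_weakly_on[OF AB(3,1) \<alpha> f_cont'[OF \<theta>] f_cont'[OF \<theta>s] f_lim'] bB]
      by simp
    from tendsto_add[OF tendsto_add[OF this to_0] \<delta>_lim]
    have lim: "(\<lambda>n. expected_cost (Suc (r n)) w' p' (x (r n)) (V (r n)) (g (r n)) False i k + inverse (real (Suc (r n))) + \<delta> (r n))
        \<longlonglongrightarrow> (LINT u:A i|\<alpha> i. stage_cost (w False) p i (\<theta> False) (u, b i k))"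
      by (simp add: cost_False)
    show "snd (\<theta> False) i \<le> (LINT u:A i|\<alpha> i. stage_cost (w False) p i (\<theta> False) (u, b i k))"
      by (rule LIMSEQ_le[OF V_lim lim]) (use large[of k] regret in blast)
  qed
  show ?thesis
    by (intro exI[of _ \<alpha>] exI[of _ \<beta>] exI[of _ \<theta>] conjI allI ballI mem \<theta> sum_one payoff opt_True opt_False)
qed

section \<open>Conditional laws as integral identities\<close>

text \<open>A family of sets on which finite measures can be compared. Conditional probabilities of the sets of such
a family, each known up to a null set, fix a conditional law.\<close>

definition determining :: "'r measure \<Rightarrow> 'r set set \<Rightarrow> bool" where
  "determining R E \<longleftrightarrow> E \<subseteq> sets R \<and> (\<forall>\<mu> \<nu>. finite_measure \<mu> \<longrightarrow> finite_measure \<nu> \<longrightarrow>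
     sets \<mu> = sets R \<longrightarrow> sets \<nu> = sets R \<longrightarrow> (\<forall>A\<in>E. emeasure \<mu> A = emeasure \<nu> A) \<longrightarrow> \<mu> = \<nu>)"

lemma determiningD:
  assumes "determining R E" "finite_measure \<mu>" "finite_measure \<nu>" "sets \<mu> = sets R" "sets \<nu> = sets R"
    "\<And>A. A \<in> E \<Longrightarrow> emeasure \<mu> A = emeasure \<nu> A"
  shows "\<mu> = \<nu>"
  using assms unfolding determining_def by blast

lemma determining_Int_stable:
  assumes "sets R = sigma_sets \<Omega> E" "Int_stable E" "E \<subseteq> Pow \<Omega>" "range (A :: nat \<Rightarrow> _) \<subseteq> E" "(\<Union>n. A n) = \<Omega>"
  shows "determining R E"
  unfolding determining_def
proof (intro conjI allI impI)
  show "E \<subseteq> sets R" using assms(1) by auto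
  fix \<mu> \<nu> :: "'a measure"
  assume fin: "finite_measure \<mu>" "finite_measure \<nu>" and sets: "sets \<mu> = sets R" "sets \<nu> = sets R"
    and eq: "\<forall>A\<in>E. emeasure \<mu> A = emeasure \<nu> A"
  show "\<mu> = \<nu>"
    by (rule measure_eqI_generator_eq[OF assms(2,3) _ _ _ assms(4,5)])
       (use eq fin sets assms(1) in \<open>auto simp: finite_measure.emeasure_finite\<close>)
qed

lemma determining_atMost: "determining (borel :: real measure) (range atMost)"
proof (rule determining_Int_stable)
  show "sets (borel :: real measure) = sigma_sets UNIV (range atMost)"
    unfolding borel_eq_atMost by (simp add: sets_measure_of)
  show "Int_stable (range (atMost :: real \<Rightarrow> _))"
    by (auto simp: Int_stable_def image_iff intro: exI[of _ "min _ _"])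
  show "range (\<lambda>n. {..real n}) \<subseteq> range atMost" by auto
  show "(\<Union>n. {..real n}) = UNIV" by (auto intro: real_arch_simple)
qed auto

lemma determining_singletons: "determining (count_space (UNIV :: 's::finite set)) (range (\<lambda>j. {j}))"
  unfolding determining_def
  by (auto intro!: measure_eqI_finite[of _ UNIV] simp: sets_eq_imp_space_eq)

lemma determining_pair:
  "determining (N \<Otimes>\<^sub>M R) {D \<times> A |D A. D \<in> sets N \<and> A \<in> sets R}"
proof (rule determining_Int_stable)
  show "sets (N \<Otimes>\<^sub>M R) = sigma_sets (space N \<times> space R) {D \<times> A |D A. D \<in> sets N \<and> A \<in> sets R}"
    by (rule sets_pair_measure)
  show "range (\<lambda>n::nat. space N \<times> space R) \<subseteq> {D \<times> A |D A. D \<in> sets N \<and> A \<in> sets R}" by auto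
qed (auto simp: Int_stable_pair_measure_generator dest: sets.sets_into_space)

text \<open>The sets of the \<open>\<sigma>\<close>-algebra generated by \<open>Y\<close> are the preimages \<open>Y -` D\<close>, and conditional expectation is
characterised by its integrals over them. The right-hand side is free of conditional expectations.\<close>

lemma (in prob_space) cond_prob_given_iff:
  assumes [measurable]: "Y \<in> measurable M N" "B \<in> events" "q \<in> borel_measurable N"
    and q: "\<And>y. y \<in> space N \<Longrightarrow> 0 \<le> q y \<and> q y \<le> 1"
  shows "(AE \<omega> in M. cond_prob_given M Y N B \<omega> = q (Y \<omega>)) \<longleftrightarrow>
    (\<forall>D\<in>sets N. emeasure M (Y -` D \<inter> space M \<inter> B) = (\<integral>\<^sup>+\<omega>. indicator D (Y \<omega>) * ennreal (q (Y \<omega>)) \<partial>M))"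
proof -
  let ?F = "vimage_algebra (space M) Y N"
  have YF: "Y \<in> measurable ?F N"
    by (rule measurable_vimage_algebra1) (use measurable_space[OF assms(1)] in auto)
  have subalg: "subalgebra M ?F"
    unfolding subalgebra_def using measurable_sets[OF assms(1)]
    by (auto simp: sets_vimage_algebra2 measurable_space[OF assms(1)])
  interpret finite_measure_subalgebra M ?F by unfold_locales (rule subalg)
  have qY [measurable]: "(\<lambda>\<omega>. q (Y \<omega>)) \<in> borel_measurable M" by measurable
  have int_q: "integrable M (\<lambda>\<omega>. q (Y \<omega>))"
    by (rule integrable_const_bound[of _ 1]) (use q measurable_space[OF assms(1)] in \<open>auto intro!: AE_I2\<close>)
  have int_B: "integrable M (indicator B :: _ \<Rightarrow> real)"
    by (rule integrable_real_indicator) (simp_all add: emeasure_eq_measure)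
  have eq_iff: "emeasure M (Y -` D \<inter> space M \<inter> B) = (\<integral>\<^sup>+\<omega>. indicator D (Y \<omega>) * ennreal (q (Y \<omega>)) \<partial>M) \<longleftrightarrow>
      (\<integral>\<omega>\<in>(Y -` D \<inter> space M). indicator B \<omega> \<partial>M) = (\<integral>\<omega>\<in>(Y -` D \<inter> space M). q (Y \<omega>) \<partial>M)"
    if [measurable]: "D \<in> sets N" for D
  proof -
    let ?D = "Y -` D \<inter> space M"
    have "(\<integral>\<^sup>+\<omega>. indicator D (Y \<omega>) * ennreal (q (Y \<omega>)) \<partial>M) = (\<integral>\<^sup>+\<omega>. ennreal (indicator ?D \<omega> * q (Y \<omega>)) \<partial>M)"
      by (intro nn_integral_cong) (auto split: split_indicator)
    also have "\<dots> = ennreal (\<integral>\<omega>. indicator ?D \<omega> * q (Y \<omega>) \<partial>M)"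
      by (rule nn_integral_eq_integral)
         (use q measurable_space[OF assms(1)] integrable_mult_indicator[OF _ int_q, of ?D] in \<open>auto intro!: AE_I2\<close>)
    finally have 1: "(\<integral>\<^sup>+\<omega>. indicator D (Y \<omega>) * ennreal (q (Y \<omega>)) \<partial>M) = ennreal (\<integral>\<omega>\<in>?D. q (Y \<omega>) \<partial>M)"
      by (simp add: set_lebesgue_integral_def)
    have "(\<integral>\<omega>\<in>?D. indicator B \<omega> \<partial>M) = (\<integral>\<omega>. indicator (?D \<inter> B) \<omega> \<partial>M)"
      unfolding set_lebesgue_integral_def by (intro Bochner_Integration.integral_cong) (auto split: split_indicator)
    also have "\<dots> = measure M (?D \<inter> B)"
      by simp
    finally have 2: "(\<integral>\<omega>\<in>?D. indicator B \<omega> \<partial>M) = measure M (?D \<inter> B)" .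
    have "0 \<le> (\<integral>\<omega>\<in>?D. q (Y \<omega>) \<partial>M)"
      unfolding set_lebesgue_integral_def
      by (intro integral_nonneg_AE AE_I2) (use q measurable_space[OF assms(1)] in auto)
    then show ?thesis
      unfolding 1 2 emeasure_eq_measure by (simp add: measure_nonneg)
  qed
  have sets_F: "A \<in> sets ?F \<longleftrightarrow> (\<exists>D\<in>sets N. A = Y -` D \<inter> space M)" for A
    using measurable_space[OF assms(1)] by (auto simp: sets_vimage_algebra2)
  show ?thesis
  proof
    assume AE: "AE \<omega> in M. cond_prob_given M Y N B \<omega> = q (Y \<omega>)"
    show "\<forall>D\<in>sets N. emeasure M (Y -` D \<inter> space M \<inter> B) = (\<integral>\<^sup>+\<omega>. indicator D (Y \<omega>) * ennreal (q (Y \<omega>)) \<partial>M)"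
    proof
      fix D assume D: "D \<in> sets N"
      let ?D = "Y -` D \<inter> space M"
      have "?D \<in> sets ?F" using D sets_F by blast
      from real_cond_exp_intA[OF int_B this]
      have "(\<integral>\<omega>\<in>?D. indicator B \<omega> \<partial>M) = (\<integral>\<omega>\<in>?D. cond_prob_given M Y N B \<omega> \<partial>M)"
        by (simp add: cond_prob_given_def)
      also have "\<dots> = (\<integral>\<omega>\<in>?D. q (Y \<omega>) \<partial>M)"
        unfolding set_lebesgue_integral_def
      proof (rule integral_cong_AE)
        show "AE \<omega> in M. indicat_real ?D \<omega> *\<^sub>R cond_prob_given M Y N B \<omega> = indicat_real ?D \<omega> *\<^sub>R q (Y \<omega>)"
          using AE by eventually_elim simp
      qed (use D in \<open>simp_all add: cond_prob_given_def\<close>)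
      finally show "emeasure M (Y -` D \<inter> space M \<inter> B) = (\<integral>\<^sup>+\<omega>. indicator D (Y \<omega>) * ennreal (q (Y \<omega>)) \<partial>M)"
        using eq_iff[OF D] by simp
    qed
  next
    assume eq: "\<forall>D\<in>sets N. emeasure M (Y -` D \<inter> space M \<inter> B) = (\<integral>\<^sup>+\<omega>. indicator D (Y \<omega>) * ennreal (q (Y \<omega>)) \<partial>M)"
    show "AE \<omega> in M. cond_prob_given M Y N B \<omega> = q (Y \<omega>)"
      unfolding cond_prob_given_def
    proof (rule real_cond_exp_charact[OF _ int_B int_q])
      show "(\<lambda>\<omega>. q (Y \<omega>)) \<in> borel_measurable ?F" using YF by measurable
      fix A assume "A \<in> sets ?F"
      then obtain D where "D \<in> sets N" "A = Y -` D \<inter> space M" using sets_F by blast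
      then show "(\<integral>\<omega>\<in>A. indicator B \<omega> \<partial>M) = (\<integral>\<omega>\<in>A. q (Y \<omega>) \<partial>M)" using eq eq_iff by blast
    qed
  qed
qed

text \<open>Disintegration: given \<open>Y\<close>, the variable \<open>Z\<close> has the law \<open>\<kappa> Y\<close>.\<close>

definition has_cond_law :: "'w measure \<Rightarrow> ('w \<Rightarrow> 'h) \<Rightarrow> 'h measure \<Rightarrow> ('w \<Rightarrow> 'r) \<Rightarrow> 'r measure \<Rightarrow> ('h \<Rightarrow> 'r measure) \<Rightarrow> bool" where
  "has_cond_law P Y N Z R \<kappa> \<longleftrightarrow> (\<forall>g \<in> borel_measurable (N \<Otimes>\<^sub>M R).
     (\<integral>\<^sup>+\<omega>. g (Y \<omega>, Z \<omega>) \<partial>P) = (\<integral>\<^sup>+\<omega>. (\<integral>\<^sup>+z. g (Y \<omega>, z) \<partial>\<kappa> (Y \<omega>)) \<partial>P))"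

text \<open>From right to left, for a fixed event \<open>Y \<in> D\<close> the two sides of the defining identity are finite
measures in the event for \<open>Z\<close>; they agree on \<open>E\<close> and hence everywhere. So the joint law of \<open>(Y, Z)\<close> and the measure built from
\<open>\<kappa>\<close> agree on rectangles, hence on all integrands.\<close>

lemma (in prob_space) has_cond_law_iff:
  assumes Y [measurable]: "Y \<in> measurable M N" and Z [measurable]: "Z \<in> measurable M R"
    and \<kappa> [measurable]: "\<kappa> \<in> N \<rightarrow>\<^sub>M prob_algebra R" and E: "determining R E"
  shows "has_cond_law M Y N Z R \<kappa> \<longleftrightarrow>
    (\<forall>A\<in>E. AE \<omega> in M. cond_prob_given M Y N {\<omega> \<in> space M. Z \<omega> \<in> A} \<omega> = measure (\<kappa> (Y \<omega>)) A)"
proof -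
  have \<kappa>_sub [measurable]: "\<kappa> \<in> N \<rightarrow>\<^sub>M subprob_algebra R" by (rule measurable_prob_algebraD[OF \<kappa>])
  have ps: "prob_space (\<kappa> y)" "sets (\<kappa> y) = sets R" if "y \<in> space N" for y
    using measurable_space[OF \<kappa> that] by (auto simp: space_prob_algebra)
  have E_sets: "E \<subseteq> sets R" using E by (simp add: determining_def)
  have cp: "(AE \<omega> in M. cond_prob_given M Y N {\<omega> \<in> space M. Z \<omega> \<in> A} \<omega> = measure (\<kappa> (Y \<omega>)) A) \<longleftrightarrow>
    (\<forall>D\<in>sets N. emeasure M {\<omega> \<in> space M. Y \<omega> \<in> D \<and> Z \<omega> \<in> A} = (\<integral>\<^sup>+\<omega>. indicator D (Y \<omega>) * emeasure (\<kappa> (Y \<omega>)) A \<partial>M))"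
    if [measurable]: "A \<in> sets R" for A
  proof -
    have "(\<lambda>y. measure (\<kappa> y) A) \<in> borel_measurable N"
      by (rule measurable_compose[OF \<kappa> measurable_measure_prob_algebra]) (rule that)
    moreover have "(\<integral>\<^sup>+\<omega>. indicator D (Y \<omega>) * ennreal (measure (\<kappa> (Y \<omega>)) A) \<partial>M) =
        (\<integral>\<^sup>+\<omega>. indicator D (Y \<omega>) * emeasure (\<kappa> (Y \<omega>)) A \<partial>M)" for D
    proof (intro nn_integral_cong)
      fix \<omega> assume "\<omega> \<in> space M"
      then interpret k: prob_space "\<kappa> (Y \<omega>)" using ps measurable_space[OF Y] by blast
      show "indicator D (Y \<omega>) * ennreal (measure (\<kappa> (Y \<omega>)) A) = indicator D (Y \<omega>) * emeasure (\<kappa> (Y \<omega>)) A"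
        by (simp add: k.emeasure_eq_measure)
    qed
    moreover have "Y -` D \<inter> space M \<inter> {\<omega> \<in> space M. Z \<omega> \<in> A} = {\<omega> \<in> space M. Y \<omega> \<in> D \<and> Z \<omega> \<in> A}" for D
      by auto
    ultimately show ?thesis
      using cond_prob_given_iff[OF Y, of "{\<omega> \<in> space M. Z \<omega> \<in> A}" "\<lambda>y. measure (\<kappa> y) A"]
      using ps by (simp add: prob_space.prob_le_1 measure_nonneg)
  qed
  show ?thesis
  proof
    assume law: "has_cond_law M Y N Z R \<kappa>"
    show "\<forall>A\<in>E. AE \<omega> in M. cond_prob_given M Y N {\<omega> \<in> space M. Z \<omega> \<in> A} \<omega> = measure (\<kappa> (Y \<omega>)) A"
    proof
      fix A assume "A \<in> E"
      then have A [measurable]: "A \<in> sets R" using E_sets by blast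
      show "AE \<omega> in M. cond_prob_given M Y N {\<omega> \<in> space M. Z \<omega> \<in> A} \<omega> = measure (\<kappa> (Y \<omega>)) A"
        unfolding cp[OF A]
      proof
        fix D assume D [measurable]: "D \<in> sets N"
        have "emeasure M {\<omega> \<in> space M. Y \<omega> \<in> D \<and> Z \<omega> \<in> A} = (\<integral>\<^sup>+\<omega>. indicator (D \<times> A) (Y \<omega>, Z \<omega>) \<partial>M)"
        proof -
          have "(\<integral>\<^sup>+\<omega>. indicator (D \<times> A) (Y \<omega>, Z \<omega>) \<partial>M) =
              (\<integral>\<^sup>+\<omega>. indicator {\<omega> \<in> space M. Y \<omega> \<in> D \<and> Z \<omega> \<in> A} \<omega> \<partial>M)"
            by (intro nn_integral_cong) (auto split: split_indicator)
          also have "\<dots> = emeasure M {\<omega> \<in> space M. Y \<omega> \<in> D \<and> Z \<omega> \<in> A}"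
            by (rule nn_integral_indicator) measurable
          finally show ?thesis ..
        qed
        also have "\<dots> = (\<integral>\<^sup>+\<omega>. (\<integral>\<^sup>+z. indicator (D \<times> A) (Y \<omega>, z) \<partial>\<kappa> (Y \<omega>)) \<partial>M)"
          using law[unfolded has_cond_law_def, rule_format, of "indicator (D \<times> A)"] by simp
        also have "\<dots> = (\<integral>\<^sup>+\<omega>. indicator D (Y \<omega>) * emeasure (\<kappa> (Y \<omega>)) A \<partial>M)"
          by (intro nn_integral_cong)
             (simp add: indicator_times ps measurable_space[OF Y] nn_integral_cmult_indicator)
        finally show "emeasure M {\<omega> \<in> space M. Y \<omega> \<in> D \<and> Z \<omega> \<in> A} = (\<integral>\<^sup>+\<omega>. indicator D (Y \<omega>) * emeasure (\<kappa> (Y \<omega>)) A \<partial>M)" .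
      qed
    qed
  next
    assume AE: "\<forall>A\<in>E. AE \<omega> in M. cond_prob_given M Y N {\<omega> \<in> space M. Z \<omega> \<in> A} \<omega> = measure (\<kappa> (Y \<omega>)) A"
    have rect: "emeasure M {\<omega> \<in> space M. Y \<omega> \<in> D \<and> Z \<omega> \<in> A} = (\<integral>\<^sup>+\<omega>. indicator D (Y \<omega>) * emeasure (\<kappa> (Y \<omega>)) A \<partial>M)"
      if D [measurable]: "D \<in> sets N" and A: "A \<in> sets R" for D A
    proof -
      define \<mu> where "\<mu> = distr (density M (\<lambda>\<omega>. indicator D (Y \<omega>))) R Z"
      define \<nu> where "\<nu> = density M (\<lambda>\<omega>. indicator D (Y \<omega>)) \<bind> (\<lambda>\<omega>. \<kappa> (Y \<omega>))"
      have sets_\<nu>: "sets \<nu> = sets R"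
        unfolding \<nu>_def by (rule sets_bind[of _ _ R]) (auto simp: ps measurable_space[OF Y] not_empty)
      have em_\<mu>: "emeasure \<mu> A = emeasure M {\<omega> \<in> space M. Y \<omega> \<in> D \<and> Z \<omega> \<in> A}"
        if [measurable]: "A \<in> sets R" for A
      proof -
        have "emeasure \<mu> A = emeasure (density M (\<lambda>\<omega>. indicator D (Y \<omega>))) (Z -` A \<inter> space M)"
          unfolding \<mu>_def using that by (subst emeasure_distr) simp_all
        also have "\<dots> = (\<integral>\<^sup>+\<omega>. indicator D (Y \<omega>) * indicator (Z -` A \<inter> space M) \<omega> \<partial>M)"
          using that by (intro emeasure_density) measurable
        also have "\<dots> = (\<integral>\<^sup>+\<omega>. indicator {\<omega> \<in> space M. Y \<omega> \<in> D \<and> Z \<omega> \<in> A} \<omega> \<partial>M)"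
          by (intro nn_integral_cong) (auto split: split_indicator)
        also have "\<dots> = emeasure M {\<omega> \<in> space M. Y \<omega> \<in> D \<and> Z \<omega> \<in> A}"
          using that by (intro nn_integral_indicator) measurable
        finally show ?thesis .
      qed
      have em_\<nu>: "emeasure \<nu> A = (\<integral>\<^sup>+\<omega>. indicator D (Y \<omega>) * emeasure (\<kappa> (Y \<omega>)) A \<partial>M)"
        if [measurable]: "A \<in> sets R" for A
        unfolding \<nu>_def using that
        by (subst emeasure_bind[of _ _ R]) (auto simp: not_empty nn_integral_density)
      have "finite_measure \<mu>"
        by (rule finite_measureI) (simp add: em_\<mu>[OF sets.top, simplified] \<mu>_def[THEN arg_cong[where f = space]])
      moreover have "finite_measure \<nu>"
      proof (rule finite_measureI)
        have "emeasure \<nu> (space R) \<le> (\<integral>\<^sup>+\<omega>. 1 \<partial>M)"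
          unfolding em_\<nu>[OF sets.top]
          by (intro nn_integral_mono)
             (auto split: split_indicator intro!: prob_space.measure_le_1 ps measurable_space[OF Y])
        then show "emeasure \<nu> (space \<nu>) \<noteq> \<infinity>"
          by (simp add: emeasure_space_1 sets_eq_imp_space_eq[OF sets_\<nu>] top_unique)
             (metis ennreal_one_neq_top infinity_ennreal_def top.extremum_unique)
      qed
      moreover have "\<forall>A\<in>E. emeasure \<mu> A = emeasure \<nu> A"
        using AE cp E_sets D by (auto simp: em_\<mu> em_\<nu> subset_eq)
      ultimately have "\<mu> = \<nu>"
        using E sets_\<nu> unfolding determining_def by (simp add: \<mu>_def)
      then show ?thesis using em_\<mu>[OF A] em_\<nu>[OF A] by simp
    qed
    define \<mu> where "\<mu> = distr M (N \<Otimes>\<^sub>M R) (\<lambda>\<omega>. (Y \<omega>, Z \<omega>))"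
    define \<nu> where "\<nu> = M \<bind> (\<lambda>\<omega>. distr (\<kappa> (Y \<omega>)) (N \<Otimes>\<^sub>M R) (\<lambda>z. (Y \<omega>, z)))"
    have kern: "(\<lambda>\<omega>. distr (\<kappa> (Y \<omega>)) (N \<Otimes>\<^sub>M R) (\<lambda>z. (Y \<omega>, z))) \<in> M \<rightarrow>\<^sub>M prob_algebra (N \<Otimes>\<^sub>M R)"
      by measurable
    have nn_\<nu>: "(\<integral>\<^sup>+x. g x \<partial>\<nu>) = (\<integral>\<^sup>+\<omega>. (\<integral>\<^sup>+z. g (Y \<omega>, z) \<partial>\<kappa> (Y \<omega>)) \<partial>M)"
      if [measurable]: "g \<in> borel_measurable (N \<Otimes>\<^sub>M R)" for g
      unfolding \<nu>_def
    proof (subst nn_integral_bind[OF that measurable_prob_algebraD[OF kern]], intro nn_integral_cong)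
      fix \<omega> assume "\<omega> \<in> space M"
      then have [simp]: "Y \<omega> \<in> space N" by (rule measurable_space[OF Y])
      have "Pair (Y \<omega>) \<in> measurable (\<kappa> (Y \<omega>)) (N \<Otimes>\<^sub>M R)"
        unfolding measurable_cong_sets[OF ps(2)[OF \<open>Y \<omega> \<in> space N\<close>] refl] by simp
      then show "(\<integral>\<^sup>+x. g x \<partial>distr (\<kappa> (Y \<omega>)) (N \<Otimes>\<^sub>M R) (Pair (Y \<omega>))) = (\<integral>\<^sup>+z. g (Y \<omega>, z) \<partial>\<kappa> (Y \<omega>))"
        by (rule nn_integral_distr) simp
    qed
    have "prob_space \<nu>"
      unfolding \<nu>_def using measurable_space[OF kern]
      by (intro prob_space_bind[OF _ measurable_prob_algebraD[OF kern]] AE_I2) (auto simp: space_prob_algebra)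
    moreover have "prob_space \<mu>" unfolding \<mu>_def by (rule prob_space_distr) simp
    moreover have "sets \<nu> = sets (N \<Otimes>\<^sub>M R)"
      unfolding \<nu>_def by (rule sets_bind) (auto simp: not_empty)
    moreover have "emeasure \<mu> (D \<times> A) = emeasure \<nu> (D \<times> A)"
      if [measurable]: "D \<in> sets N" "A \<in> sets R" for D A
    proof -
      have "emeasure \<nu> (D \<times> A) = (\<integral>\<^sup>+x. indicator (D \<times> A) x \<partial>\<nu>)"
        by (rule nn_integral_indicator[symmetric]) (simp add: \<open>sets \<nu> = sets (N \<Otimes>\<^sub>M R)\<close>)
      also have "\<dots> = (\<integral>\<^sup>+\<omega>. (\<integral>\<^sup>+z. indicator (D \<times> A) (Y \<omega>, z) \<partial>\<kappa> (Y \<omega>)) \<partial>M)"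
        by (rule nn_\<nu>) simp
      also have "\<dots> = (\<integral>\<^sup>+\<omega>. indicator D (Y \<omega>) * emeasure (\<kappa> (Y \<omega>)) A \<partial>M)"
        by (intro nn_integral_cong)
           (simp add: indicator_times ps measurable_space[OF Y] nn_integral_cmult_indicator)
      also have "\<dots> = emeasure M {\<omega> \<in> space M. Y \<omega> \<in> D \<and> Z \<omega> \<in> A}" by (rule rect[symmetric]) simp_all
      also have "\<dots> = emeasure \<mu> (D \<times> A)"
        unfolding \<mu>_def by (subst emeasure_distr) (auto intro!: arg_cong[where f = "emeasure M"])
      finally show ?thesis by simp
    qed
    ultimately have "\<mu> = \<nu>"
      by (intro determiningD[OF determining_pair[of N R]]) (auto simp: \<mu>_def dest: prob_space.axioms(1))
    show "has_cond_law M Y N Z R \<kappa>"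
      unfolding has_cond_law_def
    proof
      fix g :: "_ \<Rightarrow> ennreal" assume g [measurable]: "g \<in> borel_measurable (N \<Otimes>\<^sub>M R)"
      have "(\<integral>\<^sup>+\<omega>. g (Y \<omega>, Z \<omega>) \<partial>M) = (\<integral>\<^sup>+x. g x \<partial>\<mu>)"
        unfolding \<mu>_def by (rule nn_integral_distr[symmetric]) simp_all
      then show "(\<integral>\<^sup>+\<omega>. g (Y \<omega>, Z \<omega>) \<partial>M) = (\<integral>\<^sup>+\<omega>. (\<integral>\<^sup>+z. g (Y \<omega>, z) \<partial>\<kappa> (Y \<omega>)) \<partial>M)"
        using nn_\<nu>[OF g] \<open>\<mu> = \<nu>\<close> by simp
    qed
  qed
qed

section \<open>Sojourn and transition kernels\<close>

lemma measurable_count_space_pair: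
  fixes f :: "'s::finite \<times> 'c \<Rightarrow> 'd"
  assumes "\<And>i. (\<lambda>y. f (i, y)) \<in> measurable N K"
  shows "f \<in> measurable (count_space UNIV \<Otimes>\<^sub>M N) K"
  by (rule measurable_pair_measure_countable1) (use assms in auto)

locale semi_markov_model =
  fixes G :: "('s::finite, 'a::polish_space, 'b::polish_space) smg" and sbar :: real
  assumes game: "semi_markov_game G" and regular: "assumption1 G sbar"
begin

lemma mem_admissible: "(i, a, b) \<in> admissible G \<longleftrightarrow> a \<in> adm1 G i \<and> b \<in> adm2 G i"
  by (simp add: admissible_def)

lemma compact_adm: "compact (adm1 G i)" "compact (adm2 G i)"
  using regular by (auto simp: assumption1_def)

lemma adm_ne: "adm1 G i \<noteq> {}" "adm2 G i \<noteq> {}"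
  using game by (auto simp: semi_markov_game_def)

lemma adm_sub: "adm1 G i \<subseteq> act1 G" "adm2 G i \<subseteq> act2 G"
  using game by (auto simp: semi_markov_game_def)

lemma adm_borel [measurable]: "adm1 G i \<in> sets borel" "adm2 G i \<in> sets borel"
  using game by (auto simp: semi_markov_game_def)

lemma sbar_pos: "0 < sbar"
  using regular by (auto simp: assumption1_def)

lemma trans_prob_nonneg: "(i, a, b) \<in> admissible G \<Longrightarrow> 0 \<le> trans_prob G i j a b"
  and trans_prob_sum: "(i, a, b) \<in> admissible G \<Longrightarrow> (\<Sum>j\<in>UNIV. trans_prob G i j a b) = 1"
  using game by (auto simp: semi_markov_game_def)

lemma continuous_trans_prob: "continuous_on (adm1 G i \<times> adm2 G i) (\<lambda>(a, b). trans_prob G i j a b)"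
  using regular by (auto simp: assumption1_def)

text \<open>Model data are continuous for admissible actions only. Each piece being compact and the states finite, extension by constants
gives Borel functions, as needed for kernels on the whole space.\<close>

lemma measurable_extend_admissible:
  fixes h :: "'s \<Rightarrow> 'a \<times> 'b \<Rightarrow> real"
  assumes "\<And>i. continuous_on (adm1 G i \<times> adm2 G i) (h i)"
  shows "(\<lambda>x. if x \<in> admissible G then h (fst x) (snd x) else c (fst x))
    \<in> borel_measurable (count_space UNIV \<Otimes>\<^sub>M borel \<Otimes>\<^sub>M borel)"
proof (rule measurable_count_space_pair)
  fix i
  have "adm1 G i \<times> adm2 G i \<in> sets borel"
    by (intro borel_compact compact_Times compact_adm)
  from borel_measurable_continuous_on_if[OF this assms, of "\<lambda>_. c i"]
  have "(\<lambda>y. if y \<in> adm1 G i \<times> adm2 G i then h i y else c i) \<in> borel_measurable (borel \<Otimes>\<^sub>M borel)"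
    by (simp add: borel_prod)
  then show "(\<lambda>y. if (i, y) \<in> admissible G then h (fst (i, y)) (snd (i, y)) else c (fst (i, y)))
      \<in> borel_measurable (borel \<Otimes>\<^sub>M borel)"
    by (simp add: mem_admissible mem_Times_iff admissible_def case_prod_beta cong: if_cong)
qed

lemma sets_admissible [measurable]: "admissible G \<in> sets (count_space UNIV \<Otimes>\<^sub>M borel \<Otimes>\<^sub>M borel)"
proof -
  have [measurable]: "(\<lambda>x. if x \<in> admissible G then 1 else 0 :: real) \<in> borel_measurable (count_space UNIV \<Otimes>\<^sub>M borel \<Otimes>\<^sub>M borel)"
    by (rule measurable_extend_admissible) simp
  have "{x \<in> space (count_space UNIV \<Otimes>\<^sub>M borel \<Otimes>\<^sub>M borel). (if x \<in> admissible G then 1 else 0 :: real) = 1}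
      \<in> sets (count_space UNIV \<Otimes>\<^sub>M borel \<Otimes>\<^sub>M borel)"
    by measurable
  moreover have "{x \<in> space (count_space UNIV \<Otimes>\<^sub>M borel \<Otimes>\<^sub>M borel). (if x \<in> admissible G then 1 else 0 :: real) = 1} = admissible G"
    by (auto simp: space_pair_measure)
  ultimately show ?thesis by simp
qed

lemma
  assumes "(i, a, b) \<in> admissible G"
  shows real_distribution_sojourn: "real_distribution (sojourn G i a b)"
    and cdf_sojourn: "cdf (sojourn G i a b) = sojourn_cdf G i a b"
proof -
  have F: "\<And>x y. x \<le> y \<Longrightarrow> sojourn_cdf G i a b x \<le> sojourn_cdf G i a b y"
    "\<And>x. continuous (at_right x) (sojourn_cdf G i a b)"
    "(sojourn_cdf G i a b \<longlongrightarrow> 0) at_bot" "(sojourn_cdf G i a b \<longlongrightarrow> 1) at_top"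
    using game assms by (auto simp: semi_markov_game_def)
  show "real_distribution (sojourn G i a b)"
    unfolding sojourn_def by (rule real_distribution_interval_measure[OF F])
  show "cdf (sojourn G i a b) = sojourn_cdf G i a b"
    unfolding sojourn_def by (rule cdf_interval_measure[OF F(1,2,3)])
qed

lemma AE_sojourn:
  assumes "(i, a, b) \<in> admissible G"
  shows "AE s in sojourn G i a b. 0 < s \<and> s \<le> sbar"
proof -
  interpret real_distribution "sojourn G i a b" by (rule real_distribution_sojourn[OF assms])
  have "prob {..0} = 0"
    using cdf_sojourn[OF assms] game assms by (auto simp: cdf_def fun_eq_iff semi_markov_game_def)
  then have "AE s in sojourn G i a b. s \<notin> {..0}"
    by (intro AE_not_in) (simp add: emeasure_eq_measure null_sets_def)
  moreover have "prob {..sbar} = 1"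
    using cdf_sojourn[OF assms] regular assms by (auto simp: cdf_def fun_eq_iff assumption1_def)
  then have "AE s in sojourn G i a b. s \<in> {..sbar}"
    by (intro prob_eq_1[THEN iffD1]) auto
  ultimately show ?thesis by eventually_elim auto
qed

text \<open>Sojourn times lie in the interval from \<open>0\<close> to \<open>sbar\<close> almost surely, so the continuity required of the
integrals over this interval holds for the full integrals.\<close>

lemma integral_sojourn_continuous:
  fixes u :: "real \<Rightarrow> real"
  assumes u: "u \<in> borel_measurable borel" "\<And>s. \<bar>u s\<bar> \<le> c"
  shows "continuous_on (adm1 G i \<times> adm2 G i) (\<lambda>(a, b). LINT s|sojourn G i a b. u s)"
proof -
  have "bounded (range u)" using u(2) by (auto intro!: boundedI)
  then have "continuous_on (adm1 G i \<times> adm2 G i) (\<lambda>(a, b). LINT s:{0..sbar}|sojourn G i a b. u s)"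
    using regular u(1) by (auto simp: assumption1_def)
  moreover have "(LINT s:{0..sbar}|sojourn G i a b. u s) = (LINT s|sojourn G i a b. u s)"
    if "(a, b) \<in> adm1 G i \<times> adm2 G i" for a b
  proof -
    have adm: "(i, a, b) \<in> admissible G" using that by (simp add: mem_admissible)
    interpret real_distribution "sojourn G i a b" by (rule real_distribution_sojourn[OF adm])
    show ?thesis
      unfolding set_lebesgue_integral_def
    proof (rule integral_cong_AE)
      show "AE s in sojourn G i a b. indicat_real {0..sbar} s *\<^sub>R u s = u s"
        using AE_sojourn[OF adm] by eventually_elim auto
    qed (use u(1) in measurable)
  qed
  ultimately show ?thesis
    by (auto simp: case_prod_beta cong: continuous_on_cong)
qed

text \<open>Off the admissible triples any law on the positive reals will do; it makes the kernel total.\<close>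

definition sojourn_law :: "'s \<times> 'a \<times> 'b \<Rightarrow> real measure" where
  "sojourn_law x = (if x \<in> admissible G then sojourn G (fst x) (fst (snd x)) (snd (snd x)) else return borel 1)"

lemma sojourn_law_admissible: "(i, a, b) \<in> admissible G \<Longrightarrow> sojourn_law (i, a, b) = sojourn G i a b"
  by (simp add: sojourn_law_def)

lemma prob_space_sojourn_law: "prob_space (sojourn_law x)" and sets_sojourn_law [measurable_cong]: "sets (sojourn_law x) = sets borel"
proof -
  have "real_distribution (sojourn_law x)" if "x \<in> admissible G"
    using real_distribution_sojourn[of "fst x" "fst (snd x)" "snd (snd x)"] that by (simp add: sojourn_law_def)
  then show "prob_space (sojourn_law x)" "sets (sojourn_law x) = sets borel"
    by (auto simp: sojourn_law_def real_distribution_def real_distribution_axioms_def prob_space_return)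
qed

lemma measurable_sojourn_law [measurable]: "sojourn_law \<in> count_space UNIV \<Otimes>\<^sub>M borel \<Otimes>\<^sub>M borel \<rightarrow>\<^sub>M prob_algebra borel"
proof (intro measurable_prob_algebraI measurable_subprob_algebra)
  fix A :: "real set" assume A: "A \<in> sets borel"
  have "(\<lambda>x. if x \<in> admissible G then (\<lambda>(a, b). LINT s|sojourn G (fst x) a b. indicat_real A s) (snd x) else indicat_real A 1)
      \<in> borel_measurable (count_space UNIV \<Otimes>\<^sub>M borel \<Otimes>\<^sub>M borel)" (is "?f \<in> _")
    by (rule measurable_extend_admissible[where h = "\<lambda>i (a, b). LINT s|sojourn G i a b. indicat_real A s"])
       (rule integral_sojourn_continuous[where c = 1], use A in \<open>auto split: split_indicator\<close>)
  moreover have "emeasure (sojourn_law x) A = ennreal (?f x)" for x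
  proof -
    interpret prob_space "sojourn_law x" by (rule prob_space_sojourn_law)
    have "A \<in> events" using A by (simp add: sets_sojourn_law)
    then show ?thesis
      using A emeasure_eq_measure[of A] by (cases "x \<in> admissible G")
        (auto simp: sojourn_law_def case_prod_beta split: split_indicator)
  qed
  ultimately show "(\<lambda>x. emeasure (sojourn_law x) A) \<in> borel_measurable (count_space UNIV \<Otimes>\<^sub>M borel \<Otimes>\<^sub>M borel)"
    by simp
qed (auto simp: prob_space_sojourn_law sets_sojourn_law prob_space_imp_subprob_space)

definition next_state_law :: "'s \<times> 'a \<times> 'b \<Rightarrow> 's measure" where
  "next_state_law x = (if x \<in> admissible G then point_measure UNIV (\<lambda>j. ennreal (trans_prob G (fst x) j (fst (snd x)) (snd (snd x))))
     else return (count_space UNIV) (fst x))"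

lemma sets_next_state_law [measurable_cong, simp]: "sets (next_state_law x) = UNIV" and space_next_state_law [simp]: "space (next_state_law x) = UNIV"
  by (auto simp: next_state_law_def space_point_measure sets_point_measure)

lemma emeasure_next_state_law: "(i, a, b) \<in> admissible G \<Longrightarrow> emeasure (next_state_law (i, a, b)) A = ennreal (\<Sum>j\<in>A. trans_prob G i j a b)"
  by (simp add: next_state_law_def emeasure_point_measure_finite sum_ennreal trans_prob_nonneg)

lemma nn_integral_next_state_law:
  "(i, a, b) \<in> admissible G \<Longrightarrow> (\<integral>\<^sup>+j. f j \<partial>next_state_law (i, a, b)) = (\<Sum>j\<in>UNIV. ennreal (trans_prob G i j a b) * f j)"
  by (simp add: next_state_law_def nn_integral_point_measure_finite)

lemma prob_space_next_state_law: "prob_space (next_state_law x)"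
proof (cases "x \<in> admissible G")
  case True
  obtain i a b where "x = (i, a, b)" by (cases x)
  with True show ?thesis
    by (intro prob_spaceI) (simp add: emeasure_next_state_law trans_prob_sum)
next
  case False
  then show ?thesis by (simp add: next_state_law_def prob_space_return)
qed

lemma measurable_next_state_law [measurable]: "next_state_law \<in> count_space UNIV \<Otimes>\<^sub>M borel \<Otimes>\<^sub>M borel \<rightarrow>\<^sub>M prob_algebra (count_space UNIV)"
proof (intro measurable_prob_algebraI measurable_subprob_algebra)
  fix A :: "'s set"
  have "(\<lambda>x. if x \<in> admissible G then (\<lambda>(a, b). \<Sum>j\<in>A. trans_prob G (fst x) j a b) (snd x) else indicat_real A (fst x))
      \<in> borel_measurable (count_space UNIV \<Otimes>\<^sub>M borel \<Otimes>\<^sub>M borel)" (is "?f \<in> _")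
    by (rule measurable_extend_admissible[where h = "\<lambda>i (a, b). \<Sum>j\<in>A. trans_prob G i j a b"])
       (auto simp: case_prod_beta intro!: continuous_on_sum continuous_trans_prob[unfolded case_prod_beta])
  moreover have "emeasure (next_state_law x) A = ennreal (?f x)" for x
  proof (cases "x \<in> admissible G")
    case True
    then show ?thesis using emeasure_next_state_law[of "fst x" "fst (snd x)" "snd (snd x)" A] by (simp add: case_prod_beta)
  next
    case False
    then show ?thesis by (simp add: next_state_law_def split: split_indicator)
  qed
  ultimately show "(\<lambda>x. emeasure (next_state_law x) A) \<in> borel_measurable (count_space UNIV \<Otimes>\<^sub>M borel \<Otimes>\<^sub>M borel)"
    by simp
qed (auto simp: prob_space_next_state_law prob_space_imp_subprob_space)

end

section \<open>Construction and uniqueness of a path measure with given step kernels\<close>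

locale controlled_semi_markov_model = semi_markov_model G sbar
  for G :: "('s::finite, 'a::polish_space, 'b::polish_space) smg" and sbar :: real +
  fixes \<pi>1 :: "('s, 'a, 'b, 'a) policy" and \<pi>2 :: "('s, 'a, 'b, 'b) policy" and i0 :: 's
  assumes pol1: "\<pi>1 \<in> policies1 G" and pol2: "\<pi>2 \<in> policies2 G"
begin

text \<open>The spaces of steps, histories and actions of the model. \<open>SAB\<close> and \<open>SABR\<close> carry the unrestricted Borel
structures on triples and steps.\<close>

abbreviation "SP \<equiv> step_space G"
abbreviation "HS \<equiv> hist_space G"
abbreviation "A1 \<equiv> act_space1 G"
abbreviation "A2 \<equiv> act_space2 G"
abbreviation "SAB \<equiv> count_space UNIV \<Otimes>\<^sub>M borel \<Otimes>\<^sub>M borel :: ('s \<times> 'a \<times> 'b) measure"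
abbreviation "SABR \<equiv> count_space UNIV \<Otimes>\<^sub>M borel \<Otimes>\<^sub>M borel \<Otimes>\<^sub>M borel :: ('s \<times> 'a \<times> 'b \<times> real) measure"

definition triple :: "('s, 'a, 'b) step \<Rightarrow> 's \<times> 'a \<times> 'b" where
  "triple x = (fst x, fst (snd x), fst (snd (snd x)))"

lemma space_step: "x \<in> space SP \<longleftrightarrow> triple x \<in> admissible G \<and> 0 < snd (snd (snd x))"
  by (auto simp: step_space_def space_restrict_space space_pair_measure triple_def)

lemma measurable_from_step: "f \<in> measurable SABR N \<Longrightarrow> f \<in> measurable SP N"
  unfolding step_space_def by (rule measurable_restrict_space1)

lemma measurable_step_components [measurable]:
  "fst \<in> measurable SP (count_space UNIV)" "triple \<in> measurable SP SAB"
  "(\<lambda>x. fst (snd x)) \<in> measurable SP A1" "(\<lambda>x. fst (snd (snd x))) \<in> measurable SP A2"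
  "(\<lambda>x. snd (snd (snd x))) \<in> borel_measurable SP"
proof -
  show "fst \<in> measurable SP (count_space UNIV)" "(\<lambda>x. snd (snd (snd x))) \<in> borel_measurable SP"
    by (rule measurable_from_step, measurable)+
  show "triple \<in> measurable SP SAB"
    unfolding triple_def by (rule measurable_from_step) measurable
  have "(\<lambda>x. fst (snd x)) \<in> measurable SP borel" "(\<lambda>x. fst (snd (snd x))) \<in> measurable SP borel"
    by (rule measurable_from_step, measurable)+
  moreover have "fst (snd x) \<in> act1 G" "fst (snd (snd x)) \<in> act2 G" if "x \<in> space SP" for x
    using that adm_sub[of "fst x"] by (auto simp: space_step triple_def mem_admissible)
  ultimately show "(\<lambda>x. fst (snd x)) \<in> measurable SP A1" "(\<lambda>x. fst (snd (snd x))) \<in> measurable SP A2"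
    unfolding act_space1_def act_space2_def by (auto simp: measurable_restrict_space2_iff)
qed

lemma measurable_act_borel:
  "f \<in> measurable N A1 \<Longrightarrow> f \<in> measurable N borel" "g \<in> measurable N A2 \<Longrightarrow> g \<in> measurable N borel"
  unfolding act_space1_def act_space2_def by (auto simp: measurable_restrict_space2_iff)

lemma step_space_ne: "space SP \<noteq> {}"
proof -
  obtain a b where "a \<in> adm1 G i0" "b \<in> adm2 G i0" using adm_ne by blast
  then have "(i0, a, b, 1) \<in> space SP" by (simp add: space_step triple_def mem_admissible)
  then show ?thesis by blast
qed

text \<open>A quadruple assembled from a state, actions and a sojourn time is a step almost surely only. Replacing the
exceptions by an arbitrary step makes kernels with values in the measures on \<open>SP\<close> possible.\<close>

definition clip :: "('s, 'a, 'b) step \<Rightarrow> ('s, 'a, 'b) step" where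
  "clip x = (if triple x \<in> admissible G \<and> 0 < snd (snd (snd x)) then x else (SOME x. x \<in> space SP))"

lemma clip_id: "x \<in> space SP \<Longrightarrow> clip x = x"
  by (simp add: clip_def space_step)

lemma measurable_clip [measurable]: "clip \<in> measurable SABR SP"
proof -
  have [measurable]: "triple \<in> measurable SABR SAB" unfolding triple_def by measurable
  have some: "(SOME x. x \<in> space SP) \<in> space SP" using step_space_ne by (simp add: some_in_eq)
  have p: "Measurable.pred SABR (\<lambda>x. triple x \<in> admissible G \<and> 0 < snd (snd (snd x)))"
    using pred_sets2[OF sets_admissible, of triple SABR] by measurable
  have "clip \<in> measurable SABR SABR"
    unfolding clip_def by (intro measurable_If p[unfolded pred_def]) (auto simp: space_pair_measure)
  moreover have "clip x \<in> space SP" for x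
    using some by (auto simp: clip_def space_step)
  then have "clip x \<in> {(i, a, b, s). (i, a, b) \<in> admissible G \<and> 0 < s}" for x
    unfolding space_step by (auto simp: triple_def case_prod_beta)
  ultimately show ?thesis
    unfolding step_space_def measurable_restrict_space2_iff by (simp add: Pi_iff)
qed

lemma measurable_policies [measurable]:
  "\<pi>1 n \<in> HS n \<rightarrow>\<^sub>M prob_algebra A1" "\<pi>2 n \<in> HS n \<rightarrow>\<^sub>M prob_algebra A2"
  using pol1 pol2 by (auto simp: policies1_def policies2_def)

lemma measurable_snd_hist [measurable]: "snd \<in> measurable (HS n) (count_space UNIV)"
  and measurable_fst_hist [measurable]: "fst \<in> measurable (HS n) (\<Pi>\<^sub>M k\<in>{..<n}. SP)"
  by (simp_all add: hist_space_def)

lemma policies_prob: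
  assumes "h \<in> space (HS n)"
  shows "prob_space (\<pi>1 n h)" "sets (\<pi>1 n h) = sets A1" "prob_space (\<pi>2 n h)" "sets (\<pi>2 n h) = sets A2"
  using measurable_space[OF measurable_policies(1) assms] measurable_space[OF measurable_policies(2) assms]
  by (auto simp: space_prob_algebra)

lemma adm_sets_act: "adm1 G i \<in> sets A1" "adm2 G i \<in> sets A2"
  using adm_sub[of i] by (auto simp: act_space1_def act_space2_def sets_restrict_space image_iff intro: adm_borel)

lemma AE_policies:
  assumes "h \<in> space (HS n)"
  shows "AE a in \<pi>1 n h. a \<in> adm1 G (snd h)" "AE b in \<pi>2 n h. b \<in> adm2 G (snd h)"
proof -
  have "measure (\<pi>1 n h) (adm1 G (snd h)) = 1" "measure (\<pi>2 n h) (adm2 G (snd h)) = 1"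
    using pol1 pol2 assms by (auto simp: policies1_def policies2_def)
  then show "AE a in \<pi>1 n h. a \<in> adm1 G (snd h)" "AE b in \<pi>2 n h. b \<in> adm2 G (snd h)"
    using prob_space.prob_eq_1[OF policies_prob(1)[OF assms], of "adm1 G (snd h)"]
      prob_space.prob_eq_1[OF policies_prob(3)[OF assms], of "adm2 G (snd h)"]
      adm_sets_act policies_prob[OF assms] by auto
qed

definition sojourn_kernel :: "(('s, 'a, 'b) hist \<times> 'a \<times> 'b) \<Rightarrow> real measure" where
  "sojourn_kernel x = sojourn_law (snd (fst x), fst (snd x), snd (snd x))"

lemma measurable_sab [measurable]:
  "(\<lambda>x. (snd (fst x), fst (snd x), snd (snd x))) \<in> measurable (HS n \<Otimes>\<^sub>M A1 \<Otimes>\<^sub>M A2) SAB"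
  by (intro measurable_Pair measurable_act_borel) measurable

lemma measurable_sojourn_kernel [measurable]: "sojourn_kernel \<in> HS n \<Otimes>\<^sub>M A1 \<Otimes>\<^sub>M A2 \<rightarrow>\<^sub>M prob_algebra borel"
  unfolding sojourn_kernel_def by (rule measurable_compose[OF measurable_sab measurable_sojourn_law])

definition assemble_step :: "(('s, 'a, 'b) hist \<times> 'a \<times> 'b) \<times> real \<Rightarrow> ('s, 'a, 'b) step" where
  "assemble_step x = clip (snd (fst (fst x)), fst (snd (fst x)), snd (snd (fst x)), snd x)"

lemma measurable_assemble_step [measurable]: "assemble_step \<in> measurable ((HS n \<Otimes>\<^sub>M A1 \<Otimes>\<^sub>M A2) \<Otimes>\<^sub>M borel) SP"
  unfolding assemble_step_def
  by (rule measurable_compose[OF _ measurable_clip]) (intro measurable_Pair measurable_act_borel; measurable)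

definition sojourn_step_kernel :: "(('s, 'a, 'b) hist \<times> 'a \<times> 'b) \<Rightarrow> ('s, 'a, 'b) step measure" where
  "sojourn_step_kernel x = distr (sojourn_kernel x) SP (\<lambda>s. assemble_step (x, s))"

lemma measurable_sojourn_step_kernel [measurable]: "sojourn_step_kernel \<in> HS n \<Otimes>\<^sub>M A1 \<Otimes>\<^sub>M A2 \<rightarrow>\<^sub>M prob_algebra SP"
  unfolding sojourn_step_kernel_def by (rule measurable_distr_prob_space2[OF measurable_sojourn_kernel]) (simp add: case_prod_eta)

definition action_step_kernel :: "nat \<Rightarrow> ('s, 'a, 'b) hist \<Rightarrow> ('s, 'a, 'b) step measure" where
  "action_step_kernel n h = (\<pi>1 n h \<Otimes>\<^sub>M \<pi>2 n h) \<bind> (\<lambda>ab. sojourn_step_kernel (h, ab))"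

lemma measurable_actions [measurable]: "(\<lambda>h. \<pi>1 n h \<Otimes>\<^sub>M \<pi>2 n h) \<in> HS n \<rightarrow>\<^sub>M prob_algebra (A1 \<Otimes>\<^sub>M A2)"
  by (rule measurable_pair_prob) measurable

lemma measurable_action_step_kernel [measurable]: "action_step_kernel n \<in> HS n \<rightarrow>\<^sub>M prob_algebra SP"
  unfolding action_step_kernel_def by (rule measurable_bind_prob_space2[OF measurable_actions]) (simp add: case_prod_eta)

lemma nn_integral_sojourn_step_kernel:
  assumes "x \<in> space (HS n \<Otimes>\<^sub>M A1 \<Otimes>\<^sub>M A2)" and [measurable]: "f \<in> borel_measurable SP"
  shows "(\<integral>\<^sup>+y. f y \<partial>sojourn_step_kernel x) = (\<integral>\<^sup>+s. f (assemble_step (x, s)) \<partial>sojourn_kernel x)"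
proof -
  have "(\<lambda>s. assemble_step (x, s)) \<in> measurable (sojourn_kernel x) SP"
    unfolding sojourn_kernel_def measurable_cong_sets[OF sets_sojourn_law refl] using assms(1) by measurable
  then show ?thesis unfolding sojourn_step_kernel_def by (rule nn_integral_distr) simp
qed

lemma nn_integral_actions:
  assumes h: "h \<in> space (HS n)" and g [measurable]: "g \<in> borel_measurable (A1 \<Otimes>\<^sub>M A2)"
  shows "(\<integral>\<^sup>+ab. g ab \<partial>(\<pi>1 n h \<Otimes>\<^sub>M \<pi>2 n h)) = (\<integral>\<^sup>+a. (\<integral>\<^sup>+b. g (a, b) \<partial>\<pi>2 n h) \<partial>\<pi>1 n h)"
proof -
  interpret p1: prob_space "\<pi>1 n h" by (rule policies_prob[OF h])
  interpret p2: prob_space "\<pi>2 n h" by (rule policies_prob[OF h])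
  have "g \<in> borel_measurable (\<pi>1 n h \<Otimes>\<^sub>M \<pi>2 n h)"
    using g by (simp add: measurable_cong_sets[OF sets_pair_measure_cong[OF policies_prob(2,4)[OF h]] refl])
  then show ?thesis by (rule p2.nn_integral_fst[symmetric])
qed

lemma AE_actions:
  assumes h: "h \<in> space (HS n)"
  shows "AE ab in \<pi>1 n h \<Otimes>\<^sub>M \<pi>2 n h. (snd h, ab) \<in> admissible G"
proof -
  interpret p1: prob_space "\<pi>1 n h" by (rule policies_prob[OF h])
  interpret p2: prob_space "\<pi>2 n h" by (rule policies_prob[OF h])
  interpret pair_prob_space "\<pi>1 n h" "\<pi>2 n h" ..
  have [measurable_cong]: "sets (\<pi>1 n h) = sets A1" "sets (\<pi>2 n h) = sets A2" by (rule policies_prob[OF h])+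
  have "AE ab in \<pi>1 n h \<Otimes>\<^sub>M \<pi>2 n h. ab \<in> adm1 G (snd h) \<times> adm2 G (snd h)"
  proof (rule AE_pair_measure)
    show "{x \<in> space (\<pi>1 n h \<Otimes>\<^sub>M \<pi>2 n h). x \<in> adm1 G (snd h) \<times> adm2 G (snd h)} \<in> sets (\<pi>1 n h \<Otimes>\<^sub>M \<pi>2 n h)"
      using adm_sets_act by measurable
    show "AE x in \<pi>1 n h. AE y in \<pi>2 n h. (x, y) \<in> adm1 G (snd h) \<times> adm2 G (snd h)"
      using AE_policies[OF h] by auto
  qed
  then show ?thesis by eventually_elim (auto simp: mem_admissible)
qed

lemma nn_integral_action_step_kernel:
  assumes h: "h \<in> space (HS n)" and [measurable]: "f \<in> borel_measurable SP"
  shows "(\<integral>\<^sup>+y. f y \<partial>action_step_kernel n h) = (\<integral>\<^sup>+ab. (\<integral>\<^sup>+s. f (assemble_step ((h, ab), s)) \<partial>sojourn_kernel (h, ab)) \<partial>(\<pi>1 n h \<Otimes>\<^sub>M \<pi>2 n h))"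
proof -
  have sets: "sets (\<pi>1 n h \<Otimes>\<^sub>M \<pi>2 n h) = sets (A1 \<Otimes>\<^sub>M A2)"
    by (intro sets_pair_measure_cong policies_prob[OF h])
  have "(\<lambda>ab. sojourn_step_kernel (h, ab)) \<in> A1 \<Otimes>\<^sub>M A2 \<rightarrow>\<^sub>M prob_algebra SP"
    by (rule measurable_compose[OF measurable_Pair1'[OF h] measurable_sojourn_step_kernel])
  then have "(\<lambda>ab. sojourn_step_kernel (h, ab)) \<in> \<pi>1 n h \<Otimes>\<^sub>M \<pi>2 n h \<rightarrow>\<^sub>M subprob_algebra SP"
    unfolding measurable_cong_sets[OF sets refl] by (rule measurable_prob_algebraD)
  then have "(\<integral>\<^sup>+y. f y \<partial>action_step_kernel n h) = (\<integral>\<^sup>+ab. (\<integral>\<^sup>+y. f y \<partial>sojourn_step_kernel (h, ab)) \<partial>(\<pi>1 n h \<Otimes>\<^sub>M \<pi>2 n h))"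
    unfolding action_step_kernel_def by (rule nn_integral_bind[OF assms(2)])
  also have "\<dots> = (\<integral>\<^sup>+ab. (\<integral>\<^sup>+s. f (assemble_step ((h, ab), s)) \<partial>sojourn_kernel (h, ab)) \<partial>(\<pi>1 n h \<Otimes>\<^sub>M \<pi>2 n h))"
  proof (rule nn_integral_cong)
    fix ab assume "ab \<in> space (\<pi>1 n h \<Otimes>\<^sub>M \<pi>2 n h)"
    then have "ab \<in> space (A1 \<Otimes>\<^sub>M A2)" unfolding sets_eq_imp_space_eq[OF sets] .
    then have "(h, ab) \<in> space (HS n \<Otimes>\<^sub>M A1 \<Otimes>\<^sub>M A2)"
      using h by (simp add: space_pair_measure[of "HS n"])
    then show "(\<integral>\<^sup>+y. f y \<partial>sojourn_step_kernel (h, ab)) = (\<integral>\<^sup>+s. f (assemble_step ((h, ab), s)) \<partial>sojourn_kernel (h, ab))"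
      by (rule nn_integral_sojourn_step_kernel) simp
  qed
  finally show ?thesis .
qed

text \<open>The law of the state in step \<open>n\<close> given the completed steps, of which only the last one matters.\<close>

primrec state_kernel :: "nat \<Rightarrow> ('s, 'a, 'b) path \<Rightarrow> 's measure" where
  "state_kernel 0 \<omega> = return (count_space UNIV) i0"
| "state_kernel (Suc n) \<omega> = next_state_law (triple (\<omega> n))"

lemma measurable_state_kernel [measurable]: "state_kernel n \<in> (\<Pi>\<^sub>M k\<in>{..<n}. SP) \<rightarrow>\<^sub>M prob_algebra (count_space UNIV)"
proof (cases n)
  case 0
  have "state_kernel 0 = (\<lambda>_. return (count_space UNIV) i0)" by auto
  moreover have "return (count_space UNIV) i0 \<in> space (prob_algebra (count_space UNIV))"
    by (simp add: space_prob_algebra prob_space_return)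
  ultimately show ?thesis using 0 by simp
next
  case (Suc m)
  have "state_kernel (Suc m) = (\<lambda>\<omega>. next_state_law (triple (\<omega> m)))" by auto
  moreover have "(\<lambda>\<omega>. next_state_law (triple (\<omega> m))) \<in> (\<Pi>\<^sub>M k\<in>{..<Suc m}. SP) \<rightarrow>\<^sub>M prob_algebra (count_space UNIV)"
    by (rule measurable_compose[OF _ measurable_next_state_law], rule measurable_compose[OF _ measurable_step_components(2)],
        rule measurable_component_singleton) simp
  ultimately show ?thesis using Suc by simp
qed

text \<open>The law of step \<open>n\<close> given the completed steps: draw the state, then the actions, then the sojourn time. The
clauses specifying the process condition on histories that include the current state. Bundling the state with
the choices made in it produces kernels from prefixes of the path to single coordinates, the setting of the
Ionescu-Tulcea theorem.\<close>

definition step_kernel :: "nat \<Rightarrow> ('s, 'a, 'b) path \<Rightarrow> ('s, 'a, 'b) step measure" where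
  "step_kernel n \<omega> = state_kernel n \<omega> \<bind> (\<lambda>j. action_step_kernel n (\<omega>, j))"

lemma measurable_step_kernel [measurable]: "step_kernel n \<in> (\<Pi>\<^sub>M k\<in>{..<n}. SP) \<rightarrow>\<^sub>M prob_algebra SP"
  unfolding step_kernel_def
  by (rule measurable_bind_prob_space2[OF measurable_state_kernel]) (use measurable_action_step_kernel[of n] in \<open>simp add: hist_space_def case_prod_eta\<close>)

lemma nn_integral_step_kernel:
  assumes \<omega>: "\<omega> \<in> space (\<Pi>\<^sub>M k\<in>{..<n}. SP)" and [measurable]: "f \<in> borel_measurable SP"
  shows "(\<integral>\<^sup>+y. f y \<partial>step_kernel n \<omega>) = (\<integral>\<^sup>+j. (\<integral>\<^sup>+y. f y \<partial>action_step_kernel n (\<omega>, j)) \<partial>state_kernel n \<omega>)"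
proof -
  have sets: "sets (state_kernel n \<omega>) = sets (count_space UNIV)"
    using measurable_space[OF measurable_state_kernel \<omega>] by (simp add: space_prob_algebra)
  have "(\<lambda>j. action_step_kernel n (\<omega>, j)) \<in> count_space UNIV \<rightarrow>\<^sub>M prob_algebra SP"
    by (rule measurable_compose[OF measurable_Pair1'[OF \<omega>] measurable_action_step_kernel[unfolded hist_space_def]])
  then have "(\<lambda>j. action_step_kernel n (\<omega>, j)) \<in> state_kernel n \<omega> \<rightarrow>\<^sub>M subprob_algebra SP"
    unfolding measurable_cong_sets[OF sets refl] by (rule measurable_prob_algebraD)
  then show ?thesis unfolding step_kernel_def by (rule nn_integral_bind[OF assms(2)])
qed

definition steps_law :: "('s, 'a, 'b) path measure \<Rightarrow> bool" where
  "steps_law P \<longleftrightarrow> (\<forall>n. has_cond_law P (\<lambda>\<omega>. restrict \<omega> {..<n}) (\<Pi>\<^sub>M k\<in>{..<n}. SP) (\<lambda>\<omega>. \<omega> n) SP (step_kernel n))"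

lemma measurable_path:
  assumes "sets P = sets (path_space G)"
  shows "(\<lambda>\<omega>. restrict \<omega> J) \<in> measurable P (\<Pi>\<^sub>M k\<in>J. SP)" "(\<lambda>\<omega>. \<omega> n) \<in> measurable P SP"
  unfolding measurable_cong_sets[OF assms refl] path_space_def
  by (rule measurable_restrict_subset, simp) (rule measurable_component_singleton, simp)

lemma measurable_upd: "(\<lambda>(x, y). fun_upd x n y) \<in> measurable ((\<Pi>\<^sub>M k\<in>{..<n}. SP) \<Otimes>\<^sub>M SP) (\<Pi>\<^sub>M k\<in>{..<Suc n}. SP)"
  unfolding case_prod_beta by (rule measurable_fun_upd[where J = "{..<n}"]) auto

lemma restrict_Suc_eq: "restrict \<omega> {..<Suc n} = (restrict \<omega> {..<n})(n := \<omega> n)"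
  by (auto simp: restrict_def fun_eq_iff)

text \<open>The step kernels determine the laws of the finite prefixes, by induction on their length, and these
determine the measure on paths.\<close>

lemma steps_law_unique:
  assumes P: "prob_space P" "sets P = sets (path_space G)" "steps_law P"
    and P': "prob_space P'" "sets P' = sets (path_space G)" "steps_law P'"
  shows "P = P'"
proof -
  interpret P: prob_space P by fact
  interpret P': prob_space P' by fact
  note meas [measurable] = measurable_path[OF P(2)] measurable_path[OF P'(2)]
  have eq: "distr P (\<Pi>\<^sub>M k\<in>{..<n}. SP) (\<lambda>\<omega>. restrict \<omega> {..<n}) = distr P' (\<Pi>\<^sub>M k\<in>{..<n}. SP) (\<lambda>\<omega>. restrict \<omega> {..<n})" for n
  proof (induction n)
    case 0
    have r: "(\<lambda>\<omega> :: ('s, 'a, 'b) path. restrict \<omega> {..<0}) = (\<lambda>_ _. undefined)" by (auto simp: restrict_def)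
    have c: "(\<lambda>_. undefined) \<in> space (\<Pi>\<^sub>M k\<in>{..<0::nat}. SP)" by (simp add: space_PiM)
    show ?case by (simp only: r P.distr_const[OF c] P'.distr_const[OF c])
  next
    case (Suc n)
    have int: "emeasure (distr R (\<Pi>\<^sub>M k\<in>{..<Suc n}. SP) (\<lambda>\<omega>. restrict \<omega> {..<Suc n})) A =
        (\<integral>\<^sup>+x. (\<integral>\<^sup>+y. indicator A (fun_upd x n y) \<partial>step_kernel n x) \<partial>distr R (\<Pi>\<^sub>M k\<in>{..<n}. SP) (\<lambda>\<omega>. restrict \<omega> {..<n}))"
      if R: "sets R = sets (path_space G)" "steps_law R" and A [measurable]: "A \<in> sets (\<Pi>\<^sub>M k\<in>{..<Suc n}. SP)" for R A
    proof -
      note [measurable] = measurable_path[OF R(1)] measurable_upd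
      have upd: "(\<lambda>z. indicator A (fun_upd (fst z) n (snd z)) :: ennreal) \<in> borel_measurable ((\<Pi>\<^sub>M k\<in>{..<n}. SP) \<Otimes>\<^sub>M SP)"
        by (rule measurable_compose[OF measurable_upd[unfolded case_prod_beta]]) simp
      have "emeasure (distr R (\<Pi>\<^sub>M k\<in>{..<Suc n}. SP) (\<lambda>\<omega>. restrict \<omega> {..<Suc n})) A = (\<integral>\<^sup>+\<omega>. indicator A (restrict \<omega> {..<Suc n}) \<partial>R)"
      proof -
        have "emeasure (distr R (\<Pi>\<^sub>M k\<in>{..<Suc n}. SP) (\<lambda>\<omega>. restrict \<omega> {..<Suc n})) A =
            (\<integral>\<^sup>+x. indicator A x \<partial>distr R (\<Pi>\<^sub>M k\<in>{..<Suc n}. SP) (\<lambda>\<omega>. restrict \<omega> {..<Suc n}))"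
          by (rule nn_integral_indicator[symmetric]) simp
        also have "\<dots> = (\<integral>\<^sup>+\<omega>. indicator A (restrict \<omega> {..<Suc n}) \<partial>R)"
          by (rule nn_integral_distr[OF measurable_path(1)[OF R(1)]]) simp
        finally show ?thesis .
      qed
      also have "\<dots> = (\<integral>\<^sup>+\<omega>. indicator A (fun_upd (fst (restrict \<omega> {..<n}, \<omega> n)) n (snd (restrict \<omega> {..<n}, \<omega> n))) \<partial>R)"
        by (simp add: restrict_Suc_eq)
      also have "\<dots> = (\<integral>\<^sup>+\<omega>. (\<integral>\<^sup>+y. indicator A (fun_upd (restrict \<omega> {..<n}) n y) \<partial>step_kernel n (restrict \<omega> {..<n})) \<partial>R)"
        using R(2)[unfolded steps_law_def has_cond_law_def, rule_format, OF upd] by simp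
      also have "\<dots> = (\<integral>\<^sup>+x. (\<integral>\<^sup>+y. indicator A (fun_upd x n y) \<partial>step_kernel n x) \<partial>distr R (\<Pi>\<^sub>M k\<in>{..<n}. SP) (\<lambda>\<omega>. restrict \<omega> {..<n}))"
      proof -
        have "(\<lambda>x. \<integral>\<^sup>+y. indicator A (fun_upd x n y) \<partial>step_kernel n x) \<in> borel_measurable (\<Pi>\<^sub>M k\<in>{..<n}. SP)"
          by (rule nn_integral_measurable_subprob_algebra2[OF _ measurable_prob_algebraD[OF measurable_step_kernel]])
             (use upd in \<open>simp add: case_prod_beta\<close>)
        then show ?thesis
          by (intro nn_integral_distr[symmetric] measurable_path(1)[OF R(1)]) simp
      qed
      finally show ?thesis .
    qed
    show ?case
    proof (rule measure_eqI)
      fix A assume "A \<in> sets (distr P (\<Pi>\<^sub>M k\<in>{..<Suc n}. SP) (\<lambda>\<omega>. restrict \<omega> {..<Suc n}))"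
      then have A: "A \<in> sets (\<Pi>\<^sub>M k\<in>{..<Suc n}. SP)" by (simp only: sets_distr)
      show "emeasure (distr P (\<Pi>\<^sub>M k\<in>{..<Suc n}. SP) (\<lambda>\<omega>. restrict \<omega> {..<Suc n})) A =
          emeasure (distr P' (\<Pi>\<^sub>M k\<in>{..<Suc n}. SP) (\<lambda>\<omega>. restrict \<omega> {..<Suc n})) A"
        by (simp only: int[OF P(2,3) A] int[OF P'(2,3) A] Suc)
    qed simp
  qed
  show ?thesis
  proof (rule measure_eqI_PiM_infinite[of P UNIV "\<lambda>_. SP"])
    show "sets P = sets (\<Pi>\<^sub>M k\<in>UNIV. SP)" "sets P' = sets (\<Pi>\<^sub>M k\<in>UNIV. SP)"
      using P(2) P'(2) by (simp_all add: path_space_def)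
    show "finite_measure P" by unfold_locales
    fix A :: "nat \<Rightarrow> ('s, 'a, 'b) step set" and J assume J: "finite J" "\<And>i. i \<in> J \<Longrightarrow> A i \<in> sets SP"
    obtain n where n: "J \<subseteq> {..<n}" using finite_nat_bounded[OF J(1)] by auto
    let ?B = "prod_emb {..<n} (\<lambda>_. SP) J (Pi\<^sub>E J A)"
    have B: "?B \<in> sets (\<Pi>\<^sub>M k\<in>{..<n}. SP)"
      using n J by (intro sets_PiM_I) auto
    have "emeasure R (prod_emb UNIV (\<lambda>_. SP) J (Pi\<^sub>E J A)) = emeasure (distr R (\<Pi>\<^sub>M k\<in>{..<n}. SP) (\<lambda>\<omega>. restrict \<omega> {..<n})) ?B"
      if R: "sets R = sets (path_space G)" for R
    proof -
      have "(\<lambda>\<omega>. restrict \<omega> {..<n}) -` ?B \<inter> space R = prod_emb UNIV (\<lambda>_. SP) J (Pi\<^sub>E J A)"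
        using n sets_eq_imp_space_eq[OF R]
        by (auto simp: prod_emb_def path_space_def space_PiM PiE_iff Int_absorb1 restrict_restrict)
      then show ?thesis
        using B measurable_path(1)[OF R] by (simp add: emeasure_distr)
    qed
    then show "emeasure P (prod_emb UNIV (\<lambda>_. SP) J (Pi\<^sub>E J A)) = emeasure P' (prod_emb UNIV (\<lambda>_. SP) J (Pi\<^sub>E J A))"
      using eq[of n] P(2) P'(2) by simp
  qed
qed

sublocale IT: Ionescu_Tulcea step_kernel "\<lambda>_. SP"
proof (rule Ionescu_Tulcea.intro)
  show "step_kernel i \<in> (\<Pi>\<^sub>M k\<in>{0..<i}. SP) \<rightarrow>\<^sub>M subprob_algebra SP" for i
    using measurable_prob_algebraD[OF measurable_step_kernel[of i]] by (simp add: atLeast0LessThan)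
  show "prob_space (step_kernel i x)" if "x \<in> space (\<Pi>\<^sub>M k\<in>{0..<i}. SP)" for i x
    using measurable_space[OF measurable_step_kernel[of i], of x] that by (simp add: atLeast0LessThan space_prob_algebra)
qed

text \<open>The projective limit provided by the Ionescu-Tulcea theorem.\<close>

definition path_law :: "('s, 'a, 'b) path measure" where "path_law = IT.PF.lim"

lemma sets_path_law: "sets path_law = sets (path_space G)"
  by (simp add: path_law_def path_space_def)

lemma path_law_prefix: "distr path_law (\<Pi>\<^sub>M k\<in>{..<n}. SP) (\<lambda>\<omega>. restrict \<omega> {..<n}) = IT.C 0 n (\<lambda>_. undefined)"
proof (rule measure_eqI)
  show "sets (distr path_law (\<Pi>\<^sub>M k\<in>{..<n}. SP) (\<lambda>\<omega>. restrict \<omega> {..<n})) = sets (IT.C 0 n (\<lambda>_. undefined))"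
    using IT.sets_C[of "\<lambda>_. undefined" 0 n] by (simp add: atLeast0LessThan)
  fix A assume "A \<in> sets (distr path_law (\<Pi>\<^sub>M k\<in>{..<n}. SP) (\<lambda>\<omega>. restrict \<omega> {..<n}))"
  then have A: "A \<in> sets (\<Pi>\<^sub>M k\<in>{0..<n}. SP)" by (simp add: atLeast0LessThan)
  have "emeasure (distr path_law (\<Pi>\<^sub>M k\<in>{0..<n}. SP) (\<lambda>\<omega>. restrict \<omega> {0..<n})) A = emeasure (IT.CI {0..<n}) A"
    unfolding path_law_def by (subst IT.distr_lim) simp_all
  also have "\<dots> = emeasure (IT.C 0 n (\<lambda>_. undefined)) (prod_emb {0..<n} (\<lambda>_. SP) {0..<n} A)"
    by (rule IT.emeasure_CI[OF order_refl A])
  also have "prod_emb {0..<n} (\<lambda>_. SP) {0..<n} A = A"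
    using sets.sets_into_space[OF A] by (intro prod_emb_id) (simp add: space_PiM)
  finally show "emeasure (distr path_law (\<Pi>\<^sub>M k\<in>{..<n}. SP) (\<lambda>\<omega>. restrict \<omega> {..<n})) A = emeasure (IT.C 0 n (\<lambda>_. undefined)) A"
    unfolding atLeast0LessThan .
qed

lemma prob_space_path_law: "prob_space path_law"
proof -
  have sp: "space path_law = space (path_space G)" by (rule sets_eq_imp_space_eq[OF sets_path_law])
  have "prob_space (distr path_law (\<Pi>\<^sub>M k\<in>{..<0}. SP) (\<lambda>\<omega>. restrict \<omega> {..<0}))"
    unfolding path_law_prefix by (rule IT.prob_space_C) simp
  then show ?thesis
    by (rule prob_space_distrD[OF measurable_path(1)[OF sets_path_law]])
qed

lemma steps_law_path_law: "steps_law path_law"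
  unfolding steps_law_def has_cond_law_def
proof (intro allI ballI)
  fix n and g :: "('s, 'a, 'b) path \<times> ('s, 'a, 'b) step \<Rightarrow> ennreal"
  assume g [measurable]: "g \<in> borel_measurable ((\<Pi>\<^sub>M k\<in>{..<n}. SP) \<Otimes>\<^sub>M SP)"
  note [measurable] = measurable_path[OF sets_path_law]
  define f where "f z = g (restrict z {..<n}, z n)" for z
  have f: "f \<in> borel_measurable (\<Pi>\<^sub>M k\<in>{..<Suc n}. SP)"
    unfolding f_def
    by (rule measurable_compose[OF _ g], intro measurable_Pair measurable_restrict_subset measurable_component_singleton) auto
  have "(\<integral>\<^sup>+\<omega>. g (restrict \<omega> {..<n}, \<omega> n) \<partial>path_law) = (\<integral>\<^sup>+\<omega>. f (restrict \<omega> {..<Suc n}) \<partial>path_law)"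
    by (simp add: f_def Int_absorb1 restrict_restrict)
  also have "\<dots> = (\<integral>\<^sup>+z. f z \<partial>IT.C 0 (Suc n) (\<lambda>_. undefined))"
    unfolding path_law_prefix[symmetric]
    by (rule nn_integral_distr[symmetric, OF measurable_path(1)[OF sets_path_law]]) (use f in simp)
  also have "\<dots> = (\<integral>\<^sup>+x. (\<integral>\<^sup>+z. f z \<partial>IT.eP n x) \<partial>IT.C 0 n (\<lambda>_. undefined))"
  proof -
    have sets: "sets (IT.C 0 n (\<lambda>_. undefined)) = sets (\<Pi>\<^sub>M k\<in>{0..<n}. SP)"
      using IT.sets_C[of "\<lambda>_. undefined" 0 n] by simp
    have eP: "IT.eP n \<in> IT.C 0 n (\<lambda>_. undefined) \<rightarrow>\<^sub>M subprob_algebra (\<Pi>\<^sub>M k\<in>{0..<Suc n}. SP)"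
      unfolding measurable_cong_sets[OF sets refl] by (rule IT.measurable_eP)
    have "f \<in> borel_measurable (\<Pi>\<^sub>M k\<in>{0..<Suc n}. SP)"
      using f unfolding atLeast0LessThan .
    from nn_integral_bind[OF this eP] show ?thesis by simp
  qed
  also have "\<dots> = (\<integral>\<^sup>+x. (\<integral>\<^sup>+y. g (x, y) \<partial>step_kernel n x) \<partial>IT.C 0 n (\<lambda>_. undefined))"
  proof (rule nn_integral_cong)
    fix x assume "x \<in> space (IT.C 0 n (\<lambda>_. undefined))"
    then have x: "x \<in> space (\<Pi>\<^sub>M k\<in>{0..<n}. SP)" using IT.space_C[of "\<lambda>_. undefined" 0 n] by simp
    then have ext: "restrict x {..<n} = x" by (auto simp: space_PiM PiE_iff restrict_def extensional_def fun_eq_iff)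
    have fg: "f (fun_upd x n y) = g (x, y)" for y
    proof -
      have "restrict (x(n := y)) {..<n} = restrict x {..<n}" by (auto simp: restrict_def)
      then show ?thesis by (simp add: f_def ext)
    qed
    have "(\<integral>\<^sup>+z. f z \<partial>IT.eP n x) = (\<integral>\<^sup>+y. f (fun_upd x n y) \<partial>step_kernel n x)"
      using f by (intro IT.nn_integral_eP[OF x]) (simp add: atLeast0LessThan)
    then show "(\<integral>\<^sup>+z. f z \<partial>IT.eP n x) = (\<integral>\<^sup>+y. g (x, y) \<partial>step_kernel n x)"
      by (simp only: fg)
  qed
  also have "\<dots> = (\<integral>\<^sup>+\<omega>. (\<integral>\<^sup>+y. g (restrict \<omega> {..<n}, y) \<partial>step_kernel n (restrict \<omega> {..<n})) \<partial>path_law)"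
  proof -
    have "(\<lambda>x. \<integral>\<^sup>+y. g (x, y) \<partial>step_kernel n x) \<in> borel_measurable (\<Pi>\<^sub>M k\<in>{..<n}. SP)"
      by (rule nn_integral_measurable_subprob_algebra2[OF _ measurable_prob_algebraD[OF measurable_step_kernel]]) simp
    then show ?thesis
      unfolding path_law_prefix[symmetric]
      by (intro nn_integral_distr measurable_path(1)[OF sets_path_law]) simp
  qed
  finally show "(\<integral>\<^sup>+\<omega>. g (restrict \<omega> {..<n}, \<omega> n) \<partial>path_law) =
      (\<integral>\<^sup>+\<omega>. (\<integral>\<^sup>+y. g (restrict \<omega> {..<n}, y) \<partial>step_kernel n (restrict \<omega> {..<n})) \<partial>path_law)" .
qed

end

section \<open>Existence and uniqueness of the law of the process\<close>

context controlled_semi_markov_model begin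

text \<open>The conditional expectation, given the history \<open>h\<close>, of a function of the history, the actions and the
sojourn time.\<close>

definition step_integral :: "nat \<Rightarrow> ((('s, 'a, 'b) hist \<times> 'a \<times> 'b) \<times> real \<Rightarrow> ennreal) \<Rightarrow> ('s, 'a, 'b) hist \<Rightarrow> ennreal" where
  "step_integral n g h = (\<integral>\<^sup>+ab. (\<integral>\<^sup>+s. g ((h, ab), s) \<partial>sojourn_kernel (h, ab)) \<partial>(\<pi>1 n h \<Otimes>\<^sub>M \<pi>2 n h))"

lemma measurable_integral_sojourn_kernel:
  assumes "g \<in> borel_measurable ((HS n \<Otimes>\<^sub>M A1 \<Otimes>\<^sub>M A2) \<Otimes>\<^sub>M borel)"
  shows "(\<lambda>x. \<integral>\<^sup>+s. g (x, s) \<partial>sojourn_kernel x) \<in> borel_measurable (HS n \<Otimes>\<^sub>M A1 \<Otimes>\<^sub>M A2)"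
  by (rule nn_integral_measurable_subprob_algebra2[OF _ measurable_prob_algebraD[OF measurable_sojourn_kernel]])
     (use assms in simp)

lemma measurable_integral_actions:
  assumes "g \<in> borel_measurable (HS n \<Otimes>\<^sub>M A1 \<Otimes>\<^sub>M A2)"
  shows "(\<lambda>h. \<integral>\<^sup>+ab. g (h, ab) \<partial>(\<pi>1 n h \<Otimes>\<^sub>M \<pi>2 n h)) \<in> borel_measurable (HS n)"
  by (rule nn_integral_measurable_subprob_algebra2[OF _ measurable_prob_algebraD[OF measurable_actions]])
     (use assms in simp)

lemma measurable_J:
  assumes "g \<in> borel_measurable ((HS n \<Otimes>\<^sub>M A1 \<Otimes>\<^sub>M A2) \<Otimes>\<^sub>M borel)"
  shows "step_integral n g \<in> borel_measurable (HS n)"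
  unfolding step_integral_def[abs_def] by (rule measurable_integral_actions[OF measurable_integral_sojourn_kernel[OF assms]])

lemma prob_space_sojourn_kernel: "prob_space (sojourn_kernel x)"
  unfolding sojourn_kernel_def by (rule prob_space_sojourn_law)

lemma prob_space_actions: "h \<in> space (HS n) \<Longrightarrow> prob_space (\<pi>1 n h \<Otimes>\<^sub>M \<pi>2 n h)"
  by (intro prob_space_pair policies_prob)

lemma step_integral_fst:
  assumes "h \<in> space (HS n)"
  shows "step_integral n (\<lambda>x. g (fst x)) h = (\<integral>\<^sup>+ab. g (h, ab) \<partial>(\<pi>1 n h \<Otimes>\<^sub>M \<pi>2 n h))"
  unfolding step_integral_def by (simp add: prob_space.emeasure_space_1[OF prob_space_sojourn_kernel])

lemma step_integral_fst_fst:
  assumes "h \<in> space (HS n)"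
  shows "step_integral n (\<lambda>x. g (fst (fst x))) h = g h"
  unfolding step_integral_def
  by (simp add: prob_space.emeasure_space_1[OF prob_space_sojourn_kernel] prob_space.emeasure_space_1[OF prob_space_actions[OF assms]])

lemma AE_sojourn_kernel:
  assumes "(snd h, ab) \<in> admissible G"
  shows "AE s in sojourn_kernel (h, ab). 0 < s \<and> s \<le> sbar"
proof -
  obtain a b where "ab = (a, b)" by (cases ab)
  then have "(snd h, a, b) \<in> admissible G" "sojourn_kernel (h, ab) = sojourn G (snd h) a b"
    using assms by (simp_all add: sojourn_kernel_def sojourn_law_admissible)
  then show ?thesis
    using AE_sojourn[of "snd h" a b] by (simp only:)
qed

text \<open>Policies choose admissible actions, and sojourn times do not exceed \<open>sbar\<close>, almost surely.\<close>

lemma step_integral_cong: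
  assumes h: "h \<in> space (HS n)"
    and eq: "\<And>a b s. (snd h, a, b) \<in> admissible G \<Longrightarrow> 0 < s \<Longrightarrow> s \<le> sbar \<Longrightarrow> g ((h, a, b), s) = g' ((h, a, b), s)"
  shows "step_integral n g h = step_integral n g' h"
  unfolding step_integral_def
proof (rule nn_integral_cong_AE)
  show "AE ab in \<pi>1 n h \<Otimes>\<^sub>M \<pi>2 n h. (\<integral>\<^sup>+s. g ((h, ab), s) \<partial>sojourn_kernel (h, ab)) = (\<integral>\<^sup>+s. g' ((h, ab), s) \<partial>sojourn_kernel (h, ab))"
    using AE_actions[OF h]
  proof eventually_elim
    case (elim ab)
    show ?case
      by (rule nn_integral_cong_AE) (use AE_sojourn_kernel[OF elim] in \<open>eventually_elim, use eq[of "fst ab" "snd ab"] elim in auto\<close>)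
  qed
qed

lemma snd_history: "snd (history n \<omega>) = state_at n \<omega>"
  by (simp add: history_def)

definition hist_step :: "nat \<Rightarrow> ('s, 'a, 'b) path \<Rightarrow> (('s, 'a, 'b) hist \<times> 'a \<times> 'b) \<times> real" where
  "hist_step n \<omega> = ((history n \<omega>, action1_at n \<omega>, action2_at n \<omega>), sojourn_at n \<omega>)"

text \<open>This and the next two definitions are the three clauses of \<open>is_law\<close> in integral form.\<close>

definition cond_actions :: "('s, 'a, 'b) path measure \<Rightarrow> nat \<Rightarrow> bool" where
  "cond_actions P n \<longleftrightarrow> has_cond_law P (history n) (HS n) (\<lambda>\<omega>. (action1_at n \<omega>, action2_at n \<omega>)) (A1 \<Otimes>\<^sub>M A2)
     (\<lambda>h. \<pi>1 n h \<Otimes>\<^sub>M \<pi>2 n h)"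

definition cond_sojourn :: "('s, 'a, 'b) path measure \<Rightarrow> nat \<Rightarrow> bool" where
  "cond_sojourn P n \<longleftrightarrow> has_cond_law P (\<lambda>\<omega>. (history n \<omega>, action1_at n \<omega>, action2_at n \<omega>)) (HS n \<Otimes>\<^sub>M A1 \<Otimes>\<^sub>M A2)
     (sojourn_at n) borel sojourn_kernel"

definition cond_state :: "('s, 'a, 'b) path measure \<Rightarrow> nat \<Rightarrow> bool" where
  "cond_state P n \<longleftrightarrow> has_cond_law P (\<lambda>\<omega>. (history n \<omega>, action1_at n \<omega>, action2_at n \<omega>, sojourn_at n \<omega>))
     (HS n \<Otimes>\<^sub>M A1 \<Otimes>\<^sub>M A2 \<Otimes>\<^sub>M borel) (state_at (Suc n)) (count_space UNIV)
     (\<lambda>x. next_state_law (snd (fst x), fst (snd x), fst (snd (snd x))))"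

lemma measurable_at:
  assumes "sets P = sets (path_space G)"
  shows "state_at n \<in> measurable P (count_space UNIV)" "action1_at n \<in> measurable P A1"
    "action2_at n \<in> measurable P A2" "sojourn_at n \<in> borel_measurable P" "history n \<in> measurable P (HS n)"
proof -
  note [measurable] = measurable_path[OF assms]
  show "state_at n \<in> measurable P (count_space UNIV)" "action1_at n \<in> measurable P A1"
    "action2_at n \<in> measurable P A2" "sojourn_at n \<in> borel_measurable P"
    unfolding state_at_def[abs_def] action1_at_def[abs_def] action2_at_def[abs_def] sojourn_at_def[abs_def]
    by (rule measurable_compose[OF measurable_path(2)[OF assms, of n]], simp)+
  then show "history n \<in> measurable P (HS n)"
    unfolding history_def[abs_def] hist_space_def by measurable
qed

lemma space_path:
  assumes "sets P = sets (path_space G)" "\<omega> \<in> space P"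
  shows "\<omega> n \<in> space SP"
  using measurable_space[OF measurable_path(2)[OF assms(1)] assms(2)] .

lemma path_step:
  assumes "sets P = sets (path_space G)" "\<omega> \<in> space P"
  shows "triple (\<omega> n) \<in> admissible G" "triple (\<omega> n) = (state_at n \<omega>, action1_at n \<omega>, action2_at n \<omega>)" "0 < sojourn_at n \<omega>"
  using space_path[OF assms, of n]
  by (auto simp: space_step triple_def state_at_def action1_at_def action2_at_def sojourn_at_def)

lemma assemble_step_hist_step:
  assumes "sets P = sets (path_space G)" "\<omega> \<in> space P"
  shows "assemble_step (hist_step n \<omega>) = \<omega> n"
  using clip_id[OF space_path[OF assms, of n]]
  by (simp add: assemble_step_def hist_step_def history_def state_at_def action1_at_def action2_at_def sojourn_at_def)

text \<open>The clauses of \<open>is_law\<close> prescribe conditional probabilities of rectangles, half-lines and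
singletons, which are determining families for the actions, the sojourn time and the next state.\<close>

lemma is_law_iff:
  "is_law G i0 \<pi>1 \<pi>2 P \<longleftrightarrow> prob_space P \<and> sets P = sets (path_space G) \<and>
     measure P {\<omega> \<in> space P. state_at 0 \<omega> = i0} = 1 \<and>
     (\<forall>n. cond_actions P n) \<and> (\<forall>n. cond_sojourn P n) \<and> (\<forall>n. cond_state P n)"
proof (cases "prob_space P \<and> sets P = sets (path_space G)")
  case True
  then interpret prob_space P by simp
  have sets: "sets P = sets (path_space G)" using True by simp
  note [measurable] = measurable_at[OF sets]
  have A: "cond_actions P n \<longleftrightarrow> (\<forall>E \<in> sets A1. \<forall>D \<in> sets A2.
        AE \<omega> in P. cond_prob_given P (history n) (HS n)
            {\<omega> \<in> space P. action1_at n \<omega> \<in> E \<and> action2_at n \<omega> \<in> D} \<omega>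
          = measure (\<pi>1 n (history n \<omega>)) E * measure (\<pi>2 n (history n \<omega>)) D)" for n
  proof -
    have "(AE \<omega> in P. cond_prob_given P (history n) (HS n)
            {\<omega> \<in> space P. (action1_at n \<omega>, action2_at n \<omega>) \<in> E \<times> D} \<omega>
          = measure (\<pi>1 n (history n \<omega>) \<Otimes>\<^sub>M \<pi>2 n (history n \<omega>)) (E \<times> D)) \<longleftrightarrow>
        (AE \<omega> in P. cond_prob_given P (history n) (HS n)
            {\<omega> \<in> space P. action1_at n \<omega> \<in> E \<and> action2_at n \<omega> \<in> D} \<omega>
          = measure (\<pi>1 n (history n \<omega>)) E * measure (\<pi>2 n (history n \<omega>)) D)" (is "?L \<longleftrightarrow> ?R")
      if "E \<in> sets A1" "D \<in> sets A2" for E D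
    proof (rule AE_cong)
      fix \<omega> assume "\<omega> \<in> space P"
      then have h: "history n \<omega> \<in> space (HS n)" using measurable_space[OF measurable_at(5)[OF sets]] by blast
      interpret p2: prob_space "\<pi>2 n (history n \<omega>)" by (rule policies_prob[OF h])
      have "measure (\<pi>1 n (history n \<omega>) \<Otimes>\<^sub>M \<pi>2 n (history n \<omega>)) (E \<times> D) =
          measure (\<pi>1 n (history n \<omega>)) E * measure (\<pi>2 n (history n \<omega>)) D"
        unfolding measure_def
        by (subst p2.emeasure_pair_measure_Times) (use that policies_prob[OF h] in \<open>simp_all add: enn2real_mult\<close>)
      then show "(cond_prob_given P (history n) (HS n)
            {\<omega> \<in> space P. (action1_at n \<omega>, action2_at n \<omega>) \<in> E \<times> D} \<omega>
          = measure (\<pi>1 n (history n \<omega>) \<Otimes>\<^sub>M \<pi>2 n (history n \<omega>)) (E \<times> D)) \<longleftrightarrow>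
        (cond_prob_given P (history n) (HS n)
            {\<omega> \<in> space P. action1_at n \<omega> \<in> E \<and> action2_at n \<omega> \<in> D} \<omega>
          = measure (\<pi>1 n (history n \<omega>)) E * measure (\<pi>2 n (history n \<omega>)) D)"
        by simp
    qed
    then have swap: "(\<forall>E \<in> sets A1. \<forall>D \<in> sets A2. AE \<omega> in P. cond_prob_given P (history n) (HS n)
            {\<omega> \<in> space P. (action1_at n \<omega>, action2_at n \<omega>) \<in> E \<times> D} \<omega>
          = measure (\<pi>1 n (history n \<omega>) \<Otimes>\<^sub>M \<pi>2 n (history n \<omega>)) (E \<times> D)) \<longleftrightarrow>
        (\<forall>E \<in> sets A1. \<forall>D \<in> sets A2. AE \<omega> in P. cond_prob_given P (history n) (HS n)
            {\<omega> \<in> space P. action1_at n \<omega> \<in> E \<and> action2_at n \<omega> \<in> D} \<omega>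
          = measure (\<pi>1 n (history n \<omega>)) E * measure (\<pi>2 n (history n \<omega>)) D)"
      by (intro ball_cong refl)
    have rect: "(\<forall>B\<in>{E \<times> D |E D. E \<in> S \<and> D \<in> T}. R B) \<longleftrightarrow> (\<forall>E\<in>S. \<forall>D\<in>T. R (E \<times> D))"
      for S :: "'a set set" and T :: "'b set set" and R
      by blast
    have "cond_actions P n \<longleftrightarrow> (\<forall>B\<in>{E \<times> D |E D. E \<in> sets A1 \<and> D \<in> sets A2}.
        AE \<omega> in P. cond_prob_given P (history n) (HS n)
            {\<omega> \<in> space P. (action1_at n \<omega>, action2_at n \<omega>) \<in> B} \<omega>
          = measure (\<pi>1 n (history n \<omega>) \<Otimes>\<^sub>M \<pi>2 n (history n \<omega>)) B)"
      unfolding cond_actions_def by (rule has_cond_law_iff[OF _ _ _ determining_pair]) measurable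
    then show ?thesis unfolding rect swap .
  qed
  have S: "cond_sojourn P n \<longleftrightarrow> (\<forall>t. AE \<omega> in P. cond_prob_given P
            (\<lambda>\<omega>. (history n \<omega>, action1_at n \<omega>, action2_at n \<omega>)) (HS n \<Otimes>\<^sub>M A1 \<Otimes>\<^sub>M A2)
            {\<omega> \<in> space P. sojourn_at n \<omega> \<le> t} \<omega>
          = sojourn_cdf G (state_at n \<omega>) (action1_at n \<omega>) (action2_at n \<omega>) t)" for n
  proof -
    have "(AE \<omega> in P. cond_prob_given P
            (\<lambda>\<omega>. (history n \<omega>, action1_at n \<omega>, action2_at n \<omega>)) (HS n \<Otimes>\<^sub>M A1 \<Otimes>\<^sub>M A2)
            {\<omega> \<in> space P. sojourn_at n \<omega> \<in> {..t}} \<omega>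
          = measure (sojourn_kernel (history n \<omega>, action1_at n \<omega>, action2_at n \<omega>)) {..t}) \<longleftrightarrow>
       (AE \<omega> in P. cond_prob_given P
            (\<lambda>\<omega>. (history n \<omega>, action1_at n \<omega>, action2_at n \<omega>)) (HS n \<Otimes>\<^sub>M A1 \<Otimes>\<^sub>M A2)
            {\<omega> \<in> space P. sojourn_at n \<omega> \<le> t} \<omega>
          = sojourn_cdf G (state_at n \<omega>) (action1_at n \<omega>) (action2_at n \<omega>) t)" for t
    proof (rule AE_cong)
      fix \<omega> assume "\<omega> \<in> space P"
      then have adm: "(state_at n \<omega>, action1_at n \<omega>, action2_at n \<omega>) \<in> admissible G"
        using path_step[OF sets, of \<omega> n] by simp
      then have "measure (sojourn_kernel (history n \<omega>, action1_at n \<omega>, action2_at n \<omega>)) {..t} =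
          sojourn_cdf G (state_at n \<omega>) (action1_at n \<omega>) (action2_at n \<omega>) t"
        unfolding cdf_sojourn[OF adm, symmetric] cdf_def
        by (simp add: sojourn_kernel_def sojourn_law_admissible history_def)
      then show "(cond_prob_given P
            (\<lambda>\<omega>. (history n \<omega>, action1_at n \<omega>, action2_at n \<omega>)) (HS n \<Otimes>\<^sub>M A1 \<Otimes>\<^sub>M A2)
            {\<omega> \<in> space P. sojourn_at n \<omega> \<in> {..t}} \<omega>
          = measure (sojourn_kernel (history n \<omega>, action1_at n \<omega>, action2_at n \<omega>)) {..t}) \<longleftrightarrow>
       (cond_prob_given P
            (\<lambda>\<omega>. (history n \<omega>, action1_at n \<omega>, action2_at n \<omega>)) (HS n \<Otimes>\<^sub>M A1 \<Otimes>\<^sub>M A2)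
            {\<omega> \<in> space P. sojourn_at n \<omega> \<le> t} \<omega>
          = sojourn_cdf G (state_at n \<omega>) (action1_at n \<omega>) (action2_at n \<omega>) t)"
        by simp
    qed
    then show ?thesis
      unfolding cond_sojourn_def
      by (subst has_cond_law_iff[OF _ _ _ determining_atMost]) auto
  qed
  have next_state_law_meas: "(\<lambda>x. next_state_law (snd (fst x), fst (snd x), fst (snd (snd x)))) \<in> HS n \<Otimes>\<^sub>M A1 \<Otimes>\<^sub>M A2 \<Otimes>\<^sub>M borel \<rightarrow>\<^sub>M prob_algebra (count_space UNIV)" for n
    by (rule measurable_compose[OF _ measurable_next_state_law]) (intro measurable_Pair measurable_act_borel; measurable)
  have X: "cond_state P n \<longleftrightarrow> (\<forall>j. AE \<omega> in P. cond_prob_given P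
            (\<lambda>\<omega>. (history n \<omega>, action1_at n \<omega>, action2_at n \<omega>, sojourn_at n \<omega>))
            (HS n \<Otimes>\<^sub>M A1 \<Otimes>\<^sub>M A2 \<Otimes>\<^sub>M borel)
            {\<omega> \<in> space P. state_at (Suc n) \<omega> = j} \<omega>
          = trans_prob G (state_at n \<omega>) j (action1_at n \<omega>) (action2_at n \<omega>))" for n
  proof -
    have "(AE \<omega> in P. cond_prob_given P
            (\<lambda>\<omega>. (history n \<omega>, action1_at n \<omega>, action2_at n \<omega>, sojourn_at n \<omega>))
            (HS n \<Otimes>\<^sub>M A1 \<Otimes>\<^sub>M A2 \<Otimes>\<^sub>M borel)
            {\<omega> \<in> space P. state_at (Suc n) \<omega> \<in> {j}} \<omega>
          = measure (next_state_law (state_at n \<omega>, action1_at n \<omega>, action2_at n \<omega>)) {j}) \<longleftrightarrow>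
      (AE \<omega> in P. cond_prob_given P
            (\<lambda>\<omega>. (history n \<omega>, action1_at n \<omega>, action2_at n \<omega>, sojourn_at n \<omega>))
            (HS n \<Otimes>\<^sub>M A1 \<Otimes>\<^sub>M A2 \<Otimes>\<^sub>M borel)
            {\<omega> \<in> space P. state_at (Suc n) \<omega> = j} \<omega>
          = trans_prob G (state_at n \<omega>) j (action1_at n \<omega>) (action2_at n \<omega>))" for j
    proof (rule AE_cong)
      fix \<omega> assume "\<omega> \<in> space P"
      then have adm: "(state_at n \<omega>, action1_at n \<omega>, action2_at n \<omega>) \<in> admissible G"
        using path_step[OF sets, of \<omega> n] by simp
      then have "measure (next_state_law (state_at n \<omega>, action1_at n \<omega>, action2_at n \<omega>)) {j} =
          trans_prob G (state_at n \<omega>) j (action1_at n \<omega>) (action2_at n \<omega>)"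
        by (simp add: measure_def emeasure_next_state_law trans_prob_nonneg)
      then show "(cond_prob_given P
            (\<lambda>\<omega>. (history n \<omega>, action1_at n \<omega>, action2_at n \<omega>, sojourn_at n \<omega>))
            (HS n \<Otimes>\<^sub>M A1 \<Otimes>\<^sub>M A2 \<Otimes>\<^sub>M borel)
            {\<omega> \<in> space P. state_at (Suc n) \<omega> \<in> {j}} \<omega>
          = measure (next_state_law (state_at n \<omega>, action1_at n \<omega>, action2_at n \<omega>)) {j}) \<longleftrightarrow>
      (cond_prob_given P
            (\<lambda>\<omega>. (history n \<omega>, action1_at n \<omega>, action2_at n \<omega>, sojourn_at n \<omega>))
            (HS n \<Otimes>\<^sub>M A1 \<Otimes>\<^sub>M A2 \<Otimes>\<^sub>M borel)
            {\<omega> \<in> space P. state_at (Suc n) \<omega> = j} \<omega>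
          = trans_prob G (state_at n \<omega>) j (action1_at n \<omega>) (action2_at n \<omega>))"
        by simp
    qed
    then show ?thesis
      unfolding cond_state_def
      by (subst has_cond_law_iff[OF _ _ next_state_law_meas determining_singletons]) (auto simp: snd_history)
  qed
  have A': "(\<forall>n. cond_actions P n) \<longleftrightarrow> (\<forall>n. \<forall>E \<in> sets A1. \<forall>D \<in> sets A2.
        AE \<omega> in P. cond_prob_given P (history n) (HS n)
            {\<omega> \<in> space P. action1_at n \<omega> \<in> E \<and> action2_at n \<omega> \<in> D} \<omega>
          = measure (\<pi>1 n (history n \<omega>)) E * measure (\<pi>2 n (history n \<omega>)) D)"
    by (intro all_cong1 A)
  have S': "(\<forall>n. cond_sojourn P n) \<longleftrightarrow> (\<forall>n t. AE \<omega> in P. cond_prob_given P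
            (\<lambda>\<omega>. (history n \<omega>, action1_at n \<omega>, action2_at n \<omega>)) (HS n \<Otimes>\<^sub>M A1 \<Otimes>\<^sub>M A2)
            {\<omega> \<in> space P. sojourn_at n \<omega> \<le> t} \<omega>
          = sojourn_cdf G (state_at n \<omega>) (action1_at n \<omega>) (action2_at n \<omega>) t)"
    by (intro all_cong1 S)
  have X': "(\<forall>n. cond_state P n) \<longleftrightarrow> (\<forall>n j. AE \<omega> in P. cond_prob_given P
            (\<lambda>\<omega>. (history n \<omega>, action1_at n \<omega>, action2_at n \<omega>, sojourn_at n \<omega>))
            (HS n \<Otimes>\<^sub>M A1 \<Otimes>\<^sub>M A2 \<Otimes>\<^sub>M borel)
            {\<omega> \<in> space P. state_at (Suc n) \<omega> = j} \<omega>
          = trans_prob G (state_at n \<omega>) j (action1_at n \<omega>) (action2_at n \<omega>))"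
    by (intro all_cong1 X)
  show ?thesis
    unfolding is_law_def A' S' X' by simp
qed (auto simp: is_law_def)

lemma step_integral_cond:
  assumes P: "sets P = sets (path_space G)" "cond_actions P n" "cond_sojourn P n"
    and g: "g \<in> borel_measurable ((HS n \<Otimes>\<^sub>M A1 \<Otimes>\<^sub>M A2) \<Otimes>\<^sub>M borel)"
  shows "(\<integral>\<^sup>+\<omega>. g (hist_step n \<omega>) \<partial>P) = (\<integral>\<^sup>+\<omega>. step_integral n g (history n \<omega>) \<partial>P)"
proof -
  have "(\<integral>\<^sup>+\<omega>. g (hist_step n \<omega>) \<partial>P) =
      (\<integral>\<^sup>+\<omega>. (\<integral>\<^sup>+s. g ((history n \<omega>, action1_at n \<omega>, action2_at n \<omega>), s)
        \<partial>sojourn_kernel (history n \<omega>, action1_at n \<omega>, action2_at n \<omega>)) \<partial>P)"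
    unfolding hist_step_def by (rule P(3)[unfolded cond_sojourn_def has_cond_law_def, rule_format, OF g])
  also have "\<dots> = (\<integral>\<^sup>+\<omega>. step_integral n g (history n \<omega>) \<partial>P)"
    unfolding step_integral_def
    using P(2)[unfolded cond_actions_def has_cond_law_def, rule_format, OF measurable_integral_sojourn_kernel[OF g]] by simp
  finally show ?thesis .
qed

text \<open>Unwinding a step kernel integrates first over the state, then over actions and sojourn time. The last two
integrals are the first two conditional laws, and the integral over the state is the third one for the preceding step, or the initial
condition.\<close>

lemma steps_lawI:
  assumes P: "prob_space P" "sets P = sets (path_space G)" "measure P {\<omega> \<in> space P. state_at 0 \<omega> = i0} = 1"
    and cond: "\<And>n. cond_actions P n" "\<And>n. cond_sojourn P n" "\<And>n. cond_state P n"
  shows "steps_law P"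
  unfolding steps_law_def has_cond_law_def
proof (intro allI ballI)
  fix n and g :: "('s, 'a, 'b) path \<times> ('s, 'a, 'b) step \<Rightarrow> ennreal"
  assume g [measurable]: "g \<in> borel_measurable ((\<Pi>\<^sub>M k\<in>{..<n}. SP) \<Otimes>\<^sub>M SP)"
  interpret prob_space P by fact
  note meas [measurable] = measurable_path[OF P(2)] measurable_at[OF P(2)]
  define f where "f x = g (fst (fst (fst x)), assemble_step x)" for x
  have f: "f \<in> borel_measurable ((HS n \<Otimes>\<^sub>M A1 \<Otimes>\<^sub>M A2) \<Otimes>\<^sub>M borel)"
    unfolding f_def by measurable
  define \<psi> where "\<psi> h = (\<integral>\<^sup>+y. g (fst h, y) \<partial>action_step_kernel n h)" for h
  have \<psi>: "\<psi> \<in> borel_measurable (HS n)"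
    unfolding \<psi>_def
    by (rule nn_integral_measurable_subprob_algebra2[OF _ measurable_prob_algebraD[OF measurable_action_step_kernel]]) measurable
  have in_hist: "history n \<omega> \<in> space (HS n)" if "\<omega> \<in> space P" for \<omega>
    using measurable_space[OF meas(7) that] .
  have "(\<integral>\<^sup>+\<omega>. g (restrict \<omega> {..<n}, \<omega> n) \<partial>P) = (\<integral>\<^sup>+\<omega>. f (hist_step n \<omega>) \<partial>P)"
  proof (rule nn_integral_cong)
    fix \<omega> assume "\<omega> \<in> space P"
    then show "g (restrict \<omega> {..<n}, \<omega> n) = f (hist_step n \<omega>)"
      unfolding f_def assemble_step_hist_step[OF P(2) \<open>\<omega> \<in> space P\<close>] by (simp add: hist_step_def history_def)
  qed
  also have "\<dots> = (\<integral>\<^sup>+\<omega>. step_integral n f (history n \<omega>) \<partial>P)"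
    by (rule step_integral_cond[OF P(2) cond(1,2) f])
  also have "\<dots> = (\<integral>\<^sup>+\<omega>. \<psi> (history n \<omega>) \<partial>P)"
  proof (rule nn_integral_cong)
    fix \<omega> assume "\<omega> \<in> space P"
    note h = in_hist[OF this]
    then have "fst (history n \<omega>) \<in> space (\<Pi>\<^sub>M k\<in>{..<n}. SP)" by (simp add: hist_space_def space_pair_measure mem_Times_iff)
    then have "(\<lambda>y. g (fst (history n \<omega>), y)) \<in> borel_measurable SP" by measurable
    from nn_integral_action_step_kernel[OF h this]
    show "step_integral n f (history n \<omega>) = \<psi> (history n \<omega>)"
      by (simp add: step_integral_def f_def \<psi>_def)
  qed
  also have "\<dots> = (\<integral>\<^sup>+\<omega>. (\<integral>\<^sup>+j. \<psi> (restrict \<omega> {..<n}, j) \<partial>state_kernel n (restrict \<omega> {..<n})) \<partial>P)"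
  proof (cases n)
    case 0
    have "AE \<omega> in P. state_at 0 \<omega> = i0"
      using AE_prob_1[OF P(3)] by eventually_elim simp
    then have "AE \<omega> in P. \<psi> (history n \<omega>) = \<psi> (restrict \<omega> {..<n}, i0)"
      by eventually_elim (simp add: history_def 0)
    then have "(\<integral>\<^sup>+\<omega>. \<psi> (history n \<omega>) \<partial>P) = (\<integral>\<^sup>+\<omega>. \<psi> (restrict \<omega> {..<n}, i0) \<partial>P)"
      by (rule nn_integral_cong_AE)
    then show ?thesis
      by (simp add: 0 nn_integral_return)
  next
    case (Suc m)
    define \<phi> where "\<phi> z = \<psi> ((fst (fst (fst z)))(m := assemble_step ((fst (fst z), fst (snd (fst z)), fst (snd (snd (fst z)))), snd (snd (snd (fst z))))), snd z)" for z
    have \<phi>: "\<phi> \<in> borel_measurable ((HS m \<Otimes>\<^sub>M A1 \<Otimes>\<^sub>M A2 \<Otimes>\<^sub>M borel) \<Otimes>\<^sub>M count_space UNIV)"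
    proof -
      have 1: "(\<lambda>z. assemble_step ((fst (fst z), fst (snd (fst z)), fst (snd (snd (fst z)))), snd (snd (snd (fst z)))))
          \<in> measurable ((HS m \<Otimes>\<^sub>M A1 \<Otimes>\<^sub>M A2 \<Otimes>\<^sub>M borel) \<Otimes>\<^sub>M count_space UNIV) SP"
        by (rule measurable_compose[OF _ measurable_assemble_step[of m]]) measurable
      have 2: "(\<lambda>z. fst (fst (fst z))) \<in> measurable ((HS m \<Otimes>\<^sub>M A1 \<Otimes>\<^sub>M A2 \<Otimes>\<^sub>M borel) \<Otimes>\<^sub>M count_space UNIV) (\<Pi>\<^sub>M k\<in>{..<m}. SP)"
        by measurable
      show ?thesis
        unfolding \<phi>_def using \<psi> unfolding Suc hist_space_def[of G "Suc m"]
        by (intro measurable_compose[OF _ \<psi>[unfolded Suc hist_space_def[of G "Suc m"]]] measurable_Pair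
            measurable_fun_upd[OF _ 2 1] measurable_snd) auto
    qed
    have upd: "(restrict \<omega> {..<m})(m := assemble_step (hist_step m \<omega>)) = restrict \<omega> {..<Suc m}" if "\<omega> \<in> space P" for \<omega>
      by (simp add: assemble_step_hist_step[OF P(2) that] restrict_Suc_eq)
    have \<phi>_eq: "\<phi> ((history m \<omega>, action1_at m \<omega>, action2_at m \<omega>, sojourn_at m \<omega>), j) = \<psi> (restrict \<omega> {..<Suc m}, j)"
      if "\<omega> \<in> space P" for \<omega> j
    proof -
      have "fst (history m \<omega>) = restrict \<omega> {..<m}" by (simp add: history_def)
      then show ?thesis
        using upd[OF that] by (simp only: \<phi>_def hist_step_def fst_conv snd_conv)
    qed
    have "(\<integral>\<^sup>+\<omega>. \<psi> (history (Suc m) \<omega>) \<partial>P) =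
        (\<integral>\<^sup>+\<omega>. \<phi> ((history m \<omega>, action1_at m \<omega>, action2_at m \<omega>, sojourn_at m \<omega>), state_at (Suc m) \<omega>) \<partial>P)"
      by (intro nn_integral_cong) (simp only: \<phi>_eq history_def[of "Suc m"])
    also have "\<dots> = (\<integral>\<^sup>+\<omega>. (\<integral>\<^sup>+j. \<phi> ((history m \<omega>, action1_at m \<omega>, action2_at m \<omega>, sojourn_at m \<omega>), j)
        \<partial>next_state_law (state_at m \<omega>, action1_at m \<omega>, action2_at m \<omega>)) \<partial>P)"
      using cond(3)[of m, unfolded cond_state_def has_cond_law_def, rule_format, OF \<phi>] by (simp add: history_def)
    also have "\<dots> = (\<integral>\<^sup>+\<omega>. (\<integral>\<^sup>+j. \<psi> (restrict \<omega> {..<Suc m}, j) \<partial>state_kernel (Suc m) (restrict \<omega> {..<Suc m})) \<partial>P)"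
      by (intro nn_integral_cong) (simp add: \<phi>_eq path_step(2)[OF P(2)])
    finally show ?thesis unfolding Suc .
  qed
  also have "\<dots> = (\<integral>\<^sup>+\<omega>. (\<integral>\<^sup>+y. g (restrict \<omega> {..<n}, y) \<partial>step_kernel n (restrict \<omega> {..<n})) \<partial>P)"
  proof (rule nn_integral_cong)
    fix \<omega> assume "\<omega> \<in> space P"
    then have \<omega>: "restrict \<omega> {..<n} \<in> space (\<Pi>\<^sub>M k\<in>{..<n}. SP)" by (rule measurable_space[OF meas(1)])
    then have "(\<lambda>y. g (restrict \<omega> {..<n}, y)) \<in> borel_measurable SP" by measurable
    from nn_integral_step_kernel[OF \<omega> this]
    show "(\<integral>\<^sup>+j. \<psi> (restrict \<omega> {..<n}, j) \<partial>state_kernel n (restrict \<omega> {..<n})) = (\<integral>\<^sup>+y. g (restrict \<omega> {..<n}, y) \<partial>step_kernel n (restrict \<omega> {..<n}))"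
      by (simp add: \<psi>_def)
  qed
  finally show "(\<integral>\<^sup>+\<omega>. g (restrict \<omega> {..<n}, \<omega> n) \<partial>P) =
      (\<integral>\<^sup>+\<omega>. (\<integral>\<^sup>+y. g (restrict \<omega> {..<n}, y) \<partial>step_kernel n (restrict \<omega> {..<n})) \<partial>P)" .
qed

lemma steps_law_J:
  assumes P: "sets P = sets (path_space G)" "steps_law P"
    and g [measurable]: "g \<in> borel_measurable ((HS n \<Otimes>\<^sub>M A1 \<Otimes>\<^sub>M A2) \<Otimes>\<^sub>M borel)"
  shows "(\<integral>\<^sup>+\<omega>. g (hist_step n \<omega>) \<partial>P) = (\<integral>\<^sup>+\<omega>. (\<integral>\<^sup>+j. step_integral n g (restrict \<omega> {..<n}, j) \<partial>state_kernel n (restrict \<omega> {..<n})) \<partial>P)"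
proof -
  note meas [measurable] = measurable_path[OF P(1)] measurable_at[OF P(1)]
  define f where "f z = g (((fst z, fst (snd z)), fst (snd (snd z)), fst (snd (snd (snd z)))), snd (snd (snd (snd z))))" for z
  have f: "f \<in> borel_measurable ((\<Pi>\<^sub>M k\<in>{..<n}. SP) \<Otimes>\<^sub>M SP)"
    unfolding f_def by (rule measurable_compose[OF _ g], unfold hist_space_def) measurable
  have "(\<integral>\<^sup>+\<omega>. g (hist_step n \<omega>) \<partial>P) = (\<integral>\<^sup>+\<omega>. f (restrict \<omega> {..<n}, \<omega> n) \<partial>P)"
    by (simp add: f_def hist_step_def history_def state_at_def action1_at_def action2_at_def sojourn_at_def)
  also have "\<dots> = (\<integral>\<^sup>+\<omega>. (\<integral>\<^sup>+y. f (restrict \<omega> {..<n}, y) \<partial>step_kernel n (restrict \<omega> {..<n})) \<partial>P)"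
    using P(2) f by (simp add: steps_law_def has_cond_law_def)
  also have "\<dots> = (\<integral>\<^sup>+\<omega>. (\<integral>\<^sup>+j. step_integral n g (restrict \<omega> {..<n}, j) \<partial>state_kernel n (restrict \<omega> {..<n})) \<partial>P)"
  proof (rule nn_integral_cong)
    fix \<omega> assume "\<omega> \<in> space P"
    then have \<omega>: "restrict \<omega> {..<n} \<in> space (\<Pi>\<^sub>M k\<in>{..<n}. SP)" by (rule measurable_space[OF meas(1)])
    have fm: "(\<lambda>y. f (restrict \<omega> {..<n}, y)) \<in> borel_measurable SP"
      by (rule measurable_compose[OF measurable_Pair1'[OF \<omega>] f])
    have "(\<integral>\<^sup>+y. f (restrict \<omega> {..<n}, y) \<partial>action_step_kernel n (restrict \<omega> {..<n}, j)) = step_integral n g (restrict \<omega> {..<n}, j)" for j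
    proof -
      have h: "(restrict \<omega> {..<n}, j) \<in> space (HS n)" using \<omega> by (simp add: hist_space_def space_pair_measure)
      have "(\<integral>\<^sup>+y. f (restrict \<omega> {..<n}, y) \<partial>action_step_kernel n (restrict \<omega> {..<n}, j)) =
          step_integral n (\<lambda>x. f (restrict \<omega> {..<n}, assemble_step x)) (restrict \<omega> {..<n}, j)"
        unfolding nn_integral_action_step_kernel[OF h fm] step_integral_def by simp
      also have "\<dots> = step_integral n g (restrict \<omega> {..<n}, j)"
        by (rule step_integral_cong[OF h]) (simp add: assemble_step_def f_def clip_def triple_def)
      finally show ?thesis .
    qed
    then show "(\<integral>\<^sup>+y. f (restrict \<omega> {..<n}, y) \<partial>step_kernel n (restrict \<omega> {..<n})) =
        (\<integral>\<^sup>+j. step_integral n g (restrict \<omega> {..<n}, j) \<partial>state_kernel n (restrict \<omega> {..<n}))"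
      by (simp add: nn_integral_step_kernel[OF \<omega> fm])
  qed
  finally show ?thesis .
qed

text \<open>Conversely, functions of one step that ignore some of its later components have integrals in which the later
kernels, being probability kernels, drop out; this isolates the conditional laws one by one.\<close>

lemma steps_lawD:
  assumes P: "prob_space P" "sets P = sets (path_space G)" "steps_law P"
  shows "measure P {\<omega> \<in> space P. state_at 0 \<omega> = i0} = 1" "cond_actions P n" "cond_sojourn P n" "cond_state P n"
proof -
  interpret prob_space P by fact
  note meas [measurable] = measurable_path[OF P(2)] measurable_at[OF P(2)]
  have hist_eq: "(\<integral>\<^sup>+\<omega>. \<psi> (history n \<omega>) \<partial>P) = (\<integral>\<^sup>+\<omega>. (\<integral>\<^sup>+j. \<psi> (restrict \<omega> {..<n}, j) \<partial>state_kernel n (restrict \<omega> {..<n})) \<partial>P)"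
    if [measurable]: "\<psi> \<in> borel_measurable (HS n)" for \<psi> n
  proof -
    have "(\<integral>\<^sup>+\<omega>. \<psi> (history n \<omega>) \<partial>P) = (\<integral>\<^sup>+\<omega>. (\<lambda>x. \<psi> (fst (fst x))) (hist_step n \<omega>) \<partial>P)"
      by (simp add: hist_step_def)
    also have "\<dots> = (\<integral>\<^sup>+\<omega>. (\<integral>\<^sup>+j. step_integral n (\<lambda>x. \<psi> (fst (fst x))) (restrict \<omega> {..<n}, j) \<partial>state_kernel n (restrict \<omega> {..<n})) \<partial>P)"
      by (rule steps_law_J[OF P(2,3)]) measurable
    also have "\<dots> = (\<integral>\<^sup>+\<omega>. (\<integral>\<^sup>+j. \<psi> (restrict \<omega> {..<n}, j) \<partial>state_kernel n (restrict \<omega> {..<n})) \<partial>P)"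
      using measurable_space[OF meas(1)[of "{..<n}"]]
      by (intro nn_integral_cong step_integral_fst_fst) (simp add: hist_space_def space_pair_measure)
    finally show ?thesis .
  qed
  have step_integral_eq: "(\<integral>\<^sup>+\<omega>. g (hist_step n \<omega>) \<partial>P) = (\<integral>\<^sup>+\<omega>. step_integral n g (history n \<omega>) \<partial>P)"
    if "g \<in> borel_measurable ((HS n \<Otimes>\<^sub>M A1 \<Otimes>\<^sub>M A2) \<Otimes>\<^sub>M borel)" for g n
    unfolding steps_law_J[OF P(2,3) that] by (rule hist_eq[OF measurable_J[OF that], symmetric])
  have in_hist: "history n \<omega> \<in> space (HS n)" if "\<omega> \<in> space P" for \<omega> n
    using measurable_space[OF meas(7) that] .
  have "emeasure P {\<omega> \<in> space P. state_at 0 \<omega> = i0} = (\<integral>\<^sup>+\<omega>. indicator {i0} (snd (history 0 \<omega>)) \<partial>P)"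
  proof -
    have "(\<integral>\<^sup>+\<omega>. indicator {i0} (snd (history 0 \<omega>)) \<partial>P) = (\<integral>\<^sup>+\<omega>. indicator {\<omega> \<in> space P. state_at 0 \<omega> = i0} \<omega> \<partial>P)"
      by (intro nn_integral_cong) (auto simp: history_def split: split_indicator)
    also have "\<dots> = emeasure P {\<omega> \<in> space P. state_at 0 \<omega> = i0}"
      by (rule nn_integral_indicator) measurable
    finally show ?thesis ..
  qed
  also have "\<dots> = (\<integral>\<^sup>+\<omega>. (\<integral>\<^sup>+j. indicator {i0} (snd (restrict \<omega> {..<0}, j)) \<partial>state_kernel 0 (restrict \<omega> {..<0})) \<partial>P)"
    by (rule hist_eq) measurable
  also have "\<dots> = 1" by (simp add: nn_integral_return emeasure_space_1)
  finally show "measure P {\<omega> \<in> space P. state_at 0 \<omega> = i0} = 1" by (simp add: measure_def)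
  show "cond_actions P n"
    unfolding cond_actions_def has_cond_law_def
  proof
    fix g :: "('s, 'a, 'b) hist \<times> 'a \<times> 'b \<Rightarrow> ennreal" assume [measurable]: "g \<in> borel_measurable (HS n \<Otimes>\<^sub>M A1 \<Otimes>\<^sub>M A2)"
    have "(\<integral>\<^sup>+\<omega>. g (history n \<omega>, action1_at n \<omega>, action2_at n \<omega>) \<partial>P) = (\<integral>\<^sup>+\<omega>. (\<lambda>x. g (fst x)) (hist_step n \<omega>) \<partial>P)"
      by (simp add: hist_step_def)
    also have "\<dots> = (\<integral>\<^sup>+\<omega>. step_integral n (\<lambda>x. g (fst x)) (history n \<omega>) \<partial>P)"
      by (rule step_integral_eq) measurable
    also have "\<dots> = (\<integral>\<^sup>+\<omega>. (\<integral>\<^sup>+ab. g (history n \<omega>, ab) \<partial>(\<pi>1 n (history n \<omega>) \<Otimes>\<^sub>M \<pi>2 n (history n \<omega>))) \<partial>P)"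
      by (intro nn_integral_cong step_integral_fst in_hist)
    finally show "(\<integral>\<^sup>+\<omega>. g (history n \<omega>, action1_at n \<omega>, action2_at n \<omega>) \<partial>P) =
        (\<integral>\<^sup>+\<omega>. (\<integral>\<^sup>+ab. g (history n \<omega>, ab) \<partial>(\<pi>1 n (history n \<omega>) \<Otimes>\<^sub>M \<pi>2 n (history n \<omega>))) \<partial>P)" .
  qed
  show "cond_sojourn P n"
    unfolding cond_sojourn_def has_cond_law_def
  proof
    fix g :: "(('s, 'a, 'b) hist \<times> 'a \<times> 'b) \<times> real \<Rightarrow> ennreal"
    assume g [measurable]: "g \<in> borel_measurable ((HS n \<Otimes>\<^sub>M A1 \<Otimes>\<^sub>M A2) \<Otimes>\<^sub>M borel)"
    note [measurable] = measurable_integral_sojourn_kernel[OF g]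
    have "(\<integral>\<^sup>+\<omega>. g (hist_step n \<omega>) \<partial>P) = (\<integral>\<^sup>+\<omega>. step_integral n g (history n \<omega>) \<partial>P)" by (rule step_integral_eq[OF g])
    also have "\<dots> = (\<integral>\<^sup>+\<omega>. step_integral n (\<lambda>x. (\<lambda>y. \<integral>\<^sup>+s. g (y, s) \<partial>sojourn_kernel y) (fst x)) (history n \<omega>) \<partial>P)"
      by (intro nn_integral_cong, subst step_integral_fst[OF in_hist]) (simp_all add: step_integral_def)
    also have "\<dots> = (\<integral>\<^sup>+\<omega>. (\<lambda>x. (\<lambda>y. \<integral>\<^sup>+s. g (y, s) \<partial>sojourn_kernel y) (fst x)) (hist_step n \<omega>) \<partial>P)"
      by (rule step_integral_eq[symmetric]) measurable
    finally show "(\<integral>\<^sup>+\<omega>. g ((history n \<omega>, action1_at n \<omega>, action2_at n \<omega>), sojourn_at n \<omega>) \<partial>P) =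
        (\<integral>\<^sup>+\<omega>. (\<integral>\<^sup>+s. g ((history n \<omega>, action1_at n \<omega>, action2_at n \<omega>), s)
          \<partial>sojourn_kernel (history n \<omega>, action1_at n \<omega>, action2_at n \<omega>)) \<partial>P)"
      by (simp add: hist_step_def)
  qed
  show "cond_state P n"
    unfolding cond_state_def has_cond_law_def
  proof
    fix g :: "(('s, 'a, 'b) hist \<times> 'a \<times> 'b \<times> real) \<times> 's \<Rightarrow> ennreal"
    assume g: "g \<in> borel_measurable ((HS n \<Otimes>\<^sub>M A1 \<Otimes>\<^sub>M A2 \<Otimes>\<^sub>M borel) \<Otimes>\<^sub>M count_space UNIV)"
    define \<psi> where "\<psi> h = (let z = fst h in g (((restrict z {..<n}, fst (z n)), fst (snd (z n)), fst (snd (snd (z n))), snd (snd (snd (z n)))), snd h))" for h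
    have comp: "(\<lambda>h. fst h n) \<in> measurable (HS (Suc n)) SP"
      by (rule measurable_compose[OF measurable_fst_hist measurable_component_singleton]) simp
    have res: "(\<lambda>h. restrict (fst h) {..<n}) \<in> measurable (HS (Suc n)) (\<Pi>\<^sub>M k\<in>{..<n}. SP)"
      by (rule measurable_compose[OF measurable_fst_hist measurable_restrict_subset]) auto
    note [measurable] = measurable_compose[OF comp measurable_step_components(1)]
      measurable_compose[OF comp measurable_step_components(3)] measurable_compose[OF comp measurable_step_components(4)]
      measurable_compose[OF comp measurable_step_components(5)]
    have \<psi>: "\<psi> \<in> borel_measurable (HS (Suc n))"
      unfolding \<psi>_def Let_def
      by (rule measurable_compose[OF _ g], unfold hist_space_def[of G n], intro measurable_Pair res) measurable
    have "(\<integral>\<^sup>+\<omega>. g ((history n \<omega>, action1_at n \<omega>, action2_at n \<omega>, sojourn_at n \<omega>), state_at (Suc n) \<omega>) \<partial>P) =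
        (\<integral>\<^sup>+\<omega>. \<psi> (history (Suc n) \<omega>) \<partial>P)"
      by (simp add: \<psi>_def history_def Let_def state_at_def action1_at_def action2_at_def sojourn_at_def restrict_restrict Int_absorb1)
    also have "\<dots> = (\<integral>\<^sup>+\<omega>. (\<integral>\<^sup>+j. \<psi> (restrict \<omega> {..<Suc n}, j) \<partial>state_kernel (Suc n) (restrict \<omega> {..<Suc n})) \<partial>P)"
      by (rule hist_eq[OF \<psi>])
    also have "\<dots> = (\<integral>\<^sup>+\<omega>. (\<integral>\<^sup>+j. g ((history n \<omega>, action1_at n \<omega>, action2_at n \<omega>, sojourn_at n \<omega>), j)
        \<partial>next_state_law (snd (history n \<omega>), action1_at n \<omega>, action2_at n \<omega>)) \<partial>P)"
      by (simp add: \<psi>_def history_def Let_def state_at_def action1_at_def action2_at_def sojourn_at_def restrict_restrict Int_absorb1 triple_def)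
    finally show "(\<integral>\<^sup>+\<omega>. g ((history n \<omega>, action1_at n \<omega>, action2_at n \<omega>, sojourn_at n \<omega>), state_at (Suc n) \<omega>) \<partial>P) =
        (\<integral>\<^sup>+\<omega>. (\<integral>\<^sup>+j. g ((history n \<omega>, action1_at n \<omega>, action2_at n \<omega>, sojourn_at n \<omega>), j)
        \<partial>next_state_law (snd (fst (history n \<omega>, action1_at n \<omega>, action2_at n \<omega>, sojourn_at n \<omega>)),
          fst (snd (history n \<omega>, action1_at n \<omega>, action2_at n \<omega>, sojourn_at n \<omega>)),
          fst (snd (snd (history n \<omega>, action1_at n \<omega>, action2_at n \<omega>, sojourn_at n \<omega>))))) \<partial>P)"
      by simp
  qed
qed

theorem is_law_law: "is_law G i0 \<pi>1 \<pi>2 (law G i0 \<pi>1 \<pi>2)"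
  unfolding law_def
proof (rule theI)
  show "is_law G i0 \<pi>1 \<pi>2 path_law"
    unfolding is_law_iff
    using steps_lawD[OF prob_space_path_law sets_path_law steps_law_path_law] prob_space_path_law sets_path_law by blast
  fix P assume "is_law G i0 \<pi>1 \<pi>2 P"
  then have "prob_space P" "sets P = sets (path_space G)" "steps_law P"
    unfolding is_law_iff by (auto intro: steps_lawI)
  then show "P = path_law"
    by (intro steps_law_unique prob_space_path_law sets_path_law steps_law_path_law)
qed

end

section \<open>Running costs and sojourn weights\<close>

text \<open>Turns a variable upper limit into a parameter of the integrand, for which continuity of parametrised
integrals is available.\<close>

lemma integral_upto_eq:
  fixes f :: "real \<Rightarrow> real"
  assumes f: "continuous_on {0..T} f" and s: "0 \<le> s" "s \<le> T"
  shows "integral {0..s} f = integral {0..T} (\<lambda>r. f (min r s)) - (T - s) * f s"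
proof -
  have cont: "continuous_on {0..T} (\<lambda>r. f (min r s))"
    by (rule continuous_on_compose2[OF f]) (use s in \<open>auto intro!: continuous_intros\<close>)
  have "integral {0..s} (\<lambda>r. f (min r s)) + integral {s..T} (\<lambda>r. f (min r s)) = integral {0..T} (\<lambda>r. f (min r s))"
    using s by (intro Henstock_Kurzweil_Integration.integral_combine integrable_continuous_interval cont) auto
  moreover have "integral {0..s} (\<lambda>r. f (min r s)) = integral {0..s} f"
    by (rule integral_cong) (simp add: min_absorb1)
  moreover have "integral {s..T} (\<lambda>r. f (min r s)) = integral {s..T} (\<lambda>_. f s)"
    by (rule integral_cong) (simp add: min_absorb2)
  ultimately show ?thesis using s by simp
qed

context semi_markov_model begin

lemma continuous_rho:
  assumes "m \<in> {1, 2}"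
  shows "continuous_on (adm1 G i \<times> adm2 G i \<times> {0..sbar}) (\<lambda>(a, b, s). rho G m i a b s)"
  using regular assms by (auto simp: assumption1_def)

lemma rho_bounded: "\<exists>C\<ge>0. \<forall>m\<in>{1, 2}. \<forall>(i, a, b) \<in> admissible G. \<forall>s\<in>{0..sbar}. \<bar>rho G m i a b s\<bar> \<le> C"
proof -
  have "\<exists>c. \<forall>x \<in> adm1 G i \<times> adm2 G i \<times> {0..sbar}. \<bar>case x of (a, b, s) \<Rightarrow> rho G m i a b s\<bar> \<le> c" if "m \<in> {1, 2}" for m i
    using compact_imp_bounded[OF compact_continuous_image[OF continuous_rho[OF that, of i]]]
      compact_Times[OF compact_adm(1) compact_Times[OF compact_adm(2) compact_Icc]]
    unfolding bounded_iff by fastforce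
  then have "\<forall>q \<in> {1, 2} \<times> UNIV. \<exists>c. \<forall>x \<in> adm1 G (snd q) \<times> adm2 G (snd q) \<times> {0..sbar}. \<bar>case x of (a, b, s) \<Rightarrow> rho G (fst q) (snd q) a b s\<bar> \<le> c"
    by (simp add: mem_Times_iff)
  from bchoice[OF this] obtain c where
    c: "\<forall>q \<in> {1, 2} \<times> UNIV. \<forall>x \<in> adm1 G (snd q) \<times> adm2 G (snd q) \<times> {0..sbar}. \<bar>case x of (a, b, s) \<Rightarrow> rho G (fst q) (snd q) a b s\<bar> \<le> c q" ..
  define C where "C = (\<Sum>q \<in> {1, 2} \<times> (UNIV :: 's set). \<bar>c q\<bar>)"
  have fin: "finite ({1, 2 :: nat} \<times> (UNIV :: 's set))" by simp
  show ?thesis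
  proof (intro exI[of _ C] conjI ballI)
    show "0 \<le> C" unfolding C_def by (intro sum_nonneg) simp
    fix m :: nat and z assume m: "m \<in> {1, 2}" and z: "z \<in> admissible G"
    obtain i a b where zi: "z = (i, a, b)" by (cases z)
    have "\<bar>rho G m i a b s\<bar> \<le> C" if s: "s \<in> {0..sbar}" for s
    proof -
      have "(m, i) \<in> {1, 2} \<times> UNIV" using m by simp
      moreover have "(a, b, s) \<in> adm1 G (snd (m, i)) \<times> adm2 G (snd (m, i)) \<times> {0..sbar}"
        using z s by (simp add: zi mem_admissible)
      ultimately have "\<bar>case (a, b, s) of (a, b, s) \<Rightarrow> rho G (fst (m, i)) (snd (m, i)) a b s\<bar> \<le> c (m, i)"
        using c by blast
      also have "\<dots> \<le> \<bar>c (m, i)\<bar>" by simp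
      also have "\<dots> \<le> C"
        unfolding C_def using m fin by (intro member_le_sum) auto
      finally show ?thesis by simp
    qed
    then show "case z of (i, a, b) \<Rightarrow> \<forall>s\<in>{0..sbar}. \<bar>rho G m i a b s\<bar> \<le> C" by (simp add: zi)
  qed
qed

definition rho_max :: real where
  "rho_max = (SOME C. C \<ge> 0 \<and> (\<forall>m\<in>{1, 2}. \<forall>(i, a, b) \<in> admissible G. \<forall>s\<in>{0..sbar}. \<bar>rho G m i a b s\<bar> \<le> C))"

lemma rho_max_nonneg: "0 \<le> rho_max"
  and rho_le_max: "m \<in> {1, 2} \<Longrightarrow> (i, a, b) \<in> admissible G \<Longrightarrow> s \<in> {0..sbar} \<Longrightarrow> \<bar>rho G m i a b s\<bar> \<le> rho_max"
  using someI_ex[OF rho_bounded] unfolding rho_max_def[symmetric] by blast+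

lemma continuous_rho_time:
  assumes "m \<in> {1, 2}" "(i, a, b) \<in> admissible G"
  shows "continuous_on {0..sbar} (rho G m i a b)"
proof -
  have "continuous_on {0..sbar} (\<lambda>s. (\<lambda>(a, b, s). rho G m i a b s) (a, b, s))"
    by (rule continuous_on_compose2[OF continuous_rho[OF assms(1), of i]])
       (use assms(2) in \<open>auto intro!: continuous_intros simp: mem_admissible\<close>)
  then show ?thesis by simp
qed

lemma run_cost_eq_integral:
  assumes "m \<in> {1, 2}" "(i, a, b) \<in> admissible G" "s \<le> sbar"
  shows "run_cost G m i a b s = integral {0..s} (rho G m i a b)"
proof -
  have "continuous_on {0..s} (rho G m i a b)"
    by (rule continuous_on_subset[OF continuous_rho_time[OF assms(1,2)]]) (use assms(3) in auto)
  then have "set_integrable lborel {0..s} (rho G m i a b)"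
    by (rule borel_integrable_atLeastAtMost')
  then show ?thesis
    unfolding run_cost_def by (rule set_borel_integral_eq_integral(2))
qed

lemma run_cost_bound:
  assumes "m \<in> {1, 2}" "(i, a, b) \<in> admissible G" "0 \<le> s" "s \<le> sbar"
  shows "\<bar>run_cost G m i a b s\<bar> \<le> rho_max * s"
proof -
  have "norm (integral (cbox 0 s) (rho G m i a b)) \<le> rho_max * measure lborel (cbox 0 s)"
  proof (rule integrable_bound)
    show "0 \<le> rho_max" by (rule rho_max_nonneg)
    show "rho G m i a b integrable_on cbox 0 s"
      unfolding cbox_interval using assms
      by (intro integrable_continuous_interval continuous_on_subset[OF continuous_rho_time[OF assms(1,2)]]) auto
    show "norm (rho G m i a b x) \<le> rho_max" if "x \<in> cbox 0 s" for x
      using rho_le_max[OF assms(1,2), of x] that assms by simp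
  qed
  then show ?thesis
    using assms by (simp add: run_cost_eq_integral)
qed

lemma continuous_run_cost:
  assumes "m \<in> {1, 2}"
  shows "continuous_on (adm1 G i \<times> adm2 G i \<times> {0..sbar}) (\<lambda>(a, b, s). run_cost G m i a b s)"
proof -
  let ?U = "adm1 G i \<times> adm2 G i \<times> {0..sbar}"
  have "continuous_on (?U \<times> cbox 0 sbar)
      (\<lambda>z. (\<lambda>(a, b, s). rho G m i a b s) (fst (fst z), fst (snd (fst z)), min (snd z) (snd (snd (fst z)))))"
    by (rule continuous_on_compose2[OF continuous_rho[OF assms]]) (auto intro!: continuous_intros)
  then have "continuous_on (?U \<times> cbox 0 sbar)
      (\<lambda>(x, r). rho G m i (fst x) (fst (snd x)) (min r (snd (snd x))))"
    by (simp add: case_prod_beta)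
  from integral_continuous_on_param[OF this]
  have 1: "continuous_on ?U (\<lambda>x. integral {0..sbar} (\<lambda>r. rho G m i (fst x) (fst (snd x)) (min r (snd (snd x)))))"
    by simp
  have 2: "continuous_on ?U (\<lambda>x. (sbar - snd (snd x)) * rho G m i (fst x) (fst (snd x)) (snd (snd x)))"
    using continuous_rho[OF assms, of i] by (intro continuous_intros) (auto simp: case_prod_beta)
  show ?thesis
  proof (rule continuous_on_cong[THEN iffD1, OF refl _ continuous_on_diff[OF 1 2]])
    fix x assume "x \<in> ?U"
    then obtain a b s where x: "x = (a, b, s)" "(i, a, b) \<in> admissible G" "0 \<le> s" "s \<le> sbar"
      by (cases x) (auto simp: mem_admissible)
    show "integral {0..sbar} (\<lambda>r. rho G m i (fst x) (fst (snd x)) (min r (snd (snd x)))) -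
        (sbar - snd (snd x)) * rho G m i (fst x) (fst (snd x)) (snd (snd x)) = (case x of (a, b, s) \<Rightarrow> run_cost G m i a b s)"
      using integral_upto_eq[OF continuous_rho_time[OF assms x(2)] x(3,4)]
      by (simp add: x(1) run_cost_eq_integral[OF assms x(2,4)])
  qed
qed

lemma sojourn_probs_on: "(i, a, b) \<in> admissible G \<Longrightarrow> sojourn G i a b \<in> probs_on {0..sbar}"
  using AE_sojourn[of i a b] prob_space_sojourn_law[of "(i, a, b)"] sets_sojourn_law[of "(i, a, b)"]
  unfolding probs_on_def by (auto simp: sojourn_law_admissible elim!: eventually_mono)

text \<open>Both the measure and the integrand depend on \<open>z\<close>. Near \<open>z\<^sub>0\<close> the integrand is
uniformly close to the one at \<open>z\<^sub>0\<close>, and the integral of that fixed function is continuous by assumption.\<close>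

lemma continuous_sojourn_integral:
  fixes e :: "('a \<times> 'b) \<times> real \<Rightarrow> real \<Rightarrow> real"
  assumes e: "continuous_on (((adm1 G i \<times> adm2 G i) \<times> {c..d}) \<times> {0..sbar}) (\<lambda>(z, s). e z s)"
  shows "continuous_on ((adm1 G i \<times> adm2 G i) \<times> {c..d})
    (\<lambda>z. LINT s:{0..sbar}|sojourn G i (fst (fst z)) (snd (fst z)). e z s)"
  unfolding continuous_on_iff
proof (intro ballI allI impI)
  let ?D = "(adm1 G i \<times> adm2 G i) \<times> {c..d}"
  let ?\<mu> = "\<lambda>z :: ('a \<times> 'b) \<times> real. sojourn G i (fst (fst z)) (snd (fst z))"
  fix z0 and \<epsilon> :: real assume z0: "z0 \<in> ?D" and "0 < \<epsilon>"
  have compD: "compact ?D" by (intro compact_Times compact_adm compact_Icc)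
  have mem: "?\<mu> z \<in> probs_on {0..sbar}" if "z \<in> ?D" for z
    by (rule sojourn_probs_on) (use that in \<open>auto simp: mem_admissible\<close>)
  have slice: "continuous_on {0..sbar} (e z)" if "z \<in> ?D" for z
    using continuous_on_slice[OF e that] by simp
  obtain d1 where d1: "0 < d1" "\<forall>a\<in>?D. \<forall>a'\<in>?D. dist a a' < d1 \<longrightarrow> (\<forall>b\<in>{0..sbar}. \<bar>(case (a, b) of (z, s) \<Rightarrow> e z s) - (case (a', b) of (z, s) \<Rightarrow> e z s)\<bar> < \<epsilon> / 2)"
    using uniform_slices[OF compD compact_Icc e, of "\<epsilon> / 2"] \<open>0 < \<epsilon>\<close> by auto
  obtain B where "\<forall>y\<in>e z0 ` {0..sbar}. norm y \<le> B"
    using compact_imp_bounded[OF compact_continuous_image[OF slice[OF z0] compact_Icc]] unfolding bounded_iff by (elim exE)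
  then have B: "norm (e z0 s) \<le> B" if "s \<in> {0..sbar}" for s using that by blast
  have u_meas: "(\<lambda>s. indicator {0..sbar} s *\<^sub>R e z0 s) \<in> borel_measurable borel"
    by (rule borel_measurable_continuous_on_indicator[OF _ slice[OF z0]]) simp
  have u_bound: "\<bar>indicator {0..sbar} s *\<^sub>R e z0 s\<bar> \<le> \<bar>B\<bar>" for s
  proof (cases "s \<in> {0..sbar}")
    case True
    then show ?thesis using B[OF True] by simp
  qed simp
  have "continuous_on (adm1 G i \<times> adm2 G i) (\<lambda>(a, b). LINT s|sojourn G i a b. indicator {0..sbar} s *\<^sub>R e z0 s)"
    by (rule integral_sojourn_continuous[OF u_meas u_bound])
  then have "continuous_on ?D (\<lambda>z. (\<lambda>(a, b). LINT s|sojourn G i a b. indicator {0..sbar} s *\<^sub>R e z0 s) (fst z))"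
    by (rule continuous_on_compose2) (auto intro!: continuous_intros)
  then have "continuous_on ?D (\<lambda>z. LINT s:{0..sbar}|?\<mu> z. e z0 s)"
    by (simp add: case_prod_beta set_lebesgue_integral_def)
  then obtain d2 where d2: "0 < d2" "\<And>z. z \<in> ?D \<Longrightarrow> dist z z0 < d2 \<Longrightarrow>
      dist (LINT s:{0..sbar}|?\<mu> z. e z0 s) (LINT s:{0..sbar}|?\<mu> z0. e z0 s) < \<epsilon> / 2"
    using z0 half_gt_zero[OF \<open>0 < \<epsilon>\<close>] unfolding continuous_on_iff by meson
  show "\<exists>d>0. \<forall>z\<in>?D. dist z z0 < d \<longrightarrow> dist (LINT s:{0..sbar}|?\<mu> z. e z s) (LINT s:{0..sbar}|?\<mu> z0. e z0 s) < \<epsilon>"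
  proof (intro exI[of _ "min d1 d2"] conjI ballI impI)
    show "0 < min d1 d2" using d1 d2 by simp
    fix z assume z: "z \<in> ?D" "dist z z0 < min d1 d2"
    have "\<bar>(LINT s:{0..sbar}|?\<mu> z. e z s) - (LINT s:{0..sbar}|?\<mu> z. e z0 s)\<bar> \<le> \<epsilon> / 2"
    proof (rule set_integral_probs_on_close[OF compact_Icc mem[OF z(1)] slice[OF z(1)] slice[OF z0]])
      fix s assume "s \<in> {0..sbar}"
      then show "\<bar>e z s - e z0 s\<bar> \<le> \<epsilon> / 2" using d1(2)[rule_format, OF z(1) z0 _ \<open>s \<in> {0..sbar}\<close>] z(2) by simp
    qed
    moreover have "\<bar>(LINT s:{0..sbar}|?\<mu> z. e z0 s) - (LINT s:{0..sbar}|?\<mu> z0. e z0 s)\<bar> < \<epsilon> / 2"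
      using d2(2)[OF z(1)] z(2) by (simp add: dist_real_def)
    ultimately show "dist (LINT s:{0..sbar}|?\<mu> z. e z s) (LINT s:{0..sbar}|?\<mu> z0. e z0 s) < \<epsilon>"
      unfolding dist_real_def by linarith
  qed
qed

text \<open>Since sojourn times are positive, every single integral is less than 1; it depends continuously on
actions from compact sets, so its supremum is attained.\<close>

lemma sojourn_discount_less_1:
  assumes "0 < \<kappa>"
  shows "\<exists>\<gamma>. 0 \<le> \<gamma> \<and> \<gamma> < 1 \<and> (\<forall>(i, a, b) \<in> admissible G. (LINT s:{0..sbar}|sojourn G i a b. exp (- \<kappa> * s)) \<le> \<gamma>)"
proof -
  have less: "(LINT s:{0..sbar}|sojourn G i a b. exp (- \<kappa> * s)) < 1" if adm: "(i, a, b) \<in> admissible G" for i a b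
  proof -
    let ?\<mu> = "sojourn G i a b"
    interpret real_distribution ?\<mu> by (rule real_distribution_sojourn[OF adm])
    note p = sojourn_probs_on[OF adm]
    have c: "continuous_on {0..sbar} (\<lambda>s. exp (- \<kappa> * s))" "continuous_on {0..sbar} (\<lambda>s. 1 - exp (- \<kappa> * s))"
      by (intro continuous_intros)+
    have int: "integrable ?\<mu> (\<lambda>s. indicator {0..sbar} s *\<^sub>R (1 - exp (- \<kappa> * s)))"
      using set_integrable_probs_on[OF compact_Icc p c(2)] by (simp add: set_integrable_def)
    have nonneg: "0 \<le> indicator {0..sbar} s *\<^sub>R (1 - exp (- \<kappa> * s))" for s
      using \<open>0 < \<kappa>\<close> by (auto split: split_indicator)
    have ne: "(LINT s|?\<mu>. indicator {0..sbar} s *\<^sub>R (1 - exp (- \<kappa> * s))) \<noteq> 0"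
    proof
      assume "(LINT s|?\<mu>. indicator {0..sbar} s *\<^sub>R (1 - exp (- \<kappa> * s))) = 0"
      then have "AE s in ?\<mu>. indicator {0..sbar} s *\<^sub>R (1 - exp (- \<kappa> * s)) = 0"
        using integral_nonneg_eq_0_iff_AE[OF int] nonneg by simp
      then have "AE s in ?\<mu>. False"
        using AE_sojourn[OF adm] by eventually_elim (use \<open>0 < \<kappa>\<close> in auto)
      then show False by simp
    qed
    have ge: "0 \<le> (LINT s|?\<mu>. indicator {0..sbar} s *\<^sub>R (1 - exp (- \<kappa> * s)))"
      by (rule integral_nonneg_AE) (use nonneg in auto)
    have "0 < (LINT s:{0..sbar}|?\<mu>. 1 - exp (- \<kappa> * s))"
      unfolding set_lebesgue_integral_def using ne ge by linarith
    moreover have "(LINT s:{0..sbar}|?\<mu>. 1 - exp (- \<kappa> * s)) = (LINT s:{0..sbar}|?\<mu>. 1) - (LINT s:{0..sbar}|?\<mu>. exp (- \<kappa> * s))"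
      by (rule set_integral_diff(2)) (intro set_integrable_probs_on[OF compact_Icc p] c continuous_intros)+
    moreover have "(LINT s:{0..sbar}|?\<mu>. (1 :: real)) = 1"
      by (rule set_integral_probs_on_const[OF compact_Icc p])
    ultimately show ?thesis by linarith
  qed
  have "\<exists>c<1. \<forall>a\<in>adm1 G i. \<forall>b\<in>adm2 G i. (LINT s:{0..sbar}|sojourn G i a b. exp (- \<kappa> * s)) \<le> c" for i
  proof -
    \<comment> \<open>A one-point interval takes the place of the range of rates.\<close>
    have "continuous_on ((adm1 G i \<times> adm2 G i) \<times> {0..0::real}) (\<lambda>z. LINT s:{0..sbar}|sojourn G i (fst (fst z)) (snd (fst z)). exp (- \<kappa> * s))"
      by (rule continuous_sojourn_integral[where e = "\<lambda>_ s. exp (- \<kappa> * s)"]) (auto intro!: continuous_intros simp: case_prod_beta)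
    note cont = this
    have comp: "compact ((adm1 G i \<times> adm2 G i) \<times> {0..0::real})"
      by (intro compact_Times compact_adm compact_Icc)
    have ne: "(adm1 G i \<times> adm2 G i) \<times> {0..0::real} \<noteq> {}" using adm_ne[of i] by auto
    have "\<exists>x\<in>(adm1 G i \<times> adm2 G i) \<times> {0..0::real}. \<forall>y\<in>(adm1 G i \<times> adm2 G i) \<times> {0..0::real}.
        (LINT s:{0..sbar}|sojourn G i (fst (fst y)) (snd (fst y)). exp (- \<kappa> * s)) \<le>
        (LINT s:{0..sbar}|sojourn G i (fst (fst x)) (snd (fst x)). exp (- \<kappa> * s))"
      by (rule continuous_attains_sup[OF comp ne cont])
    then obtain x where x: "x \<in> (adm1 G i \<times> adm2 G i) \<times> {0..0::real}"
      "\<And>y. y \<in> (adm1 G i \<times> adm2 G i) \<times> {0..0::real} \<Longrightarrow>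
        (LINT s:{0..sbar}|sojourn G i (fst (fst y)) (snd (fst y)). exp (- \<kappa> * s)) \<le>
        (LINT s:{0..sbar}|sojourn G i (fst (fst x)) (snd (fst x)). exp (- \<kappa> * s))" by auto
    show ?thesis
    proof (intro exI[of _ "LINT s:{0..sbar}|sojourn G i (fst (fst x)) (snd (fst x)). exp (- \<kappa> * s)"] conjI ballI)
      show "(LINT s:{0..sbar}|sojourn G i (fst (fst x)) (snd (fst x)). exp (- \<kappa> * s)) < 1"
        by (rule less) (use x(1) in \<open>auto simp: mem_admissible\<close>)
      fix a b assume "a \<in> adm1 G i" "b \<in> adm2 G i"
      then show "(LINT s:{0..sbar}|sojourn G i a b. exp (- \<kappa> * s)) \<le>
          (LINT s:{0..sbar}|sojourn G i (fst (fst x)) (snd (fst x)). exp (- \<kappa> * s))"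
        using x(2)[of "((a, b), 0)"] by simp
    qed
  qed
  then have "\<forall>i. \<exists>c. c < 1 \<and> (\<forall>a\<in>adm1 G i. \<forall>b\<in>adm2 G i. (LINT s:{0..sbar}|sojourn G i a b. exp (- \<kappa> * s)) \<le> c)"
    by blast
  from choice[OF this] obtain c where c: "\<forall>i. c i < 1 \<and> (\<forall>a\<in>adm1 G i. \<forall>b\<in>adm2 G i. (LINT s:{0..sbar}|sojourn G i a b. exp (- \<kappa> * s)) \<le> c i)" ..
  show ?thesis
  proof (intro exI[of _ "max 0 (Max (range c))"] conjI ballI)
    have "Max (range c) \<in> range c" by (rule Max_in) auto
    then show "max 0 (Max (range c)) < 1" using c by auto
    fix z assume "z \<in> admissible G"
    then obtain i a b where z: "z = (i, a, b)" "a \<in> adm1 G i" "b \<in> adm2 G i"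
      by (cases z) (auto simp: mem_admissible)
    have "c i \<le> Max (range c)" by (rule Max_ge) auto
    moreover have "(LINT s:{0..sbar}|sojourn G i a b. exp (- \<kappa> * s)) \<le> c i" using c z by blast
    ultimately have "(LINT s:{0..sbar}|sojourn G i a b. exp (- \<kappa> * s)) \<le> Max (range c)" by (rule order.trans[rotated])
    then show "case z of (i, a, b) \<Rightarrow> (LINT s:{0..sbar}|sojourn G i a b. exp (- \<kappa> * s)) \<le> max 0 (Max (range c))"
      unfolding z prod.case le_max_iff_disj by (rule disjI2)
  qed simp
qed

definition sojourn_weight :: "real \<Rightarrow> nat \<Rightarrow> 's \<Rightarrow> 'a \<Rightarrow> 'b \<Rightarrow> real \<Rightarrow> real" where
  "sojourn_weight \<theta> m i a b g = (LINT s:{0..sbar}|sojourn G i a b. exp (\<theta> * (run_cost G m i a b s - g * s)))"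

lemma continuous_run_cost_time:
  assumes "m \<in> {1, 2}" "(i, a, b) \<in> admissible G"
  shows "continuous_on {0..sbar} (\<lambda>s. run_cost G m i a b s)"
proof -
  have "continuous_on {0..sbar} (\<lambda>s. (\<lambda>(a, b, s). run_cost G m i a b s) (a, b, s))"
    by (rule continuous_on_compose2[OF continuous_run_cost[OF assms(1), of i]])
       (use assms(2) in \<open>auto intro!: continuous_intros simp: mem_admissible\<close>)
  then show ?thesis by simp
qed

lemma continuous_sojourn_weight:
  assumes "m \<in> {1, 2}"
  shows "continuous_on (adm1 G i \<times> adm2 G i \<times> {c..d}) (\<lambda>(a, b, g). sojourn_weight \<theta> m i a b g)"
proof -
  have "continuous_on (((adm1 G i \<times> adm2 G i) \<times> {c..d}) \<times> {0..sbar})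
      (\<lambda>z. (\<lambda>(a, b, s). run_cost G m i a b s) (fst (fst (fst z)), snd (fst (fst z)), snd z))"
    by (rule continuous_on_compose2[OF continuous_run_cost[OF assms]]) (auto intro!: continuous_intros)
  then have "continuous_on (((adm1 G i \<times> adm2 G i) \<times> {c..d}) \<times> {0..sbar})
      (\<lambda>(z, s). exp (\<theta> * (run_cost G m i (fst (fst z)) (snd (fst z)) s - snd z * s)))"
    by (auto simp: case_prod_beta intro!: continuous_intros)
  from continuous_sojourn_integral[OF this]
  have "continuous_on ((adm1 G i \<times> adm2 G i) \<times> {c..d}) (\<lambda>z. sojourn_weight \<theta> m i (fst (fst z)) (snd (fst z)) (snd z))"
    by (simp add: sojourn_weight_def)
  then have "continuous_on (adm1 G i \<times> adm2 G i \<times> {c..d})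
      (\<lambda>x. (\<lambda>z. sojourn_weight \<theta> m i (fst (fst z)) (snd (fst z)) (snd z)) ((fst x, fst (snd x)), snd (snd x)))"
    by (rule continuous_on_compose2) (auto intro!: continuous_intros)
  then show ?thesis by (simp add: case_prod_beta)
qed

lemma continuous_weight_integrand:
  assumes "m \<in> {1, 2}" "(i, a, b) \<in> admissible G"
  shows "continuous_on {0..sbar} (\<lambda>s. exp (\<theta> * (run_cost G m i a b s - g * s)))"
  by (intro continuous_intros continuous_run_cost_time[OF assms])

lemma sojourn_weight_mono:
  assumes "m \<in> {1, 2}" "(i, a, b) \<in> admissible G" "continuous_on {0..sbar} u"
  shows "(\<And>s. s \<in> {0..sbar} \<Longrightarrow> exp (\<theta> * (run_cost G m i a b s - g * s)) \<le> u s) \<Longrightarrow>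
      sojourn_weight \<theta> m i a b g \<le> (LINT s:{0..sbar}|sojourn G i a b. u s)"
    and "(\<And>s. s \<in> {0..sbar} \<Longrightarrow> u s \<le> exp (\<theta> * (run_cost G m i a b s - g * s))) \<Longrightarrow>
      (LINT s:{0..sbar}|sojourn G i a b. u s) \<le> sojourn_weight \<theta> m i a b g"
  unfolding sojourn_weight_def
  by (rule set_integral_probs_on_mono[OF compact_Icc sojourn_probs_on[OF assms(2)]];
      (rule continuous_weight_integrand[OF assms(1,2)] | rule assms(3) | assumption))+

lemma sojourn_weight_pos:
  assumes "0 < \<theta>" "m \<in> {1, 2}" "(i, a, b) \<in> admissible G"
  shows "exp (- \<theta> * (rho_max + \<bar>g\<bar>) * sbar) \<le> sojourn_weight \<theta> m i a b g"
proof -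
  have "exp (- \<theta> * (rho_max + \<bar>g\<bar>) * sbar) \<le> exp (\<theta> * (run_cost G m i a b s - g * s))" if s: "s \<in> {0..sbar}" for s
  proof -
    have "\<bar>run_cost G m i a b s\<bar> \<le> rho_max * s" using s by (intro run_cost_bound assms) auto
    moreover have "rho_max * s \<le> rho_max * sbar" using s rho_max_nonneg by (intro mult_left_mono) auto
    moreover have "g * s \<le> \<bar>g\<bar> * sbar" using s by (intro mult_mono) auto
    ultimately have "- ((rho_max + \<bar>g\<bar>) * sbar) \<le> run_cost G m i a b s - g * s" by (simp add: algebra_simps abs_le_iff)
    from mult_left_mono[OF this, of \<theta>] \<open>0 < \<theta>\<close> show ?thesis by (simp add: algebra_simps)
  qed
  then have "(LINT s:{0..sbar}|sojourn G i a b. exp (- \<theta> * (rho_max + \<bar>g\<bar>) * sbar)) \<le> sojourn_weight \<theta> m i a b g"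
    by (intro sojourn_weight_mono(2) assms continuous_intros)
  then show ?thesis by (simp add: set_integral_probs_on_const[OF compact_Icc sojourn_probs_on[OF assms(3)]])
qed

text \<open>Rates are confined to the interval from \<open>- L\<close> to \<open>L\<close> with \<open>L = rho_max + 1\<close>. At the rate \<open>L\<close> the net cost of a
sojourn of length \<open>s\<close> is at most \<open>- s\<close>, so its weight is uniformly less than 1; at \<open>- L\<close> the net cost is nonnegative and
the weight at least 1.\<close>

theorem bellman_equilibrium:
  assumes "0 < \<theta>"
  shows "\<exists>\<alpha> \<beta> \<Theta>. (\<forall>i. \<alpha> i \<in> probs_on (adm1 G i)) \<and> (\<forall>i. \<beta> i \<in> probs_on (adm2 G i)) \<and>
    (\<forall>m. (\<forall>i. 0 \<le> snd (\<Theta> m) i) \<and> (\<Sum>i\<in>UNIV. snd (\<Theta> m) i) = 1) \<and>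
    (\<forall>m i. snd (\<Theta> m) i = (LINT a:adm1 G i|\<alpha> i. LINT b:adm2 G i|\<beta> i.
       stage_cost (sojourn_weight \<theta> (if m then 1 else 2)) (trans_prob G) i (\<Theta> m) (a, b))) \<and>
    (\<forall>i. \<forall>a\<in>adm1 G i. snd (\<Theta> True) i \<le> (LINT b:adm2 G i|\<beta> i. stage_cost (sojourn_weight \<theta> 1) (trans_prob G) i (\<Theta> True) (a, b))) \<and>
    (\<forall>i. \<forall>b\<in>adm2 G i. snd (\<Theta> False) i \<le> (LINT a:adm1 G i|\<alpha> i. stage_cost (sojourn_weight \<theta> 2) (trans_prob G) i (\<Theta> False) (a, b)))"
proof -
  define L where "L = rho_max + 1"
  have "0 < L" using rho_max_nonneg by (simp add: L_def)
  obtain \<omega> where \<omega>: "\<omega> < 1" "\<forall>(i, a, b) \<in> admissible G. (LINT s:{0..sbar}|sojourn G i a b. exp (- \<theta> * s)) \<le> \<omega>"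
    using sojourn_discount_less_1[OF assms] by blast
  define w where "w m = sojourn_weight \<theta> (if m then 1 else 2)" for m :: bool
  have bound: "\<bar>run_cost G (if m then 1 else 2) i a b s\<bar> \<le> rho_max * s"
    if "(i, a, b) \<in> admissible G" "s \<in> {0..sbar}" for m i a b s
    using that by (intro run_cost_bound) auto
  have "\<exists>\<alpha> \<beta> \<Theta>. (\<forall>i. \<alpha> i \<in> probs_on (adm1 G i)) \<and> (\<forall>i. \<beta> i \<in> probs_on (adm2 G i)) \<and>
    (\<forall>m. \<Theta> m \<in> parameters L \<and> (\<Sum>i\<in>UNIV. snd (\<Theta> m) i) = 1) \<and>
    (\<forall>m i. snd (\<Theta> m) i = (LINT a:adm1 G i|\<alpha> i. LINT b:adm2 G i|\<beta> i. stage_cost (w m) (trans_prob G) i (\<Theta> m) (a, b))) \<and>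
    (\<forall>i. \<forall>a\<in>adm1 G i. snd (\<Theta> True) i \<le> (LINT b:adm2 G i|\<beta> i. stage_cost (w True) (trans_prob G) i (\<Theta> True) (a, b))) \<and>
    (\<forall>i. \<forall>b\<in>adm2 G i. snd (\<Theta> False) i \<le> (LINT a:adm1 G i|\<alpha> i. stage_cost (w False) (trans_prob G) i (\<Theta> False) (a, b)))"
  proof (rule compact_game_equilibrium[where L = L and \<omega> = \<omega>])
    show "continuous_on (adm1 G i \<times> adm2 G i \<times> {- L..L}) (\<lambda>(a, b, g). w m i a b g)" for m i
      unfolding w_def by (rule continuous_sojourn_weight) simp
    fix m i a b assume ab: "a \<in> adm1 G i" "b \<in> adm2 G i"
    then have adm: "(i, a, b) \<in> admissible G" by (simp add: mem_admissible)
    show "0 \<le> w m i a b g" for g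
      unfolding w_def using sojourn_weight_pos[OF assms _ adm, of "if m then 1 else 2" g]
      by (auto intro: order.trans[OF exp_ge_zero])
    show "w m i a b L \<le> \<omega>"
    proof -
      have "w m i a b L \<le> (LINT s:{0..sbar}|sojourn G i a b. exp (- \<theta> * s))"
        unfolding w_def
      proof (rule sojourn_weight_mono(1)[OF _ adm])
        fix s assume "s \<in> {0..sbar}"
        from bound[OF adm this, of m] have "run_cost G (if m then 1 else 2) i a b s - L * s \<le> - s"
          by (simp add: L_def algebra_simps abs_le_iff)
        from mult_left_mono[OF this, of \<theta>] assms
        show "exp (\<theta> * (run_cost G (if m then 1 else 2) i a b s - L * s)) \<le> exp (- \<theta> * s)" by simp
      qed (auto intro!: continuous_intros)
      also have "\<dots> \<le> \<omega>" using \<omega>(2) adm by blast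
      finally show ?thesis .
    qed
    show "1 \<le> w m i a b (- L)"
    proof -
      have "(LINT s:{0..sbar}|sojourn G i a b. 1) \<le> w m i a b (- L)"
        unfolding w_def
      proof (rule sojourn_weight_mono(2)[OF _ adm])
        fix s assume s: "s \<in> {0..sbar}"
        from bound[OF adm this, of m] s have "0 \<le> run_cost G (if m then 1 else 2) i a b s - (- L) * s"
          by (simp add: L_def algebra_simps abs_le_iff)
        then show "1 \<le> exp (\<theta> * (run_cost G (if m then 1 else 2) i a b s - (- L) * s))" using assms by simp
      qed auto
      then show ?thesis by (simp add: set_integral_probs_on_const[OF compact_Icc sojourn_probs_on[OF adm]])
    qed
  qed (use \<open>0 < L\<close> \<omega>(1) compact_adm adm_ne continuous_trans_prob trans_prob_nonneg trans_prob_sum in \<open>auto simp: mem_admissible\<close>)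
  then obtain \<alpha> \<beta> \<Theta> where *: "(\<forall>i. \<alpha> i \<in> probs_on (adm1 G i)) \<and> (\<forall>i. \<beta> i \<in> probs_on (adm2 G i)) \<and>
    (\<forall>m. \<Theta> m \<in> parameters L \<and> (\<Sum>i\<in>UNIV. snd (\<Theta> m) i) = 1) \<and>
    (\<forall>m i. snd (\<Theta> m) i = (LINT a:adm1 G i|\<alpha> i. LINT b:adm2 G i|\<beta> i. stage_cost (w m) (trans_prob G) i (\<Theta> m) (a, b))) \<and>
    (\<forall>i. \<forall>a\<in>adm1 G i. snd (\<Theta> True) i \<le> (LINT b:adm2 G i|\<beta> i. stage_cost (w True) (trans_prob G) i (\<Theta> True) (a, b))) \<and>
    (\<forall>i. \<forall>b\<in>adm2 G i. snd (\<Theta> False) i \<le> (LINT a:adm1 G i|\<alpha> i. stage_cost (w False) (trans_prob G) i (\<Theta> False) (a, b)))"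
    by (elim exE)
  have w: "w True = sojourn_weight \<theta> 1" "w False = sojourn_weight \<theta> 2" by (simp_all add: w_def)
  have "0 \<le> snd (\<Theta> m) i" for m i
  proof -
    have "\<Theta> m \<in> parameters L" using * by blast
    then show ?thesis by (auto simp: parameters_def)
  qed
  then show ?thesis
  proof (intro exI[of _ \<alpha>] exI[of _ \<beta>] exI[of _ \<Theta>] conjI)
    show "\<forall>m. (\<forall>i. 0 \<le> snd (\<Theta> m) i) \<and> (\<Sum>i\<in>UNIV. snd (\<Theta> m) i) = 1"
      using * \<open>\<And>m i. 0 \<le> snd (\<Theta> m) i\<close> by blast
  qed (use *[unfolded w] in \<open>unfold w_def, blast+\<close>)
qed

end

section \<open>One-step expectations\<close>

context controlled_semi_markov_model begin

text \<open>The truncation at \<open>sbar\<close>, which is almost surely void, keeps the running cost in the range where it is known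
to be continuous, hence measurable.\<close>

definition step_cost :: "nat \<Rightarrow> ('s, 'a, 'b) step \<Rightarrow> real" where
  "step_cost m x = run_cost G m (fst x) (fst (snd x)) (fst (snd (snd x))) (min (snd (snd (snd x))) sbar)"

lemma measurable_step_cost [measurable]:
  assumes "m \<in> {1, 2}"
  shows "step_cost m \<in> borel_measurable SP"
proof -
  define f where "f x = (if snd x \<in> adm1 G (fst x) \<times> adm2 G (fst x) \<times> {0..sbar}
      then (\<lambda>(a, b, s). run_cost G m (fst x) a b s) (snd x) else 0)" for x :: "('s, 'a, 'b) step"
  have "f \<in> borel_measurable SABR"
  proof (rule measurable_count_space_pair)
    fix i
    have "adm1 G i \<times> adm2 G i \<times> {0..sbar} \<in> sets borel"
      by (intro borel_compact compact_Times compact_adm compact_Icc)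
    from borel_measurable_continuous_on_if[OF this continuous_run_cost[OF assms], of "\<lambda>_. 0"]
    have "(\<lambda>y. if y \<in> adm1 G i \<times> adm2 G i \<times> {0..sbar} then (\<lambda>(a, b, s). run_cost G m i a b s) y else 0)
        \<in> borel_measurable (borel \<Otimes>\<^sub>M borel \<Otimes>\<^sub>M borel)"
      by (simp add: borel_prod)
    then show "(\<lambda>y. f (i, y)) \<in> borel_measurable (borel \<Otimes>\<^sub>M borel \<Otimes>\<^sub>M borel)"
      by (simp add: f_def cong: if_cong)
  qed
  moreover have "(\<lambda>x. (fst x, fst (snd x), fst (snd (snd x)), min (snd (snd (snd x))) sbar)) \<in> measurable SP SABR"
    by (rule measurable_from_step) measurable
  ultimately have "(\<lambda>x. f (fst x, fst (snd x), fst (snd (snd x)), min (snd (snd (snd x))) sbar)) \<in> borel_measurable SP"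
    by (rule measurable_compose[rotated])
  moreover have "f (fst x, fst (snd x), fst (snd (snd x)), min (snd (snd (snd x))) sbar) = step_cost m x"
    if "x \<in> space SP" for x
    using that sbar_pos by (simp add: f_def step_cost_def space_step triple_def mem_admissible)
  ultimately show ?thesis by (subst measurable_cong[symmetric]) auto
qed

lemma step_cost_bound:
  assumes "m \<in> {1, 2}" "x \<in> space SP"
  shows "\<bar>step_cost m x\<bar> \<le> rho_max * snd (snd (snd x))"
proof -
  have "\<bar>step_cost m x\<bar> \<le> rho_max * min (snd (snd (snd x))) sbar"
    unfolding step_cost_def
    using assms sbar_pos by (intro run_cost_bound) (auto simp: space_step triple_def)
  also have "\<dots> \<le> rho_max * snd (snd (snd x))"
    by (intro mult_left_mono rho_max_nonneg) simp
  finally show ?thesis .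
qed

abbreviation "LAW \<equiv> law G i0 \<pi>1 \<pi>2"

lemma LAW:
  shows "prob_space LAW" "sets LAW = sets (path_space G)" "measure LAW {\<omega> \<in> space LAW. state_at 0 \<omega> = i0} = 1"
    "cond_actions LAW n" "cond_sojourn LAW n" "cond_state LAW n"
  using is_law_law unfolding is_law_iff by auto

lemma in_hist: "\<omega> \<in> space LAW \<Longrightarrow> history n \<omega> \<in> space (HS n)"
  using measurable_space[OF measurable_at(5)[OF LAW(2)]] by blast

definition next_value :: "('s \<Rightarrow> ennreal) \<Rightarrow> ('s, 'a, 'b) step \<Rightarrow> ennreal" where
  "next_value v x = (\<integral>\<^sup>+j. v j \<partial>next_state_law (triple x))"

lemma measurable_next_value [measurable]: "next_value v \<in> borel_measurable SP"
proof -
  have "(\<lambda>x. \<integral>\<^sup>+j. v j \<partial>next_state_law x) \<in> borel_measurable SAB"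
    by (rule measurable_compose[OF measurable_prob_algebraD[OF measurable_next_state_law] nn_integral_measurable_subprob_algebra]) simp
  from measurable_compose[OF measurable_step_components(2) this] show ?thesis
    unfolding next_value_def[abs_def] .
qed

text \<open>Conditioning on the history before step \<open>n\<close> and then on the step itself. The factor \<open>\<phi>\<close> depends on the
completed steps and can be taken out.\<close>

lemma one_step:
  assumes \<phi> [measurable]: "\<phi> \<in> borel_measurable (\<Pi>\<^sub>M k\<in>{..<n}. SP)" and f [measurable]: "f \<in> borel_measurable SP"
  shows "(\<integral>\<^sup>+\<omega>. \<phi> (restrict \<omega> {..<n}) * (f (\<omega> n) * v (state_at (Suc n) \<omega>)) \<partial>LAW) =
    (\<integral>\<^sup>+\<omega>. \<phi> (restrict \<omega> {..<n}) * step_integral n (\<lambda>y. f (assemble_step y) * next_value v (assemble_step y)) (history n \<omega>) \<partial>LAW)"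
proof -
  note [measurable] = measurable_path[OF LAW(2)] measurable_at[OF LAW(2)]
  have fst_hist: "fst (history n \<omega>) = restrict \<omega> {..<n}" for \<omega> :: "('s, 'a, 'b) path" by (simp add: history_def)
  have next_state_law_meas: "u \<in> borel_measurable (next_state_law x)" for u :: "'s \<Rightarrow> ennreal" and x
    by (simp add: measurable_def)
  define q where "q z = \<phi> (fst (fst (fst z))) * (f (assemble_step ((fst (fst z), fst (snd (fst z)), fst (snd (snd (fst z)))), snd (snd (snd (fst z))))) * v (snd z))" for z
  have "(\<lambda>z. assemble_step ((fst (fst z), fst (snd (fst z)), fst (snd (snd (fst z)))), snd (snd (snd (fst z)))))
      \<in> measurable ((HS n \<Otimes>\<^sub>M A1 \<Otimes>\<^sub>M A2 \<Otimes>\<^sub>M borel) \<Otimes>\<^sub>M count_space UNIV) SP"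
    by (rule measurable_compose[OF _ measurable_assemble_step[of n]]) measurable
  note [measurable] = measurable_compose[OF this f]
  have q: "q \<in> borel_measurable ((HS n \<Otimes>\<^sub>M A1 \<Otimes>\<^sub>M A2 \<Otimes>\<^sub>M borel) \<Otimes>\<^sub>M count_space UNIV)"
    unfolding q_def by measurable
  have q_eq: "q ((history n \<omega>, action1_at n \<omega>, action2_at n \<omega>, sojourn_at n \<omega>), j) = \<phi> (restrict \<omega> {..<n}) * (f (\<omega> n) * v j)"
    if "\<omega> \<in> space LAW" for \<omega> j
    using assemble_step_hist_step[OF LAW(2) that, of n] by (simp add: q_def hist_step_def fst_hist)
  define r where "r y = \<phi> (fst (fst (fst y))) * (f (assemble_step y) * next_value v (assemble_step y))" for y
  have r: "r \<in> borel_measurable ((HS n \<Otimes>\<^sub>M A1 \<Otimes>\<^sub>M A2) \<Otimes>\<^sub>M borel)"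
    unfolding r_def by measurable
  have "(\<integral>\<^sup>+\<omega>. \<phi> (restrict \<omega> {..<n}) * (f (\<omega> n) * v (state_at (Suc n) \<omega>)) \<partial>LAW) =
      (\<integral>\<^sup>+\<omega>. q ((history n \<omega>, action1_at n \<omega>, action2_at n \<omega>, sojourn_at n \<omega>), state_at (Suc n) \<omega>) \<partial>LAW)"
    by (intro nn_integral_cong) (simp only: q_eq)
  also have "\<dots> = (\<integral>\<^sup>+\<omega>. (\<integral>\<^sup>+j. q ((history n \<omega>, action1_at n \<omega>, action2_at n \<omega>, sojourn_at n \<omega>), j)
      \<partial>next_state_law (state_at n \<omega>, action1_at n \<omega>, action2_at n \<omega>)) \<partial>LAW)"
    using LAW(6)[of n, unfolded cond_state_def has_cond_law_def, rule_format, OF q] by (simp add: snd_history)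
  also have "\<dots> = (\<integral>\<^sup>+\<omega>. r (hist_step n \<omega>) \<partial>LAW)"
  proof (rule nn_integral_cong)
    fix \<omega> assume \<omega>: "\<omega> \<in> space LAW"
    have "(\<integral>\<^sup>+j. q ((history n \<omega>, action1_at n \<omega>, action2_at n \<omega>, sojourn_at n \<omega>), j) \<partial>next_state_law (triple (\<omega> n))) =
        \<phi> (restrict \<omega> {..<n}) * (f (\<omega> n) * next_value v (\<omega> n))"
      by (simp add: q_eq[OF \<omega>] nn_integral_cmult[OF next_state_law_meas] next_value_def)
    also have "\<dots> = r (hist_step n \<omega>)"
      unfolding r_def assemble_step_hist_step[OF LAW(2) \<omega>] by (simp add: hist_step_def fst_hist)
    finally show "(\<integral>\<^sup>+j. q ((history n \<omega>, action1_at n \<omega>, action2_at n \<omega>, sojourn_at n \<omega>), j)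
        \<partial>next_state_law (state_at n \<omega>, action1_at n \<omega>, action2_at n \<omega>)) = r (hist_step n \<omega>)"
      by (simp only: path_step(2)[OF LAW(2) \<omega>])
  qed
  also have "\<dots> = (\<integral>\<^sup>+\<omega>. step_integral n r (history n \<omega>) \<partial>LAW)"
    by (rule step_integral_cond[OF LAW(2,4,5) r])
  also have "\<dots> = (\<integral>\<^sup>+\<omega>. \<phi> (restrict \<omega> {..<n}) * step_integral n (\<lambda>y. f (assemble_step y) * next_value v (assemble_step y)) (history n \<omega>) \<partial>LAW)"
  proof (rule nn_integral_cong)
    fix \<omega> assume "\<omega> \<in> space LAW"
    then have h: "history n \<omega> \<in> space (HS n)" by (rule in_hist)
    let ?h = "history n \<omega>"
    have sets: "sets (\<pi>1 n ?h \<Otimes>\<^sub>M \<pi>2 n ?h) = sets (A1 \<Otimes>\<^sub>M A2)"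
      by (intro sets_pair_measure_cong policies_prob[OF h])
    define r' where "r' y = f (assemble_step y) * next_value v (assemble_step y)" for y
    have r': "r' \<in> borel_measurable ((HS n \<Otimes>\<^sub>M A1 \<Otimes>\<^sub>M A2) \<Otimes>\<^sub>M borel)"
      unfolding r'_def by measurable
    have "step_integral n r ?h = (\<integral>\<^sup>+ab. \<phi> (fst ?h) * (\<integral>\<^sup>+s. r' ((?h, ab), s) \<partial>sojourn_kernel (?h, ab)) \<partial>(\<pi>1 n ?h \<Otimes>\<^sub>M \<pi>2 n ?h))"
      unfolding step_integral_def
    proof (rule nn_integral_cong)
      fix ab assume "ab \<in> space (\<pi>1 n ?h \<Otimes>\<^sub>M \<pi>2 n ?h)"
      then have "ab \<in> space (A1 \<Otimes>\<^sub>M A2)" unfolding sets_eq_imp_space_eq[OF sets] .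
      then have x: "(?h, ab) \<in> space (HS n \<Otimes>\<^sub>M A1 \<Otimes>\<^sub>M A2)"
        using h by (simp add: space_pair_measure[of "HS n"])
      have "(\<lambda>s. r' ((?h, ab), s)) \<in> borel_measurable (sojourn_kernel (?h, ab))"
        unfolding sojourn_kernel_def measurable_cong_sets[OF sets_sojourn_law refl]
        by (rule measurable_compose[OF measurable_Pair1'[OF x] r'])
      then show "(\<integral>\<^sup>+s. r ((?h, ab), s) \<partial>sojourn_kernel (?h, ab)) = \<phi> (fst ?h) * (\<integral>\<^sup>+s. r' ((?h, ab), s) \<partial>sojourn_kernel (?h, ab))"
        unfolding r_def r'_def[symmetric] by (simp add: nn_integral_cmult)
    qed
    also have "\<dots> = \<phi> (fst ?h) * step_integral n r' ?h"
      unfolding step_integral_def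
      by (intro nn_integral_cmult)
         (unfold measurable_cong_sets[OF sets refl],
          rule measurable_compose[OF measurable_Pair1'[OF h] measurable_integral_sojourn_kernel[OF r']])
    finally show "step_integral n r ?h = \<phi> (restrict \<omega> {..<n}) * step_integral n (\<lambda>y. f (assemble_step y) * next_value v (assemble_step y)) ?h"
      by (simp add: fst_hist r'_def[abs_def])
  qed
  finally show ?thesis .
qed

lemma step_integral_eval:
  assumes h: "h \<in> space (HS n)" and V: "\<And>j. 0 \<le> V j"
    and f: "\<And>i a b s. (i, a, b) \<in> admissible G \<Longrightarrow> 0 < s \<Longrightarrow> s \<le> sbar \<Longrightarrow> f (i, a, b, s) = ennreal (U i a b s)"
    and U: "\<And>i a b. (i, a, b) \<in> admissible G \<Longrightarrow> continuous_on {0..sbar} (U i a b)" "\<And>i a b s. 0 \<le> U i a b s"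
  shows "step_integral n (\<lambda>y. f (assemble_step y) * next_value (\<lambda>j. ennreal (V j)) (assemble_step y)) h =
    (\<integral>\<^sup>+ab. ennreal ((LINT s:{0..sbar}|sojourn G (snd h) (fst ab) (snd ab). U (snd h) (fst ab) (snd ab) s) *
       (\<Sum>j\<in>UNIV. V j * trans_prob G (snd h) j (fst ab) (snd ab))) \<partial>(\<pi>1 n h \<Otimes>\<^sub>M \<pi>2 n h))"
  unfolding step_integral_def
proof (rule nn_integral_cong_AE)
  show "AE ab in \<pi>1 n h \<Otimes>\<^sub>M \<pi>2 n h.
    (\<integral>\<^sup>+s. f (assemble_step ((h, ab), s)) * next_value (\<lambda>j. ennreal (V j)) (assemble_step ((h, ab), s)) \<partial>sojourn_kernel (h, ab)) =
    ennreal ((LINT s:{0..sbar}|sojourn G (snd h) (fst ab) (snd ab). U (snd h) (fst ab) (snd ab) s) *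
       (\<Sum>j\<in>UNIV. V j * trans_prob G (snd h) j (fst ab) (snd ab)))"
    using AE_actions[OF h]
  proof eventually_elim
    case (elim ab)
    obtain a b where ab: "ab = (a, b)" by (cases ab)
    let ?i = "snd h"
    have adm: "(?i, a, b) \<in> admissible G" using elim by (simp add: ab)
    let ?\<mu> = "sojourn G ?i a b"
    interpret real_distribution ?\<mu> by (rule real_distribution_sojourn[OF adm])
    define c where "c = (\<Sum>j\<in>UNIV. V j * trans_prob G ?i j a b)"
    have c0: "0 \<le> c" unfolding c_def by (intro sum_nonneg mult_nonneg_nonneg V trans_prob_nonneg[OF adm])
    have next_state_law_c: "next_value (\<lambda>j. ennreal (V j)) (?i, a, b, s) = ennreal c" for s
      by (simp add: next_value_def triple_def nn_integral_next_state_law[OF adm] c_def sum_ennreal[symmetric] V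
          trans_prob_nonneg[OF adm] mult_nonneg_nonneg ennreal_mult' mult.commute)
    have int: "set_integrable ?\<mu> {0..sbar} (U ?i a b)"
      by (rule set_integrable_probs_on[OF compact_Icc sojourn_probs_on[OF adm] U(1)[OF adm]])
    have sojourn_law: "sojourn_kernel (h, ab) = ?\<mu>" by (simp add: ab sojourn_kernel_def sojourn_law_admissible[OF adm])
    have "(\<integral>\<^sup>+s. f (assemble_step ((h, ab), s)) * next_value (\<lambda>j. ennreal (V j)) (assemble_step ((h, ab), s)) \<partial>?\<mu>) =
        (\<integral>\<^sup>+s. ennreal (indicator {0..sbar} s *\<^sub>R U ?i a b s) * ennreal c \<partial>?\<mu>)"
    proof (rule nn_integral_cong_AE)
      show "AE s in ?\<mu>. f (assemble_step ((h, ab), s)) * next_value (\<lambda>j. ennreal (V j)) (assemble_step ((h, ab), s)) =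
          ennreal (indicator {0..sbar} s *\<^sub>R U ?i a b s) * ennreal c"
        using AE_sojourn[OF adm]
      proof eventually_elim
        case (elim s)
        then have "assemble_step ((h, ab), s) = (?i, a, b, s)"
          using adm by (simp add: assemble_step_def clip_def triple_def ab)
        then show ?case using elim adm by (simp add: f next_state_law_c)
      qed
    qed
    also have "\<dots> = (\<integral>\<^sup>+s. ennreal (indicator {0..sbar} s *\<^sub>R U ?i a b s) \<partial>?\<mu>) * ennreal c"
      using int unfolding set_integrable_def by (intro nn_integral_multc) simp
    also have "(\<integral>\<^sup>+s. ennreal (indicator {0..sbar} s *\<^sub>R U ?i a b s) \<partial>?\<mu>) = ennreal (LINT s:{0..sbar}|?\<mu>. U ?i a b s)"
      unfolding set_lebesgue_integral_def
      by (rule nn_integral_eq_integral) (use int U(2) in \<open>auto simp: set_integrable_def\<close>)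
    also have "ennreal (LINT s:{0..sbar}|?\<mu>. U ?i a b s) * ennreal c = ennreal ((LINT s:{0..sbar}|?\<mu>. U ?i a b s) * c)"
      using c0 by (simp add: ennreal_mult'')
    finally show ?case unfolding sojourn_law by (simp add: ab c_def)
  qed
qed

definition excess :: "nat \<Rightarrow> real \<Rightarrow> nat \<Rightarrow> ('s, 'a, 'b) path \<Rightarrow> real" where
  "excess m g n \<omega> = (\<Sum>k<n. step_cost m (\<omega> k) - g * snd (snd (snd (\<omega> k))))"

definition stage_value :: "real \<Rightarrow> nat \<Rightarrow> real \<Rightarrow> ('s \<Rightarrow> real) \<Rightarrow> nat \<Rightarrow> ('s, 'a, 'b) hist \<Rightarrow> ennreal" where
  "stage_value \<theta> m g V n h = (\<integral>\<^sup>+ab. ennreal (stage_cost (sojourn_weight \<theta> m) (trans_prob G) (snd h) (g, V) ab)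
     \<partial>(\<pi>1 n h \<Otimes>\<^sub>M \<pi>2 n h))"

lemma jump_time_eq: "jump_time n \<omega> = (\<Sum>k<n. snd (snd (snd (\<omega> k))))"
  by (simp add: jump_time_def sojourn_at_def)

lemma excess_restrict: "excess m g n (restrict \<omega> {..<n}) = excess m g n \<omega>"
  and jump_time_restrict: "jump_time n (restrict \<omega> {..<n}) = jump_time n \<omega>"
  by (simp_all add: excess_def jump_time_eq)

lemma measurable_prefix [measurable]:
  assumes "m \<in> {1, 2}" "n \<le> N"
  shows "excess m g n \<in> borel_measurable (\<Pi>\<^sub>M k\<in>{..<N}. SP)"
    and "jump_time n \<in> borel_measurable (\<Pi>\<^sub>M k\<in>{..<N}. SP)"
proof -
  have comp: "(\<lambda>\<omega>. \<omega> k) \<in> measurable (\<Pi>\<^sub>M k\<in>{..<N}. SP) SP" if "k < n" for k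
    by (rule measurable_component_singleton) (use that assms(2) in auto)
  have 1: "(\<lambda>\<omega>. step_cost m (\<omega> k)) \<in> borel_measurable (\<Pi>\<^sub>M k\<in>{..<N}. SP)" if "k < n" for k
    by (rule measurable_compose[OF comp[OF that] measurable_step_cost[OF assms(1)]])
  have 2: "(\<lambda>\<omega>. snd (snd (snd (\<omega> k)))) \<in> borel_measurable (\<Pi>\<^sub>M k\<in>{..<N}. SP)" if "k < n" for k
    by (rule measurable_compose[OF comp[OF that] measurable_step_components(5)])
  show "excess m g n \<in> borel_measurable (\<Pi>\<^sub>M k\<in>{..<N}. SP)"
    unfolding excess_def[abs_def]
    by (intro borel_measurable_sum borel_measurable_diff borel_measurable_times 1 2) auto
  show "jump_time n \<in> borel_measurable (\<Pi>\<^sub>M k\<in>{..<N}. SP)"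
    unfolding jump_time_eq[abs_def] by (intro borel_measurable_sum 2) auto
qed

text \<open>The basic martingale identity. With \<open>\<psi>\<close> the indicator of times up to \<open>t\<close> it describes the process
stopped at the first jump after \<open>t\<close>.\<close>

lemma weighted_step:
  assumes m: "m \<in> {1, 2}" and V: "\<And>j. 0 \<le> V j" and \<psi> [measurable]: "\<psi> \<in> borel_measurable borel"
  shows "(\<integral>\<^sup>+\<omega>. \<psi> (jump_time n \<omega>) * ennreal (exp (\<theta> * excess m g (Suc n) \<omega>) * V (state_at (Suc n) \<omega>)) \<partial>LAW) =
    (\<integral>\<^sup>+\<omega>. \<psi> (jump_time n \<omega>) * (ennreal (exp (\<theta> * excess m g n \<omega>)) * stage_value \<theta> m g V n (history n \<omega>)) \<partial>LAW)"
proof -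
  define f where "f x = ennreal (exp (\<theta> * (step_cost m x - g * snd (snd (snd x)))))" for x :: "('s, 'a, 'b) step"
  note [measurable] = measurable_step_cost[OF m] measurable_prefix[OF m order_refl]
  have f: "f \<in> borel_measurable SP" unfolding f_def by measurable
  define \<phi> where "\<phi> \<omega> = \<psi> (jump_time n \<omega>) * ennreal (exp (\<theta> * excess m g n \<omega>))" for \<omega> :: "('s, 'a, 'b) path"
  have \<phi>: "\<phi> \<in> borel_measurable (\<Pi>\<^sub>M k\<in>{..<n}. SP)" unfolding \<phi>_def by measurable
  have \<phi>_restrict: "\<phi> (restrict \<omega> {..<n}) = \<phi> \<omega>" for \<omega> by (simp only: \<phi>_def excess_restrict jump_time_restrict)
  have "\<psi> (jump_time n \<omega>) * ennreal (exp (\<theta> * excess m g (Suc n) \<omega>) * V (state_at (Suc n) \<omega>)) =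
      \<phi> (restrict \<omega> {..<n}) * (f (\<omega> n) * ennreal (V (state_at (Suc n) \<omega>)))" for \<omega>
    unfolding \<phi>_restrict using V
    by (simp add: \<phi>_def f_def excess_def distrib_left exp_add ennreal_mult mult.assoc)
  then have "(\<integral>\<^sup>+\<omega>. \<psi> (jump_time n \<omega>) * ennreal (exp (\<theta> * excess m g (Suc n) \<omega>) * V (state_at (Suc n) \<omega>)) \<partial>LAW) =
      (\<integral>\<^sup>+\<omega>. \<phi> (restrict \<omega> {..<n}) * (f (\<omega> n) * (\<lambda>j. ennreal (V j)) (state_at (Suc n) \<omega>)) \<partial>LAW)"
    by simp
  also have "\<dots> = (\<integral>\<^sup>+\<omega>. \<phi> (restrict \<omega> {..<n}) * step_integral n (\<lambda>y. f (assemble_step y) * next_value (\<lambda>j. ennreal (V j)) (assemble_step y)) (history n \<omega>) \<partial>LAW)"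
    by (rule one_step[OF \<phi> f])
  also have "\<dots> = (\<integral>\<^sup>+\<omega>. \<psi> (jump_time n \<omega>) * (ennreal (exp (\<theta> * excess m g n \<omega>)) * stage_value \<theta> m g V n (history n \<omega>)) \<partial>LAW)"
  proof (rule nn_integral_cong)
    fix \<omega> assume "\<omega> \<in> space LAW"
    then have h: "history n \<omega> \<in> space (HS n)" by (rule in_hist)
    have "step_integral n (\<lambda>y. f (assemble_step y) * next_value (\<lambda>j. ennreal (V j)) (assemble_step y)) (history n \<omega>) = stage_value \<theta> m g V n (history n \<omega>)"
      unfolding stage_value_def stage_cost_def sojourn_weight_def fst_conv snd_conv
      by (rule step_integral_eval[OF h V]) (auto simp: f_def step_cost_def min_absorb1 intro!: continuous_weight_integrand[OF m])
    then show "\<phi> (restrict \<omega> {..<n}) * step_integral n (\<lambda>y. f (assemble_step y) * next_value (\<lambda>j. ennreal (V j)) (assemble_step y)) (history n \<omega>) =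
        \<psi> (jump_time n \<omega>) * (ennreal (exp (\<theta> * excess m g n \<omega>)) * stage_value \<theta> m g V n (history n \<omega>))"
      unfolding \<phi>_restrict by (simp add: \<phi>_def mult.assoc)
  qed
  finally show ?thesis .
qed

lemma discount_step:
  assumes \<gamma>: "\<forall>(i, a, b) \<in> admissible G. (LINT s:{0..sbar}|sojourn G i a b. exp (- 1 * s)) \<le> \<gamma>" "0 \<le> \<gamma>"
  shows "(\<integral>\<^sup>+\<omega>. ennreal (exp (- jump_time n \<omega>)) \<partial>LAW) \<le> ennreal (\<gamma> ^ n)"
proof (induction n)
  case 0
  interpret prob_space LAW by (rule LAW)
  show ?case by (simp add: jump_time_def emeasure_space_1)
next
  case (Suc n)
  interpret prob_space LAW by (rule LAW)
  note [measurable] = measurable_path[OF LAW(2)] measurable_prefix(2)[of 1, OF _ order_refl, simplified]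
  define f where "f x = ennreal (exp (- 1 * snd (snd (snd x))))" for x :: "('s, 'a, 'b) step"
  have f: "f \<in> borel_measurable SP" unfolding f_def by measurable
  define \<phi> where "\<phi> \<omega> = ennreal (exp (- jump_time n \<omega>))" for \<omega> :: "('s, 'a, 'b) path"
  have \<phi> [measurable]: "\<phi> \<in> borel_measurable (\<Pi>\<^sub>M k\<in>{..<n}. SP)" unfolding \<phi>_def by measurable
  have \<phi>_restrict: "\<phi> (restrict \<omega> {..<n}) = \<phi> \<omega>" for \<omega> by (simp only: \<phi>_def jump_time_restrict)
  have "ennreal (exp (- jump_time (Suc n) \<omega>)) = \<phi> (restrict \<omega> {..<n}) * (f (\<omega> n) * (\<lambda>j. ennreal 1) (state_at (Suc n) \<omega>))" for \<omega>
    unfolding \<phi>_restrict by (simp add: \<phi>_def f_def jump_time_eq exp_diff exp_minus ennreal_mult[symmetric] field_simps)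
  then have "(\<integral>\<^sup>+\<omega>. ennreal (exp (- jump_time (Suc n) \<omega>)) \<partial>LAW) =
      (\<integral>\<^sup>+\<omega>. \<phi> (restrict \<omega> {..<n}) * (f (\<omega> n) * (\<lambda>j. ennreal 1) (state_at (Suc n) \<omega>)) \<partial>LAW)" by simp
  also have "\<dots> = (\<integral>\<^sup>+\<omega>. \<phi> (restrict \<omega> {..<n}) * step_integral n (\<lambda>y. f (assemble_step y) * next_value (\<lambda>j. ennreal 1) (assemble_step y)) (history n \<omega>) \<partial>LAW)"
    by (rule one_step[OF \<phi> f])
  also have "\<dots> \<le> (\<integral>\<^sup>+\<omega>. \<phi> (restrict \<omega> {..<n}) * ennreal \<gamma> \<partial>LAW)"
  proof (intro nn_integral_mono mult_left_mono)
    fix \<omega> assume "\<omega> \<in> space LAW"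
    then have h: "history n \<omega> \<in> space (HS n)" by (rule in_hist)
    interpret act: prob_space "\<pi>1 n (history n \<omega>) \<Otimes>\<^sub>M \<pi>2 n (history n \<omega>)" by (rule prob_space_actions[OF h])
    have "step_integral n (\<lambda>y. f (assemble_step y) * next_value (\<lambda>j. ennreal 1) (assemble_step y)) (history n \<omega>) =
      (\<integral>\<^sup>+ab. ennreal ((LINT s:{0..sbar}|sojourn G (snd (history n \<omega>)) (fst ab) (snd ab). exp (- 1 * s)) *
       (\<Sum>j\<in>UNIV. 1 * trans_prob G (snd (history n \<omega>)) j (fst ab) (snd ab))) \<partial>(\<pi>1 n (history n \<omega>) \<Otimes>\<^sub>M \<pi>2 n (history n \<omega>)))"
      by (rule step_integral_eval[OF h]) (auto simp: f_def intro!: continuous_intros)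
    also have "\<dots> \<le> (\<integral>\<^sup>+ab. ennreal \<gamma> \<partial>(\<pi>1 n (history n \<omega>) \<Otimes>\<^sub>M \<pi>2 n (history n \<omega>)))"
    proof (rule nn_integral_mono_AE)
      show "AE ab in \<pi>1 n (history n \<omega>) \<Otimes>\<^sub>M \<pi>2 n (history n \<omega>).
        ennreal ((LINT s:{0..sbar}|sojourn G (snd (history n \<omega>)) (fst ab) (snd ab). exp (- 1 * s)) *
       (\<Sum>j\<in>UNIV. 1 * trans_prob G (snd (history n \<omega>)) j (fst ab) (snd ab))) \<le> ennreal \<gamma>"
        using AE_actions[OF h]
      proof eventually_elim
        case (elim ab)
        then have adm: "(snd (history n \<omega>), fst ab, snd ab) \<in> admissible G" by simp
        then show ?case using \<gamma>(1) trans_prob_sum[OF adm] by (auto intro!: ennreal_leI)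
      qed
    qed
    also have "\<dots> = ennreal \<gamma>" by (simp add: act.emeasure_space_1)
    finally show "step_integral n (\<lambda>y. f (assemble_step y) * next_value (\<lambda>j. ennreal 1) (assemble_step y)) (history n \<omega>) \<le> ennreal \<gamma>" .
  qed simp
  also have "\<dots> = (\<integral>\<^sup>+\<omega>. \<phi> (restrict \<omega> {..<n}) \<partial>LAW) * ennreal \<gamma>"
    by (rule nn_integral_multc) measurable
  also have "\<dots> \<le> ennreal (\<gamma> ^ n) * ennreal \<gamma>"
    unfolding \<phi>_restrict using Suc by (intro mult_right_mono) (simp_all add: \<phi>_def)
  also have "\<dots> = ennreal (\<gamma> ^ Suc n)"
    using \<gamma>(2) by (simp add: ennreal_mult[symmetric] mult.commute)
  finally show ?case .
qed

end

section \<open>Growth rate of the exponential cost\<close>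

lemma ext_ln_mono:
  assumes "0 < r" "ennreal r \<le> x"
  shows "ereal (ln r) \<le> ext_ln x"
proof (cases x)
  case (real y)
  then have "r \<le> y" using assms by (simp add: ennreal_le_iff)
  then show ?thesis using real assms(1) by (auto simp: ext_ln_def)
next
  case top
  then show ?thesis by (simp add: ext_ln_def)
qed

lemma ext_ln_mono':
  assumes "0 < r" "x \<le> ennreal r"
  shows "ext_ln x \<le> ereal (ln r)"
proof (cases x)
  case (real y)
  then have "y \<le> r" using assms by (simp add: ennreal_le_iff)
  then show ?thesis using real assms(1) by (auto simp: ext_ln_def)
next
  case top
  then show ?thesis using assms by (simp add: top_unique)
qed

text \<open>Constant factors do not influence the exponential growth rate.\<close>

lemma growth_rate_limit:
  assumes "0 < \<theta>" "0 < a"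
  shows "((\<lambda>t. ereal (1 / (\<theta> * t)) * ereal (ln (exp (\<theta> * g * t) * a))) \<longlongrightarrow> ereal g) at_top"
proof -
  have "((\<lambda>t. g + ln a / \<theta> * inverse t) \<longlongrightarrow> g + ln a / \<theta> * 0) at_top"
    by (intro tendsto_intros tendsto_inverse_0_at_top filterlim_ident)
  then have "((\<lambda>t. ereal (g + ln a / \<theta> * inverse t)) \<longlongrightarrow> ereal g) at_top" by simp
  moreover have "\<forall>\<^sub>F t in at_top. ereal (g + ln a / \<theta> * inverse t) = ereal (1 / (\<theta> * t)) * ereal (ln (exp (\<theta> * g * t) * a))"
    using eventually_gt_at_top[of "0 :: real"]
  proof eventually_elim
    case (elim t)
    then show ?case using assms by (simp add: ln_mult field_simps)
  qed
  ultimately show ?thesis by (rule Lim_transform_eventually)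
qed

context controlled_semi_markov_model begin

lemma step_in_space: "\<omega> \<in> space LAW \<Longrightarrow> \<omega> n \<in> space SP"
  by (rule space_path[OF LAW(2)])

lemma jump_time_Suc: "jump_time (Suc n) \<omega> = jump_time n \<omega> + sojourn_at n \<omega>"
  by (simp add: jump_time_def)

lemma jump_time_strict: "\<omega> \<in> space LAW \<Longrightarrow> jump_time n \<omega> < jump_time (Suc n) \<omega>"
  using path_step(3)[OF LAW(2)] by (simp add: jump_time_Suc)

lemma jump_time_mono: "\<omega> \<in> space LAW \<Longrightarrow> n \<le> k \<Longrightarrow> jump_time n \<omega> \<le> jump_time k \<omega>"
  by (rule lift_Suc_mono_le[of "\<lambda>n. jump_time n \<omega>", OF less_imp_le[OF jump_time_strict]])

lemma excess_bound:
  assumes m: "m \<in> {1, 2}" and \<omega>: "\<omega> \<in> space LAW"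
  shows "\<bar>excess m g n \<omega>\<bar> \<le> (rho_max + \<bar>g\<bar>) * jump_time n \<omega>"
proof -
  have "\<bar>excess m g n \<omega>\<bar> \<le> (\<Sum>k<n. \<bar>step_cost m (\<omega> k) - g * snd (snd (snd (\<omega> k)))\<bar>)"
    unfolding excess_def by (rule sum_abs)
  also have "\<dots> \<le> (\<Sum>k<n. (rho_max + \<bar>g\<bar>) * snd (snd (snd (\<omega> k))))"
  proof (rule sum_mono)
    fix k
    have pos: "0 < snd (snd (snd (\<omega> k)))" using step_in_space[OF \<omega>, of k] by (simp add: space_step)
    have "\<bar>step_cost m (\<omega> k) - g * snd (snd (snd (\<omega> k)))\<bar> \<le> \<bar>step_cost m (\<omega> k)\<bar> + \<bar>g * snd (snd (snd (\<omega> k)))\<bar>"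
      by (rule abs_triangle_ineq4)
    also have "\<dots> \<le> rho_max * snd (snd (snd (\<omega> k))) + \<bar>g\<bar> * snd (snd (snd (\<omega> k)))"
      using pos by (intro add_mono step_cost_bound[OF m step_in_space[OF \<omega>]]) (simp add: abs_mult)
    finally show "\<bar>step_cost m (\<omega> k) - g * snd (snd (snd (\<omega> k)))\<bar> \<le> (rho_max + \<bar>g\<bar>) * snd (snd (snd (\<omega> k)))"
      by (simp add: algebra_simps)
  qed
  also have "\<dots> = (rho_max + \<bar>g\<bar>) * jump_time n \<omega>"
    by (simp add: jump_time_eq sum_distrib_left)
  finally show ?thesis .
qed

lemma measurable_LAW [measurable]:
  shows "m \<in> {1, 2} \<Longrightarrow> excess m g n \<in> borel_measurable LAW"
    and "jump_time n \<in> borel_measurable LAW" "state_at n \<in> measurable LAW (count_space UNIV)"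
    "sojourn_at n \<in> borel_measurable LAW"
proof -
  have "(\<lambda>\<omega>. jump_time n (restrict \<omega> {..<n})) \<in> borel_measurable LAW"
    by (rule measurable_compose[OF measurable_path(1)[OF LAW(2)] measurable_prefix(2)[of 1]]) auto
  then show "jump_time n \<in> borel_measurable LAW" unfolding jump_time_restrict .
  show "excess m g n \<in> borel_measurable LAW" if "m \<in> {1, 2}"
  proof -
    have "(\<lambda>\<omega>. excess m g n (restrict \<omega> {..<n})) \<in> borel_measurable LAW"
      by (rule measurable_compose[OF measurable_path(1)[OF LAW(2)] measurable_prefix(1)[OF that]]) auto
    then show ?thesis unfolding excess_restrict .
  qed
qed (rule measurable_at[OF LAW(2)])+

lemma AE_sojourn_le: "AE \<omega> in LAW. \<forall>n. sojourn_at n \<omega> \<le> sbar"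
  unfolding AE_all_countable
proof
  fix n
  define f where "f y = (indicator {sbar<..} (snd y) :: ennreal)" for y :: "(('s, 'a, 'b) hist \<times> 'a \<times> 'b) \<times> real"
  have f: "f \<in> borel_measurable ((HS n \<Otimes>\<^sub>M A1 \<Otimes>\<^sub>M A2) \<Otimes>\<^sub>M borel)" unfolding f_def by measurable
  have "(\<integral>\<^sup>+\<omega>. f (hist_step n \<omega>) \<partial>LAW) = (\<integral>\<^sup>+\<omega>. step_integral n f (history n \<omega>) \<partial>LAW)"
    by (rule step_integral_cond[OF LAW(2,4,5) f])
  also have "\<dots> = (\<integral>\<^sup>+\<omega>. 0 \<partial>LAW)"
  proof (rule nn_integral_cong)
    fix \<omega> assume "\<omega> \<in> space LAW"
    then have h: "history n \<omega> \<in> space (HS n)" by (rule in_hist)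
    have "step_integral n f (history n \<omega>) = step_integral n (\<lambda>_. 0) (history n \<omega>)"
      by (rule step_integral_cong[OF h]) (simp add: f_def)
    then show "step_integral n f (history n \<omega>) = 0" by (simp add: step_integral_def)
  qed
  finally have "(\<integral>\<^sup>+\<omega>. indicator {sbar<..} (sojourn_at n \<omega>) \<partial>LAW) = (0 :: ennreal)"
    by (simp add: f_def hist_step_def)
  then have "AE \<omega> in LAW. indicator {sbar<..} (sojourn_at n \<omega>) = (0 :: ennreal)"
    by (subst (asm) nn_integral_0_iff_AE) measurable
  then show "AE \<omega> in LAW. sojourn_at n \<omega> \<le> sbar"
    by eventually_elim (simp add: indicator_def not_less split: if_splits)
qed

definition discount_bound :: real where
  "discount_bound = (SOME \<gamma>. 0 \<le> \<gamma> \<and> \<gamma> < 1 \<and> (\<forall>(i, a, b) \<in> admissible G. (LINT s:{0..sbar}|sojourn G i a b. exp (- 1 * s)) \<le> \<gamma>))"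

lemma discount_bound: "0 \<le> discount_bound" "discount_bound < 1" "\<forall>(i, a, b) \<in> admissible G. (LINT s:{0..sbar}|sojourn G i a b. exp (- 1 * s)) \<le> discount_bound"
  using someI_ex[OF sojourn_discount_less_1[of 1]] unfolding discount_bound_def[symmetric] by simp_all

text \<open>Markov's inequality for \<open>exp (- T\<^sub>n)\<close>.\<close>

lemma jump_time_le_prob: "(\<integral>\<^sup>+\<omega>. indicator {..t} (jump_time n \<omega>) \<partial>LAW) \<le> ennreal (exp t * discount_bound ^ n)"
proof -
  have "(\<integral>\<^sup>+\<omega>. indicator {..t} (jump_time n \<omega>) \<partial>LAW) \<le> (\<integral>\<^sup>+\<omega>. ennreal (exp t) * ennreal (exp (- jump_time n \<omega>)) \<partial>LAW)"
  proof (rule nn_integral_mono)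
    fix \<omega>
    show "indicator {..t} (jump_time n \<omega>) \<le> ennreal (exp t) * ennreal (exp (- jump_time n \<omega>))"
    proof (cases "jump_time n \<omega> \<le> t")
      case True
      then have "1 \<le> exp (t - jump_time n \<omega>)" by simp
      then have "ennreal 1 \<le> ennreal (exp (t - jump_time n \<omega>))" by (rule ennreal_leI)
      then show ?thesis using True by (simp add: ennreal_mult[symmetric] exp_add[symmetric])
    qed simp
  qed
  also have "\<dots> = ennreal (exp t) * (\<integral>\<^sup>+\<omega>. ennreal (exp (- jump_time n \<omega>)) \<partial>LAW)"
    by (rule nn_integral_cmult) measurable
  also have "\<dots> \<le> ennreal (exp t) * ennreal (discount_bound ^ n)"
    by (intro mult_left_mono discount_step discount_bound) simp
  finally show ?thesis using discount_bound(1) by (simp add: ennreal_mult)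
qed

lemma discount_bound_power_small: "0 < e \<Longrightarrow> \<exists>n. K * discount_bound ^ n < e"
proof -
  assume "0 < e"
  have "(\<lambda>n. K * discount_bound ^ n) \<longlonglongrightarrow> K * 0"
    by (intro tendsto_mult tendsto_const LIMSEQ_realpow_zero discount_bound)
  then have "\<forall>\<^sub>F n in sequentially. K * discount_bound ^ n < e"
    using \<open>0 < e\<close> by (intro order_tendstoD(2)) simp_all
  then show ?thesis by (rule eventually_happens'[rotated]) simp
qed

lemma AE_jump_time_unbounded: "AE \<omega> in LAW. \<forall>k :: nat. \<exists>n. real k < jump_time n \<omega>"
  unfolding AE_all_countable
proof
  fix k :: nat
  let ?B = "{\<omega> \<in> space LAW. \<forall>n. jump_time n \<omega> \<le> real k}"
  have B [measurable]: "?B \<in> sets LAW" by measurable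
  have small: "emeasure LAW ?B \<le> ennreal e" if e: "0 < e" for e
  proof -
    obtain n where n: "exp (real k) * discount_bound ^ n < e" using discount_bound_power_small[OF e, of "exp (real k)"] by (elim exE)
    have "emeasure LAW ?B = (\<integral>\<^sup>+\<omega>. indicator ?B \<omega> \<partial>LAW)" by simp
    also have "\<dots> \<le> (\<integral>\<^sup>+\<omega>. indicator {..real k} (jump_time n \<omega>) \<partial>LAW)"
      by (intro nn_integral_mono) (auto split: split_indicator)
    also have "\<dots> \<le> ennreal e"
      by (rule order.trans[OF jump_time_le_prob[of "real k" n] ennreal_leI[OF less_imp_le[OF n]]])
    finally show ?thesis .
  qed
  have "emeasure LAW ?B \<le> 0"
  proof (rule ennreal_le_epsilon)
    fix e :: real assume "0 < e"
    from small[OF this] show "emeasure LAW ?B \<le> 0 + ennreal e" by simp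
  qed
  then have "?B \<in> null_sets LAW" using B by (intro null_setsI) simp_all
  then have "AE \<omega> in LAW. \<omega> \<notin> ?B" by (rule AE_not_in)
  then show "AE \<omega> in LAW. \<exists>n. real k < jump_time n \<omega>"
    using AE_space by eventually_elim (auto simp: not_le)
qed

text \<open>The process that is a martingale when \<open>V\<close> solves the optimality equation.\<close>

definition weight :: "real \<Rightarrow> nat \<Rightarrow> real \<Rightarrow> ('s \<Rightarrow> real) \<Rightarrow> nat \<Rightarrow> ('s, 'a, 'b) path \<Rightarrow> ennreal" where
  "weight \<theta> m g V n \<omega> = ennreal (exp (\<theta> * excess m g n \<omega>) * V (state_at n \<omega>))"

text \<open>The weight at jump \<open>n + 1\<close>, on the event that this is the first jump after time \<open>t\<close>.\<close>

definition crossing :: "real \<Rightarrow> nat \<Rightarrow> real \<Rightarrow> ('s \<Rightarrow> real) \<Rightarrow> real \<Rightarrow> nat \<Rightarrow> ('s, 'a, 'b) path \<Rightarrow> ennreal" where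
  "crossing \<theta> m g V t n \<omega> = indicator {..t} (jump_time n \<omega>) * (indicator {t<..} (jump_time (Suc n) \<omega>) * weight \<theta> m g V (Suc n) \<omega>)"

lemma measurable_weight:
  assumes "m \<in> {1, 2}"
  shows "weight \<theta> m g V n \<in> borel_measurable LAW" "crossing \<theta> m g V t n \<in> borel_measurable LAW"
proof -
  note [measurable] = measurable_LAW(1)[OF assms] measurable_LAW(2-)
  have V: "(\<lambda>\<omega>. V (state_at k \<omega>)) \<in> borel_measurable LAW" for k
    by (rule measurable_compose[OF measurable_LAW(3)]) simp
  note [measurable] = V
  have [measurable]: "weight \<theta> m g V k \<in> borel_measurable LAW" for k
    unfolding weight_def[abs_def] by measurable
  show "weight \<theta> m g V n \<in> borel_measurable LAW" by measurable
  show "crossing \<theta> m g V t n \<in> borel_measurable LAW"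
    unfolding crossing_def[abs_def] by measurable
qed

definition stopped_value :: "real \<Rightarrow> nat \<Rightarrow> real \<Rightarrow> ('s \<Rightarrow> real) \<Rightarrow> real \<Rightarrow> nat \<Rightarrow> ennreal" where
  "stopped_value \<theta> m g V t n = (\<integral>\<^sup>+\<omega>. indicator {..t} (jump_time n \<omega>) * weight \<theta> m g V n \<omega> \<partial>LAW)"

text \<open>What has not been stopped before step \<open>n\<close> is either stopped by it or carried on.\<close>

lemma stopped_step:
  assumes m: "m \<in> {1, 2}" and V: "\<And>j. 0 \<le> V j"
  shows "(\<integral>\<^sup>+\<omega>. indicator {..t} (jump_time n \<omega>) * (ennreal (exp (\<theta> * excess m g n \<omega>)) * stage_value \<theta> m g V n (history n \<omega>)) \<partial>LAW) =
    stopped_value \<theta> m g V t (Suc n) + (\<integral>\<^sup>+\<omega>. crossing \<theta> m g V t n \<omega> \<partial>LAW)"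
proof -
  note [measurable] = measurable_weight[OF m] measurable_LAW(2)
  have "(\<integral>\<^sup>+\<omega>. indicator {..t} (jump_time n \<omega>) * (ennreal (exp (\<theta> * excess m g n \<omega>)) * stage_value \<theta> m g V n (history n \<omega>)) \<partial>LAW) =
      (\<integral>\<^sup>+\<omega>. indicator {..t} (jump_time n \<omega>) * weight \<theta> m g V (Suc n) \<omega> \<partial>LAW)"
    unfolding weight_def by (rule weighted_step[OF m V, symmetric]) simp
  also have "\<dots> = (\<integral>\<^sup>+\<omega>. indicator {..t} (jump_time (Suc n) \<omega>) * weight \<theta> m g V (Suc n) \<omega> + crossing \<theta> m g V t n \<omega> \<partial>LAW)"
  proof (rule nn_integral_cong)
    fix \<omega> assume "\<omega> \<in> space LAW"
    from jump_time_strict[OF this, of n]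
    show "indicator {..t} (jump_time n \<omega>) * weight \<theta> m g V (Suc n) \<omega> =
        indicator {..t} (jump_time (Suc n) \<omega>) * weight \<theta> m g V (Suc n) \<omega> + crossing \<theta> m g V t n \<omega>"
      by (auto simp: crossing_def split: split_indicator)
  qed
  also have "\<dots> = stopped_value \<theta> m g V t (Suc n) + (\<integral>\<^sup>+\<omega>. crossing \<theta> m g V t n \<omega> \<partial>LAW)"
    unfolding stopped_value_def by (rule nn_integral_add) measurable
  finally show ?thesis .
qed

lemma stopped_value_alt:
  assumes "\<And>j. 0 \<le> V j"
  shows "stopped_value \<theta> m g V t n = (\<integral>\<^sup>+\<omega>. indicator {..t} (jump_time n \<omega>) * (ennreal (exp (\<theta> * excess m g n \<omega>)) * ennreal (V (snd (history n \<omega>)))) \<partial>LAW)"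
  unfolding stopped_value_def weight_def using assms by (simp add: snd_history ennreal_mult)

lemma stopped_value_0:
  assumes "0 \<le> t"
  shows "stopped_value \<theta> m g V t 0 = ennreal (V i0)"
proof -
  interpret prob_space LAW by (rule LAW)
  have "AE \<omega> in LAW. state_at 0 \<omega> = i0" using AE_prob_1[OF LAW(3)] by eventually_elim simp
  then have "stopped_value \<theta> m g V t 0 = (\<integral>\<^sup>+\<omega>. ennreal (V i0) \<partial>LAW)"
    unfolding stopped_value_def
    by (intro nn_integral_cong_AE, eventually_elim) (use assms in \<open>simp add: weight_def excess_def jump_time_def\<close>)
  then show ?thesis by (simp add: emeasure_space_1)
qed

text \<open>Before time \<open>t\<close> the weight is bounded, and the probability of \<open>n\<close> jumps up to \<open>t\<close> tends to 0.\<close>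

lemma stopped_value_small:
  assumes "0 < \<theta>" and m: "m \<in> {1, 2}" and V: "\<And>j. 0 \<le> V j" "\<And>j. V j \<le> v" and t: "0 \<le> t"
  shows "stopped_value \<theta> m g V t n \<le> ennreal ((exp (\<theta> * ((rho_max + \<bar>g\<bar>) * t)) * v) * exp t * discount_bound ^ n)"
proof -
  have v0: "0 \<le> v" using V order.trans by blast
  have "stopped_value \<theta> m g V t n \<le> (\<integral>\<^sup>+\<omega>. ennreal (exp (\<theta> * ((rho_max + \<bar>g\<bar>) * t)) * v) * indicator {..t} (jump_time n \<omega>) \<partial>LAW)"
    unfolding stopped_value_def
  proof (rule nn_integral_mono)
    fix \<omega> assume \<omega>: "\<omega> \<in> space LAW"
    show "indicator {..t} (jump_time n \<omega>) * weight \<theta> m g V n \<omega> \<le> ennreal (exp (\<theta> * ((rho_max + \<bar>g\<bar>) * t)) * v) * indicator {..t} (jump_time n \<omega>)"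
    proof (cases "jump_time n \<omega> \<le> t")
      case True
      have "excess m g n \<omega> \<le> (rho_max + \<bar>g\<bar>) * jump_time n \<omega>" using excess_bound[OF m \<omega>, of g n] by simp
      also have "\<dots> \<le> (rho_max + \<bar>g\<bar>) * t" using True rho_max_nonneg by (intro mult_left_mono) auto
      finally have "exp (\<theta> * excess m g n \<omega>) \<le> exp (\<theta> * ((rho_max + \<bar>g\<bar>) * t))" using \<open>0 < \<theta>\<close> by simp
      then have "exp (\<theta> * excess m g n \<omega>) * V (state_at n \<omega>) \<le> exp (\<theta> * ((rho_max + \<bar>g\<bar>) * t)) * v"
        by (intro mult_mono V) auto
      then show ?thesis using True by (simp add: weight_def ennreal_leI)
    qed simp
  qed
  also have "\<dots> = ennreal (exp (\<theta> * ((rho_max + \<bar>g\<bar>) * t)) * v) * (\<integral>\<^sup>+\<omega>. indicator {..t} (jump_time n \<omega>) \<partial>LAW)"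
    by (rule nn_integral_cmult) measurable
  also have "\<dots> \<le> ennreal (exp (\<theta> * ((rho_max + \<bar>g\<bar>) * t)) * v) * ennreal (exp t * discount_bound ^ n)"
    by (intro mult_left_mono jump_time_le_prob) simp
  also have "\<dots> = ennreal ((exp (\<theta> * ((rho_max + \<bar>g\<bar>) * t)) * v) * exp t * discount_bound ^ n)"
    using v0 discount_bound(1) by (simp add: ennreal_mult[symmetric] mult.assoc)
  finally show ?thesis .
qed

text \<open>Optional stopping for a submartingale, by telescoping: the mass not yet stopped vanishes in the limit.\<close>

lemma crossing_ge:
  assumes "0 < \<theta>" and m: "m \<in> {1, 2}" and V: "\<And>j. 0 \<le> V j" and t: "0 \<le> t"
    and sub: "\<And>n h. h \<in> space (HS n) \<Longrightarrow> ennreal (V (snd h)) \<le> stage_value \<theta> m g V n h"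
  shows "ennreal (V i0) \<le> (\<integral>\<^sup>+\<omega>. (\<Sum>n. crossing \<theta> m g V t n \<omega>) \<partial>LAW)"
proof -
  let ?d = "\<lambda>n. \<integral>\<^sup>+\<omega>. crossing \<theta> m g V t n \<omega> \<partial>LAW"
  have step: "stopped_value \<theta> m g V t n \<le> stopped_value \<theta> m g V t (Suc n) + ?d n" for n
    unfolding stopped_step[OF m V, symmetric] stopped_value_alt[of V, OF V, of \<theta> m g t n]
    by (intro nn_integral_mono mult_left_mono sub in_hist) auto
  have sums: "stopped_value \<theta> m g V t 0 \<le> stopped_value \<theta> m g V t n + (\<Sum>k<n. ?d k)" for n
  proof (induction n)
    case (Suc n)
    have "stopped_value \<theta> m g V t n + (\<Sum>k<n. ?d k) \<le> (stopped_value \<theta> m g V t (Suc n) + ?d n) + (\<Sum>k<n. ?d k)"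
      by (intro add_right_mono step)
    from order.trans[OF Suc this] show ?case by (simp add: ac_simps)
  qed simp
  have total: "(\<integral>\<^sup>+\<omega>. (\<Sum>n. crossing \<theta> m g V t n \<omega>) \<partial>LAW) = (\<Sum>n. ?d n)"
    by (rule nn_integral_suminf) (rule measurable_weight[OF m])
  define v where "v = Max (range V)"
  have v: "V j \<le> v" for j unfolding v_def by (intro Max_ge) simp_all
  show ?thesis
    unfolding total
  proof (rule ennreal_le_epsilon)
    fix e :: real assume "0 < e"
    then obtain n where n: "(exp (\<theta> * ((rho_max + \<bar>g\<bar>) * t)) * v) * exp t * discount_bound ^ n < e"
      using discount_bound_power_small[of e "(exp (\<theta> * ((rho_max + \<bar>g\<bar>) * t)) * v) * exp t"] by auto
    have "ennreal (V i0) \<le> stopped_value \<theta> m g V t n + (\<Sum>k<n. ?d k)"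
      using sums[of n] by (simp add: stopped_value_0[OF t])
    also have "\<dots> \<le> ennreal e + (\<Sum>n. ?d n)"
      by (intro add_mono sum_le_suminf order.trans[OF stopped_value_small[where V=V and g=g and n=n, OF \<open>0 < \<theta>\<close> m V v t] ennreal_leI[OF less_imp_le[OF n]]]) auto
    finally show "ennreal (V i0) \<le> (\<Sum>n. ?d n) + ennreal e" by (simp add: add.commute)
  qed
qed

text \<open>Optional stopping for a nonnegative supermartingale; the mass not yet stopped is just dropped.\<close>

lemma crossing_le:
  assumes m: "m \<in> {1, 2}" and V: "\<And>j. 0 \<le> V j" and t: "0 \<le> t"
    and super: "\<And>n h. h \<in> space (HS n) \<Longrightarrow> stage_value \<theta> m g V n h \<le> ennreal (V (snd h))"
  shows "(\<integral>\<^sup>+\<omega>. (\<Sum>n. crossing \<theta> m g V t n \<omega>) \<partial>LAW) \<le> ennreal (V i0)"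
proof -
  let ?d = "\<lambda>n. \<integral>\<^sup>+\<omega>. crossing \<theta> m g V t n \<omega> \<partial>LAW"
  have step: "stopped_value \<theta> m g V t (Suc n) + ?d n \<le> stopped_value \<theta> m g V t n" for n
    unfolding stopped_step[OF m V, symmetric] stopped_value_alt[of V, OF V, of \<theta> m g t n]
    by (intro nn_integral_mono mult_left_mono super in_hist) auto
  have sums: "stopped_value \<theta> m g V t n + (\<Sum>k<n. ?d k) \<le> stopped_value \<theta> m g V t 0" for n
  proof (induction n)
    case (Suc n)
    have "(stopped_value \<theta> m g V t (Suc n) + ?d n) + (\<Sum>k<n. ?d k) \<le> stopped_value \<theta> m g V t n + (\<Sum>k<n. ?d k)"
      by (intro add_right_mono step)
    from order.trans[OF this Suc] show ?case by (simp add: ac_simps)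
  qed simp
  have total: "(\<integral>\<^sup>+\<omega>. (\<Sum>n. crossing \<theta> m g V t n \<omega>) \<partial>LAW) = (\<Sum>n. ?d n)"
    by (rule nn_integral_suminf) (rule measurable_weight[OF m])
  have "(\<Sum>k<n. ?d k) \<le> ennreal (V i0)" for n
  proof -
    have "(\<Sum>k<n. ?d k) \<le> stopped_value \<theta> m g V t n + (\<Sum>k<n. ?d k)" by (rule add_increasing) simp_all
    also have "\<dots> \<le> ennreal (V i0)" using sums[of n] by (simp only: stopped_value_0[OF t])
    finally show ?thesis .
  qed
  then have "(\<Sum>n. ?d n) \<le> ennreal (V i0)" unfolding suminf_eq_SUP by (intro SUP_least)
  then show ?thesis unfolding total .
qed

text \<open>Almost surely exactly one jump \<open>N + 1\<close> crosses \<open>t\<close>, with \<open>N\<close> the jump count at \<open>t\<close>. The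
interval from \<open>T\<^sub>N\<close> to \<open>T\<^sub>N\<^sub>+\<^sub>1\<close> contains \<open>t\<close> and has length at most \<open>sbar\<close>, so its two parts contribute
boundedly to the difference of the excess at the crossing and the excess at \<open>t\<close>.\<close>

lemma weight_at_crossing:
  assumes "0 < \<theta>" and m: "m \<in> {1, 2}" and V: "\<And>j. 0 \<le> V j" and t: "0 \<le> t"
  shows "AE \<omega> in LAW. \<exists>y j. (\<Sum>n. crossing \<theta> m g V t n \<omega>) = ennreal (exp (\<theta> * y) * V j) \<and>
    \<bar>y - (total_cost G m t \<omega> - g * t)\<bar> \<le> (2 * rho_max + \<bar>g\<bar>) * sbar"
  using AE_sojourn_le AE_jump_time_unbounded AE_space
proof eventually_elim
  case (elim \<omega>)
  have \<omega>: "\<omega> \<in> space LAW" by fact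
  obtain k :: nat where "t \<le> real k" using real_arch_simple by blast
  then have ex: "\<exists>n. t < jump_time n \<omega>" using elim(2) by (meson le_less_trans)
  define M where "M = (LEAST n. t < jump_time n \<omega>)"
  have M: "t < jump_time M \<omega>" unfolding M_def using ex by (rule LeastI_ex)
  have "M \<noteq> 0" using M t by (intro notI) (simp add: jump_time_def)
  then obtain N where N: "M = Suc N" by (cases M) auto
  have N_le: "jump_time N \<omega> \<le> t"
    using not_less_Least[of N "\<lambda>n. t < jump_time n \<omega>"] N by (simp add: M_def not_less)
  have jc: "jump_count t \<omega> = N"
    unfolding jump_count_def
  proof (rule cSup_eq_maximum)
    show "N \<in> {n. jump_time n \<omega> \<le> t}" using N_le by simp
    fix n assume "n \<in> {n. jump_time n \<omega> \<le> t}"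
    then show "n \<le> N"
      using M jump_time_mono[OF \<omega>, of M n] N by (cases "M \<le> n") auto
  qed
  have "crossing \<theta> m g V t n \<omega> = 0" if "n \<noteq> N" for n
  proof (cases "n < N")
    case True
    then have "jump_time (Suc n) \<omega> \<le> t" using jump_time_mono[OF \<omega>, of "Suc n" N] N_le by simp
    then show ?thesis by (simp add: crossing_def)
  next
    case False
    with that have "M \<le> n" using N by simp
    then have "t < jump_time n \<omega>" using jump_time_mono[OF \<omega>, of M n] M by simp
    then show ?thesis by (simp add: crossing_def)
  qed
  then have "(\<Sum>n. crossing \<theta> m g V t n \<omega>) = (\<Sum>n\<in>{N}. crossing \<theta> m g V t n \<omega>)"
    by (intro suminf_finite) auto
  also have "\<dots> = weight \<theta> m g V (Suc N) \<omega>"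
    using N_le M N by (simp add: crossing_def)
  finally have sum_eq: "(\<Sum>n. crossing \<theta> m g V t n \<omega>) = ennreal (exp (\<theta> * excess m g (Suc N) \<omega>) * V (state_at (Suc N) \<omega>))"
    by (simp add: weight_def)
  have adm: "(state_at k \<omega>, action1_at k \<omega>, action2_at k \<omega>) \<in> admissible G" for k
    using path_step(1,2)[OF LAW(2) \<omega>, of k] by simp
  have rc: "step_cost m (\<omega> k) = run_cost G m (state_at k \<omega>) (action1_at k \<omega>) (action2_at k \<omega>) (sojourn_at k \<omega>)" for k
    using elim(1) by (simp add: step_cost_def state_at_def action1_at_def action2_at_def sojourn_at_def min_absorb1)
  let ?R = "run_cost G m (state_at N \<omega>) (action1_at N \<omega>) (action2_at N \<omega>)"
  have ex_eq: "excess m g (Suc N) \<omega> = (\<Sum>k<N. step_cost m (\<omega> k)) + ?R (sojourn_at N \<omega>) - g * jump_time (Suc N) \<omega>"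
    by (simp add: excess_def sum_subtractf jump_time_eq sum_distrib_left rc[symmetric] algebra_simps)
  have tc: "total_cost G m t \<omega> = (\<Sum>k<N. step_cost m (\<omega> k)) + ?R (t - jump_time N \<omega>)"
    by (simp add: total_cost_def jc rc)
  have s: "0 < sojourn_at N \<omega>" "sojourn_at N \<omega> \<le> sbar" using path_step(3)[OF LAW(2) \<omega>] elim(1) by auto
  have lt: "t < jump_time N \<omega> + sojourn_at N \<omega>" using M N by (simp add: jump_time_Suc)
  have b1: "\<bar>?R (sojourn_at N \<omega>)\<bar> \<le> rho_max * sbar"
    using run_cost_bound[OF m adm[of N], of "sojourn_at N \<omega>"] s mult_left_mono[OF s(2) rho_max_nonneg] by simp
  have b2: "\<bar>?R (t - jump_time N \<omega>)\<bar> \<le> rho_max * sbar"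
    using run_cost_bound[OF m adm[of N], of "t - jump_time N \<omega>"] s lt N_le
      mult_left_mono[of "t - jump_time N \<omega>" sbar, OF _ rho_max_nonneg] by simp
  have b3: "\<bar>g * jump_time (Suc N) \<omega> - g * t\<bar> \<le> \<bar>g\<bar> * sbar"
  proof -
    have "\<bar>g * jump_time (Suc N) \<omega> - g * t\<bar> = \<bar>g\<bar> * \<bar>jump_time (Suc N) \<omega> - t\<bar>"
      by (simp add: right_diff_distrib[symmetric] abs_mult)
    also have "\<dots> \<le> \<bar>g\<bar> * sbar" using s lt N_le by (intro mult_left_mono) (auto simp: jump_time_Suc)
    finally show ?thesis .
  qed
  have "\<bar>excess m g (Suc N) \<omega> - (total_cost G m t \<omega> - g * t)\<bar> \<le> (2 * rho_max + \<bar>g\<bar>) * sbar"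
    unfolding ex_eq tc using b1 b2 b3 by (simp add: algebra_simps abs_le_iff)
  with sum_eq show ?case by blast
qed

lemma growth_lower_bound:
  assumes "0 < \<theta>" and m: "m \<in> {1, 2}" and V: "\<And>j. 0 \<le> V j" "\<And>j. V j \<le> v" "0 < v" and t: "0 \<le> t"
    and sub: "\<And>n h. h \<in> space (HS n) \<Longrightarrow> ennreal (V (snd h)) \<le> stage_value \<theta> m g V n h"
  shows "ennreal (exp (\<theta> * g * t) * (V i0 / (exp (\<theta> * ((2 * rho_max + \<bar>g\<bar>) * sbar)) * v))) \<le>
    (\<integral>\<^sup>+\<omega>. ennreal (exp (\<theta> * total_cost G m t \<omega>)) \<partial>LAW)"
proof -
  let ?b = "(2 * rho_max + \<bar>g\<bar>) * sbar"
  define c where "c = exp (\<theta> * g * t) / (exp (\<theta> * ?b) * v)"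
  have c: "0 \<le> c" using V(3) by (simp add: c_def)
  have [measurable]: "(\<lambda>\<omega>. \<Sum>n. crossing \<theta> m g V t n \<omega>) \<in> borel_measurable LAW"
    using measurable_weight(2)[OF m] by (intro borel_measurable_suminf_order)
  have "ennreal (exp (\<theta> * g * t) * (V i0 / (exp (\<theta> * ?b) * v))) = ennreal c * ennreal (V i0)"
    using c V(1) by (simp add: ennreal_mult[symmetric] c_def)
  also have "\<dots> \<le> ennreal c * (\<integral>\<^sup>+\<omega>. (\<Sum>n. crossing \<theta> m g V t n \<omega>) \<partial>LAW)"
    by (intro mult_left_mono crossing_ge[OF assms(1) m V(1) t sub]) auto
  also have "\<dots> = (\<integral>\<^sup>+\<omega>. ennreal c * (\<Sum>n. crossing \<theta> m g V t n \<omega>) \<partial>LAW)"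
    by (rule nn_integral_cmult[symmetric]) measurable
  also have "\<dots> \<le> (\<integral>\<^sup>+\<omega>. ennreal (exp (\<theta> * total_cost G m t \<omega>)) \<partial>LAW)"
  proof (rule nn_integral_mono_AE)
    show "AE \<omega> in LAW. ennreal c * (\<Sum>n. crossing \<theta> m g V t n \<omega>) \<le> ennreal (exp (\<theta> * total_cost G m t \<omega>))"
      using weight_at_crossing[where V=V and g=g, OF assms(1) m V(1) t]
    proof eventually_elim
      case (elim \<omega>)
      then obtain y j where y: "(\<Sum>n. crossing \<theta> m g V t n \<omega>) = ennreal (exp (\<theta> * y) * V j)"
        "\<bar>y - (total_cost G m t \<omega> - g * t)\<bar> \<le> ?b" by blast
      from y(2) have "y \<le> total_cost G m t \<omega> - g * t + ?b" by (simp add: abs_le_iff)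
      from mult_left_mono[OF this, of \<theta>] assms(1)
      have "\<theta> * g * t - \<theta> * ?b + \<theta> * y \<le> \<theta> * total_cost G m t \<omega>" by (simp add: algebra_simps)
      then have le: "exp (\<theta> * g * t - \<theta> * ?b + \<theta> * y) \<le> exp (\<theta> * total_cost G m t \<omega>)" by simp
      have "c * (exp (\<theta> * y) * V j) = exp (\<theta> * g * t - \<theta> * ?b + \<theta> * y) * (V j / v)"
        by (simp add: c_def exp_add exp_diff)
      also have "\<dots> \<le> exp (\<theta> * total_cost G m t \<omega>) * 1"
        using V by (intro mult_mono le) (auto simp: divide_le_eq_1)
      finally have "ennreal (c * (exp (\<theta> * y) * V j)) \<le> ennreal (exp (\<theta> * total_cost G m t \<omega>))"
        by (intro ennreal_leI) simp
      then show ?case using c V(1)[of j] by (simp add: y(1) ennreal_mult)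
    qed
  qed
  finally show ?thesis .
qed

lemma growth_upper_bound:
  assumes "0 < \<theta>" and m: "m \<in> {1, 2}" and V: "\<And>j. v \<le> V j" "0 < v" and t: "0 \<le> t"
    and super: "\<And>n h. h \<in> space (HS n) \<Longrightarrow> stage_value \<theta> m g V n h \<le> ennreal (V (snd h))"
  shows "(\<integral>\<^sup>+\<omega>. ennreal (exp (\<theta> * total_cost G m t \<omega>)) \<partial>LAW) \<le>
    ennreal (exp (\<theta> * g * t) * (exp (\<theta> * ((2 * rho_max + \<bar>g\<bar>) * sbar)) * V i0 / v))"
proof -
  let ?b = "(2 * rho_max + \<bar>g\<bar>) * sbar"
  define c where "c = exp (\<theta> * g * t) * exp (\<theta> * ?b) / v"
  have c: "0 \<le> c" using V(2) by (simp add: c_def)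
  have V0: "0 \<le> V j" for j using V(1)[of j] V(2) by simp
  have [measurable]: "(\<lambda>\<omega>. \<Sum>n. crossing \<theta> m g V t n \<omega>) \<in> borel_measurable LAW"
    using measurable_weight(2)[OF m] by (intro borel_measurable_suminf_order)
  have "(\<integral>\<^sup>+\<omega>. ennreal (exp (\<theta> * total_cost G m t \<omega>)) \<partial>LAW) \<le> (\<integral>\<^sup>+\<omega>. ennreal c * (\<Sum>n. crossing \<theta> m g V t n \<omega>) \<partial>LAW)"
  proof (rule nn_integral_mono_AE)
    show "AE \<omega> in LAW. ennreal (exp (\<theta> * total_cost G m t \<omega>)) \<le> ennreal c * (\<Sum>n. crossing \<theta> m g V t n \<omega>)"
      using weight_at_crossing[where V=V and g=g, OF assms(1) m V0 t]
    proof eventually_elim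
      case (elim \<omega>)
      then obtain y j where y: "(\<Sum>n. crossing \<theta> m g V t n \<omega>) = ennreal (exp (\<theta> * y) * V j)"
        "\<bar>y - (total_cost G m t \<omega> - g * t)\<bar> \<le> ?b" by blast
      from y(2) have "total_cost G m t \<omega> \<le> y + g * t + ?b" by (simp add: abs_le_iff)
      from mult_left_mono[OF this, of \<theta>] assms(1)
      have "\<theta> * total_cost G m t \<omega> \<le> \<theta> * g * t + \<theta> * ?b + \<theta> * y" by (simp add: algebra_simps)
      then have le: "exp (\<theta> * total_cost G m t \<omega>) \<le> exp (\<theta> * g * t + \<theta> * ?b + \<theta> * y)" by simp
      have "exp (\<theta> * total_cost G m t \<omega>) * 1 \<le> exp (\<theta> * g * t + \<theta> * ?b + \<theta> * y) * (V j / v)"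
        using V by (intro mult_mono le) auto
      also have "\<dots> = c * (exp (\<theta> * y) * V j)"
        by (simp add: c_def exp_add)
      finally have "ennreal (exp (\<theta> * total_cost G m t \<omega>)) \<le> ennreal (c * (exp (\<theta> * y) * V j))"
        by (intro ennreal_leI) simp
      then show ?case using c V0[of j] by (simp add: y(1) ennreal_mult)
    qed
  qed
  also have "\<dots> = ennreal c * (\<integral>\<^sup>+\<omega>. (\<Sum>n. crossing \<theta> m g V t n \<omega>) \<partial>LAW)"
    by (rule nn_integral_cmult) measurable
  also have "\<dots> \<le> ennreal c * ennreal (V i0)"
    by (intro mult_left_mono crossing_le[OF m V0 t super]) auto
  also have "\<dots> = ennreal (exp (\<theta> * g * t) * (exp (\<theta> * ?b) * V i0 / v))"
    using c V0 by (simp add: ennreal_mult[symmetric] c_def mult.assoc)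
  finally show ?thesis .
qed

text \<open>The verification bound for deviations: \<open>V\<close> may be replaced by its expected stage cost only at a loss for the player, whatever the
history, so the cost grows at a rate of at least \<open>g\<close>.\<close>

theorem risk_cost_ge:
  assumes "0 < \<theta>" and m: "m \<in> {1, 2}" and V: "\<And>j. 0 < V j"
    and sub: "\<And>n h. h \<in> space (HS n) \<Longrightarrow> ennreal (V (snd h)) \<le> stage_value \<theta> m g V n h"
  shows "ereal g \<le> risk_cost G \<theta> m i0 \<pi>1 \<pi>2"
proof -
  define v where "v = Max (range V)"
  have v: "V j \<le> v" for j unfolding v_def by (rule Max_ge) auto
  have v0: "0 < v" using V[of i0] v[of i0] by simp
  define a where "a = V i0 / (exp (\<theta> * ((2 * rho_max + \<bar>g\<bar>) * sbar)) * v)"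
  have a: "0 < a" using V v0 by (simp add: a_def)
  have "ereal g = Limsup at_top (\<lambda>t. ereal (1 / (\<theta> * t)) * ereal (ln (exp (\<theta> * g * t) * a)))"
    by (rule lim_imp_Limsup[symmetric, OF _ growth_rate_limit[OF assms(1) a]]) simp
  also have "\<dots> \<le> risk_cost G \<theta> m i0 \<pi>1 \<pi>2"
    unfolding risk_cost_def
  proof (rule Limsup_mono)
    show "\<forall>\<^sub>F t in at_top. ereal (1 / (\<theta> * t)) * ereal (ln (exp (\<theta> * g * t) * a)) \<le>
        ereal (1 / (\<theta> * t)) * ext_ln (\<integral>\<^sup>+\<omega>. ennreal (exp (\<theta> * total_cost G m t \<omega>)) \<partial>LAW)"
      using eventually_gt_at_top[of "0 :: real"]
    proof eventually_elim
      case (elim t)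
      have "ereal (ln (exp (\<theta> * g * t) * a)) \<le> ext_ln (\<integral>\<^sup>+\<omega>. ennreal (exp (\<theta> * total_cost G m t \<omega>)) \<partial>LAW)"
        unfolding a_def
        by (intro ext_ln_mono growth_lower_bound[OF assms(1) m less_imp_le[OF V] v v0 _ sub])
           (use V v0 elim in \<open>auto intro!: divide_pos_pos mult_pos_pos\<close>)
      then show ?case using assms(1) elim by (intro ereal_mult_left_mono) auto
    qed
  qed
  finally show ?thesis .
qed

theorem risk_cost_le:
  assumes "0 < \<theta>" and m: "m \<in> {1, 2}" and V: "\<And>j. 0 < V j"
    and super: "\<And>n h. h \<in> space (HS n) \<Longrightarrow> stage_value \<theta> m g V n h \<le> ennreal (V (snd h))"
  shows "risk_cost G \<theta> m i0 \<pi>1 \<pi>2 \<le> ereal g"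
proof -
  define v where "v = Min (range V)"
  have v: "v \<le> V j" for j unfolding v_def by (rule Min_le) auto
  have "v \<in> range V" unfolding v_def by (rule Min_in) auto
  then have v0: "0 < v" using V by auto
  define a where "a = exp (\<theta> * ((2 * rho_max + \<bar>g\<bar>) * sbar)) * V i0 / v"
  have a: "0 < a" using V v0 by (simp add: a_def)
  have "risk_cost G \<theta> m i0 \<pi>1 \<pi>2 \<le> Limsup at_top (\<lambda>t. ereal (1 / (\<theta> * t)) * ereal (ln (exp (\<theta> * g * t) * a)))"
    unfolding risk_cost_def
  proof (rule Limsup_mono)
    show "\<forall>\<^sub>F t in at_top. ereal (1 / (\<theta> * t)) * ext_ln (\<integral>\<^sup>+\<omega>. ennreal (exp (\<theta> * total_cost G m t \<omega>)) \<partial>LAW) \<le>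
        ereal (1 / (\<theta> * t)) * ereal (ln (exp (\<theta> * g * t) * a))"
      using eventually_gt_at_top[of "0 :: real"]
    proof eventually_elim
      case (elim t)
      have "ext_ln (\<integral>\<^sup>+\<omega>. ennreal (exp (\<theta> * total_cost G m t \<omega>)) \<partial>LAW) \<le> ereal (ln (exp (\<theta> * g * t) * a))"
        unfolding a_def
        by (intro ext_ln_mono' growth_upper_bound[OF assms(1) m v v0 _ super])
           (use V v0 elim in \<open>auto intro!: divide_pos_pos mult_pos_pos\<close>)
      then show ?case using assms(1) elim by (intro ereal_mult_left_mono) auto
    qed
  qed
  also have "\<dots> = ereal g"
    by (rule lim_imp_Limsup[OF _ growth_rate_limit[OF assms(1) a]]) simp
  finally show ?thesis .
qed

text \<open>A nonnegative supermartingale that starts at 0 stays there.\<close>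

lemma vanishing_value_unreachable:
  assumes m: "m \<in> {1, 2}" and V: "\<And>j. 0 \<le> V j" "V i0 = 0" "0 < V j"
    and super: "\<And>n h. h \<in> space (HS n) \<Longrightarrow> stage_value \<theta> m g V n h \<le> ennreal (V (snd h))"
  shows "measure LAW {\<omega> \<in> space (path_space G). state_at n \<omega> = j} = 0"
proof -
  note [measurable] = measurable_weight[OF m] measurable_LAW
  have "(\<integral>\<^sup>+\<omega>. weight \<theta> m g V n \<omega> \<partial>LAW) \<le> 0"
  proof (induction n)
    case 0
    have "(\<integral>\<^sup>+\<omega>. weight \<theta> m g V 0 \<omega> \<partial>LAW) = stopped_value \<theta> m g V 0 0"
      unfolding stopped_value_def by (simp add: jump_time_def)
    then show ?case by (simp add: stopped_value_0 V)
  next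
    case (Suc n)
    have "(\<integral>\<^sup>+\<omega>. weight \<theta> m g V (Suc n) \<omega> \<partial>LAW) =
        (\<integral>\<^sup>+\<omega>. 1 * (ennreal (exp (\<theta> * excess m g n \<omega>)) * stage_value \<theta> m g V n (history n \<omega>)) \<partial>LAW)"
      unfolding weight_def using weighted_step[OF m V(1), of "\<lambda>_. 1" n \<theta> g] by simp
    also have "\<dots> \<le> (\<integral>\<^sup>+\<omega>. 1 * (ennreal (exp (\<theta> * excess m g n \<omega>)) * ennreal (V (snd (history n \<omega>)))) \<partial>LAW)"
      by (intro nn_integral_mono mult_left_mono super in_hist) auto
    also have "\<dots> = (\<integral>\<^sup>+\<omega>. weight \<theta> m g V n \<omega> \<partial>LAW)"
      using V(1) by (simp add: weight_def snd_history ennreal_mult)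
    finally show ?case using Suc by simp
  qed
  then have "AE \<omega> in LAW. weight \<theta> m g V n \<omega> = 0"
    by (subst nn_integral_0_iff_AE[symmetric]) (auto intro: measurable_weight[OF m])
  then have "AE \<omega> in LAW. state_at n \<omega> \<noteq> j"
    by eventually_elim (use V in \<open>auto simp: weight_def ennreal_eq_0_iff mult_le_0_iff\<close>)
  then have "AE \<omega> in LAW. \<omega> \<notin> {\<omega> \<in> space (path_space G). state_at n \<omega> = j}"
    by eventually_elim simp
  moreover have "{\<omega> \<in> space (path_space G). state_at n \<omega> = j} \<in> sets LAW"
    unfolding sets_eq_imp_space_eq[OF LAW(2), symmetric] by measurable
  ultimately have "emeasure LAW {\<omega> \<in> space (path_space G). state_at n \<omega> = j} = 0"
    by (subst (asm) AE_iff_null_sets[symmetric]) auto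
  then show ?thesis by (simp add: measure_def)
qed

end

section \<open>Mixed actions on traces of the Borel sets\<close>

text \<open>Policies and mixed actions are measures on traces of the Borel sets, while \<open>probs_on\<close> consists of
measures on the whole space. The inclusion map transports the former to the latter, with the same integrals over the
carrying compact set; \<open>restrict_space\<close> leads back.\<close>

lemma measurable_trace_embedding:
  assumes "sets \<mu> = sets (restrict_space borel S)"
  shows "(\<lambda>x. x) \<in> borel_measurable \<mu>"
  unfolding measurable_cong_sets[OF assms refl] by (rule measurable_restrict_space1) simp

lemma distr_probs_on:
  assumes K: "K \<in> sets borel" "K \<subseteq> S" and \<mu>: "prob_space \<mu>" "sets \<mu> = sets (restrict_space borel S)" "AE x in \<mu>. x \<in> K"
  shows "distr \<mu> borel (\<lambda>x. x) \<in> probs_on K"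
proof -
  have id [measurable]: "(\<lambda>x. x) \<in> borel_measurable \<mu>"
    by (rule measurable_trace_embedding[OF \<mu>(2)])
  show ?thesis
    unfolding probs_on_def
    using \<mu>(3) K(1) by (auto simp: AE_distr_iff intro!: prob_space.prob_space_distr[OF \<mu>(1)])
qed

lemma set_integral_distr_trace:
  fixes f :: "'a::topological_space \<Rightarrow> real"
  assumes K: "K \<in> sets borel" "K \<subseteq> S" and \<mu>: "sets \<mu> = sets (restrict_space borel S)" and f: "continuous_on K f"
  shows "(LINT x:K|distr \<mu> borel (\<lambda>x. x). f x) = (LINT x:K|\<mu>. f x)"
proof -
  have id [measurable]: "(\<lambda>x. x) \<in> borel_measurable \<mu>"
    by (rule measurable_trace_embedding[OF \<mu>])
  have "(\<lambda>x. indicator K x *\<^sub>R f x) \<in> borel_measurable borel"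
    by (rule borel_measurable_continuous_on_indicator[OF K(1) f])
  then show ?thesis
    unfolding set_lebesgue_integral_def by (subst integral_distr) auto
qed

lemma nn_integral_probs_on:
  fixes f :: "'a::polish_space \<Rightarrow> real"
  assumes K: "compact K" "K \<subseteq> S" and \<mu>: "prob_space \<mu>" "sets \<mu> = sets (restrict_space borel S)" "AE x in \<mu>. x \<in> K"
    and f: "continuous_on K f" "\<And>x. x \<in> K \<Longrightarrow> 0 \<le> f x"
  shows "(\<integral>\<^sup>+x. ennreal (f x) \<partial>\<mu>) = ennreal (LINT x:K|distr \<mu> borel (\<lambda>x. x). f x)"
proof -
  have Kb: "K \<in> sets borel" using K(1) by (rule borel_compact)
  let ?\<nu> = "distr \<mu> borel (\<lambda>x. x)"
  have id [measurable]: "(\<lambda>x. x) \<in> borel_measurable \<mu>"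
    by (rule measurable_trace_embedding[OF \<mu>(2)])
  have "(\<lambda>x. indicator K x *\<^sub>R f x) \<in> borel_measurable borel"
    by (rule borel_measurable_continuous_on_indicator[OF Kb f(1)])
  then have meas: "(\<lambda>x. ennreal (indicator K x *\<^sub>R f x)) \<in> borel_measurable ?\<nu>"
    unfolding measurable_distr_eq1 by (rule measurable_compose[OF _ measurable_ennreal])
  have "(\<integral>\<^sup>+x. ennreal (f x) \<partial>\<mu>) = (\<integral>\<^sup>+x. ennreal (indicator K x *\<^sub>R f x) \<partial>\<mu>)"
    by (rule nn_integral_cong_AE) (use \<mu>(3) in \<open>eventually_elim, simp\<close>)
  also have "\<dots> = (\<integral>\<^sup>+x. ennreal (indicator K x *\<^sub>R f x) \<partial>?\<nu>)"
    by (rule nn_integral_distr[symmetric, OF id meas])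
  also have "\<dots> = ennreal (LINT x:K|?\<nu>. f x)"
    unfolding set_lebesgue_integral_def
  proof (rule nn_integral_eq_integral)
    show "integrable ?\<nu> (\<lambda>x. indicat_real K x *\<^sub>R f x)"
      using set_integrable_probs_on[OF K(1) distr_probs_on[OF Kb K(2) \<mu>] f(1)] by (simp add: set_integrable_def)
    show "AE x in ?\<nu>. 0 \<le> indicat_real K x *\<^sub>R f x"
      using f(2) by (intro AE_I2) (simp add: indicator_def)
  qed
  finally show ?thesis .
qed

lemma
  fixes K :: "'a::polish_space set"
  assumes \<alpha>: "\<alpha> \<in> probs_on K" and K: "K \<in> sets borel" "K \<subseteq> S" and S: "S \<in> sets borel"
  shows prob_space_trace: "prob_space (restrict_space \<alpha> S)"
    and sets_trace: "sets (restrict_space \<alpha> S) = sets (restrict_space borel S)"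
    and AE_trace: "AE x in restrict_space \<alpha> S. x \<in> K"
    and distr_trace: "distr (restrict_space \<alpha> S) borel (\<lambda>x. x) = \<alpha>"
    and measure_trace: "measure (restrict_space \<alpha> S) K = 1"
proof -
  have a: "prob_space \<alpha>" "sets \<alpha> = sets borel" "AE x in \<alpha>. x \<in> K"
    using \<alpha> by (auto simp: probs_on_def)
  interpret prob_space \<alpha> by (rule a)
  have sp: "space \<alpha> = UNIV" using sets_eq_imp_space_eq[OF a(2)] by simp
  have AE_S: "AE x in \<alpha>. x \<in> S" using a(3) by eventually_elim (use K in auto)
  have S\<alpha>: "S \<inter> space \<alpha> \<in> sets \<alpha>" using S a(2) sp by simp
  have "emeasure \<alpha> S = 1" using AE_S S a(2) by (intro emeasure_eq_1_AE) auto
  then show "prob_space (restrict_space \<alpha> S)"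
    using S a(2) sp by (intro prob_spaceI) (simp add: space_restrict_space emeasure_restrict_space)
  show "sets (restrict_space \<alpha> S) = sets (restrict_space borel S)"
    using a(2) by (rule sets_restrict_space_cong)
  show AE_K: "AE x in restrict_space \<alpha> S. x \<in> K"
    using a(3) unfolding AE_restrict_space_iff[OF S\<alpha>] by eventually_elim simp
  show "distr (restrict_space \<alpha> S) borel (\<lambda>x. x) = \<alpha>"
  proof (rule measure_eqI)
    fix A assume "A \<in> sets (distr (restrict_space \<alpha> S) borel (\<lambda>x. x))"
    then have A: "A \<in> sets borel" by simp
    have id: "(\<lambda>x. x) \<in> measurable (restrict_space \<alpha> S) borel"
      using measurable_restrict_space1[of "\<lambda>x. x" \<alpha> borel S] a(2) by (simp add: measurable_ident_sets)
    have "emeasure (distr (restrict_space \<alpha> S) borel (\<lambda>x. x)) A = emeasure \<alpha> (A \<inter> S)"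
      using A a(2) sp S
      by (simp add: emeasure_distr[OF id] emeasure_restrict_space space_restrict_space)
    also have "\<dots> = emeasure \<alpha> A"
      using A S a(2) AE_S by (intro emeasure_eq_AE) auto
    finally show "emeasure (distr (restrict_space \<alpha> S) borel (\<lambda>x. x)) A = emeasure \<alpha> A" .
  qed (simp add: a(2))
  have "measure \<alpha> K = 1" using a K by (subst prob_eq_1) auto
  then show "measure (restrict_space \<alpha> S) K = 1"
    using S a(2) sp K by (simp add: measure_restrict_space)
qed

text \<open>Needed because a deviation of player 2 concerns the inner integral of the stage cost.\<close>

lemma set_integral_probs_on_swap:
  fixes f :: "'a::polish_space \<times> 'b::polish_space \<Rightarrow> real"
  assumes K: "compact K1" "compact K2" and f: "continuous_on (K1 \<times> K2) f"
    and \<alpha>: "\<alpha> \<in> probs_on K1" and \<beta>: "\<beta> \<in> probs_on K2"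
  shows "(LINT a:K1|\<alpha>. LINT b:K2|\<beta>. f (a, b)) = (LINT b:K2|\<beta>. LINT a:K1|\<alpha>. f (a, b))"
proof -
  have a: "prob_space \<alpha>" "sets \<alpha> = sets borel" and b: "prob_space \<beta>" "sets \<beta> = sets borel"
    using \<alpha> \<beta> by (auto simp: probs_on_def)
  interpret A: prob_space \<alpha> by (rule a)
  interpret B: prob_space \<beta> by (rule b)
  interpret P: pair_prob_space \<alpha> \<beta> ..
  define g where "g x = indicat_real (K1 \<times> K2) x *\<^sub>R f x" for x
  obtain C where C: "\<And>x. x \<in> K1 \<times> K2 \<Longrightarrow> norm (f x) \<le> C"
    using compact_imp_bounded[OF compact_continuous_image[OF f compact_Times[OF K]]] by (auto simp: bounded_iff)
  have "g \<in> borel_measurable borel"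
    unfolding g_def by (rule borel_measurable_continuous_on_indicator[OF borel_compact[OF compact_Times[OF K]] f])
  then have meas: "g \<in> borel_measurable (\<alpha> \<Otimes>\<^sub>M \<beta>)"
    unfolding measurable_cong_sets[OF sets_pair_measure_cong[OF a(2) b(2)] refl] borel_prod .
  have "integrable (\<alpha> \<Otimes>\<^sub>M \<beta>) g"
  proof (rule P.P.integrable_const_bound[of _ "\<bar>C\<bar>"])
    show "AE x in \<alpha> \<Otimes>\<^sub>M \<beta>. norm (g x) \<le> \<bar>C\<bar>"
    proof (rule AE_I2)
      fix x show "norm (g x) \<le> \<bar>C\<bar>" using C[of x] by (auto simp: g_def indicator_def)
    qed
  qed (rule meas)
  then have int: "integrable (\<alpha> \<Otimes>\<^sub>M \<beta>) (\<lambda>(a, b). g (a, b))" by simp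
  have 1: "indicat_real K1 a *\<^sub>R (LINT b|\<beta>. indicat_real K2 b *\<^sub>R f (a, b)) = (LINT b|\<beta>. g (a, b))" for a
    by (cases "a \<in> K1") (simp_all add: g_def indicator_times)
  have 2: "indicat_real K2 b *\<^sub>R (LINT a|\<alpha>. indicat_real K1 a *\<^sub>R f (a, b)) = (LINT a|\<alpha>. g (a, b))" for b
    by (cases "b \<in> K2") (simp_all add: g_def indicator_times)
  show ?thesis
    unfolding set_lebesgue_integral_def 1 2 by (rule P.Fubini_integral[OF int, symmetric])
qed

lemma set_integral_cong_on:
  fixes f g :: "'a \<Rightarrow> real"
  assumes "\<And>x. x \<in> K \<Longrightarrow> f x = g x"
  shows "(LINT x:K|M. f x) = (LINT x:K|M. g x)"
  unfolding set_lebesgue_integral_def by (rule Bochner_Integration.integral_cong) (simp_all add: assms indicator_def)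

context semi_markov_model begin

abbreviation stage :: "real \<Rightarrow> nat \<Rightarrow> real \<times> ('s \<Rightarrow> real) \<Rightarrow> 's \<Rightarrow> 'a \<times> 'b \<Rightarrow> real" where
  "stage \<theta> m \<Theta> i ab \<equiv> stage_cost (sojourn_weight \<theta> m) (trans_prob G) i \<Theta> ab"

lemma continuous_stage:
  assumes "m \<in> {1, 2}"
  shows "continuous_on (adm1 G i \<times> adm2 G i) (stage \<theta> m \<Theta> i)"
proof -
  have "continuous_on (adm1 G i \<times> adm2 G i)
      (\<lambda>ab. (\<lambda>(a, b, g). sojourn_weight \<theta> m i a b g) (fst ab, snd ab, fst \<Theta>))"
    by (rule continuous_on_compose2[OF continuous_sojourn_weight[OF assms, of i "fst \<Theta>" "fst \<Theta>"]]) (auto intro!: continuous_intros)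
  then show ?thesis
    using continuous_trans_prob[of i]
    unfolding stage_cost_def by (auto intro!: continuous_intros simp: case_prod_beta)
qed

lemma stage_nonneg:
  assumes "0 < \<theta>" "m \<in> {1, 2}" "\<And>j. 0 \<le> snd \<Theta> j" "a \<in> adm1 G i" "b \<in> adm2 G i"
  shows "0 \<le> stage \<theta> m \<Theta> i (a, b)"
proof -
  have adm: "(i, a, b) \<in> admissible G" using assms by (simp add: mem_admissible)
  have "0 \<le> sojourn_weight \<theta> m i a b (fst \<Theta>)"
    using sojourn_weight_pos[OF assms(1,2) adm, of "fst \<Theta>"] by (rule order.trans[OF exp_ge_zero])
  then show ?thesis
    using assms(3) trans_prob_nonneg[OF adm] unfolding stage_cost_def by (auto intro!: mult_nonneg_nonneg sum_nonneg)
qed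

text \<open>The values enter \<open>bellman\<close> through their logarithms, the multiplicative equation through \<open>V = exp (\<theta> * y)\<close>.\<close>

lemma bellman_eq:
  assumes "0 < \<theta>" "m \<in> {1, 2}" and V: "\<And>j. 0 < V j"
    and \<alpha>: "sets \<alpha> = sets (restrict_space borel S1)" "adm1 G i \<subseteq> S1"
    and \<beta>: "prob_space \<beta>" "sets \<beta> = sets (restrict_space borel S2)" "AE b in \<beta>. b \<in> adm2 G i" "adm2 G i \<subseteq> S2"
  shows "bellman G sbar \<theta> m g (\<lambda>j. ln (V j) / \<theta>) i \<alpha> \<beta> =
    (LINT a:adm1 G i|distr \<alpha> borel (\<lambda>x. x). LINT b:adm2 G i|distr \<beta> borel (\<lambda>x. x). stage \<theta> m (g, V) i (a, b))"
proof -
  have \<beta>': "distr \<beta> borel (\<lambda>x. x) \<in> probs_on (adm2 G i)"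
    by (rule distr_probs_on[OF adm_borel(2) \<beta>(4) \<beta>(1-3)])
  have "bellman G sbar \<theta> m g (\<lambda>j. ln (V j) / \<theta>) i \<alpha> \<beta> = (LINT a:adm1 G i|\<alpha>. LINT b:adm2 G i|\<beta>. stage \<theta> m (g, V) i (a, b))"
    using \<open>0 < \<theta>\<close> V by (simp add: bellman_def stage_cost_def sojourn_weight_def)
  also have "\<dots> = (LINT a:adm1 G i|\<alpha>. LINT b:adm2 G i|distr \<beta> borel (\<lambda>x. x). stage \<theta> m (g, V) i (a, b))"
  proof (rule set_integral_cong_on)
    fix a assume "a \<in> adm1 G i"
    from set_integral_distr_trace[OF adm_borel(2) \<beta>(4,2) continuous_on_slice[OF continuous_stage[OF assms(2)] this]]
    show "(LINT b:adm2 G i|\<beta>. stage \<theta> m (g, V) i (a, b)) = (LINT b:adm2 G i|distr \<beta> borel (\<lambda>x. x). stage \<theta> m (g, V) i (a, b))"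
      by simp
  qed
  also have "\<dots> = (LINT a:adm1 G i|distr \<alpha> borel (\<lambda>x. x). LINT b:adm2 G i|distr \<beta> borel (\<lambda>x. x). stage \<theta> m (g, V) i (a, b))"
    by (rule set_integral_distr_trace[OF adm_borel(1) \<alpha>(2,1), symmetric])
       (rule continuous_on_set_integral_probs_on[OF compact_adm continuous_stage[OF assms(2)] \<beta>'])
  finally show ?thesis .
qed

end

context controlled_semi_markov_model begin

lemma stage_value_eq:
  assumes "0 < \<theta>" "m \<in> {1, 2}" "\<And>j. 0 \<le> V j" and h: "h \<in> space (HS n)"
  shows "stage_value \<theta> m g V n h = ennreal (LINT a:adm1 G (snd h)|distr (\<pi>1 n h) borel (\<lambda>x. x).
    LINT b:adm2 G (snd h)|distr (\<pi>2 n h) borel (\<lambda>x. x). stage \<theta> m (g, V) (snd h) (a, b))"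
proof -
  let ?i = "snd h" let ?K = "adm1 G (snd h) \<times> adm2 G (snd h)"
  let ?f = "stage \<theta> m (g, V) (snd h)"
  let ?\<beta> = "distr (\<pi>2 n h) borel (\<lambda>x. x)"
  have f: "continuous_on ?K ?f" by (rule continuous_stage[OF assms(2)])
  have nonneg: "0 \<le> ?f (a, b)" if "a \<in> adm1 G ?i" "b \<in> adm2 G ?i" for a b
    by (rule stage_nonneg[OF assms(1,2) _ that]) (simp add: assms(3))
  have sets: "sets (\<pi>1 n h) = sets (restrict_space borel (act1 G))" "sets (\<pi>2 n h) = sets (restrict_space borel (act2 G))"
    using policies_prob[OF h] by (simp_all add: act_space1_def act_space2_def)
  have \<beta>: "?\<beta> \<in> probs_on (adm2 G ?i)"
    by (rule distr_probs_on[OF adm_borel(2) adm_sub(2) policies_prob(3)[OF h] sets(2) AE_policies(2)[OF h]])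
  have "(\<lambda>x. indicator ?K x *\<^sub>R ?f x) \<in> borel_measurable borel"
    by (rule borel_measurable_continuous_on_indicator[OF borel_compact[OF compact_Times[OF compact_adm]] f])
  then have "(\<lambda>x. indicator ?K x *\<^sub>R ?f x) \<in> borel_measurable (borel \<Otimes>\<^sub>M borel)" by (simp only: borel_prod)
  moreover have "(\<lambda>x. (fst x, snd x)) \<in> measurable (A1 \<Otimes>\<^sub>M A2) (borel \<Otimes>\<^sub>M borel)"
    by (intro measurable_Pair measurable_compose[OF measurable_fst] measurable_compose[OF measurable_snd] measurable_act_borel measurable_ident[unfolded id_def])
  ultimately have "(\<lambda>x. indicator ?K (fst x, snd x) *\<^sub>R ?f (fst x, snd x)) \<in> borel_measurable (A1 \<Otimes>\<^sub>M A2)"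
    by (rule measurable_compose[rotated])
  then have meas: "(\<lambda>x. ennreal (indicator ?K x *\<^sub>R ?f x)) \<in> borel_measurable (A1 \<Otimes>\<^sub>M A2)" by simp
  have "stage_value \<theta> m g V n h = (\<integral>\<^sup>+ab. ennreal (indicator ?K ab *\<^sub>R ?f ab) \<partial>(\<pi>1 n h \<Otimes>\<^sub>M \<pi>2 n h))"
    unfolding stage_value_def
    by (rule nn_integral_cong_AE) (use AE_actions[OF h] in \<open>eventually_elim, auto simp: admissible_def\<close>)
  also have "\<dots> = (\<integral>\<^sup>+a. (\<integral>\<^sup>+b. ennreal (indicator ?K (a, b) *\<^sub>R ?f (a, b)) \<partial>\<pi>2 n h) \<partial>\<pi>1 n h)"
    by (rule nn_integral_actions[OF h meas])
  also have "\<dots> = (\<integral>\<^sup>+a. ennreal (LINT b:adm2 G ?i|?\<beta>. ?f (a, b)) \<partial>\<pi>1 n h)"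
  proof (rule nn_integral_cong_AE, use AE_policies(1)[OF h] in eventually_elim)
    fix a assume a: "a \<in> adm1 G ?i"
    have "(\<integral>\<^sup>+b. ennreal (indicator ?K (a, b) *\<^sub>R ?f (a, b)) \<partial>\<pi>2 n h) = (\<integral>\<^sup>+b. ennreal (?f (a, b)) \<partial>\<pi>2 n h)"
      by (rule nn_integral_cong_AE, use AE_policies(2)[OF h] in eventually_elim) (use a in simp)
    also have "\<dots> = ennreal (LINT b:adm2 G ?i|?\<beta>. ?f (a, b))"
      by (rule nn_integral_probs_on[OF compact_adm(2) adm_sub(2) policies_prob(3)[OF h] sets(2) AE_policies(2)[OF h]
            continuous_on_slice[OF f a] nonneg[OF a]])
    finally show "(\<integral>\<^sup>+b. ennreal (indicator ?K (a, b) *\<^sub>R ?f (a, b)) \<partial>\<pi>2 n h) = ennreal (LINT b:adm2 G ?i|?\<beta>. ?f (a, b))" .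
  qed
  also have "\<dots> = ennreal (LINT a:adm1 G ?i|distr (\<pi>1 n h) borel (\<lambda>x. x). LINT b:adm2 G ?i|?\<beta>. ?f (a, b))"
  proof (rule nn_integral_probs_on[OF compact_adm(1) adm_sub(1) policies_prob(1)[OF h] sets(1) AE_policies(1)[OF h]])
    show "continuous_on (adm1 G ?i) (\<lambda>a. LINT b:adm2 G ?i|?\<beta>. ?f (a, b))"
      by (rule continuous_on_set_integral_probs_on[OF compact_adm f \<beta>])
    fix a assume a: "a \<in> adm1 G ?i"
    have "(LINT b:adm2 G ?i|?\<beta>. 0) \<le> (LINT b:adm2 G ?i|?\<beta>. ?f (a, b))"
      by (rule set_integral_probs_on_mono[OF compact_adm(2) \<beta> _ continuous_on_slice[OF f a] nonneg[OF a]]) simp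
    then show "0 \<le> (LINT b:adm2 G ?i|?\<beta>. ?f (a, b))"
      by (simp add: set_lebesgue_integral_def)
  qed
  finally show ?thesis .
qed

end

context semi_markov_model begin

lemma stationary_trace:
  shows "(\<And>i. \<alpha> i \<in> probs_on (adm1 G i)) \<Longrightarrow> (\<lambda>i. restrict_space (\<alpha> i) (act1 G)) \<in> stationary1 G"
    and "(\<And>i. \<beta> i \<in> probs_on (adm2 G i)) \<Longrightarrow> (\<lambda>i. restrict_space (\<beta> i) (act2 G)) \<in> stationary2 G"
proof -
  have act: "act1 G \<in> sets borel" "act2 G \<in> sets borel" using game by (auto simp: semi_markov_game_def)
  show "(\<lambda>i. restrict_space (\<alpha> i) (act1 G)) \<in> stationary1 G" if \<alpha>: "\<And>i. \<alpha> i \<in> probs_on (adm1 G i)"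
    using prob_space_trace[OF \<alpha> adm_borel(1) adm_sub(1) act(1)] sets_trace[OF \<alpha> adm_borel(1) adm_sub(1) act(1)]
      measure_trace[OF \<alpha> adm_borel(1) adm_sub(1) act(1)]
    by (auto simp: stationary1_def space_prob_algebra act_space1_def)
  show "(\<lambda>i. restrict_space (\<beta> i) (act2 G)) \<in> stationary2 G" if \<beta>: "\<And>i. \<beta> i \<in> probs_on (adm2 G i)"
    using prob_space_trace[OF \<beta> adm_borel(2) adm_sub(2) act(2)] sets_trace[OF \<beta> adm_borel(2) adm_sub(2) act(2)]
      measure_trace[OF \<beta> adm_borel(2) adm_sub(2) act(2)]
    by (auto simp: stationary2_def space_prob_algebra act_space2_def)
qed

lemma stat_policy_policies:
  shows "\<phi>1 \<in> stationary1 G \<Longrightarrow> stat_policy \<phi>1 \<in> policies1 G"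
    and "\<phi>2 \<in> stationary2 G \<Longrightarrow> stat_policy \<phi>2 \<in> policies2 G"
proof -
  have snd: "snd \<in> measurable (hist_space G n) (count_space UNIV)" for n by (simp add: hist_space_def)
  show "stat_policy \<phi>1 \<in> policies1 G" if "\<phi>1 \<in> stationary1 G"
    using that measurable_compose[OF snd, of \<phi>1] by (simp add: stationary1_def policies1_def stat_policy_def)
  show "stat_policy \<phi>2 \<in> policies2 G" if "\<phi>2 \<in> stationary2 G"
    using that measurable_compose[OF snd, of \<phi>2] by (simp add: stationary2_def policies2_def stat_policy_def)
qed

lemma AE_mixed:
  shows "\<psi> \<in> mixed1 G i \<Longrightarrow> AE a in \<psi>. a \<in> adm1 G i" and "\<eta> \<in> mixed2 G i \<Longrightarrow> AE b in \<eta>. b \<in> adm2 G i"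
  by (auto simp: mixed1_def mixed2_def space_prob_algebra space_restrict_space dest!: sets_eq_imp_space_eq intro!: AE_I2)

lemma mixed_probs_on:
  shows "\<psi> \<in> mixed1 G i \<Longrightarrow> distr \<psi> borel (\<lambda>x. x) \<in> probs_on (adm1 G i)"
    and "\<eta> \<in> mixed2 G i \<Longrightarrow> distr \<eta> borel (\<lambda>x. x) \<in> probs_on (adm2 G i)"
proof -
  show "distr \<psi> borel (\<lambda>x. x) \<in> probs_on (adm1 G i)" if "\<psi> \<in> mixed1 G i"
    by (rule distr_probs_on[OF adm_borel(1) order_refl _ _ AE_mixed(1)[OF that]])
       (use that in \<open>simp_all add: mixed1_def space_prob_algebra\<close>)
  show "distr \<eta> borel (\<lambda>x. x) \<in> probs_on (adm2 G i)" if "\<eta> \<in> mixed2 G i"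
    by (rule distr_probs_on[OF adm_borel(2) order_refl _ _ AE_mixed(2)[OF that]])
       (use that in \<open>simp_all add: mixed2_def space_prob_algebra\<close>)
qed

end

theorem theorem6:
  fixes G :: "('s::finite, 'a::polish_space, 'b::polish_space) smg"
    and \<theta> sbar :: real and istar :: 's
  assumes "semi_markov_game G"
    and "0 < \<theta>"
    and "assumption1 G sbar"
    and "assumption2 G"
    and "assumption3 G sbar \<theta> istar"
  shows "\<exists>(g1::real) (g2::real) (y1::'s \<Rightarrow> real) (y2::'s \<Rightarrow> real).
    \<exists>\<phi>1\<in>stationary1 G. \<exists>\<phi>2\<in>stationary2 G.
      (\<forall>i. exp (\<theta> * y1 i) = (INF \<psi>\<in>mixed1 G i. bellman G sbar \<theta> 1 g1 y1 i \<psi> (\<phi>2 i)) \<and>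
           (INF \<psi>\<in>mixed1 G i. bellman G sbar \<theta> 1 g1 y1 i \<psi> (\<phi>2 i))
             = bellman G sbar \<theta> 1 g1 y1 i (\<phi>1 i) (\<phi>2 i) \<and>
           exp (\<theta> * y2 i) = (INF \<eta>\<in>mixed2 G i. bellman G sbar \<theta> 2 g2 y2 i (\<phi>1 i) \<eta>) \<and>
           (INF \<eta>\<in>mixed2 G i. bellman G sbar \<theta> 2 g2 y2 i (\<phi>1 i) \<eta>)
             = bellman G sbar \<theta> 2 g2 y2 i (\<phi>1 i) (\<phi>2 i)) \<and>
      nash_equilibrium G \<theta> (stat_policy \<phi>1) (stat_policy \<phi>2) \<and>
      (\<forall>i. risk_cost G \<theta> 1 i (stat_policy \<phi>1) (stat_policy \<phi>2) = ereal g1 \<and>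
           risk_cost G \<theta> 2 i (stat_policy \<phi>1) (stat_policy \<phi>2) = ereal g2)"
proof -
  interpret semi_markov_model G sbar by unfold_locales (rule assms)+
  have act: "act1 G \<in> sets borel" "act2 G \<in> sets borel" using game by (auto simp: semi_markov_game_def)
  obtain \<alpha> \<beta> \<Theta> where \<alpha>\<beta>: "\<forall>i. \<alpha> i \<in> probs_on (adm1 G i)" "\<forall>i. \<beta> i \<in> probs_on (adm2 G i)"
    and \<Theta>: "\<forall>m. (\<forall>i. 0 \<le> snd (\<Theta> m) i) \<and> (\<Sum>i\<in>UNIV. snd (\<Theta> m) i) = 1"
    and eq0: "\<forall>m i. snd (\<Theta> m) i = (LINT a:adm1 G i|\<alpha> i. LINT b:adm2 G i|\<beta> i. stage \<theta> (if m then 1 else 2) (\<Theta> m) i (a, b))"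
    and dev: "\<forall>i. \<forall>a\<in>adm1 G i. snd (\<Theta> True) i \<le> (LINT b:adm2 G i|\<beta> i. stage \<theta> 1 (\<Theta> True) i (a, b))"
      "\<forall>i. \<forall>b\<in>adm2 G i. snd (\<Theta> False) i \<le> (LINT a:adm1 G i|\<alpha> i. stage \<theta> 2 (\<Theta> False) i (a, b))"
    using bellman_equilibrium[OF assms(2)] by (elim exE conjE)
  have \<alpha>: "\<alpha> i \<in> probs_on (adm1 G i)" and \<beta>: "\<beta> i \<in> probs_on (adm2 G i)" for i using \<alpha>\<beta> by auto
  define g V player where "g m = fst (\<Theta> m)" and "V m = snd (\<Theta> m)" and "player m = (if m then 1 else 2 :: nat)" for m
  have \<Theta>_eq: "\<Theta> m = (g m, V m)" for m by (simp add: g_def V_def)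
  have player: "player m \<in> {1, 2}" for m by (simp add: player_def)
  have V0: "0 \<le> V m i" and V_sum: "(\<Sum>i\<in>UNIV. V m i) = 1" for m i using \<Theta> by (auto simp: V_def)
  have eq: "(LINT a:adm1 G i|\<alpha> i. LINT b:adm2 G i|\<beta> i. stage \<theta> (player m) (g m, V m) i (a, b)) = V m i" for m i
    using eq0[rule_format, of m i] by (simp add: \<Theta>_eq player_def)
  \<comment> \<open>The bounds against pure deviations integrate to bounds against mixed ones.\<close>
  have dev1: "V True i \<le> (LINT a:adm1 G i|\<nu>. LINT b:adm2 G i|\<beta> i. stage \<theta> 1 (g True, V True) i (a, b))"
    if \<nu>: "\<nu> \<in> probs_on (adm1 G i)" for i \<nu>
  proof -
    have "V True i = (LINT a:adm1 G i|\<nu>. V True i)" by (rule set_integral_probs_on_const[OF compact_adm(1) \<nu>, symmetric])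
    also have "\<dots> \<le> (LINT a:adm1 G i|\<nu>. LINT b:adm2 G i|\<beta> i. stage \<theta> 1 (g True, V True) i (a, b))"
    proof (rule set_integral_probs_on_mono[OF compact_adm(1) \<nu>])
      show "continuous_on (adm1 G i) (\<lambda>a. LINT b:adm2 G i|\<beta> i. stage \<theta> 1 (g True, V True) i (a, b))"
        by (rule continuous_on_set_integral_probs_on[OF compact_adm continuous_stage \<beta>]) simp
    qed (use dev(1) in \<open>simp_all add: \<Theta>_eq\<close>)
    finally show ?thesis .
  qed
  have dev2: "V False i \<le> (LINT a:adm1 G i|\<alpha> i. LINT b:adm2 G i|\<nu>. stage \<theta> 2 (g False, V False) i (a, b))"
    if \<nu>: "\<nu> \<in> probs_on (adm2 G i)" for i \<nu>
  proof -
    let ?f = "stage \<theta> 2 (g False, V False) i"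
    have f: "continuous_on (adm1 G i \<times> adm2 G i) ?f" by (rule continuous_stage) simp
    have f': "continuous_on (adm2 G i \<times> adm1 G i) (\<lambda>x. ?f (snd x, fst x))"
      by (rule continuous_on_compose2[OF f]) (auto intro!: continuous_intros)
    have "V False i = (LINT b:adm2 G i|\<nu>. V False i)" by (rule set_integral_probs_on_const[OF compact_adm(2) \<nu>, symmetric])
    also have "\<dots> \<le> (LINT b:adm2 G i|\<nu>. LINT a:adm1 G i|\<alpha> i. ?f (a, b))"
    proof (rule set_integral_probs_on_mono[OF compact_adm(2) \<nu>])
      show "continuous_on (adm2 G i) (\<lambda>b. LINT a:adm1 G i|\<alpha> i. ?f (a, b))"
        using continuous_on_set_integral_probs_on[OF compact_adm(2,1) f' \<alpha>] by simp
    qed (use dev(2) in \<open>simp_all add: \<Theta>_eq\<close>)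
    also have "\<dots> = (LINT a:adm1 G i|\<alpha> i. LINT b:adm2 G i|\<nu>. ?f (a, b))"
      by (rule set_integral_probs_on_swap[OF compact_adm f \<alpha> \<nu>, symmetric])
    finally show ?thesis .
  qed
  define \<phi>1 \<phi>2 where "\<phi>1 i = restrict_space (\<alpha> i) (act1 G)" and "\<phi>2 i = restrict_space (\<beta> i) (act2 G)" for i
  have \<phi>: "\<phi>1 \<in> stationary1 G" "\<phi>2 \<in> stationary2 G"
    using stationary_trace(1)[OF \<alpha>] stationary_trace(2)[OF \<beta>] by (simp_all add: \<phi>1_def[abs_def] \<phi>2_def[abs_def])
  note pol = stat_policy_policies(1)[OF \<phi>(1)] stat_policy_policies(2)[OF \<phi>(2)]
  have d1: "distr (\<phi>1 i) borel (\<lambda>x. x) = \<alpha> i" and d2: "distr (\<phi>2 i) borel (\<lambda>x. x) = \<beta> i" for i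
    by (simp_all add: \<phi>1_def \<phi>2_def distr_trace[OF \<alpha> adm_borel(1) adm_sub(1) act(1)] distr_trace[OF \<beta> adm_borel(2) adm_sub(2) act(2)])
  \<comment> \<open>Irreducibility leads from \<open>i\<close> to a state of positive value.\<close>
  have V_pos: "0 < V m i" for m i
  proof (rule ccontr)
    assume "\<not> 0 < V m i"
    then have Vi: "V m i = 0" using V0[of m i] by simp
    have "\<exists>j. V m j \<noteq> 0"
    proof (rule ccontr)
      assume "\<nexists>j. V m j \<noteq> 0"
      then show False using V_sum[of m] by simp
    qed
    then obtain j where j: "V m j \<noteq> 0" ..
    obtain n where n: "0 < measure (law G i (stat_policy \<phi>1) (stat_policy \<phi>2)) {\<omega> \<in> space (path_space G). state_at n \<omega> = j}"
      using assms(4)[unfolded assumption2_def, rule_format, OF \<phi>, of i j] ..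
    interpret controlled_semi_markov_model G sbar "stat_policy \<phi>1" "stat_policy \<phi>2" i
      by unfold_locales (rule pol)+
    have "measure (law G i (stat_policy \<phi>1) (stat_policy \<phi>2)) {\<omega> \<in> space (path_space G). state_at n \<omega> = j} = 0"
    proof (rule vanishing_value_unreachable[where V = "V m" and \<theta> = \<theta> and g = "g m", OF player V0 Vi])
      show "0 < V m j" using j V0[of m j] by simp
      show "stage_value \<theta> (player m) (g m) (V m) n h \<le> ennreal (V m (snd h))" if "h \<in> space (HS n)" for n h
        by (subst stage_value_eq[OF assms(2) player V0 that]) (simp add: stat_policy_def d1 d2 eq)
    qed
    with n show False by simp
  qed
  have le: "risk_cost G \<theta> (player m) i (stat_policy \<phi>1) (stat_policy \<phi>2) \<le> ereal (g m)" for m i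
  proof -
    interpret controlled_semi_markov_model G sbar "stat_policy \<phi>1" "stat_policy \<phi>2" i
      by unfold_locales (rule pol)+
    show ?thesis
    proof (rule risk_cost_le[OF assms(2) player V_pos])
      show "stage_value \<theta> (player m) (g m) (V m) n h \<le> ennreal (V m (snd h))" if "h \<in> space (HS n)" for n h
        by (subst stage_value_eq[OF assms(2) player V0 that]) (simp add: stat_policy_def d1 d2 eq)
    qed
  qed
  have ge1: "ereal (g True) \<le> risk_cost G \<theta> 1 i \<pi> (stat_policy \<phi>2)" if \<pi>: "\<pi> \<in> policies1 G" for i \<pi>
  proof -
    interpret controlled_semi_markov_model G sbar \<pi> "stat_policy \<phi>2" i
      by unfold_locales (rule \<pi> pol)+
    show ?thesis
    proof (rule risk_cost_ge[where V = "V True", OF assms(2) _ V_pos])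
      fix n h assume h: "h \<in> space (HS n)"
      have "distr (\<pi> n h) borel (\<lambda>x. x) \<in> probs_on (adm1 G (snd h))"
        by (rule distr_probs_on[OF adm_borel(1) adm_sub(1) policies_prob(1)[OF h] _ AE_policies(1)[OF h]])
           (use policies_prob(2)[OF h] in \<open>simp add: act_space1_def\<close>)
      from dev1[OF this] show "ennreal (V True (snd h)) \<le> stage_value \<theta> 1 (g True) (V True) n h"
        by (subst stage_value_eq[OF assms(2) _ V0 h]) (simp_all add: stat_policy_def d2 ennreal_leI)
    qed simp
  qed
  have ge2: "ereal (g False) \<le> risk_cost G \<theta> 2 i (stat_policy \<phi>1) \<pi>" if \<pi>: "\<pi> \<in> policies2 G" for i \<pi>
  proof -
    interpret controlled_semi_markov_model G sbar "stat_policy \<phi>1" \<pi> i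
      by unfold_locales (rule \<pi> pol)+
    show ?thesis
    proof (rule risk_cost_ge[where V = "V False", OF assms(2) _ V_pos])
      fix n h assume h: "h \<in> space (HS n)"
      have "distr (\<pi> n h) borel (\<lambda>x. x) \<in> probs_on (adm2 G (snd h))"
        by (rule distr_probs_on[OF adm_borel(2) adm_sub(2) policies_prob(3)[OF h] _ AE_policies(2)[OF h]])
           (use policies_prob(4)[OF h] in \<open>simp add: act_space2_def\<close>)
      from dev2[OF this] show "ennreal (V False (snd h)) \<le> stage_value \<theta> 2 (g False) (V False) n h"
        by (subst stage_value_eq[OF assms(2) _ V0 h]) (simp_all add: stat_policy_def d1 ennreal_leI)
    qed simp
  qed
  define y where "y m j = ln (V m j) / \<theta>" for m j
  have exp_y: "exp (\<theta> * y m j) = V m j" for m j using assms(2) V_pos by (simp add: y_def)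
  note tr1 = prob_space_trace[OF \<alpha> adm_borel(1)] sets_trace[OF \<alpha> adm_borel(1)] AE_trace[OF \<alpha> adm_borel(1)]
  note tr2 = prob_space_trace[OF \<beta> adm_borel(2)] sets_trace[OF \<beta> adm_borel(2)] AE_trace[OF \<beta> adm_borel(2)]
  have b1: "bellman G sbar \<theta> (player m) (g m) (y m) i \<psi> (\<phi>2 i) =
      (LINT a:adm1 G i|distr \<psi> borel (\<lambda>x. x). LINT b:adm2 G i|\<beta> i. stage \<theta> (player m) (g m, V m) i (a, b))"
    if "sets \<psi> = sets (restrict_space borel S)" "adm1 G i \<subseteq> S" for m i \<psi> S
    unfolding y_def d2[symmetric]
    unfolding \<phi>2_def
    by (rule bellman_eq[OF assms(2) player V_pos that tr2[OF adm_sub(2) act(2)] adm_sub(2)])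
  have b2: "bellman G sbar \<theta> (player m) (g m) (y m) i (\<phi>1 i) \<eta> =
      (LINT a:adm1 G i|\<alpha> i. LINT b:adm2 G i|distr \<eta> borel (\<lambda>x. x). stage \<theta> (player m) (g m, V m) i (a, b))"
    if "\<eta> \<in> mixed2 G i" for m i \<eta>
    unfolding y_def d1[symmetric]
    unfolding \<phi>1_def
    by (rule bellman_eq[OF assms(2) player V_pos tr1(2)[OF adm_sub(1) act(1)] adm_sub(1) _ _ AE_mixed(2)[OF that] order_refl])
       (use that in \<open>simp_all add: mixed2_def space_prob_algebra\<close>)
  have b_eq: "bellman G sbar \<theta> (player m) (g m) (y m) i (\<phi>1 i) (\<phi>2 i) = V m i" for m i
    using b1[of "\<phi>1 i" "act1 G" i m] by (simp add: \<phi>1_def tr1[OF adm_sub(1) act(1)] adm_sub(1) d1[unfolded \<phi>1_def] eq)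
  have inf1: "(INF \<psi>\<in>mixed1 G i. bellman G sbar \<theta> 1 (g True) (y True) i \<psi> (\<phi>2 i)) = V True i" for i
  proof (rule cInf_eq_minimum)
    let ?\<psi> = "restrict_space (\<alpha> i) (adm1 G i)"
    have mem: "?\<psi> \<in> mixed1 G i"
      by (simp add: mixed1_def space_prob_algebra tr1[OF order_refl adm_borel(1)])
    have "V True i = bellman G sbar \<theta> 1 (g True) (y True) i ?\<psi> (\<phi>2 i)"
      using b1[of ?\<psi> "adm1 G i" i True] eq[of i True]
      by (simp add: tr1[OF order_refl adm_borel(1)] distr_trace[OF \<alpha> adm_borel(1) order_refl adm_borel(1)] player_def)
    then show "V True i \<in> (\<lambda>\<psi>. bellman G sbar \<theta> 1 (g True) (y True) i \<psi> (\<phi>2 i)) ` mixed1 G i"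
      by (rule image_eqI[OF _ mem])
    fix x assume "x \<in> (\<lambda>\<psi>. bellman G sbar \<theta> 1 (g True) (y True) i \<psi> (\<phi>2 i)) ` mixed1 G i"
    then obtain \<psi> where \<psi>: "\<psi> \<in> mixed1 G i" "x = bellman G sbar \<theta> 1 (g True) (y True) i \<psi> (\<phi>2 i)" by (elim imageE)
    have "sets \<psi> = sets (restrict_space borel (adm1 G i))" using \<psi>(1) by (simp add: mixed1_def space_prob_algebra)
    from b1[OF this order_refl, of True] dev1[OF mixed_probs_on(1)[OF \<psi>(1)]]
    show "V True i \<le> x" by (simp add: \<psi>(2) player_def)
  qed
  have inf2: "(INF \<eta>\<in>mixed2 G i. bellman G sbar \<theta> 2 (g False) (y False) i (\<phi>1 i) \<eta>) = V False i" for i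
  proof (rule cInf_eq_minimum)
    let ?\<eta> = "restrict_space (\<beta> i) (adm2 G i)"
    have mem: "?\<eta> \<in> mixed2 G i"
      by (simp add: mixed2_def space_prob_algebra tr2[OF order_refl adm_borel(2)])
    have "V False i = bellman G sbar \<theta> 2 (g False) (y False) i (\<phi>1 i) ?\<eta>"
      using b2[OF mem, of False] eq[of i False]
      by (simp add: distr_trace[OF \<beta> adm_borel(2) order_refl adm_borel(2)] player_def)
    then show "V False i \<in> (\<lambda>\<eta>. bellman G sbar \<theta> 2 (g False) (y False) i (\<phi>1 i) \<eta>) ` mixed2 G i"
      by (rule image_eqI[OF _ mem])
    fix x assume "x \<in> (\<lambda>\<eta>. bellman G sbar \<theta> 2 (g False) (y False) i (\<phi>1 i) \<eta>) ` mixed2 G i"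
    then obtain \<eta> where \<eta>: "\<eta> \<in> mixed2 G i" "x = bellman G sbar \<theta> 2 (g False) (y False) i (\<phi>1 i) \<eta>" by (elim imageE)
    from b2[OF \<eta>(1), of False] dev2[OF mixed_probs_on(2)[OF \<eta>(1)]]
    show "V False i \<le> x" by (simp add: \<eta>(2) player_def)
  qed
  have cost1: "risk_cost G \<theta> 1 i (stat_policy \<phi>1) (stat_policy \<phi>2) = ereal (g True)" for i
    using le[of True i] ge1[OF pol(1), of i] by (simp add: player_def)
  have cost2: "risk_cost G \<theta> 2 i (stat_policy \<phi>1) (stat_policy \<phi>2) = ereal (g False)" for i
    using le[of False i] ge2[OF pol(2), of i] by (simp add: player_def)
  show ?thesis
  proof (rule exI[of _ "g True"], rule exI[of _ "g False"], rule exI[of _ "y True"], rule exI[of _ "y False"],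
      rule bexI[OF _ \<phi>(1)], rule bexI[OF _ \<phi>(2)], intro conjI allI)
    show "nash_equilibrium G \<theta> (stat_policy \<phi>1) (stat_policy \<phi>2)"
      unfolding nash_equilibrium_def cost1 cost2 by (intro conjI allI ballI pol ge1 ge2)
  qed (use b_eq[of True] b_eq[of False] in \<open>simp_all add: exp_y inf1 inf2 cost1 cost2 player_def del: One_nat_def\<close>)
qed

end
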